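(* Let $n\ge2$. For any nonempty open set $\Omega\subseteq\mathbb{R}^n$ there is $u\in BD(\Omega)\cap L^\infty(\Omega;\mathbb{R}^n)$ such that $Eu=E^cu$ and $\nabla u\notin L^1(\Omega;\mathbb{R}^{n\times n})$. In particular $u\notin GBV(\Omega;\mathbb{R}^n)$.
   Context: $\mathcal{L}^n$ is Lebesgue measure, $\mathcal{H}^{n-1}$ is $(n-1)$-dimensional Hausdorff measure. $BD(\Omega):=\{u\in L^1(\Omega;\mathbb{R}^n): Eu\in\mathcal{M}(\Omega;\mathbb{R}^{n\times n}_{\mathrm{sym}})\}$, where $Eu:=(Du+Du^T)/2$ is the symmetrized distributional gradient and $\mathcal{M}$ denotes bounded Radon measures. For $u\in BD(\Omega)$, the jump set $J_u$ is the set of $x\in\Omega$ for which there are $u_+\ne u_-$ in $\mathbb{R}^n$ and $\nu\in S^{n-1}$ with $\lim_{r\to0}\frac1{\mathcal{L}^n(B_r)}\int_{B_r(x)\cap\{\pm(y-x)\cdot\nu>0\}}|u(y)-u_\pm|\,dy=0$; $[u]=u_+-u_-$. One has $Eu=e(u)\mathcal{L}^n+\frac{[u]\otimes\nu+\nu\otimes[u]}{2}\mathcal{H}^{n-1}\llcorner J_u+E^cu$, where $e(u)$ is the density of the absolutely continuous part of $Eu$ and the Cantor part $E^cu$ is the restriction to $\Omega\setminus J_u$ of the singular part of $Eu$. Thus $Eu=E^cu$ means that both the absolutely continuous part and the jump part of $Eu$ vanish. $\nabla u$ denotes the approximate gradient of $u$, which exists $\mathcal{L}^n$-a.e. for $u\in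 BD(\Omega)$. $GBV(\Omega;\mathbb{R}^n)$ is the set of measurable $w:\Omega\to\mathbb{R}^n$ such that $\phi(w)\in BV_{\mathrm{loc}}(\Omega)$ for all $\phi\in C^1(\mathbb{R}^n)$ such that $\nabla\phi$ has compact support. *)

theory Defs
  imports "HOL-Analysis.Analysis"
begin

text \<open>
  A bounded Radon measure on an open set \<open>\<Omega>\<close> with values in a finite-dimensional space is a
  countably additive function on the Borel subsets of \<open>\<Omega>\<close>; boundedness of the total variation
  and regularity are then automatic. Set functions are extended by 0 to all other sets, so that
  equality of functions is equality of measures.
\<close>

abbreviation borel_sets :: "'a::topological_space set \<Rightarrow> 'a set set" where
  "borel_sets \<Omega> \<equiv> sets (restrict_space borel \<Omega>)"

definition radon_measure ::
  "'a::topological_space set \<Rightarrow> ('a set \<Rightarrow> 'b::real_normed_vector) \<Rightarrow> bool" where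
  "radon_measure \<Omega> \<mu> \<longleftrightarrow>
     (\<forall>A. A \<notin> borel_sets \<Omega> \<longrightarrow> \<mu> A = 0) \<and>
     (\<forall>A :: nat \<Rightarrow> 'a set. range A \<subseteq> borel_sets \<Omega> \<and> disjoint_family A \<longrightarrow>
        (\<lambda>k. \<mu> (A k)) sums \<mu> (\<Union>k. A k))"

text \<open>
  Positive part in the Jordan decomposition of a signed measure,
  \<open>\<mu>\<^sup>+(A) = sup {\<mu>(B) | B \<subseteq> A}\<close>. The coercion \<open>ennreal\<close> sends negative reals to 0, which does not
  affect the supremum as \<open>B = {}\<close> is admitted. The negative part of \<open>\<mu>\<close> is the positive part
  of \<open>-\<mu>\<close>.
\<close>

definition positive_part :: "'a::topological_space set \<Rightarrow> ('a set \<Rightarrow> real) \<Rightarrow> 'a measure" where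
  "positive_part \<Omega> \<mu> = measure_of \<Omega> (borel_sets \<Omega>)
     (\<lambda>A. SUP B \<in> {B \<in> borel_sets \<Omega>. B \<subseteq> A}. ennreal (\<mu> B))"

definition signed_integral ::
  "'a::topological_space set \<Rightarrow> ('a set \<Rightarrow> real) \<Rightarrow> ('a \<Rightarrow> real) \<Rightarrow> real" where
  "signed_integral \<Omega> \<mu> f =
     integral\<^sup>L (positive_part \<Omega> \<mu>) f - integral\<^sup>L (positive_part \<Omega> (\<lambda>A. - \<mu> A)) f"

definition ac_lebesgue ::
  "'a::euclidean_space set \<Rightarrow> ('a set \<Rightarrow> 'b::real_normed_vector) \<Rightarrow> bool" where
  "ac_lebesgue \<Omega> \<mu> \<longleftrightarrow> (\<forall>A \<in> borel_sets \<Omega>. A \<in> null_sets lebesgue \<longrightarrow> \<mu> A = 0)"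

definition singular_lebesgue ::
  "'a::euclidean_space set \<Rightarrow> ('a set \<Rightarrow> 'b::real_normed_vector) \<Rightarrow> bool" where
  "singular_lebesgue \<Omega> \<mu> \<longleftrightarrow>
     (\<exists>N \<in> borel_sets \<Omega>. N \<in> null_sets lebesgue \<and> (\<forall>A \<in> borel_sets \<Omega>. A \<inter> N = {} \<longrightarrow> \<mu> A = 0))"

definition singular_part ::
  "'a::euclidean_space set \<Rightarrow> ('a set \<Rightarrow> 'b::real_normed_vector) \<Rightarrow> 'a set \<Rightarrow> 'b" where
  "singular_part \<Omega> \<mu> =
     (THE \<sigma>. radon_measure \<Omega> \<sigma> \<and> singular_lebesgue \<Omega> \<sigma> \<and> ac_lebesgue \<Omega> (\<lambda>A. \<mu> A - \<sigma> A))"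

definition restrict_radon ::
  "'a::topological_space set \<Rightarrow> ('a set \<Rightarrow> 'b::real_normed_vector) \<Rightarrow> 'a set \<Rightarrow> 'a set \<Rightarrow> 'b" where
  "restrict_radon \<Omega> \<mu> S = (\<lambda>A. if A \<in> borel_sets \<Omega> then \<mu> (A \<inter> S) else 0)"

primrec C_k :: "nat \<Rightarrow> ('a::euclidean_space \<Rightarrow> real) \<Rightarrow> bool" where
  "C_k 0 f \<longleftrightarrow> continuous_on UNIV f"
| "C_k (Suc k) f \<longleftrightarrow> (\<forall>x. f differentiable (at x)) \<and>
     (\<forall>b\<in>Basis. C_k k (\<lambda>x. frechet_derivative f (at x) b))"

definition test_function :: "'a::euclidean_space set \<Rightarrow> ('a \<Rightarrow> real) \<Rightarrow> bool" where
  "test_function \<Omega> \<phi> \<longleftrightarrow> (\<forall>k. C_k k \<phi>) \<and>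
     compact (closure {x. \<phi> x \<noteq> 0}) \<and> closure {x. \<phi> x \<noteq> 0} \<subseteq> \<Omega>"

definition distr_partial ::
  "(real^'n) set \<Rightarrow> 'n \<Rightarrow> (real^'n \<Rightarrow> real) \<Rightarrow> (real^'n \<Rightarrow> real) \<Rightarrow> real" where
  "distr_partial \<Omega> j v \<phi> =
     - (LINT x:\<Omega>|lebesgue. v x * frechet_derivative \<phi> (at x) (axis j 1))"

definition distr_sym_grad ::
  "(real^'n) set \<Rightarrow> 'n \<Rightarrow> 'n \<Rightarrow> (real^'n \<Rightarrow> real^'n) \<Rightarrow> (real^'n \<Rightarrow> real) \<Rightarrow> real" where
  "distr_sym_grad \<Omega> i j u \<phi> =
     (distr_partial \<Omega> j (\<lambda>x. u x $ i) \<phi> + distr_partial \<Omega> i (\<lambda>x. u x $ j) \<phi>) / 2"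

text \<open>
  Functions on \<open>\<Omega>\<close> are total functions of which only the values in \<open>\<Omega>\<close> matter.
\<close>

definition L_infinity :: "'a::euclidean_space set \<Rightarrow> ('a \<Rightarrow> 'b::euclidean_space) set" where
  "L_infinity \<Omega> = {u \<in> borel_measurable (lebesgue_on \<Omega>).
     \<exists>C. AE x in lebesgue_on \<Omega>. norm (u x) \<le> C}"

definition is_sym_grad_measure ::
  "(real^'n) set \<Rightarrow> (real^'n \<Rightarrow> real^'n) \<Rightarrow> ((real^'n) set \<Rightarrow> real^'n^'n) \<Rightarrow> bool" where
  "is_sym_grad_measure \<Omega> u \<mu> \<longleftrightarrow> radon_measure \<Omega> \<mu> \<and> (\<forall>A. transpose (\<mu> A) = \<mu> A) \<and>
     (\<forall>\<phi>. test_function \<Omega> \<phi> \<longrightarrow>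
       (\<forall>i j. distr_sym_grad \<Omega> i j u \<phi> = signed_integral \<Omega> (\<lambda>A. \<mu> A $ i $ j) \<phi>))"

definition BD :: "(real^'n) set \<Rightarrow> (real^'n \<Rightarrow> real^'n) set" where
  "BD \<Omega> = {u. u absolutely_integrable_on \<Omega> \<and> (\<exists>\<mu>. is_sym_grad_measure \<Omega> u \<mu>)}"

definition sym_grad ::
  "(real^'n) set \<Rightarrow> (real^'n \<Rightarrow> real^'n) \<Rightarrow> (real^'n) set \<Rightarrow> real^'n^'n" where
  "sym_grad \<Omega> u = (THE \<mu>. is_sym_grad_measure \<Omega> u \<mu>)"

definition BV :: "(real^'n) set \<Rightarrow> (real^'n \<Rightarrow> real) set" where
  "BV \<Omega> = {v. v absolutely_integrable_on \<Omega> \<and>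
     (\<exists>\<mu> :: (real^'n) set \<Rightarrow> real^'n. radon_measure \<Omega> \<mu> \<and>
       (\<forall>\<phi>. test_function \<Omega> \<phi> \<longrightarrow>
         (\<forall>j. distr_partial \<Omega> j v \<phi> = signed_integral \<Omega> (\<lambda>A. \<mu> A $ j) \<phi>)))}"

definition BV_loc :: "(real^'n) set \<Rightarrow> (real^'n \<Rightarrow> real) set" where
  "BV_loc \<Omega> = {v. \<forall>U. open U \<and> compact (closure U) \<and> closure U \<subseteq> \<Omega> \<longrightarrow> v \<in> BV U}"

definition GBV :: "(real^'n) set \<Rightarrow> (real^'n \<Rightarrow> real^'n) set" where
  "GBV \<Omega> = {w \<in> borel_measurable (lebesgue_on \<Omega>).
     \<forall>\<phi> :: real^'n \<Rightarrow> real. C_k 1 \<phi> \<and>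
       compact (closure {y. frechet_derivative \<phi> (at y) \<noteq> (\<lambda>_. 0)}) \<longrightarrow>
       (\<lambda>x. \<phi> (w x)) \<in> BV_loc \<Omega>}"

text \<open>
  The integrals below are Bochner integrals and hence only meaningful if \<open>u\<close> is locally
  integrable, as is the case for \<open>u \<in> BD \<Omega>\<close>.
\<close>

definition has_one_sided_limit ::
  "(real^'n \<Rightarrow> real^'n) \<Rightarrow> real^'n \<Rightarrow> real^'n \<Rightarrow> real^'n \<Rightarrow> bool" where
  "has_one_sided_limit u x \<nu> a \<longleftrightarrow>
     ((\<lambda>r. (LINT y:(ball x r \<inter> {y. (y - x) \<bullet> \<nu> > 0})|lebesgue. norm (u y - a))
            / measure lebesgue (ball x r)) \<longlongrightarrow> 0) (at_right 0)"

definition jump_set :: "(real^'n) set \<Rightarrow> (real^'n \<Rightarrow> real^'n) \<Rightarrow> (real^'n) set" where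
  "jump_set \<Omega> u = {x \<in> \<Omega>. \<exists>u_plus u_minus \<nu>. u_plus \<noteq> u_minus \<and> norm \<nu> = 1 \<and>
     has_one_sided_limit u x \<nu> u_plus \<and> has_one_sided_limit u x (- \<nu>) u_minus}"

definition cantor_part ::
  "(real^'n) set \<Rightarrow> (real^'n \<Rightarrow> real^'n) \<Rightarrow> (real^'n) set \<Rightarrow> real^'n^'n" where
  "cantor_part \<Omega> u = restrict_radon \<Omega> (singular_part \<Omega> (sym_grad \<Omega> u)) (\<Omega> - jump_set \<Omega> u)"

text \<open>
  Approximate differentiability in the usual \<open>L\<^sup>1\<close> sense; \<open>z\<close> is the approximate limit
  of \<open>u\<close> at \<open>x\<close>, so that the notion does not depend on the representative of \<open>u\<close>.
\<close>

definition has_approx_grad ::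
  "(real^'n \<Rightarrow> real^'n) \<Rightarrow> real^'n \<Rightarrow> real^'n^'n \<Rightarrow> bool" where
  "has_approx_grad u x L \<longleftrightarrow> (\<exists>z.
     ((\<lambda>r. (LINT y:ball x r|lebesgue. norm (u y - z - L *v (y - x)) / r)
            / measure lebesgue (ball x r)) \<longlongrightarrow> 0) (at_right 0))"

text \<open>
  For \<open>u \<in> BD \<Omega>\<close> the approximate gradient exists almost everywhere; on the exceptional set its
  value is immaterial and chosen to be 0.
\<close>

definition approx_grad :: "(real^'n \<Rightarrow> real^'n) \<Rightarrow> real^'n \<Rightarrow> real^'n^'n" where
  "approx_grad u x = (if \<exists>L. has_approx_grad u x L then THE L. has_approx_grad u x L else 0)"

end

theory Submission
  imports Defs
begin

text \<open>
  The symmetric part of a gradient does not control the skew part in \<open>L\<^sup>1\<close>. The proof makes this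
  quantitative with an explicit field in a plane, turns the small strain of that field into a
  Cantor measure, and superposes countably many such fields on disjoint boxes.

  \<^emph>\<open>The planar field.\<close> Let \<open>A\<^sub>m(y)\<close> and \<open>B\<^sub>m(z)\<close> be Riesz products: \<open>A\<^sub>0 = B\<^sub>0 = 1\<close>, and each
  function arises from the previous one by multiplication with a rapidly oscillating factor of
  mean 1 that is mostly 0 or 2. The function \<open>D(z,y) = \<alpha> \<Sum>\<^sub>m (B\<^sub>m\<^sub>+\<^sub>1(z) - B\<^sub>m(z)) A\<^sub>m\<^sub>+\<^sub>1(y)\<close>,
  \<open>m < M\<close>, is large: on the set where \<open>B\<close> has doubled \<open>m\<close> times and then dropped to zero while \<open>A\<close>
  has doubled \<open>m + 1\<close> times, a geometric sum shows \<open>\<bar>D\<bar> \<ge> \<alpha> 4\<^sup>m\<^sup>+\<^sup>1 / 3\<close>. These sets are disjoint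
  and have measure about \<open>4\<^sup>-\<^sup>m\<^sup>-\<^sup>1\<close>, so the integral of \<open>\<bar>D\<bar>\<close> grows linearly in \<open>M\<close>. On the other
  hand the increments of \<open>B\<close> oscillate fast, hence the primitive of \<open>D\<close> in \<open>z\<close> is uniformly small;
  and summation by parts gives \<open>\<alpha> (A\<^sub>M B\<^sub>M - 1) - D = \<alpha> \<Sum>\<^sub>m B\<^sub>m (A\<^sub>m\<^sub>+\<^sub>1 - A\<^sub>m)\<close>, whose primitive
  in \<open>y\<close> is uniformly small as well. In the gradient of the field with these two primitives as
  components, the diagonal entries are small. The other two entries are large, but their sum is
  \<open>\<alpha> (A\<^sub>M B\<^sub>M - 1)\<close>, which has \<open>L\<^sup>1\<close> norm of order \<open>\<alpha>\<close> whatever \<open>M\<close> is. This is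
  \<open>lacunary_products\<close>, \<open>staircase_sum_lower_bound\<close> and \<open>planar_field\<close>.

  \<^emph>\<open>Singular strain.\<close> Let \<open>c\<close> be a monotone continuous function close to the identity that is
  locally constant off a null set \<open>N\<close>, and let \<open>T\<close> be its right inverse, which maps into \<open>N\<close>. The
  derivative of \<open>f \<circ> c\<close> is the image of \<open>f'\<close> times Lebesgue measure under \<open>T\<close>
  (\<open>integral_staircase_by_parts\<close>). Now every coordinate in the planar field is replaced by its
  image under \<open>c\<close>, except for the variables of integration in the two primitives of \<open>D\<close>. Then the
  density of the absolutely continuous part of the gradient consists of the two entries \<open>D\<close> and
  \<open>- D\<close>, which cancel in the strain. Everything else is an image of an integrable density under a
  map into a null set, and is still small. Multiplication by a cutoff composed with \<open>c\<close> makes the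
  support compact (locale \<open>rotating_field\<close>, lemma \<open>ex_rotation_cell\<close>).

  \<^emph>\<open>Superposition.\<close> On disjoint boxes in \<open>\<Omega>\<close>, numbered by \<open>K\<close>, take such fields with supremum and
  strain at most \<open>2\<^sup>-\<^sup>K\<^sup>-\<^sup>1\<close> and with rotations \<open>D\<^sub>K\<close> whose absolute value has integral at least
  1. The sum is bounded and continuous, so it has no jumps. Its strain is a finite measure carried
  by a null set, and coincides with its Cantor part. Almost everywhere on the core of the \<open>K\<close>-th
  box one entry of the approximate gradient is \<open>D\<^sub>K\<close>, so the approximate gradient is not
  integrable. If a truncation of the field had bounded variation, then one entry of its derivative
  would be a finite signed measure with values at least \<open>1/2\<close> in modulus on infinitely many
  disjoint sets, which is impossible.

  Since measures are set functions here, the link between set functions and distributions has to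
  be made explicit: signed integrals are identified by their values on indicator functions
  (\<open>signed_integral_eqI\<close>), and measures by their integrals of test functions
  (\<open>radon_measure_eqI_test\<close>).
\<close>

section \<open>Signed measures and their integrals\<close>

lemma radon_measure_sums:
  assumes "radon_measure \<Omega> \<mu>" "range A \<subseteq> borel_sets \<Omega>" "disjoint_family A"
  shows "(\<lambda>k. \<mu> (A k)) sums \<mu> (\<Union>k. A k)"
  using assms unfolding radon_measure_def by blast

lemma radon_measure_outside:
  "radon_measure \<Omega> \<mu> \<Longrightarrow> A \<notin> borel_sets \<Omega> \<Longrightarrow> \<mu> A = 0"
  unfolding radon_measure_def by blast

lemma radon_measure_empty:
  assumes "radon_measure \<Omega> \<mu>"
  shows "\<mu> {} = 0"
proof -
  have "(\<lambda>k::nat. \<mu> {}) sums \<mu> (\<Union>k::nat. {})"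
    by (rule radon_measure_sums[OF assms]) (auto simp: disjoint_family_on_def)
  then have "summable (\<lambda>k::nat. \<mu> {})"
    by (rule sums_summable)
  then show ?thesis
    by (simp add: summable_const_iff)
qed

lemma radon_measure_Un:
  assumes "radon_measure \<Omega> \<mu>" "A \<in> borel_sets \<Omega>" "B \<in> borel_sets \<Omega>" "A \<inter> B = {}"
  shows "\<mu> (A \<union> B) = \<mu> A + \<mu> B"
proof -
  have "(\<lambda>n. \<mu> (binaryset A B n)) sums \<mu> (\<Union>n. binaryset A B n)"
    by (rule radon_measure_sums[OF assms(1)])
       (use assms in \<open>auto simp: binaryset_def disjoint_family_on_def\<close>)
  moreover have "(\<lambda>n. \<mu> (binaryset A B n)) sums (\<mu> A + \<mu> B)"
    by (rule binaryset_sums) (rule radon_measure_empty[OF assms(1)])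
  ultimately show ?thesis
    by (metis UN_binaryset_eq sums_unique2)
qed

lemma radon_measure_Diff:
  assumes "radon_measure \<Omega> \<mu>" "A \<in> borel_sets \<Omega>" "B \<in> borel_sets \<Omega>" "B \<subseteq> A"
  shows "\<mu> (A - B) = \<mu> A - \<mu> B"
proof -
  have "\<mu> (B \<union> (A - B)) = \<mu> B + \<mu> (A - B)"
    by (rule radon_measure_Un[OF assms(1)]) (use assms in auto)
  moreover have "B \<union> (A - B) = A" using assms by blast
  ultimately show ?thesis by simp
qed

lemma borel_sets_subset: "A \<in> borel_sets \<Omega> \<Longrightarrow> A \<subseteq> \<Omega>"
  using sets.sets_into_space[of A "restrict_space borel \<Omega>"] by (simp add: space_restrict_space)

lemma borel_sets_iff:
  "\<Omega> \<in> sets borel \<Longrightarrow> A \<in> borel_sets \<Omega> \<longleftrightarrow> A \<in> sets borel \<and> A \<subseteq> \<Omega>"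
  by (subst sets_restrict_space_iff) auto

lemma self_in_borel_sets: "\<Omega> \<in> borel_sets \<Omega>"
  using sets.top[of "restrict_space borel \<Omega>"] by (simp add: space_restrict_space)

lemma radon_measure_uminus:
  "radon_measure \<Omega> \<mu> \<Longrightarrow> radon_measure \<Omega> (\<lambda>A. - \<mu> A)"
  unfolding radon_measure_def by (auto intro: sums_minus)

lemma radon_measure_diff:
  "radon_measure \<Omega> \<mu> \<Longrightarrow> radon_measure \<Omega> \<nu> \<Longrightarrow> radon_measure \<Omega> (\<lambda>A. \<mu> A - \<nu> A)"
  unfolding radon_measure_def by (auto intro: sums_diff)

lemma radon_measure_bounded_linear:
  assumes "bounded_linear h" "radon_measure \<Omega> \<mu>"
  shows "radon_measure \<Omega> (\<lambda>A. h (\<mu> A))"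
  using assms(2) bounded_linear.sums[OF assms(1)]
  by (auto simp: radon_measure_def linear_simps[OF assms(1)])

text \<open>
  The mass that enters the definition of \<open>positive_part\<close>. As \<open>measure_of\<close> returns the zero measure
  unless this mass is countably additive on the Borel sets, additivity has to be proved before the
  positive part can be used.
\<close>

definition upper_variation ::
  "'a::topological_space set \<Rightarrow> ('a set \<Rightarrow> real) \<Rightarrow> 'a set \<Rightarrow> ennreal" where
  "upper_variation \<Omega> \<mu> A = (SUP B \<in> {B \<in> borel_sets \<Omega>. B \<subseteq> A}. ennreal (\<mu> B))"

lemma upper_variation_upper:
  "B \<in> borel_sets \<Omega> \<Longrightarrow> B \<subseteq> A \<Longrightarrow> ennreal (\<mu> B) \<le> upper_variation \<Omega> \<mu> A"
  unfolding upper_variation_def by (rule SUP_upper) auto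

lemma upper_variation_mono:
  "A \<subseteq> A' \<Longrightarrow> upper_variation \<Omega> \<mu> A \<le> upper_variation \<Omega> \<mu> A'"
  unfolding upper_variation_def by (rule SUP_subset_mono) auto

lemma ennreal_sums_le:
  fixes f :: "nat \<Rightarrow> real"
  assumes "f sums s"
  shows "ennreal s \<le> (\<Sum>i. ennreal (f i))"
proof -
  have "(\<lambda>n. ennreal (\<Sum>i<n. f i)) \<longlonglongrightarrow> ennreal s"
    using assms unfolding sums_def by (rule tendsto_ennrealI)
  moreover have "ennreal (\<Sum>i<n. f i) \<le> (\<Sum>i. ennreal (f i))" for n
  proof -
    have "ennreal (\<Sum>i<n. f i) \<le> ennreal (\<Sum>i<n. max 0 (f i))"
      by (intro ennreal_leI sum_mono) auto
    also have "\<dots> = (\<Sum>i<n. ennreal (max 0 (f i)))"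
      by (rule sum_ennreal[symmetric]) auto
    also have "\<dots> = (\<Sum>i<n. ennreal (f i))"
      by (intro sum.cong) (auto simp: max_def ennreal_neg)
    also have "\<dots> \<le> (\<Sum>i. ennreal (f i))"
      by (rule sum_le_suminf) auto
    finally show ?thesis .
  qed
  ultimately show ?thesis
    by (intro LIMSEQ_le_const2[of _ "ennreal s"]) auto
qed

text \<open>
  If \<open>C \<subseteq> A\<close> and \<open>D \<subseteq> B\<close> nearly attain the two suprema, then \<open>C \<union> D\<close> is a competitor for \<open>A \<union> B\<close>.
  A set of negative measure contributes nothing and is left out.
\<close>

lemma upper_variation_superadditive:
  assumes r: "radon_measure \<Omega> \<mu>" and "A \<inter> B = {}"
  shows "upper_variation \<Omega> \<mu> A + upper_variation \<Omega> \<mu> B \<le> upper_variation \<Omega> \<mu> (A \<union> B)"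
proof -
  define S where "S A = {B \<in> borel_sets \<Omega>. B \<subseteq> A}" for A
  have ne: "S A \<noteq> {}" for A unfolding S_def by auto
  have *: "ennreal (\<mu> C) + ennreal (\<mu> D) \<le> upper_variation \<Omega> \<mu> (A \<union> B)"
    if "C \<in> S A" "D \<in> S B" for C D
  proof -
    consider "\<mu> C \<ge> 0 \<and> \<mu> D \<ge> 0" | "\<mu> C \<le> 0" | "\<mu> D \<le> 0" by linarith
    then show ?thesis
    proof cases
      case 1
      have "ennreal (\<mu> C) + ennreal (\<mu> D) = ennreal (\<mu> C + \<mu> D)"
        using 1 by (simp add: ennreal_plus)
      also have "\<mu> C + \<mu> D = \<mu> (C \<union> D)"
        using that assms(2) by (subst radon_measure_Un[OF r]) (auto simp: S_def)
      also have "ennreal \<dots> \<le> upper_variation \<Omega> \<mu> (A \<union> B)"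
        by (rule upper_variation_upper) (use that in \<open>auto simp: S_def\<close>)
      finally show ?thesis .
    next
      case 2
      then show ?thesis using that by (auto simp: S_def ennreal_neg intro: upper_variation_upper)
    next
      case 3
      then show ?thesis using that by (auto simp: S_def ennreal_neg intro: upper_variation_upper)
    qed
  qed
  have "upper_variation \<Omega> \<mu> A + ennreal (\<mu> D) \<le> upper_variation \<Omega> \<mu> (A \<union> B)" if "D \<in> S B" for D
    unfolding upper_variation_def S_def[symmetric]
    apply (subst ennreal_SUP_add_left[OF ne, symmetric])
    using *[OF _ that] by (intro SUP_least) (auto simp: upper_variation_def S_def)
  then have "(SUP D\<in>S B. upper_variation \<Omega> \<mu> A + ennreal (\<mu> D)) \<le> upper_variation \<Omega> \<mu> (A \<union> B)"
    by (rule SUP_least)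
  also have "(SUP D\<in>S B. upper_variation \<Omega> \<mu> A + ennreal (\<mu> D))
      = upper_variation \<Omega> \<mu> A + (SUP D\<in>S B. ennreal (\<mu> D))"
    by (rule ennreal_SUP_add_right[OF ne, symmetric])
  finally show ?thesis
    by (simp add: upper_variation_def S_def)
qed

lemma upper_variation_countably_additive:
  assumes r: "radon_measure \<Omega> \<mu>"
  shows "countably_additive (borel_sets \<Omega>) (upper_variation \<Omega> \<mu>)"
proof (rule countably_additiveI)
  fix A :: "nat \<Rightarrow> 'a set"
  assume A: "range A \<subseteq> borel_sets \<Omega>" "disjoint_family A"
  have "(\<Sum>i<n. upper_variation \<Omega> \<mu> (A i)) \<le> upper_variation \<Omega> \<mu> (\<Union>i<n. A i)" for n
  proof (induction n)
    case (Suc n)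
    have "(\<Sum>i<Suc n. upper_variation \<Omega> \<mu> (A i))
        \<le> upper_variation \<Omega> \<mu> (\<Union>i<n. A i) + upper_variation \<Omega> \<mu> (A n)"
      using Suc by (simp add: add_right_mono)
    also have "\<dots> \<le> upper_variation \<Omega> \<mu> ((\<Union>i<n. A i) \<union> A n)"
    proof (rule upper_variation_superadditive[OF r])
      have "A i \<inter> A n = {}" if "i < n" for i
        using disjoint_family_onD[OF A(2), of i n] that by auto
      then show "(\<Union>i<n. A i) \<inter> A n = {}" by blast
    qed
    also have "(\<Union>i<n. A i) \<union> A n = (\<Union>i<Suc n. A i)"
      by (auto simp: less_Suc_eq)
    finally show ?case .
  qed auto
  also have "upper_variation \<Omega> \<mu> (\<Union>i<n. A i) \<le> upper_variation \<Omega> \<mu> (\<Union>i. A i)" for n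
    by (rule upper_variation_mono) auto
  finally have "(\<Sum>i. upper_variation \<Omega> \<mu> (A i)) \<le> upper_variation \<Omega> \<mu> (\<Union>i. A i)"
    by (intro suminf_le_const summableI) auto
  moreover have "upper_variation \<Omega> \<mu> (\<Union>i. A i) \<le> (\<Sum>i. upper_variation \<Omega> \<mu> (A i))"
    unfolding upper_variation_def[of _ _ "\<Union>i. A i"]
  proof (rule SUP_least)
    fix B assume "B \<in> {B \<in> borel_sets \<Omega>. B \<subseteq> (\<Union>i. A i)}"
    then have B: "B \<in> borel_sets \<Omega>" "B \<subseteq> (\<Union>i. A i)" by auto
    have "(\<lambda>i. \<mu> (B \<inter> A i)) sums \<mu> (\<Union>i. B \<inter> A i)"
      by (rule radon_measure_sums[OF r]) (use A B in \<open>auto simp: disjoint_family_on_def\<close>)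
    moreover have "(\<Union>i. B \<inter> A i) = B" using B by blast
    ultimately have "ennreal (\<mu> B) \<le> (\<Sum>i. ennreal (\<mu> (B \<inter> A i)))"
      using ennreal_sums_le by metis
    also have "\<dots> \<le> (\<Sum>i. upper_variation \<Omega> \<mu> (A i))"
      by (intro suminf_le upper_variation_upper summableI) (use A B in auto)
    finally show "ennreal (\<mu> B) \<le> (\<Sum>i. upper_variation \<Omega> \<mu> (A i))" .
  qed
  ultimately show "(\<Sum>i. upper_variation \<Omega> \<mu> (A i)) = upper_variation \<Omega> \<mu> (\<Union>i. A i)"
    by (rule antisym)
qed

lemma upper_variation_empty: "radon_measure \<Omega> \<mu> \<Longrightarrow> upper_variation \<Omega> \<mu> {} = 0"
proof -
  assume r: "radon_measure \<Omega> \<mu>"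
  have "{B \<in> borel_sets \<Omega>. B \<subseteq> {}} = {{}}" by auto
  then show ?thesis
    unfolding upper_variation_def using radon_measure_empty[OF r] by simp
qed

lemma positive_part_measure:
  assumes r: "radon_measure \<Omega> \<mu>"
  shows sets_positive_part: "sets (positive_part \<Omega> \<mu>) = borel_sets \<Omega>"
    and space_positive_part: "space (positive_part \<Omega> \<mu>) = \<Omega>"
    and emeasure_positive_part:
      "A \<in> borel_sets \<Omega> \<Longrightarrow> emeasure (positive_part \<Omega> \<mu>) A = upper_variation \<Omega> \<mu> A"
proof -
  have eq: "positive_part \<Omega> \<mu> = measure_of \<Omega> (borel_sets \<Omega>) (upper_variation \<Omega> \<mu>)"
    unfolding positive_part_def upper_variation_def ..
  have sp: "space (restrict_space borel \<Omega>) = \<Omega>" by (simp add: space_restrict_space)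
  have sub: "borel_sets \<Omega> \<subseteq> Pow \<Omega>" using borel_sets_subset by auto
  have ss: "sigma_sets \<Omega> (borel_sets \<Omega>) = borel_sets \<Omega>"
    using sets.sigma_sets_eq[of "restrict_space borel \<Omega>"] sp by simp
  show s: "sets (positive_part \<Omega> \<mu>) = borel_sets \<Omega>"
    unfolding eq sets_measure_of[OF sub] ss ..
  show "space (positive_part \<Omega> \<mu>) = \<Omega>"
    unfolding eq space_measure_of[OF sub] ..
  show "emeasure (positive_part \<Omega> \<mu>) A = upper_variation \<Omega> \<mu> A" if "A \<in> borel_sets \<Omega>"
    by (rule emeasure_measure_of[OF eq sub])
       (use s that upper_variation_countably_additive[OF r] upper_variation_empty[OF r]
         in \<open>auto simp: positive_def\<close>)
qed

text \<open>
  Suppose the variation of \<open>A\<close> is infinite and choose \<open>B \<subseteq> A\<close> with \<open>\<mu> B > \<bar>\<mu> A\<bar> + 1\<close>. One of \<open>B\<close>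
  and \<open>A - B\<close> has infinite variation again, and the other one has measure at least 1 in modulus.
  Iteration splits off infinitely many disjoint sets of measure at least 1 in modulus, against the
  convergence of their sum.
\<close>

lemma upper_variation_finite:
  fixes \<Omega> :: "'a::topological_space set"
  assumes r: "radon_measure \<Omega> \<mu>"
  shows "upper_variation \<Omega> \<mu> \<Omega> < \<infinity>"
proof (rule ccontr)
  assume "\<not> upper_variation \<Omega> \<mu> \<Omega> < \<infinity>"
  then have inf: "upper_variation \<Omega> \<mu> \<Omega> = \<infinity>" by (simp add: not_less top_unique)
  define I where "I A \<longleftrightarrow> A \<in> borel_sets \<Omega> \<and> upper_variation \<Omega> \<mu> A = \<infinity>" for A
  have step: "\<exists>A'. I A' \<and> A' \<subseteq> A \<and> \<bar>\<mu> (A - A')\<bar> \<ge> 1" if "I A" for A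
  proof -
    have "ennreal (\<bar>\<mu> A\<bar> + 1) < upper_variation \<Omega> \<mu> A"
      using that by (simp add: I_def)
    then obtain B where B: "B \<in> borel_sets \<Omega>" "B \<subseteq> A" "ennreal (\<bar>\<mu> A\<bar> + 1) < ennreal (\<mu> B)"
      unfolding upper_variation_def less_SUP_iff by auto
    have mB: "\<mu> B > \<bar>\<mu> A\<bar> + 1" using B(3) by (subst (asm) ennreal_less_iff) auto
    have d: "\<mu> (A - B) = \<mu> A - \<mu> B"
      by (rule radon_measure_Diff[OF r]) (use that B in \<open>auto simp: I_def\<close>)
    have AB: "A - B \<in> borel_sets \<Omega>" using that B by (auto simp: I_def)
    let ?P = "positive_part \<Omega> \<mu>"
    have "emeasure ?P A \<le> emeasure ?P (B \<union> (A - B))"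
      by (intro emeasure_mono) (use B(1) AB in \<open>auto simp only: sets_positive_part[OF r]\<close>)
    also have "\<dots> \<le> emeasure ?P B + emeasure ?P (A - B)"
      by (intro emeasure_subadditive) (use B AB sets_positive_part[OF r] in auto)
    finally have "upper_variation \<Omega> \<mu> A \<le> upper_variation \<Omega> \<mu> B + upper_variation \<Omega> \<mu> (A - B)"
      using that B AB by (simp add: emeasure_positive_part[OF r] I_def)
    then have "upper_variation \<Omega> \<mu> B = \<infinity> \<or> upper_variation \<Omega> \<mu> (A - B) = \<infinity>"
      using that by (auto simp: I_def top_unique)
    then show ?thesis
    proof
      assume "upper_variation \<Omega> \<mu> B = \<infinity>"
      then show ?thesis using B d mB by (intro exI[of _ B]) (auto simp: I_def)
    next
      assume "upper_variation \<Omega> \<mu> (A - B) = \<infinity>"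
      moreover have "A - (A - B) = B" using B by blast
      ultimately show ?thesis using AB mB by (intro exI[of _ "A - B"]) (auto simp: I_def)
    qed
  qed
  have "\<exists>f. \<forall>n::nat. I (f n) \<and> (f (Suc n) \<subseteq> f n \<and> \<bar>\<mu> (f n - f (Suc n))\<bar> \<ge> 1)"
  proof (rule dependent_nat_choice)
    show "\<exists>x. I x" using inf self_in_borel_sets unfolding I_def by blast
  qed (use step in blast)
  then obtain f where f: "\<And>n. I (f n)" "\<And>n. f (Suc n) \<subseteq> f n" "\<And>n. \<bar>\<mu> (f n - f (Suc n))\<bar> \<ge> 1"
    by blast
  have dec: "decseq f" using f(2) by (rule decseq_SucI)
  have disj: "disjoint_family (\<lambda>n. f n - f (Suc n))"
    unfolding disjoint_family_on_def
  proof (intro ballI impI)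
    have *: "(f m - f (Suc m)) \<inter> (f n - f (Suc n)) = {}" if "m < n" for m n
    proof -
      have "f n \<subseteq> f (Suc m)" using dec that by (auto simp: decseq_def)
      then show ?thesis by blast
    qed
    fix m n :: nat assume "m \<noteq> n"
    then show "(f m - f (Suc m)) \<inter> (f n - f (Suc n)) = {}"
      using *[of m n] *[of n m] by (cases "m < n") (auto simp: Int_commute)
  qed
  have "(\<lambda>n. \<mu> (f n - f (Suc n))) sums \<mu> (\<Union>n. f n - f (Suc n))"
    by (rule radon_measure_sums[OF r _ disj]) (use f(1) in \<open>auto simp: I_def\<close>)
  then have "(\<lambda>n. \<mu> (f n - f (Suc n))) \<longlonglongrightarrow> 0"
    by (rule summable_LIMSEQ_zero[OF sums_summable])
  then obtain n where "\<bar>\<mu> (f n - f (Suc n))\<bar> < 1"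
    using LIMSEQ_D[of _ 0 1] by fastforce
  then show False using f(3)[of n] by linarith
qed

lemma finite_measure_positive_part:
  "radon_measure \<Omega> \<mu> \<Longrightarrow> finite_measure (positive_part \<Omega> \<mu>)"
  by (rule finite_measureI)
     (use upper_variation_finite[of \<Omega> \<mu>] in
       \<open>simp add: space_positive_part emeasure_positive_part self_in_borel_sets\<close>)

text \<open>
  By \<open>\<mu> B = \<mu> A - \<mu> (A - B)\<close>, passing from \<open>B\<close> to \<open>A - B\<close> turns the supremum of \<open>\<mu>\<close> over the Borel
  subsets of \<open>A\<close> into \<open>\<mu> A\<close> plus the supremum of \<open>- \<mu>\<close>.
\<close>

lemma jordan_decomposition:
  assumes r: "radon_measure \<Omega> \<mu>" and A: "A \<in> borel_sets \<Omega>"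
  shows "\<mu> A = measure (positive_part \<Omega> \<mu>) A - measure (positive_part \<Omega> (\<lambda>A. - \<mu> A)) A"
proof -
  note r' = radon_measure_uminus[OF r]
  let ?P = "positive_part \<Omega> \<mu>" and ?Q = "positive_part \<Omega> (\<lambda>A. - \<mu> A)"
  interpret P: finite_measure ?P by (rule finite_measure_positive_part[OF r])
  interpret Q: finite_measure ?Q by (rule finite_measure_positive_part[OF r'])
  have P: "upper_variation \<Omega> \<mu> A = ennreal (measure ?P A)"
    using emeasure_positive_part[OF r A] by (simp add: P.emeasure_eq_measure)
  have Q: "upper_variation \<Omega> (\<lambda>A. - \<mu> A) A = ennreal (measure ?Q A)"
    using emeasure_positive_part[OF r' A] by (simp add: Q.emeasure_eq_measure)
  have PB: "\<mu> B \<le> measure ?P A" if "B \<in> borel_sets \<Omega>" "B \<subseteq> A" for B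
    using upper_variation_upper[OF that, of \<mu>] P by (simp add: ennreal_le_iff)
  have QB: "- \<mu> B \<le> measure ?Q A" if "B \<in> borel_sets \<Omega>" "B \<subseteq> A" for B
    using upper_variation_upper[OF that, of "\<lambda>A. - \<mu> A"] Q by (simp add: ennreal_le_iff)
  have d: "\<mu> (A - B) = \<mu> A - \<mu> B" if "B \<in> borel_sets \<Omega>" "B \<subseteq> A" for B
    by (rule radon_measure_Diff[OF r A that])
  have "upper_variation \<Omega> (\<lambda>A. - \<mu> A) A \<le> ennreal (measure ?P A - \<mu> A)"
    unfolding upper_variation_def
  proof (rule SUP_least)
    fix B assume "B \<in> {B \<in> borel_sets \<Omega>. B \<subseteq> A}"
    then have B: "B \<in> borel_sets \<Omega>" "B \<subseteq> A" by auto
    have "\<mu> (A - B) \<le> measure ?P A" by (rule PB) (use A B in auto)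
    then show "ennreal (- \<mu> B) \<le> ennreal (measure ?P A - \<mu> A)"
      using d[OF B] by (intro ennreal_leI) auto
  qed
  then have 1: "measure ?Q A \<le> measure ?P A - \<mu> A"
    using PB[OF A] by (simp add: Q ennreal_le_iff)
  have "upper_variation \<Omega> \<mu> A \<le> ennreal (measure ?Q A + \<mu> A)"
    unfolding upper_variation_def
  proof (rule SUP_least)
    fix B assume "B \<in> {B \<in> borel_sets \<Omega>. B \<subseteq> A}"
    then have B: "B \<in> borel_sets \<Omega>" "B \<subseteq> A" by auto
    have "- \<mu> (A - B) \<le> measure ?Q A" by (rule QB) (use A B in auto)
    then show "ennreal (\<mu> B) \<le> ennreal (measure ?Q A + \<mu> A)"
      using d[OF B] by (intro ennreal_leI) auto
  qed
  then have 2: "measure ?P A \<le> measure ?Q A + \<mu> A"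
    using QB[OF A] by (simp add: P ennreal_le_iff)
  from 1 2 show ?thesis by simp
qed

definition bounded_borel :: "('a::topological_space \<Rightarrow> real) \<Rightarrow> bool" where
  "bounded_borel f \<longleftrightarrow> f \<in> borel_measurable borel \<and> (\<exists>c. \<forall>x. \<bar>f x\<bar> \<le> c)"

lemma bounded_borel_indicator: "A \<in> sets borel \<Longrightarrow> bounded_borel (indicator A)"
  unfolding bounded_borel_def by (auto intro!: exI[of _ 1] simp: indicator_def)

lemma bounded_borel_const: "bounded_borel (\<lambda>_. c)"
  unfolding bounded_borel_def by (auto intro: exI[of _ "\<bar>c\<bar>"])

lemma bounded_borel_scale:
  assumes "bounded_borel f" shows "bounded_borel (\<lambda>x. c * f x)"
proof -
  obtain B where B: "f \<in> borel_measurable borel" "\<And>x. \<bar>f x\<bar> \<le> B"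
    using assms unfolding bounded_borel_def by auto
  then have "\<bar>c * f x\<bar> \<le> \<bar>c\<bar> * B" for x by (auto simp: abs_mult intro: mult_left_mono)
  then show ?thesis using B(1) unfolding bounded_borel_def by auto
qed

lemma bounded_borel_add:
  assumes "bounded_borel f" "bounded_borel g" shows "bounded_borel (\<lambda>x. f x + g x)"
proof -
  obtain B where B: "f \<in> borel_measurable borel" "\<And>x. \<bar>f x\<bar> \<le> B"
    using assms unfolding bounded_borel_def by auto
  obtain C where C: "g \<in> borel_measurable borel" "\<And>x. \<bar>g x\<bar> \<le> C"
    using assms unfolding bounded_borel_def by auto
  have "\<bar>f x + g x\<bar> \<le> B + C" for x
    using B(2)[of x] C(2)[of x] by linarith
  then show ?thesis using B(1) C(1) unfolding bounded_borel_def by auto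
qed

lemma bounded_borel_sum:
  assumes "finite S" "\<And>s. s \<in> S \<Longrightarrow> bounded_borel (f s)"
  shows "bounded_borel (\<lambda>x. \<Sum>s\<in>S. f s x)"
  using assms
proof (induction S)
  case empty
  then show ?case by (simp add: bounded_borel_const)
next
  case (insert s S)
  then show ?case by (auto intro: bounded_borel_add)
qed

text \<open>
  A bounded measurable function is a uniform limit of the step functions \<open>e * \<lfloor>f / e\<rfloor>\<close>. Hence
  linear functionals that are bounded in the supremum norm are determined by their values on
  indicator functions.
\<close>

lemma bounded_functional_eqI:
  fixes I J :: "('a::topological_space \<Rightarrow> real) \<Rightarrow> real"
  assumes addI: "\<And>f g. bounded_borel f \<Longrightarrow> bounded_borel g \<Longrightarrow> I (\<lambda>x. f x + g x) = I f + I g"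
    and scaleI: "\<And>f c. bounded_borel f \<Longrightarrow> I (\<lambda>x. c * f x) = c * I f"
    and boundI: "\<And>f c. bounded_borel f \<Longrightarrow> (\<And>x. \<bar>f x\<bar> \<le> c) \<Longrightarrow> \<bar>I f\<bar> \<le> C * c"
    and addJ: "\<And>f g. bounded_borel f \<Longrightarrow> bounded_borel g \<Longrightarrow> J (\<lambda>x. f x + g x) = J f + J g"
    and scaleJ: "\<And>f c. bounded_borel f \<Longrightarrow> J (\<lambda>x. c * f x) = c * J f"
    and boundJ: "\<And>f c. bounded_borel f \<Longrightarrow> (\<And>x. \<bar>f x\<bar> \<le> c) \<Longrightarrow> \<bar>J f\<bar> \<le> D * c"
    and ind: "\<And>A. A \<in> sets borel \<Longrightarrow> I (indicator A) = J (indicator A)"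
    and f: "bounded_borel f"
  shows "I f = J f"
proof -
  have sumI: "I (\<lambda>x. \<Sum>s\<in>S. g s x) = (\<Sum>s\<in>S. I (g s))"
    if "finite S" "\<And>s. s \<in> S \<Longrightarrow> bounded_borel (g s)" for S :: "int set" and g
    using that
  proof (induction S)
    case empty
    show ?case using scaleI[OF bounded_borel_const[of 0], of 0] by simp
  next
    case (insert s S)
    then show ?case by (simp add: addI bounded_borel_sum)
  qed
  have sumJ: "J (\<lambda>x. \<Sum>s\<in>S. g s x) = (\<Sum>s\<in>S. J (g s))"
    if "finite S" "\<And>s. s \<in> S \<Longrightarrow> bounded_borel (g s)" for S :: "int set" and g
    using that
  proof (induction S)
    case empty
    show ?case using scaleJ[OF bounded_borel_const[of 0], of 0] by simp
  next
    case (insert s S)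
    then show ?case by (simp add: addJ bounded_borel_sum)
  qed
  obtain B where B: "f \<in> borel_measurable borel" "\<And>x. \<bar>f x\<bar> \<le> B"
    using f unfolding bounded_borel_def by auto
  have main: "\<bar>I f - J f\<bar> \<le> (C + D) * e" if e: "e > 0" for e
  proof -
    define S where "S = {\<lfloor>- B / e\<rfloor>..\<lfloor>B / e\<rfloor>}"
    define g where "g j x = (e * real_of_int j) * indicator {x. \<lfloor>f x / e\<rfloor> = j} x" for j x
    define s where "s x = (\<Sum>j\<in>S. g j x)" for x
    have meas: "{x. \<lfloor>f x / e\<rfloor> = j} \<in> sets borel" for j
      using B(1) by measurable
    have g: "bounded_borel (g j)" for j
      unfolding g_def by (intro bounded_borel_scale bounded_borel_indicator meas)
    have s: "bounded_borel s"
      unfolding s_def by (intro bounded_borel_sum g) (auto simp: S_def)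
    have s_eq: "s x = e * real_of_int \<lfloor>f x / e\<rfloor>" for x
    proof -
      have "\<lfloor>f x / e\<rfloor> \<in> S"
        unfolding S_def using B(2)[of x] e
        by (auto simp: abs_le_iff field_simps intro!: floor_mono)
      moreover have "g j x = (if j = \<lfloor>f x / e\<rfloor> then e * real_of_int \<lfloor>f x / e\<rfloor> else 0)" for j
        by (auto simp: g_def)
      ultimately show ?thesis
        unfolding s_def by (simp add: S_def)
    qed
    have d: "bounded_borel (\<lambda>x. f x + (- 1) * s x)"
      by (intro bounded_borel_add bounded_borel_scale f s)
    have db: "\<bar>f x + (-1) * s x\<bar> \<le> e" for x
    proof -
      have "real_of_int \<lfloor>f x / e\<rfloor> \<le> f x / e" "f x / e < real_of_int \<lfloor>f x / e\<rfloor> + 1"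
        by linarith+
      moreover have "f x = e * (f x / e)" using e by simp
      ultimately have "e * real_of_int \<lfloor>f x / e\<rfloor> \<le> f x" "f x \<le> e * (real_of_int \<lfloor>f x / e\<rfloor> + 1)"
        using e mult_left_mono[of "real_of_int \<lfloor>f x / e\<rfloor>" "f x / e" e]
          mult_left_mono[of "f x / e" "real_of_int \<lfloor>f x / e\<rfloor> + 1" e] by linarith+
      then show ?thesis unfolding s_eq by (simp add: algebra_simps)
    qed
    have sJ: "I s = J s"
    proof -
      have "I s = (\<Sum>j\<in>S. I (g j))"
        unfolding s_def by (rule sumI) (auto simp: S_def g)
      also have "\<dots> = (\<Sum>j\<in>S. J (g j))"
        unfolding g_def
        by (intro sum.cong refl) (simp add: scaleI scaleJ bounded_borel_indicator meas ind)
      also have "\<dots> = J s"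
        unfolding s_def by (rule sumJ[symmetric]) (auto simp: S_def g)
      finally show ?thesis .
    qed
    have "I (\<lambda>x. f x + (-1) * s x) = I f - I s"
      using addI[OF f bounded_borel_scale[OF s, of "-1"]] scaleI[OF s, of "-1"] by simp
    moreover have "J (\<lambda>x. f x + (-1) * s x) = J f - J s"
      using addJ[OF f bounded_borel_scale[OF s, of "-1"]] scaleJ[OF s, of "-1"] by simp
    ultimately have "I f - J f = I (\<lambda>x. f x + (-1) * s x) - J (\<lambda>x. f x + (-1) * s x)"
      using sJ by simp
    also have "\<bar>\<dots>\<bar> \<le> C * e + D * e"
      using boundI[OF d db] boundJ[OF d db] by linarith
    finally show ?thesis by (simp add: algebra_simps)
  qed
  have "\<bar>I f - J f\<bar> \<le> 0"
  proof (rule field_le_epsilon)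
    fix e :: real assume e: "e > 0"
    have "\<bar>I f - J f\<bar> \<le> (C + D) * (e / (\<bar>C + D\<bar> + 1))" by (rule main) (use e in auto)
    also have "\<dots> \<le> (\<bar>C + D\<bar> + 1) * (e / (\<bar>C + D\<bar> + 1))"
      by (rule mult_right_mono) (use e in auto)
    also have "\<dots> = e" by simp
    finally show "\<bar>I f - J f\<bar> \<le> 0 + e" by simp
  qed
  then show ?thesis by simp
qed

lemma integrable_positive_part:
  assumes r: "radon_measure \<Omega> \<mu>" and f: "bounded_borel f"
  shows "integrable (positive_part \<Omega> \<mu>) f"
proof -
  interpret P: finite_measure "positive_part \<Omega> \<mu>" by (rule finite_measure_positive_part[OF r])
  obtain B where B: "f \<in> borel_measurable borel" "\<And>x. \<bar>f x\<bar> \<le> B"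
    using f unfolding bounded_borel_def by auto
  have "f \<in> borel_measurable (positive_part \<Omega> \<mu>)"
    using measurable_restrict_space1[OF B(1), of \<Omega>]
    by (simp cong: measurable_cong_sets add: sets_positive_part[OF r])
  then show ?thesis
    by (rule P.integrable_const_bound[rotated]) (use B(2) in auto)
qed

lemma signed_integral_add:
  assumes r: "radon_measure \<Omega> \<mu>" and "bounded_borel f" "bounded_borel g"
  shows "signed_integral \<Omega> \<mu> (\<lambda>x. f x + g x) = signed_integral \<Omega> \<mu> f + signed_integral \<Omega> \<mu> g"
  unfolding signed_integral_def
  using assms integrable_positive_part[OF r] integrable_positive_part[OF radon_measure_uminus[OF r]]
  by simp

lemma signed_integral_scale:
  "signed_integral \<Omega> \<mu> (\<lambda>x. c * f x) = c * signed_integral \<Omega> \<mu> f"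
  unfolding signed_integral_def by (simp add: right_diff_distrib)

lemma signed_integral_bound:
  assumes r: "radon_measure \<Omega> \<mu>" and f: "bounded_borel f" and c: "\<And>x. \<bar>f x\<bar> \<le> c"
  shows "\<bar>signed_integral \<Omega> \<mu> f\<bar>
    \<le> (measure (positive_part \<Omega> \<mu>) \<Omega> + measure (positive_part \<Omega> (\<lambda>A. - \<mu> A)) \<Omega>) * c"
proof -
  have *: "\<bar>integral\<^sup>L (positive_part \<Omega> \<nu>) f\<bar> \<le> measure (positive_part \<Omega> \<nu>) \<Omega> * c"
    if r: "radon_measure \<Omega> \<nu>" for \<nu>
  proof -
    interpret P: finite_measure "positive_part \<Omega> \<nu>" by (rule finite_measure_positive_part[OF r])
    have "\<bar>integral\<^sup>L (positive_part \<Omega> \<nu>) f\<bar> \<le> integral\<^sup>L (positive_part \<Omega> \<nu>) (\<lambda>x. \<bar>f x\<bar>)"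
      using integral_norm_bound[of "positive_part \<Omega> \<nu>" f] by simp
    also have "\<dots> \<le> integral\<^sup>L (positive_part \<Omega> \<nu>) (\<lambda>x. c)"
      by (intro integral_mono) (use integrable_positive_part[OF r f] c in auto)
    also have "\<dots> = measure (positive_part \<Omega> \<nu>) \<Omega> * c"
      by (simp add: space_positive_part[OF r])
    finally show ?thesis .
  qed
  show ?thesis
    unfolding signed_integral_def
    using *[OF r] *[OF radon_measure_uminus[OF r]] by (simp add: distrib_right)
qed

lemma signed_integral_indicator:
  assumes r: "radon_measure \<Omega> \<mu>" and "\<Omega> \<in> sets borel" "A \<in> sets borel"
  shows "signed_integral \<Omega> \<mu> (indicator A) = \<mu> (A \<inter> \<Omega>)"
proof -
  have A: "A \<inter> \<Omega> \<in> borel_sets \<Omega>" using assms by (simp add: borel_sets_iff)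
  have *: "integral\<^sup>L (positive_part \<Omega> \<nu>) (indicator A) = measure (positive_part \<Omega> \<nu>) (A \<inter> \<Omega>)"
    if r: "radon_measure \<Omega> \<nu>" for \<nu>
    by (simp add: space_positive_part[OF r])
  show ?thesis
    unfolding signed_integral_def *[OF r] *[OF radon_measure_uminus[OF r]]
    using jordan_decomposition[OF r A] by simp
qed

text \<open>
  All signed integrals below are computed in this way: a bounded linear functional with the right
  values on indicator functions is the integral, and the Jordan decomposition of the measure is
  never determined.
\<close>

lemma signed_integral_eqI:
  assumes r: "radon_measure \<Omega> \<mu>" and \<Omega>: "\<Omega> \<in> sets borel"
    and "\<And>f g. bounded_borel f \<Longrightarrow> bounded_borel g \<Longrightarrow> I (\<lambda>x. f x + g x) = I f + I g"
    and "\<And>f c. bounded_borel f \<Longrightarrow> I (\<lambda>x. c * f x) = c * I f"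
    and "\<And>f c. bounded_borel f \<Longrightarrow> (\<And>x. \<bar>f x\<bar> \<le> c) \<Longrightarrow> \<bar>I f\<bar> \<le> C * c"
    and "\<And>A. A \<in> sets borel \<Longrightarrow> I (indicator A) = \<mu> (A \<inter> \<Omega>)"
    and "bounded_borel f"
  shows "signed_integral \<Omega> \<mu> f = I f"
proof (rule bounded_functional_eqI[of "signed_integral \<Omega> \<mu>" _ I C])
  show "signed_integral \<Omega> \<mu> (\<lambda>x. f x + g x) = signed_integral \<Omega> \<mu> f + signed_integral \<Omega> \<mu> g"
    if "bounded_borel f" "bounded_borel g" for f g
    by (rule signed_integral_add[OF r that])
  show "signed_integral \<Omega> \<mu> (\<lambda>x. c * f x) = c * signed_integral \<Omega> \<mu> f" for c f
    by (rule signed_integral_scale)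
  show "\<bar>signed_integral \<Omega> \<mu> f\<bar>
      \<le> (measure (positive_part \<Omega> \<mu>) \<Omega> + measure (positive_part \<Omega> (\<lambda>A. - \<mu> A)) \<Omega>) * c"
    if "bounded_borel f" "\<And>x. \<bar>f x\<bar> \<le> c" for f c
    by (rule signed_integral_bound[OF r that])
  show "signed_integral \<Omega> \<mu> (indicator A) = I (indicator A)" if "A \<in> sets borel" for A
    using signed_integral_indicator[OF r \<Omega> that] assms(6)[OF that] by simp
qed (fact assms(3) assms(4) assms(5) assms(7))+

section \<open>Smooth approximations of boxes\<close>

lemma C_k_const: "C_k k (\<lambda>x::'a::euclidean_space. c)"
  by (induction k arbitrary: c) (auto simp: frechet_derivative_const)

lemma C_k_Suc_imp: "C_k (Suc k) f \<Longrightarrow> C_k k f"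
proof (induction k arbitrary: f)
  case 0
  then show ?case
    by (auto intro!: differentiable_imp_continuous_on simp: differentiable_on_def differentiable_at_withinI)
next
  case (Suc k)
  then show ?case by (auto simp del: C_k.simps(2) simp: C_k.simps(2)[of "Suc k"] C_k.simps(2)[of k])
qed

lemma C_k_add: "C_k k f \<Longrightarrow> C_k k g \<Longrightarrow> C_k k (\<lambda>x. f x + g x)"
proof (induction k arbitrary: f g)
  case 0
  then show ?case by (auto intro: continuous_on_add)
next
  case (Suc k)
  have "frechet_derivative (\<lambda>x. f x + g x) (at x) = (\<lambda>h. frechet_derivative f (at x) h + frechet_derivative g (at x) h)" for x
    using Suc.prems by (intro frechet_derivative_at[symmetric] has_derivative_add) (auto simp: frechet_derivative_works)
  then show ?case using Suc by (auto intro: differentiable_add)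
qed

lemma C_k_mult: "C_k k f \<Longrightarrow> C_k k g \<Longrightarrow> C_k k (\<lambda>x. f x * g x)"
proof (induction k arbitrary: f g)
  case 0
  then show ?case by (auto intro: continuous_on_mult)
next
  case (Suc k)
  have fg: "C_k k f" "C_k k g" using Suc.prems C_k_Suc_imp by blast+
  have "frechet_derivative (\<lambda>x. f x * g x) (at x) = (\<lambda>h. f x * frechet_derivative g (at x) h + frechet_derivative f (at x) h * g x)" for x
    using Suc.prems by (intro frechet_derivative_at[symmetric] has_derivative_mult) (auto simp: frechet_derivative_works)
  then show ?case using Suc fg by (auto intro!: C_k_add Suc.IH)
qed

lemma C_k_prod:
  assumes "finite S" "\<And>s. s \<in> S \<Longrightarrow> C_k k (f s)"
  shows "C_k k (\<lambda>x. \<Prod>s\<in>S. f s x)"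
  using assms by (induction S) (auto simp: C_k_const intro: C_k_mult)

text \<open>
  The functions \<open>p(1/t) exp(-1/t)\<close>, extended by zero to \<open>t \<le> 0\<close>. Allowing all polynomials \<open>p\<close>
  makes the family closed under differentiation, so that smoothness of every order follows by one
  induction.
\<close>

definition flat_exp :: "real poly \<Rightarrow> real \<Rightarrow> real" where
  "flat_exp p t = (if t > 0 then poly p (1 / t) * exp (- (1 / t)) else 0)"

definition flat_exp_deriv :: "real poly \<Rightarrow> real poly" where
  "flat_exp_deriv p = [:0, 0, 1:] * (p - pderiv p)"

lemma poly_exp_tendsto_0: "((\<lambda>x. poly p x * exp (- x)) \<longlongrightarrow> (0::real)) at_top"
proof -
  have "((\<lambda>x. \<Sum>i\<le>degree p. coeff p i * (x ^ i / exp x)) \<longlongrightarrow> (\<Sum>i\<le>degree p. coeff p i * 0)) at_top"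
    by (intro tendsto_sum tendsto_mult tendsto_const tendsto_power_div_exp_0)
  moreover have "(\<Sum>i\<le>degree p. coeff p i * (x ^ i / exp x)) = poly p x * exp (- x)" for x
    by (simp add: poly_altdef sum_distrib_right exp_minus divide_inverse mult.assoc)
  ultimately show ?thesis by simp
qed

lemma flat_exp_tendsto_0: "(flat_exp p \<longlongrightarrow> 0) (at 0)"
proof -
  have "((\<lambda>t. poly p (1 / t) * exp (- (1 / t))) \<longlongrightarrow> 0) (at_right (0::real))"
  proof (rule filterlim_compose[OF poly_exp_tendsto_0])
    show "LIM t at_right (0::real). 1 / t :> at_top"
      using filterlim_inverse_at_top_right by (simp add: divide_inverse)
  qed
  then have "(flat_exp p \<longlongrightarrow> 0) (at_right 0)"
    by (rule Lim_transform_eventually) (auto simp: flat_exp_def eventually_at_filter)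
  moreover have "(flat_exp p \<longlongrightarrow> 0) (at_left 0)"
    by (rule Lim_transform_eventually[OF tendsto_const]) (auto simp: flat_exp_def eventually_at_filter)
  ultimately show ?thesis by (simp add: filterlim_at_split)
qed

lemma flat_exp_has_derivative:
  "(flat_exp p has_real_derivative flat_exp (flat_exp_deriv p) t) (at t)"
proof -
  consider "t > 0" | "t < 0" | "t = 0" by linarith
  then show ?thesis
  proof cases
    case 1
    have "((\<lambda>t. poly p (1 / t) * exp (- (1 / t))) has_real_derivative flat_exp (flat_exp_deriv p) t) (at t)"
      using 1 by (auto intro!: derivative_eq_intros DERIV_chain2[of "poly p"] poly_DERIV
          simp: flat_exp_def flat_exp_deriv_def field_simps power2_eq_square)
    then show ?thesis
      by (rule has_field_derivative_transform_within_open[of _ _ _ "{0<..}"])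
         (use 1 in \<open>auto simp: flat_exp_def\<close>)
  next
    case 2
    have "((\<lambda>t. 0) has_real_derivative flat_exp (flat_exp_deriv p) t) (at t)"
      using 2 by (simp add: flat_exp_def)
    then show ?thesis
      by (rule has_field_derivative_transform_within_open[of _ _ _ "{..<0}"])
         (use 2 in \<open>auto simp: flat_exp_def\<close>)
  next
    case 3
    have "flat_exp p h / h = flat_exp ([:0,1:] * p) h" for h
      by (simp add: flat_exp_def)
    then have "((\<lambda>h. (flat_exp p (0 + h) - flat_exp p 0) / h) \<longlongrightarrow> 0) (at 0)"
      using flat_exp_tendsto_0[of "[:0,1:] * p"] by (simp add: flat_exp_def[of p 0])
    then show ?thesis using 3 by (simp add: DERIV_def flat_exp_def[of _ 0])
  qed
qed

lemma C_k_flat_exp_coordinate: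
  "C_k k (\<lambda>x::real^'n. d * flat_exp p (c * x $ i + e))"
proof (induction k arbitrary: p d)
  case 0
  have "continuous_on UNIV (flat_exp p)"
    using flat_exp_has_derivative by (intro continuous_at_imp_continuous_on ballI DERIV_isCont) blast
  then have "continuous_on UNIV (\<lambda>x::real^'n. flat_exp p (c * x $ i + e))"
    by (rule continuous_on_compose2) (auto intro!: continuous_intros)
  then show ?case by (auto intro: continuous_on_mult)
next
  case (Suc k)
  have d: "((\<lambda>x::real^'n. d * flat_exp p (c * x $ i + e)) has_derivative
      (\<lambda>h. d * (flat_exp (flat_exp_deriv p) (c * x $ i + e) * (c * h $ i)))) (at x)" for x
  proof -
    have l: "((\<lambda>x::real^'n. c * x $ i + e) has_derivative (\<lambda>h. c * h $ i)) (at x)"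
      by (intro has_derivative_add_const has_derivative_mult_right
          bounded_linear_imp_has_derivative bounded_linear_vec_nth)
    show ?thesis
      by (rule has_derivative_mult_right)
         (rule has_derivative_compose[OF l flat_exp_has_derivative[unfolded has_field_derivative_def]])
  qed
  have "frechet_derivative (\<lambda>x::real^'n. d * flat_exp p (c * x $ i + e)) (at x)
      = (\<lambda>h. d * (flat_exp (flat_exp_deriv p) (c * x $ i + e) * (c * h $ i)))" for x
    using frechet_derivative_at[OF d] by simp
  moreover have "(\<lambda>x. d * (flat_exp (flat_exp_deriv p) (c * x $ i + e) * (c * b $ i)))
      = (\<lambda>x::real^'n. (d * c * b $ i) * flat_exp (flat_exp_deriv p) (c * x $ i + e))" for b :: "real^'n"
    by (auto simp: algebra_simps)
  ultimately show ?case using d Suc by (auto simp: differentiable_def simp del: mult.assoc)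
qed

lemma flat_exp_1_bounds: "0 \<le> flat_exp 1 t" "flat_exp 1 t \<le> 1"
  by (auto simp: flat_exp_def)

text \<open>
  The factors are \<open>flat_exp 1 (n s - 1)\<close> for the signed distances \<open>s\<close> of \<open>x\<close> to the faces. The
  shift by 1 keeps the support at distance \<open>1/n\<close> from the boundary of the box, and inside the box
  each argument tends to infinity with \<open>n\<close>.
\<close>

definition box_bump :: "real^'n \<Rightarrow> real^'n \<Rightarrow> nat \<Rightarrow> real^'n \<Rightarrow> real" where
  "box_bump a b n x = (\<Prod>i\<in>UNIV. flat_exp 1 (real n * x $ i + (- real n * a $ i - 1))
     * flat_exp 1 (- real n * x $ i + (real n * b $ i - 1)))"

lemma C_k_box_bump: "C_k k (box_bump a b n)"
  unfolding box_bump_def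
  by (intro C_k_prod C_k_mult C_k_flat_exp_coordinate[of _ 1, simplified]) auto

lemma box_bump_bounds: "0 \<le> box_bump a b n x" "box_bump a b n x \<le> 1"
  unfolding box_bump_def
  by (auto intro!: prod_nonneg prod_le_1 mult_le_one mult_nonneg_nonneg flat_exp_1_bounds)

lemma test_function_box_bump:
  fixes a b :: "real^'n"
  assumes "box a b \<subseteq> V" "n > 0"
  shows "test_function V (box_bump a b n)"
proof -
  let ?a = "\<chi> i. a $ i + 1 / n" and ?b = "\<chi> i. b $ i - 1 / n"
  have "{x. box_bump a b n x \<noteq> 0} \<subseteq> cbox ?a ?b"
  proof
    fix x assume "x \<in> {x. box_bump a b n x \<noteq> 0}"
    then have *: "real n * x $ i + (- real n * a $ i - 1) > 0 \<and> - real n * x $ i + (real n * b $ i - 1) > 0" for i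
      by (auto simp: box_bump_def flat_exp_def split: if_splits)
    have "a $ i + 1 / n \<le> x $ i \<and> x $ i \<le> b $ i - 1 / n" for i
      using *[of i] assms(2) by (auto simp: field_simps)
    then show "x \<in> cbox ?a ?b" by (auto simp: mem_box_cart)
  qed
  then have cl: "closure {x. box_bump a b n x \<noteq> 0} \<subseteq> cbox ?a ?b"
    by (intro closure_minimal) auto
  also have "\<dots> \<subseteq> box a b"
  proof
    fix x assume "x \<in> cbox ?a ?b"
    then have "a $ i + 1 / n \<le> x $ i \<and> x $ i \<le> b $ i - 1 / n" for i
      by (auto simp: mem_box_cart)
    moreover have "1 / real n > 0" using assms by simp
    ultimately have "a $ i < x $ i \<and> x $ i < b $ i" for i
      by (smt (verit))
    then show "x \<in> box a b" by (auto simp: mem_box_cart)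
  qed
  finally have "closure {x. box_bump a b n x \<noteq> 0} \<subseteq> V" using assms by blast
  moreover have "compact (closure {x. box_bump a b n x \<noteq> 0})"
    using cl by (meson bounded_cbox bounded_subset closed_closure compact_eq_bounded_closed)
  ultimately show ?thesis unfolding test_function_def using C_k_box_bump by auto
qed

lemma flat_exp_1_limit:
  "(\<lambda>n. flat_exp 1 (real n * s - 1)) \<longlonglongrightarrow> (if s > 0 then 1 else 0)"
proof (cases "s > 0")
  case True
  have "LIM n sequentially. s * real n :> at_top"
    by (rule filterlim_tendsto_pos_mult_at_top[OF tendsto_const True filterlim_real_sequentially])
  then have inf: "LIM n sequentially. -1 + s * real n :> at_top"
    by (rule filterlim_tendsto_add_at_top[OF tendsto_const])
  then have "(\<lambda>n. inverse (-1 + s * real n)) \<longlonglongrightarrow> 0"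
    by (rule tendsto_inverse_0_at_top)
  then have "(\<lambda>n. exp (- inverse (-1 + s * real n))) \<longlonglongrightarrow> exp (- 0)"
    by (intro tendsto_exp tendsto_minus)
  moreover have "eventually (\<lambda>n. -1 + s * real n > 0) sequentially"
    using inf unfolding filterlim_at_top_dense by blast
  ultimately have "(\<lambda>n. flat_exp 1 (real n * s - 1)) \<longlonglongrightarrow> exp (- 0)"
    by (elim Lim_transform_eventually)
       (auto elim!: eventually_mono simp: flat_exp_def inverse_eq_divide algebra_simps)
  then show ?thesis using True by simp
next
  case False
  then have "real n * s - 1 \<le> 0" for n by (smt (verit) mult_nonneg_nonpos of_nat_0_le_iff)
  then have "flat_exp 1 (real n * s - 1) = 0" for n by (auto simp: flat_exp_def not_less)
  then show ?thesis using False by simp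
qed

lemma box_bump_limit: "(\<lambda>n. box_bump a b n x) \<longlonglongrightarrow> indicator (box a b) x"
proof -
  have "(\<lambda>n. \<Prod>i\<in>UNIV. flat_exp 1 (real n * (x $ i - a $ i) - 1) * flat_exp 1 (real n * (b $ i - x $ i) - 1))
     \<longlonglongrightarrow> (\<Prod>i\<in>UNIV. (if x $ i - a $ i > 0 then 1 else 0) * (if b $ i - x $ i > 0 then 1 else 0))"
    by (intro tendsto_prod tendsto_mult flat_exp_1_limit)
  moreover have "(\<Prod>i\<in>UNIV. (if x $ i - a $ i > 0 then 1 else 0) * (if b $ i - x $ i > 0 then 1 else 0))
     = (indicator (box a b) x :: real)"
    by (auto simp: indicator_def mem_box_cart intro!: prod.neutral)
  ultimately show ?thesis by (simp add: box_bump_def algebra_simps)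
qed

section \<open>A Cantor staircase near the identity\<close>

text \<open>
  Slope 2 on the first half of each unit interval and slope 0 on the second half.
\<close>

definition climb :: "real \<Rightarrow> real" where
  "climb y = of_int \<lfloor>y\<rfloor> + min 1 (2 * frac y)"

lemma climb_lipschitz:
  assumes "x \<le> y"
  shows "climb x \<le> climb y" "climb y - climb x \<le> 2 * (y - x)"
proof -
  have fr: "frac z = z - of_int \<lfloor>z\<rfloor>" "0 \<le> frac z" "frac z < 1" for z :: real
    using frac_lt_1[of z] by (auto simp: frac_def)
  have fl: "\<lfloor>x\<rfloor> \<le> \<lfloor>y\<rfloor>" using assms by (rule floor_mono)
  have "climb x \<le> climb y \<and> climb y - climb x \<le> 2 * (y - x)"
  proof (cases "\<lfloor>x\<rfloor> = \<lfloor>y\<rfloor>")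
    case True
    then show ?thesis using assms by (auto simp: climb_def fr(1) min_def)
  next
    case False
    then have "\<lfloor>x\<rfloor> + 1 \<le> \<lfloor>y\<rfloor>" using fl by linarith
    then have "real_of_int \<lfloor>x\<rfloor> + 1 \<le> real_of_int \<lfloor>y\<rfloor>"
      by (metis of_int_1 of_int_add of_int_le_iff)
    then show ?thesis
      using fr[of x] fr[of y] unfolding climb_def min_def by (smt (verit))
  qed
  then show "climb x \<le> climb y" "climb y - climb x \<le> 2 * (y - x)" by auto
qed

lemma climb_add_of_int: "climb (y + of_int k) = climb y + of_int k"
  by (simp add: climb_def frac_def)

lemma climb_near: "\<bar>climb y - y\<bar> \<le> 1"
proof -
  have "0 \<le> frac y" "frac y < 1" "y = of_int \<lfloor>y\<rfloor> + frac y"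
    using frac_lt_1[of y] by (auto simp: frac_def)
  then show ?thesis unfolding climb_def by linarith
qed

definition stretch :: "real \<Rightarrow> real" where
  "stretch x = climb (2 * x)"

lemma stretch_mono: "x \<le> y \<Longrightarrow> stretch x \<le> stretch y"
  unfolding stretch_def by (intro climb_lipschitz) simp

lemma stretch_dist: "\<bar>stretch y - stretch x\<bar> \<le> 4 * \<bar>y - x\<bar>"
proof -
  have *: "\<bar>stretch y - stretch x\<bar> \<le> 4 * \<bar>y - x\<bar>" if "x \<le> y" for x y
    using climb_lipschitz[of "2 * x" "2 * y"] that unfolding stretch_def by auto
  show ?thesis using *[of x y] *[of y x] by (cases "x \<le> y") (auto simp: abs_minus_commute)
qed

lemma continuous_stretch: "isCont stretch x"
  unfolding isCont_def
proof (rule LIM_I)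
  fix r :: real assume "r > 0"
  then show "\<exists>s>0. \<forall>y. y \<noteq> x \<and> norm (y - x) < s \<longrightarrow> norm (stretch y - stretch x) < r"
    by (intro exI[of _ "r / 4"])
       (auto intro: le_less_trans[OF stretch_dist])
qed

lemma stretch_pow_mono: "x \<le> y \<Longrightarrow> (stretch ^^ n) x \<le> (stretch ^^ n) y"
  by (induction n) (auto intro: stretch_mono)

lemma stretch_add_of_int: "stretch (x + of_int k) = stretch x + of_int (2 * k)"
  using climb_add_of_int[of "2 * x" "2 * k"] by (simp add: stretch_def algebra_simps)

lemma stretch_pow_add_1: "(stretch ^^ n) (x + 1) = (stretch ^^ n) x + of_int (2 ^ n)"
proof (induction n)
  case (Suc n)
  have "(stretch ^^ Suc n) (x + 1) = stretch ((stretch ^^ n) x + of_int (2 ^ n))"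
    by (simp only: funpow.simps o_apply Suc)
  then show ?case by (simp only: stretch_add_of_int) simp
qed auto

definition cantor_term :: "nat \<Rightarrow> real \<Rightarrow> real" where
  "cantor_term n x = (stretch ((stretch ^^ n) x) - 2 * (stretch ^^ n) x) / 2 ^ Suc n"

text \<open>
  The limit of \<open>stretch\<^sup>n x / 2\<^sup>n\<close>, which solves \<open>c (stretch x) = 2 c x\<close>. Writing the limit as a
  series of increments makes uniform convergence and the distance to the identity visible.
\<close>

definition cantor :: "real \<Rightarrow> real" where
  "cantor x = x + (\<Sum>n. cantor_term n x)"

lemma cantor_term_bound: "\<bar>cantor_term n x\<bar> \<le> (1 / 2) ^ Suc n"
  using climb_near[of "2 * (stretch ^^ n) x"]
  unfolding cantor_term_def stretch_def[of "(stretch ^^ n) x" for n x]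
  by (simp add: power_divide divide_right_mono del: funpow.simps power_Suc)

lemma summable_half: "summable (\<lambda>n. (1 / 2 :: real) ^ Suc n)"
  by (simp add: summable_geometric)

lemma summable_cantor_term: "summable (\<lambda>n. cantor_term n x)"
  by (rule summable_comparison_test'[OF summable_half, of 0]) (use cantor_term_bound in auto)

lemma cantor_near: "\<bar>cantor x - x\<bar> \<le> 1"
proof -
  have "\<bar>\<Sum>n. cantor_term n x\<bar> \<le> (\<Sum>n. (1 / 2 :: real) ^ Suc n)"
    using cantor_term_bound[of _ x]
    by (intro order_trans[OF summable_rabs] suminf_le summable_half
        summable_comparison_test'[OF summable_half, of 0]) auto
  also have "\<dots> = 1" using power_half_series by (rule sums_unique[symmetric])
  finally show ?thesis by (simp add: cantor_def)
qed

lemma cantor_partial: "x + (\<Sum>k<n. cantor_term k x) = (stretch ^^ n) x / 2 ^ n"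
  by (induction n) (auto simp: cantor_term_def field_simps)

lemma cantor_limit: "(\<lambda>n. (stretch ^^ n) x / 2 ^ n) \<longlonglongrightarrow> cantor x"
  unfolding cantor_partial[symmetric] cantor_def
  by (intro tendsto_add tendsto_const summable_LIMSEQ summable_cantor_term)

lemma continuous_cantor: "continuous_on UNIV cantor"
proof -
  have "uniform_limit UNIV (\<lambda>n x. \<Sum>k<n. cantor_term k x) (\<lambda>x. \<Sum>k. cantor_term k x) sequentially"
    by (rule Weierstrass_m_test[OF _ summable_half]) (use cantor_term_bound in auto)
  moreover have "continuous_on UNIV (\<lambda>x. \<Sum>k<n. cantor_term k x)" for n
  proof -
    have "continuous_on UNIV (stretch ^^ n)" for n
    proof (induction n)
      case (Suc n)
      have "continuous_on UNIV stretch"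
        by (simp add: continuous_at_imp_continuous_on continuous_stretch)
      then have "continuous_on UNIV (\<lambda>x. stretch ((stretch ^^ n) x))"
        by (rule continuous_on_compose2[OF _ Suc]) auto
      then show ?case by (simp add: o_def)
    qed (simp add: id_def)
    then have "continuous_on UNIV (\<lambda>x. (stretch ^^ n) x / 2 ^ n - x)"
      by (intro continuous_intros) auto
    then show ?thesis by (simp flip: cantor_partial)
  qed
  ultimately have "continuous_on UNIV (\<lambda>x. \<Sum>k. cantor_term k x)"
    by (intro uniform_limit_theorem[of _ _ sequentially]) auto
  then show ?thesis unfolding cantor_def by (intro continuous_intros)
qed

lemma cantor_mono: "x \<le> y \<Longrightarrow> cantor x \<le> cantor y"
  by (rule LIMSEQ_le[OF cantor_limit cantor_limit])
     (auto intro!: exI[of _ 0] divide_right_mono stretch_pow_mono)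

lemma cantor_add_1: "cantor (x + 1) = cantor x + 1"
proof -
  have "(\<lambda>n. (stretch ^^ n) x / 2 ^ n + 1) \<longlonglongrightarrow> cantor x + 1"
    by (intro tendsto_add tendsto_const cantor_limit)
  then have "(\<lambda>n. (stretch ^^ n) (x + 1) / 2 ^ n) \<longlonglongrightarrow> cantor x + 1"
    by (simp add: stretch_pow_add_1 add_divide_distrib)
  then show ?thesis by (rule LIMSEQ_unique[OF cantor_limit])
qed

lemma cantor_stretch: "cantor (stretch x) = 2 * cantor x"
proof -
  have "(\<lambda>n. (stretch ^^ Suc n) x / 2 ^ Suc n) \<longlonglongrightarrow> cantor x"
    by (rule LIMSEQ_Suc[OF cantor_limit])
  then have "(\<lambda>n. 2 * ((stretch ^^ Suc n) x / 2 ^ Suc n)) \<longlonglongrightarrow> 2 * cantor x"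
    by (rule tendsto_mult_left)
  then have "(\<lambda>n. (stretch ^^ n) (stretch x) / 2 ^ n) \<longlonglongrightarrow> 2 * cantor x"
    by (simp add: funpow_Suc_right del: funpow.simps)
  then show ?thesis by (rule LIMSEQ_unique[OF cantor_limit])
qed

text \<open>
  The points where \<open>cantor\<close> increases. Self-similarity of this set is inherited from the
  functional equations of \<open>cantor\<close>, so that no expansion in digits is needed.
\<close>

definition cantor_set :: "real set" where
  "cantor_set = {x. \<not> (\<forall>\<^sub>F y in nhds x. cantor y = cantor x)}"

lemma closed_cantor_set: "closed cantor_set"
proof -
  have "open (- cantor_set)"
  proof (rule open_subopen[THEN iffD2, rule_format])
    fix x assume "x \<in> - cantor_set"
    then have "\<forall>\<^sub>F y in nhds x. cantor y = cantor x" by (simp add: cantor_set_def)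
    then obtain U where U: "open U" "x \<in> U" "\<And>y. y \<in> U \<Longrightarrow> cantor y = cantor x"
      unfolding eventually_nhds by blast
    have "U \<subseteq> - cantor_set"
    proof
      fix y assume "y \<in> U"
      then have "\<forall>\<^sub>F z in nhds y. cantor z = cantor y"
        by (intro eventually_mono[OF eventually_nhds_in_open[OF U(1)]]) (auto simp: U(3))
      then show "y \<in> - cantor_set" by (simp add: cantor_set_def)
    qed
    then show "\<exists>T. open T \<and> x \<in> T \<and> T \<subseteq> - cantor_set" using U(1,2) by blast
  qed
  then show ?thesis by (simp add: closed_def)
qed

lemma cantor_set_stretch: "x \<in> cantor_set \<Longrightarrow> stretch x \<in> cantor_set"
proof (rule ccontr)
  assume x: "x \<in> cantor_set" and "stretch x \<notin> cantor_set"
  then have "\<forall>\<^sub>F y in nhds (stretch x). cantor y = cantor (stretch x)" by (simp add: cantor_set_def)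
  moreover have "filterlim stretch (nhds (stretch x)) (nhds x)"
    using continuous_stretch[of x] by (simp add: isCont_def tendsto_at_iff_tendsto_nhds)
  ultimately have "\<forall>\<^sub>F y in nhds x. cantor (stretch y) = cantor (stretch x)"
    by (rule eventually_compose_filterlim)
  then show False using x by (simp add: cantor_stretch cantor_set_def)
qed

text \<open>
  Where the fractional part of \<open>2 x\<close> exceeds \<open>1/2\<close>, the function \<open>stretch\<close> is constant, hence so
  is \<open>cantor = cantor \<circ> stretch / 2\<close>.
\<close>

lemma cantor_set_frac: "x \<in> cantor_set \<Longrightarrow> frac (2 * x) \<le> 1 / 2"
proof (rule ccontr)
  assume x: "x \<in> cantor_set" and *: "\<not> frac (2 * x) \<le> 1 / 2"
  define k where "k = \<lfloor>2 * x\<rfloor>"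
  have st: "stretch y = of_int k + 1" if "y \<in> {of_int k / 2 + 1 / 4<..<of_int k / 2 + 1 / 2}" for y
  proof -
    have "\<lfloor>2 * y\<rfloor> = k" using that by (intro floor_unique) auto
    then show ?thesis using that by (auto simp: stretch_def climb_def frac_def)
  qed
  have mem: "x \<in> {of_int k / 2 + 1 / 4<..<of_int k / 2 + 1 / 2}"
    using * frac_lt_1[of "2 * x"] by (auto simp: k_def frac_def)
  have "cantor y = cantor x" if "y \<in> {of_int k / 2 + 1 / 4<..<of_int k / 2 + 1 / 2}" for y
    using cantor_stretch[of x] cantor_stretch[of y] st[OF mem] st[OF that] by simp
  then have "\<forall>\<^sub>F y in nhds x. cantor y = cantor x"
    by (rule eventually_mono[OF eventually_nhds_in_open[OF open_greaterThanLessThan mem]])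
  then show False using x by (simp add: cantor_set_def)
qed

lemma cantor_set_minus_1: "x \<in> cantor_set \<Longrightarrow> x - 1 \<in> cantor_set"
proof (rule ccontr)
  assume x: "x \<in> cantor_set" and "x - 1 \<notin> cantor_set"
  then have "\<forall>\<^sub>F y in nhds (x - 1). cantor y = cantor (x - 1)" by (simp add: cantor_set_def)
  moreover have "filterlim (\<lambda>y. y - 1) (nhds (x - 1)) (nhds x)"
    by (intro tendsto_diff tendsto_const filterlim_ident)
  ultimately have "\<forall>\<^sub>F y in nhds x. cantor (y - 1) = cantor (x - 1)"
    by (rule eventually_compose_filterlim)
  moreover have "cantor (y - 1) = cantor y - 1" for y using cantor_add_1[of "y - 1"] by simp
  ultimately show False using x by (simp add: cantor_set_def)
qed

lemma cantor_set_plus_1: "x \<in> cantor_set \<Longrightarrow> x + 1 \<in> cantor_set"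
proof (rule ccontr)
  assume x: "x \<in> cantor_set" and "x + 1 \<notin> cantor_set"
  then have "\<forall>\<^sub>F y in nhds (x + 1). cantor y = cantor (x + 1)" by (simp add: cantor_set_def)
  moreover have "filterlim (\<lambda>y. y + 1) (nhds (x + 1)) (nhds x)"
    by (intro tendsto_add tendsto_const filterlim_ident)
  ultimately have "\<forall>\<^sub>F y in nhds x. cantor (y + 1) = cantor (x + 1)"
    by (rule eventually_compose_filterlim)
  then show False using x by (simp add: cantor_add_1 cantor_set_def)
qed

lemma cantor_set_add_int:
  assumes "x \<in> cantor_set" shows "x + of_int k \<in> cantor_set"
proof (induction k rule: int_induct[where k = 0])
  case (step1 i)
  then show ?case using cantor_set_plus_1[of "x + of_int i"] by (simp add: algebra_simps)
next
  case (step2 i)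
  then show ?case using cantor_set_minus_1[of "x + of_int i"] by (simp add: algebra_simps)
qed (use assms in simp)

lemma measure_affine_image_real:
  fixes E :: "real set"
  assumes "compact E"
  shows "(\<lambda>x. x / 4 + b) ` E \<in> lmeasurable" "measure lebesgue ((\<lambda>x. x / 4 + b) ` E) = measure lebesgue E / 4"
proof -
  show "(\<lambda>x. x / 4 + b) ` E \<in> lmeasurable"
    by (intro lmeasurable_compact compact_continuous_image continuous_intros assms) auto
  have "emeasure lebesgue ((\<lambda>x. (1 / 4) *\<^sub>R x + b) ` E) = ennreal (\<bar>1 / 4\<bar> ^ DIM(real)) * emeasure lebesgue E"
    by (rule emeasure_lebesgue_affine)
  then have "emeasure lebesgue ((\<lambda>x. x / 4 + b) ` E) = ennreal (1 / 4) * emeasure lebesgue E"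
    by simp
  then show "measure lebesgue ((\<lambda>x. x / 4 + b) ` E) = measure lebesgue E / 4"
    by (simp add: measure_def enn2real_mult)
qed

text \<open>
  The part of the set in the unit interval is covered, up to the point 1, by two copies of itself
  scaled by \<open>1/4\<close>. Its measure \<open>m\<close> therefore satisfies \<open>m \<le> m / 2\<close>.
\<close>

lemma negligible_cantor_set: "negligible cantor_set"
proof -
  define E where "E = cantor_set \<inter> {0..1}"
  have cE: "compact E"
    unfolding E_def by (intro closed_Int_compact closed_cantor_set) auto
  then have E: "E \<in> lmeasurable" by (rule lmeasurable_compact)
  have sub: "E \<subseteq> ((\<lambda>x. x / 4 + 0) ` E \<union> (\<lambda>x. x / 4 + 1 / 2) ` E) \<union> {1}"
  proof
    fix x assume x: "x \<in> E"
    then have xc: "x \<in> cantor_set" and x01: "0 \<le> x" "x \<le> 1" by (auto simp: E_def)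
    have fr: "frac (2 * x) \<le> 1 / 2" and sx: "stretch x \<in> cantor_set"
      using cantor_set_frac[OF xc] cantor_set_stretch[OF xc] by auto
    consider "x < 1 / 2" | "1 / 2 \<le> x \<and> x < 1" | "x = 1" using x01 by linarith
    then show "x \<in> ((\<lambda>x. x / 4 + 0) ` E \<union> (\<lambda>x. x / 4 + 1 / 2) ` E) \<union> {1}"
    proof cases
      case 1
      then have "\<lfloor>2 * x\<rfloor> = 0" using x01 by (intro floor_unique) auto
      then have "stretch x = 4 * x" "x \<le> 1 / 4"
        using fr by (auto simp: stretch_def climb_def frac_def)
      then have "4 * x \<in> E" using sx x01 by (auto simp: E_def)
      then have "x \<in> (\<lambda>x. x / 4 + 0) ` E" by (intro image_eqI[of _ _ "4 * x"]) auto
      then show ?thesis by blast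
    next
      case 2
      then have "\<lfloor>2 * x\<rfloor> = 1" using x01 by (intro floor_unique) auto
      then have "stretch x = 4 * x - 1" "x \<le> 3 / 4"
        using fr by (auto simp: stretch_def climb_def frac_def)
      then have "4 * x - 2 \<in> E" using cantor_set_minus_1[OF sx] 2 by (auto simp: E_def)
      then have "x \<in> (\<lambda>x. x / 4 + 1 / 2) ` E"
        by (intro image_eqI[of _ _ "4 * x - 2"]) (auto simp: field_simps)
      then show ?thesis by blast
    qed auto
  qed
  have m: "(\<lambda>x. x / 4 + 0) ` E \<in> lmeasurable" "(\<lambda>x. x / 4 + 1 / 2) ` E \<in> lmeasurable"
    by (intro measure_affine_image_real cE)+
  have one: "{1::real} \<in> lmeasurable" by (rule lmeasurable_compact) simp
  have "measure lebesgue E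
      \<le> measure lebesgue (((\<lambda>x. x / 4 + 0) ` E \<union> (\<lambda>x. x / 4 + 1 / 2) ` E) \<union> {1})"
    by (intro measure_mono_fmeasurable sub fmeasurable.Un m one) (use E in auto)
  also have "\<dots> \<le> measure lebesgue ((\<lambda>x. x / 4 + 0) ` E \<union> (\<lambda>x. x / 4 + 1 / 2) ` E) + measure lebesgue {1::real}"
    by (intro measure_Un_le fmeasurableD fmeasurable.Un m one)
  also have "\<dots> \<le> measure lebesgue ((\<lambda>x. x / 4 + 0) ` E) + measure lebesgue ((\<lambda>x. x / 4 + 1 / 2) ` E) + 0"
    by (intro add_mono measure_Un_le fmeasurableD m) auto
  also have "\<dots> = measure lebesgue E / 2"
    using measure_affine_image_real(2)[OF cE, of 0] measure_affine_image_real(2)[OF cE, of "1 / 2"] by simp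
  finally have "measure lebesgue E = 0"
    using measure_nonneg[of lebesgue E] by linarith
  then have nE: "negligible E" using E by (simp add: negligible_iff_measure0)
  have "cantor_set \<subseteq> (\<Union>k::int. (+) (of_int k) ` E)"
  proof
    fix x assume "x \<in> cantor_set"
    then have "x + of_int (- \<lfloor>x\<rfloor>) \<in> cantor_set" by (rule cantor_set_add_int)
    then have "x - of_int \<lfloor>x\<rfloor> \<in> E" by (auto simp: E_def) linarith
    then have "x \<in> (+) (of_int \<lfloor>x\<rfloor>) ` E" by (intro image_eqI[of _ _ "x - of_int \<lfloor>x\<rfloor>"]) auto
    then show "x \<in> (\<Union>k::int. (+) (of_int k) ` E)" by blast
  qed
  moreover have "negligible (\<Union>k::int. (+) (of_int k) ` E)"
    by (rule negligible_countable_Union) (auto intro: negligible_translation nE)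
  ultimately show ?thesis by (rule negligible_subset[rotated])
qed

text \<open>
  The equivalence \<open>T s \<le> x \<longleftrightarrow> s \<le> c x\<close> says that \<open>T s\<close> is the smallest solution of \<open>c x = s\<close>. Image
  measures under \<open>T\<close> are carried by the null set \<open>N\<close>; this is how singular measures enter the
  construction.
\<close>

locale singular_staircase =
  fixes \<epsilon> :: real and c T :: "real \<Rightarrow> real" and N :: "real set"
  assumes c_continuous: "continuous_on UNIV c"
    and c_mono: "x \<le> y \<Longrightarrow> c x \<le> c y"
    and c_near: "\<bar>c x - x\<bar> \<le> \<epsilon>"
    and T_le_iff: "T s \<le> x \<longleftrightarrow> s \<le> c x"
    and N_closed: "closed N"
    and N_negligible: "negligible N"
    and c_locally_constant: "x \<notin> N \<Longrightarrow> \<forall>\<^sub>F y in nhds x. c y = c x"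
begin

lemma T_mono: "s \<le> t \<Longrightarrow> T s \<le> T t"
  using T_le_iff by (meson order_trans order_refl)

lemma c_T: "c (T s) = s"
proof (rule antisym)
  show "s \<le> c (T s)" using T_le_iff[of s "T s"] by simp
  show "c (T s) \<le> s"
  proof (rule ccontr)
    assume "\<not> c (T s) \<le> s"
    then have "c (T s) > s" by simp
    moreover have "isCont c (T s)"
      using c_continuous by (simp add: continuous_on_eq_continuous_at)
    ultimately have "\<forall>\<^sub>F y in at (T s). c y > s"
      unfolding isCont_def by (rule order_tendstoD(1)[rotated])
    then have "\<forall>\<^sub>F y in at_left (T s). c y > s"
      by (rule filter_leD[rotated]) (simp add: at_le)
    moreover have "\<forall>\<^sub>F y in at_left (T s). y < T s"
      by (simp add: eventually_at_filter)
    ultimately have "\<forall>\<^sub>F y in at_left (T s). False"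
      by eventually_elim (use T_le_iff in \<open>meson less_imp_le not_le\<close>)
    then show False by simp
  qed
qed

lemma T_near: "\<bar>T s - s\<bar> \<le> \<epsilon>"
  using c_near[of "T s"] by (simp add: c_T abs_minus_commute)

text \<open>
  To the left of \<open>T s\<close> the function \<open>c\<close> is smaller than \<open>s = c (T s)\<close>, so it is not constant near
  \<open>T s\<close>.
\<close>

lemma T_in_N: "T s \<in> N"
proof (rule ccontr)
  assume "T s \<notin> N"
  then have "\<forall>\<^sub>F y in nhds (T s). c y = s" using c_locally_constant[of "T s"] by (simp add: c_T)
  then have "\<forall>\<^sub>F y in at_left (T s). c y = s"
    by (rule filter_leD[rotated]) (simp add: at_within_def le_infI1)
  moreover have "\<forall>\<^sub>F y in at_left (T s). y < T s"
    by (simp add: eventually_at_filter)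
  ultimately have "\<forall>\<^sub>F y in at_left (T s). False"
    by eventually_elim (use T_le_iff in \<open>metis order_refl not_le\<close>)
  then show False by simp
qed

lemma borel_measurable_T [measurable]: "T \<in> borel_measurable borel"
  by (rule borel_measurable_mono) (auto simp: mono_def T_mono)

lemma borel_measurable_c [measurable]: "c \<in> borel_measurable borel"
  using c_continuous by (rule borel_measurable_continuous_onI)

end

lemma ex_singular_staircase:
  assumes "\<epsilon> > 0"
  shows "\<exists>c T N. singular_staircase \<epsilon> c T N"
proof -
  define c where "c x = \<epsilon> * cantor (x / \<epsilon>)" for x
  define T where "T s = Inf {x. s \<le> c x}" for s
  define N where "N = (\<lambda>x. \<epsilon> *\<^sub>R x) ` cantor_set"
  have cont: "continuous_on UNIV c"
    unfolding c_def using assms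
    by (intro continuous_intros continuous_on_compose2[OF continuous_cantor]) auto
  have mono: "c x \<le> c y" if "x \<le> y" for x y
    unfolding c_def using that assms by (intro mult_left_mono cantor_mono divide_right_mono) auto
  have near: "\<bar>c x - x\<bar> \<le> \<epsilon>" for x
  proof -
    have "c x - x = \<epsilon> * (cantor (x / \<epsilon>) - x / \<epsilon>)" using assms by (simp add: c_def field_simps)
    then have "\<bar>c x - x\<bar> = \<epsilon> * \<bar>cantor (x / \<epsilon>) - x / \<epsilon>\<bar>" using assms by (simp add: abs_mult)
    also have "\<dots> \<le> \<epsilon> * 1" by (rule mult_left_mono[OF cantor_near]) (use assms in simp)
    finally show ?thesis by simp
  qed
  have T: "T s \<le> x \<longleftrightarrow> s \<le> c x" for s x
  proof
    have bdd: "bdd_below {x. s \<le> c x}"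
    proof (rule bdd_belowI[of _ "s - \<epsilon>"])
      fix y assume "y \<in> {x. s \<le> c x}"
      then show "s - \<epsilon> \<le> y" using near[of y] by auto
    qed
    have "closed {x. s \<le> c x}" by (intro closed_Collect_le cont continuous_on_const)
    moreover have "s \<le> c (s + \<epsilon>)" using near[of "s + \<epsilon>"] by linarith
    then have "{x. s \<le> c x} \<noteq> {}" by blast
    ultimately have "T s \<in> {x. s \<le> c x}"
      unfolding T_def using bdd by (intro closed_contains_Inf)
    then show "s \<le> c x" if "T s \<le> x" using mono[OF that] by simp
    show "T s \<le> x" if "s \<le> c x" unfolding T_def by (rule cInf_lower) (use that bdd in auto)
  qed
  have lc: "\<forall>\<^sub>F y in nhds x. c y = c x" if "x \<notin> N" for x
  proof -
    have "x / \<epsilon> \<notin> cantor_set"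
      using that assms by (auto simp: N_def image_iff)
    then have "\<forall>\<^sub>F y in nhds (x / \<epsilon>). cantor y = cantor (x / \<epsilon>)" by (simp add: cantor_set_def)
    moreover have "filterlim (\<lambda>y. y / \<epsilon>) (nhds (x / \<epsilon>)) (nhds x)"
      using assms by (intro tendsto_divide tendsto_const filterlim_ident) auto
    ultimately have "\<forall>\<^sub>F y in nhds x. cantor (y / \<epsilon>) = cantor (x / \<epsilon>)"
      by (rule eventually_compose_filterlim)
    then show ?thesis by (simp add: c_def)
  qed
  have "closed N" unfolding N_def by (intro closed_scaling closed_cantor_set)
  moreover have "negligible N"
    unfolding N_def 
    by (rule negligible_differentiable_image_negligible) (auto simp: negligible_cantor_set)
  ultimately have "singular_staircase \<epsilon> c T N"
    by unfold_locales (use cont mono near T lc in auto)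
  then show ?thesis by blast
qed

section \<open>Integrals along coordinate lines\<close>

lemma integrable_translation:
  fixes F :: "'a::euclidean_space \<Rightarrow> real"
  assumes [measurable]: "F \<in> borel_measurable borel"
  shows "integrable lborel (\<lambda>x. F (x + a)) \<longleftrightarrow> integrable lborel F"
    and "(\<integral>x. F (x + a) \<partial>lborel) = (\<integral>x. F x \<partial>lborel)"
proof -
  have d: "lborel = distr lborel borel (\<lambda>x. x + a)"
    unfolding add.commute[of _ a] by (rule lborel_distr_plus[symmetric])
  show "integrable lborel (\<lambda>x. F (x + a)) \<longleftrightarrow> integrable lborel F"
    by (subst (2) d) (simp add: integrable_distr_eq)
  show "(\<integral>x. F (x + a) \<partial>lborel) = (\<integral>x. F x \<partial>lborel)"
    by (subst (2) d) (simp add: integral_distr)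
qed

lemma nn_integral_translation:
  fixes F :: "'a::euclidean_space \<Rightarrow> ennreal"
  assumes [measurable]: "F \<in> borel_measurable borel"
  shows "(\<integral>\<^sup>+x. F (x + a) \<partial>lborel) = (\<integral>\<^sup>+x. F x \<partial>lborel)"
proof -
  have d: "lborel = distr lborel borel (\<lambda>x. x + a)"
    unfolding add.commute[of _ a] by (rule lborel_distr_plus[symmetric])
  show ?thesis
    by (subst (2) d) (simp add: nn_integral_distr)
qed

lemma measurable_vec_nth [measurable]: "(\<lambda>x::real^'n. x $ k) \<in> borel_measurable borel"
  by (intro borel_measurable_continuous_onI continuous_intros)

text \<open>
  Fubini's theorem for the lines in one coordinate direction, without identifying the space with a
  product. Insert a weight \<open>w (x\<^sub>k - s)\<close> of integral 1 in \<open>s\<close>, interchange the integrals,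
  translate \<open>x\<close> by \<open>s\<close> in direction \<open>k\<close>, and interchange back: now the weight is \<open>w (x\<^sub>k)\<close> and the
  inner integral runs along a line.
\<close>

lemma integral_eq_0_by_lines:
  fixes F :: "real^'n \<Rightarrow> real"
  assumes F: "integrable lborel F"
    and zero: "\<And>x. (\<integral>s. F (x + s *\<^sub>R axis k 1) \<partial>lborel) = 0"
  shows "(\<integral>x. F x \<partial>lborel) = 0"
proof -
  let ?e = "axis k 1 :: real^'n"
  define w :: "real \<Rightarrow> real" where "w = indicator {0..1}"
  have [measurable]: "F \<in> borel_measurable borel" "w \<in> borel_measurable borel"
    using borel_measurable_integrable[OF F] by (auto simp: w_def)
  have w: "0 \<le> w t" for t by (simp add: w_def)
  have w1: "(\<integral>\<^sup>+s. ennreal (w (t - s)) \<partial>lborel) = 1" "(\<integral>s. w (t - s) \<partial>lborel) = 1" for t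
  proof -
    have eq: "w (t - s) = indicator {t - 1..t} s" for s by (auto simp: w_def indicator_def)
    show "(\<integral>\<^sup>+s. ennreal (w (t - s)) \<partial>lborel) = 1" "(\<integral>s. w (t - s) \<partial>lborel) = 1"
      unfolding eq by (auto simp: ennreal_indicator)
  qed
  define H where "H x s = F x * w (x $ k - s)" for x s
  have [measurable]: "(\<lambda>(x, s). H x s) \<in> borel_measurable (borel \<Otimes>\<^sub>M borel)"
    unfolding H_def by measurable
  have nnH: "(\<integral>\<^sup>+x. \<integral>\<^sup>+s. ennreal (norm (H x s)) \<partial>lborel \<partial>lborel) < \<infinity>"
  proof -
    have "(\<integral>\<^sup>+s. ennreal (norm (H x s)) \<partial>lborel) = ennreal \<bar>F x\<bar>" for x
      by (simp add: H_def abs_mult w ennreal_mult nn_integral_cmult w1)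
    then show ?thesis using F by (simp add: integrable_iff_bounded)
  qed
  interpret lborel_pair: pair_sigma_finite "lborel :: (real^'n) measure" "lborel :: real measure" ..
  have iH: "integrable (lborel \<Otimes>\<^sub>M lborel) (\<lambda>(x, s). H x s)"
    by (rule integrableI_bounded)
       (use nnH in \<open>simp_all add: lborel.nn_integral_fst[symmetric] case_prod_beta cong: measurable_cong_sets\<close>)
  have "(\<integral>x. F x \<partial>lborel) = (\<integral>x. \<integral>s. H x s \<partial>lborel \<partial>lborel)"
    by (simp add: H_def w1)
  also have "\<dots> = (\<integral>s. \<integral>x. H x s \<partial>lborel \<partial>lborel)"
    by (rule lborel_pair.Fubini_integral[symmetric]) (use iH in simp)
  also have "\<dots> = (\<integral>s. \<integral>x. H (x + s *\<^sub>R ?e) s \<partial>lborel \<partial>lborel)"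
    by (intro Bochner_Integration.integral_cong refl integrable_translation(2)[symmetric]) measurable
  also have "\<dots> = (\<integral>x. \<integral>s. H (x + s *\<^sub>R ?e) s \<partial>lborel \<partial>lborel)"
  proof (rule lborel_pair.Fubini_integral)
    have "(\<integral>\<^sup>+x. \<integral>\<^sup>+s. ennreal (norm (H (x + s *\<^sub>R ?e) s)) \<partial>lborel \<partial>lborel)
        = (\<integral>\<^sup>+s. \<integral>\<^sup>+x. ennreal (norm (H (x + s *\<^sub>R ?e) s)) \<partial>lborel \<partial>lborel)"
      by (rule lborel_pair.Fubini'[symmetric]) measurable
    also have "\<dots> = (\<integral>\<^sup>+s. \<integral>\<^sup>+x. ennreal (norm (H x s)) \<partial>lborel \<partial>lborel)"
      by (intro nn_integral_cong nn_integral_translation) measurable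
    also have "\<dots> = (\<integral>\<^sup>+x. \<integral>\<^sup>+s. ennreal (norm (H x s)) \<partial>lborel \<partial>lborel)"
      by (rule lborel_pair.Fubini') measurable
    finally have "(\<integral>\<^sup>+x. \<integral>\<^sup>+s. ennreal (norm (H (x + s *\<^sub>R ?e) s)) \<partial>lborel \<partial>lborel) < \<infinity>"
      using nnH by simp
    then show "integrable (lborel \<Otimes>\<^sub>M lborel) (\<lambda>(x, s). H (x + s *\<^sub>R ?e) s)"
      by (intro integrableI_bounded)
         (simp_all add: lborel.nn_integral_fst[symmetric] case_prod_beta cong: measurable_cong_sets)
  qed
  also have "\<dots> = (\<integral>x. w (x $ k) * (\<integral>s. F (x + s *\<^sub>R ?e) \<partial>lborel) \<partial>lborel)"
    by (simp add: H_def mult.commute)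
  also have "\<dots> = 0" by (simp add: zero)
  finally show ?thesis .
qed

text \<open>
  If \<open>a\<close> does not depend on \<open>x\<^sub>k\<close>, then the integral of \<open>a x * g (x\<^sub>k)\<close> is proportional to the
  integral of \<open>g\<close>. This form of the product rule for integrals needs no name for the integral over
  the remaining coordinates.
\<close>

lemma integral_coordinate_exchange:
  fixes a :: "real^'n \<Rightarrow> real"
  assumes a: "\<And>x s. a (x + s *\<^sub>R axis k 1) = a x"
    and g1: "integrable lborel g1" "integrable lborel (\<lambda>x. a x * g1 (x $ k))"
    and g2: "integrable lborel g2" "integrable lborel (\<lambda>x. a x * g2 (x $ k))"
  shows "(\<integral>t. g2 t \<partial>lborel) * (\<integral>x. a x * g1 (x $ k) \<partial>lborel)
    = (\<integral>t. g1 t \<partial>lborel) * (\<integral>x. a x * g2 (x $ k) \<partial>lborel)"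
proof -
  let ?A = "\<integral>t. g1 t \<partial>lborel" and ?B = "\<integral>t. g2 t \<partial>lborel"
  have m [measurable]: "g1 \<in> borel_measurable borel" "g2 \<in> borel_measurable borel"
    using borel_measurable_integrable[OF g1(1)] borel_measurable_integrable[OF g2(1)] by auto
  have "(\<integral>x. ?B * (a x * g1 (x $ k)) - ?A * (a x * g2 (x $ k)) \<partial>lborel) = 0"
  proof (rule integral_eq_0_by_lines[where k = k])
    show "integrable lborel (\<lambda>x. ?B * (a x * g1 (x $ k)) - ?A * (a x * g2 (x $ k)))"
      using g1 g2 by auto
    fix x
    have i: "integrable lborel (\<lambda>s. g1 (s + x $ k))" "integrable lborel (\<lambda>s. g2 (s + x $ k))"
      using g1 g2 integrable_translation(1)[OF m(1)] integrable_translation(1)[OF m(2)] by auto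
    have "(\<integral>s. ?B * (a x * g1 (s + x $ k)) - ?A * (a x * g2 (s + x $ k)) \<partial>lborel)
      = ?B * (a x * (\<integral>s. g1 (s + x $ k) \<partial>lborel)) - ?A * (a x * (\<integral>s. g2 (s + x $ k) \<partial>lborel))"
      using i by simp
    also have "\<dots> = 0"
      by (simp add: integrable_translation(2)[OF m(1)] integrable_translation(2)[OF m(2)])
    moreover have "(x + s *\<^sub>R axis k 1) $ k = s + x $ k" for s by (simp add: axis_def)
    ultimately show "(\<integral>s. ?B * (a (x + s *\<^sub>R axis k 1) * g1 ((x + s *\<^sub>R axis k 1) $ k))
        - ?A * (a (x + s *\<^sub>R axis k 1) * g2 ((x + s *\<^sub>R axis k 1) $ k)) \<partial>lborel) = 0"
      by (simp only: a)
  qed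
  moreover have "(\<integral>x. ?B * (a x * g1 (x $ k)) - ?A * (a x * g2 (x $ k)) \<partial>lborel)
    = ?B * (\<integral>x. a x * g1 (x $ k) \<partial>lborel) - ?A * (\<integral>x. a x * g2 (x $ k) \<partial>lborel)"
    using g1 g2 by simp
  ultimately show ?thesis by simp
qed

lemma integrable_continuous_vanishing:
  fixes f :: "'a::euclidean_space \<Rightarrow> real"
  assumes "continuous_on UNIV f" "\<And>x. x \<notin> K \<Longrightarrow> f x = 0" "compact K"
  shows "integrable lborel f"
proof -
  have "integrable lborel (\<lambda>x. indicator K x *\<^sub>R f x)"
    by (rule borel_integrable_compact[OF assms(3) continuous_on_subset[OF assms(1)]]) simp
  moreover have "(\<lambda>x. indicator K x *\<^sub>R f x) = f"
    by (auto simp: fun_eq_iff indicator_def assms(2))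
  ultimately show ?thesis by simp
qed

lemma integral_derivative_interval:
  fixes F :: "real \<Rightarrow> real"
  assumes "a \<le> b" "\<And>x. (F has_real_derivative f x) (at x)" "continuous_on UNIV f"
  shows "(\<integral>x. indicator {a..b} x * f x \<partial>lborel) = F b - F a"
proof -
  have "(\<integral>x. f x * indicator {a..b} x \<partial>lborel) = F b - F a"
    by (rule integral_FTC_Icc_real) (use assms in \<open>auto simp: continuous_on_eq_continuous_at\<close>)
  then show ?thesis by (simp add: mult.commute)
qed

context singular_staircase
begin

text \<open>
  The distributional derivative of \<open>f \<circ> c\<close> is the image under \<open>T\<close> of the measure with density
  \<open>f'\<close>. To see this, integrate \<open>f' s * \<psi>' t\<close> over the set \<open>s \<le> c t\<close> in both orders; by the
  definition of \<open>T\<close> it is also the set \<open>T s \<le> t\<close>.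
\<close>

lemma integral_staircase_by_parts:
  assumes f: "\<And>y. (f has_real_derivative f' y) (at y)" "continuous_on UNIV f'"
    and psi: "\<And>t. (\<psi> has_real_derivative \<psi>' t) (at t)" "continuous_on UNIV \<psi>'"
    and supp: "\<And>t. t \<notin> {-R<..<R} \<Longrightarrow> \<psi> t = 0"
  shows "(\<integral>t. f (c t) * \<psi>' t \<partial>lborel) = - (\<integral>s. f' s * \<psi> (T s) \<partial>lborel)"
    and "integrable lborel (\<lambda>t. f (c t) * \<psi>' t)" and "integrable lborel (\<lambda>s. f' s * \<psi> (T s))"
proof -
  define a b where "a = - (\<bar>R\<bar> + 1)" and "b = \<bar>R\<bar> + 1"
  have ab: "a < b" "{-R<..<R} \<subseteq> {a<..<b}" by (auto simp: a_def b_def)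
  have supp': "\<psi> t = 0" if "t \<le> a \<or> b \<le> t" for t
    using that ab(2) by (intro supp) auto
  have psi'_0: "\<psi>' t = 0" if "t \<notin> {a..b}" for t
  proof -
    have "((\<lambda>u. 0) has_real_derivative 0) (at t)" by simp
    then have "(\<psi> has_real_derivative 0) (at t)"
      by (rule has_field_derivative_transform_within_open[of _ _ _ "- {a..b}"])
         (use that in \<open>auto simp: supp'\<close>)
    then show ?thesis using DERIV_unique[OF psi(1)] by blast
  qed
  have cab: "c a \<le> c b" using ab c_mono by simp
  have cont_f: "continuous_on UNIV f"
    using f(1) by (meson DERIV_isCont continuous_at_imp_continuous_on)
  have cont_psi: "continuous_on UNIV \<psi>"
    using psi(1) by (meson DERIV_isCont continuous_at_imp_continuous_on)
  have [measurable]: "f \<in> borel_measurable borel" "f' \<in> borel_measurable borel"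
      "\<psi> \<in> borel_measurable borel" "\<psi>' \<in> borel_measurable borel"
    using cont_f f(2) cont_psi psi(2) by (auto intro: borel_measurable_continuous_onI)
  have fc: "continuous_on UNIV (\<lambda>t. f (c t))"
    by (rule continuous_on_compose2[OF cont_f c_continuous]) auto
  show int1: "integrable lborel (\<lambda>t. f (c t) * \<psi>' t)"
    by (rule integrable_continuous_vanishing[of _ "{a..b}"])
       (auto intro!: continuous_intros fc psi(2) simp: psi'_0)
  have psiT: "\<psi> (T s) = 0" if "s \<notin> {c a..c b}" for s
  proof -
    from that consider "s < c a" | "c b < s" by fastforce
    then show ?thesis
    proof cases
      case 1 then have "T s \<le> a" using T_le_iff by simp
      then show ?thesis using supp' by simp
    next
      case 2 then have "\<not> T s \<le> b" using T_le_iff by simp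
      then show ?thesis using supp' by simp
    qed
  qed
  have bd: "bounded (range \<psi>)"
  proof -
    have "bounded (\<psi> ` {a..b})"
      by (intro compact_imp_bounded compact_continuous_image continuous_on_subset[OF cont_psi]) auto
    moreover have "range \<psi> \<subseteq> insert 0 (\<psi> ` {a..b})"
    proof (rule image_subsetI)
      fix t show "\<psi> t \<in> insert 0 (\<psi> ` {a..b})"
        using supp'[of t] by (cases "t \<in> {a..b}") auto
    qed
    ultimately show ?thesis by (meson bounded_insert bounded_subset)
  qed
  then obtain B where B: "\<And>t. \<bar>\<psi> t\<bar> \<le> B" by (auto simp: bounded_iff)
  have f'i: "integrable lborel (\<lambda>s. indicator {c a..c b} s * f' s)"
    using borel_integrable_compact[of "{c a..c b}" f'] continuous_on_subset[OF f(2)] by simp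
  have eqT: "f' s * \<psi> (T s) = (indicator {c a..c b} s * f' s) * \<psi> (T s)" for s
    using psiT[of s] by (auto simp: indicator_def)
  show int2: "integrable lborel (\<lambda>s. f' s * \<psi> (T s))"
  proof (subst eqT, rule Bochner_Integration.integrable_bound)
    show "integrable lborel (\<lambda>s. B * (indicator {c a..c b} s * f' s))" using f'i by simp
    show "AE s in lborel. norm (indicator {c a..c b} s * f' s * \<psi> (T s))
        \<le> norm (B * (indicator {c a..c b} s * f' s))"
    proof (rule AE_I2)
      fix s
      have "\<bar>indicator {c a..c b} s * f' s\<bar> * \<bar>\<psi> (T s)\<bar> \<le> \<bar>indicator {c a..c b} s * f' s\<bar> * \<bar>B\<bar>"
        using B[of "T s"] by (intro mult_left_mono) auto
      then show "norm (indicator {c a..c b} s * f' s * \<psi> (T s)) \<le> norm (B * (indicator {c a..c b} s * f' s))"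
        by (simp add: abs_mult mult.commute)
    qed
  qed measurable
  define K where "K s t = (indicator {c a..c b} s * f' s) * ((indicator {a..b} t * \<psi>' t) * indicator {s..} (c t))" for s t
  have psi'i: "integrable lborel (\<lambda>t. indicator {a..b} t * \<psi>' t)"
    using borel_integrable_compact[of "{a..b}" \<psi>'] continuous_on_subset[OF psi(2)] by simp
  have Kmeas: "(\<lambda>(s, t). K s t) \<in> borel_measurable (borel \<Otimes>\<^sub>M borel)"
  proof -
    have "(\<lambda>(s, t). indicator {s..} (c t) :: real) = (\<lambda>p. indicator {p \<in> space (borel \<Otimes>\<^sub>M borel). fst p \<le> c (snd p)} p)"
      by (auto simp: indicator_def space_pair_measure fun_eq_iff)
    moreover have "\<dots> \<in> borel_measurable (borel \<Otimes>\<^sub>M borel)" by measurable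
    ultimately have [measurable]: "(\<lambda>(s, t). indicator {s..} (c t) :: real) \<in> borel_measurable (borel \<Otimes>\<^sub>M borel)" by simp
    show ?thesis unfolding K_def case_prod_beta
      using \<open>(\<lambda>(s, t). indicator {s..} (c t) :: real) \<in> _\<close> by (simp add: case_prod_beta)
  qed
  have iK: "integrable (lborel \<Otimes>\<^sub>M lborel) (\<lambda>(s, t). K s t)"
  proof (rule Bochner_Integration.integrable_bound)
    show "integrable (lborel \<Otimes>\<^sub>M lborel) (\<lambda>(s, t). (indicator {c a..c b} s * f' s) * (indicator {a..b} t * \<psi>' t))"
    proof (rule lborel_pair.Fubini_integrable)
      show "(\<lambda>(s, t). (indicator {c a..c b} s * f' s) * (indicator {a..b} t * \<psi>' t))
          \<in> borel_measurable (lborel \<Otimes>\<^sub>M lborel)" by measurable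
      show "integrable lborel (\<lambda>s. \<integral>t. norm (case (s, t) of (s, t) \<Rightarrow>
          (indicator {c a..c b} s * f' s) * (indicator {a..b} t * \<psi>' t)) \<partial>lborel)"
        using integrable_norm[OF f'i] by (simp add: abs_mult)
      show "AE s in lborel. integrable lborel (\<lambda>t. case (s, t) of (s, t) \<Rightarrow>
          (indicator {c a..c b} s * f' s) * (indicator {a..b} t * \<psi>' t))"
        using psi'i by simp
    qed
    show "(\<lambda>(s, t). K s t) \<in> borel_measurable (lborel \<Otimes>\<^sub>M lborel)"
      using Kmeas by (simp cong: measurable_cong_sets)
  qed (auto simp: K_def indicator_def)
  have inner_s: "(\<integral>s. K s t \<partial>lborel) = indicator {a..b} t * \<psi>' t * (f (c t) - f (c a))" for t
  proof (cases "t \<in> {a..b}")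
    case True
    then have ct: "c a \<le> c t" "c t \<le> c b" using c_mono by auto
    have "K s t = \<psi>' t * (indicator {c a..c t} s * f' s)" for s
      using True ct by (auto simp: K_def indicator_def)
    then have "(\<integral>s. K s t \<partial>lborel) = \<psi>' t * (\<integral>s. indicator {c a..c t} s * f' s \<partial>lborel)" by simp
    also have "\<dots> = \<psi>' t * (f (c t) - f (c a))"
      by (subst integral_derivative_interval[OF ct(1) f]) simp
    finally show ?thesis using True by simp
  qed (simp add: K_def)
  have inner_t: "(\<integral>t. K s t \<partial>lborel) = - (f' s * \<psi> (T s))" for s
  proof (cases "s \<in> {c a..c b}")
    case True
    have "T s \<le> b" using True T_le_iff by simp
    have eq: "K s t = f' s * (indicator {max a (T s)..b} t * \<psi>' t)" for t
      using True T_le_iff[of s t] by (auto simp: K_def indicator_def)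
    have "(\<integral>t. K s t \<partial>lborel) = f' s * (\<integral>t. indicator {max a (T s)..b} t * \<psi>' t \<partial>lborel)"
      unfolding eq by simp
    also have "\<dots> = f' s * (\<psi> b - \<psi> (max a (T s)))"
      using \<open>T s \<le> b\<close> ab by (subst integral_derivative_interval[OF _ psi]) auto
    also have "\<psi> (max a (T s)) = \<psi> (T s)" using supp' by (auto simp: max_def)
    finally show ?thesis using supp' by simp
  qed (simp add: K_def psiT)
  have "(\<integral>t. indicator {a..b} t * \<psi>' t * (f (c t) - f (c a)) \<partial>lborel) = - (\<integral>s. f' s * \<psi> (T s) \<partial>lborel)"
    using lborel_pair.Fubini_integral[of "\<lambda>s t. K s t"] iK by (simp add: inner_s inner_t)
  moreover have "(\<integral>t. indicator {a..b} t * \<psi>' t * (f (c t) - f (c a)) \<partial>lborel) = (\<integral>t. f (c t) * \<psi>' t \<partial>lborel)"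
  proof -
    have "indicator {a..b} t * \<psi>' t * (f (c t) - f (c a)) = f (c t) * \<psi>' t - f (c a) * (indicator {a..b} t * \<psi>' t)" for t
      using psi'_0[of t] by (auto simp: indicator_def algebra_simps)
    moreover have "(\<integral>t. indicator {a..b} t * \<psi>' t \<partial>lborel) = 0"
      using ab supp' by (subst integral_derivative_interval[OF _ psi]) auto
    ultimately show ?thesis using int1 psi'i by simp
  qed
  ultimately show "(\<integral>t. f (c t) * \<psi>' t \<partial>lborel) = - (\<integral>s. f' s * \<psi> (T s) \<partial>lborel)" by simp
qed

end

section \<open>Test functions and derivatives along lines\<close>

text \<open>
  The derivative is a second argument, so that the calculus rules below compute it by unification.
\<close>

definition C1 :: "(real \<Rightarrow> real) \<Rightarrow> (real \<Rightarrow> real) \<Rightarrow> bool" where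
  "C1 f f' \<longleftrightarrow> (\<forall>x. (f has_real_derivative f' x) (at x)) \<and> continuous_on UNIV f'"

lemma C1_deriv: "C1 f f' \<Longrightarrow> (f has_real_derivative f' x) (at x)"
  by (simp add: C1_def)

lemma C1_cont': "C1 f f' \<Longrightarrow> continuous_on UNIV f'"
  by (simp add: C1_def)

lemma C1_cont: "C1 f f' \<Longrightarrow> continuous_on UNIV f"
  unfolding C1_def by (meson DERIV_isCont continuous_at_imp_continuous_on)

lemma C1_const: "C1 (\<lambda>x. a) (\<lambda>x. 0)"
  by (auto simp: C1_def)

lemma C1_ident: "C1 (\<lambda>x. x) (\<lambda>x. 1)"
  by (auto simp: C1_def)

lemma C1_add: "C1 f f' \<Longrightarrow> C1 g g' \<Longrightarrow> C1 (\<lambda>x. f x + g x) (\<lambda>x. f' x + g' x)"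
  by (auto simp: C1_def intro: DERIV_add continuous_on_add)

lemma C1_diff: "C1 f f' \<Longrightarrow> C1 g g' \<Longrightarrow> C1 (\<lambda>x. f x - g x) (\<lambda>x. f' x - g' x)"
  by (auto simp: C1_def intro: DERIV_diff continuous_on_diff)

lemma C1_minus: "C1 f f' \<Longrightarrow> C1 (\<lambda>x. - f x) (\<lambda>x. - f' x)"
  by (auto simp: C1_def intro: DERIV_minus continuous_on_minus)

lemma C1_mult: "C1 f f' \<Longrightarrow> C1 g g' \<Longrightarrow> C1 (\<lambda>x. f x * g x) (\<lambda>x. f' x * g x + g' x * f x)"
  using C1_cont[of f f'] C1_cont[of g g']
  by (auto simp: C1_def intro!: DERIV_mult continuous_on_add continuous_on_mult)

lemma C1_cmult: "C1 f f' \<Longrightarrow> C1 (\<lambda>x. a * f x) (\<lambda>x. a * f' x)"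
  by (auto simp: C1_def intro!: DERIV_cmult continuous_on_mult)

lemma C1_sum: "(\<And>i. i \<in> I \<Longrightarrow> C1 (f i) (f' i)) \<Longrightarrow> C1 (\<lambda>x. \<Sum>i\<in>I. f i x) (\<lambda>x. \<Sum>i\<in>I. f' i x)"
  by (auto simp: C1_def intro!: DERIV_sum continuous_on_sum)

lemma C1_compose_affine: "C1 f f' \<Longrightarrow> C1 (\<lambda>x. f (a * x + b)) (\<lambda>x. a * f' (a * x + b))"
proof -
  assume f: "C1 f f'"
  have "((\<lambda>x. f (a * x + b)) has_real_derivative a * f' (a * x + b)) (at x)" for x
  proof -
    have "((\<lambda>x. a * x + b) has_real_derivative a) (at x)" by (auto intro!: derivative_eq_intros)
    from DERIV_chain2[OF C1_deriv[OF f] this] show ?thesis by (simp add: mult.commute)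
  qed
  moreover have "continuous_on UNIV (\<lambda>x. a * f' (a * x + b))"
    by (intro continuous_on_mult continuous_on_const continuous_on_compose2[OF C1_cont'[OF f]])
       (auto intro!: continuous_intros)
  ultimately show ?thesis by (auto simp: C1_def)
qed

definition partial_deriv :: "'n \<Rightarrow> (real^'n \<Rightarrow> real) \<Rightarrow> real^'n \<Rightarrow> real" where
  "partial_deriv k \<phi> x = frechet_derivative \<phi> (at x) (axis k 1)"

lemma test_function_C_k: "test_function V \<phi> \<Longrightarrow> C_k k \<phi>"
  by (simp add: test_function_def)

lemma test_function_has_derivative:
  "test_function V \<phi> \<Longrightarrow> (\<phi> has_derivative frechet_derivative \<phi> (at x)) (at x)"
  using test_function_C_k[of V \<phi> "Suc 0"] by (auto simp: frechet_derivative_works[symmetric])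

lemma test_function_continuous: "test_function V \<phi> \<Longrightarrow> continuous_on UNIV \<phi>"
  using test_function_C_k[of V \<phi> 0] by simp

lemma test_function_continuous_partial:
  "test_function V \<phi> \<Longrightarrow> continuous_on UNIV (partial_deriv k \<phi>)"
proof -
  assume "test_function V \<phi>"
  then have "C_k (Suc 0) \<phi>" by (rule test_function_C_k)
  then have "\<forall>b\<in>Basis. continuous_on UNIV (\<lambda>x. frechet_derivative \<phi> (at x) b)" by simp
  then have "continuous_on UNIV (\<lambda>x. frechet_derivative \<phi> (at x) (axis k 1))"
    by (rule bspec) (auto simp: Basis_vec_def)
  then show ?thesis by (simp add: partial_deriv_def[abs_def])
qed

lemma test_function_support:
  assumes "test_function V \<phi>"
  obtains K where "compact K" "K \<subseteq> V" "\<And>x. x \<notin> K \<Longrightarrow> \<phi> x = 0" "\<And>x k. x \<notin> K \<Longrightarrow> partial_deriv k \<phi> x = 0"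
proof
  let ?K = "closure {x. \<phi> x \<noteq> 0}"
  show "compact ?K" "?K \<subseteq> V" using assms by (auto simp: test_function_def)
  show z: "\<phi> x = 0" if "x \<notin> ?K" for x
    using that closure_subset[of "{x. \<phi> x \<noteq> 0}"] by blast
  show "partial_deriv k \<phi> x = 0" if "x \<notin> ?K" for x k
  proof -
    have "((\<lambda>_. 0) has_derivative (\<lambda>_. 0)) (at x)" by simp
    then have "(\<phi> has_derivative (\<lambda>_. 0)) (at x)"
    proof (rule has_derivative_transform_within_open[where s = "- ?K"])
      show "open (- ?K)" by (rule open_Compl[OF closed_closure])
      show "x \<in> - ?K" using that by simp
      show "0 = \<phi> y" if "y \<in> - ?K" for y using z[of y] that by simp
    qed
    then have "frechet_derivative \<phi> (at x) = (\<lambda>_. 0)" by (rule frechet_derivative_at[symmetric])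
    then show ?thesis by (simp add: partial_deriv_def)
  qed
qed

lemma bounded_borel_continuous_vanishing:
  fixes f :: "'a::euclidean_space \<Rightarrow> real"
  assumes "continuous_on UNIV f" "\<And>x. x \<notin> K \<Longrightarrow> f x = 0" "compact K"
  shows "bounded_borel f"
proof -
  have "bounded (f ` K)"
    by (intro compact_imp_bounded compact_continuous_image continuous_on_subset[OF assms(1)] assms(3)) auto
  then obtain B where B: "\<And>x. x \<in> K \<Longrightarrow> \<bar>f x\<bar> \<le> B" by (auto simp: bounded_iff)
  have "\<bar>f x\<bar> \<le> \<bar>B\<bar>" for x using B[of x] assms(2)[of x] by (cases "x \<in> K") auto
  then show ?thesis
    using borel_measurable_continuous_onI[OF assms(1)] by (auto simp: bounded_borel_def)
qed

lemma test_function_bounded_borel: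
  fixes \<phi> :: "real^'n \<Rightarrow> real"
  shows "test_function V \<phi> \<Longrightarrow> bounded_borel \<phi>"
proof -
  assume \<phi>: "test_function V \<phi>"
  obtain K where "compact K" "\<And>x. x \<notin> K \<Longrightarrow> \<phi> x = 0"
    using test_function_support[OF \<phi>] by metis
  then show ?thesis
    using bounded_borel_continuous_vanishing[OF test_function_continuous[OF \<phi>]] by blast
qed

lemma partial_deriv_bounded_borel: "test_function V \<phi> \<Longrightarrow> bounded_borel (partial_deriv k \<phi>)"
proof -
  assume \<phi>: "test_function V \<phi>"
  obtain K where "compact K" "\<And>x. x \<notin> K \<Longrightarrow> partial_deriv k \<phi> x = 0"
    using test_function_support[OF \<phi>] by metis
  then show ?thesis
    using bounded_borel_continuous_vanishing[OF test_function_continuous_partial[OF \<phi>]] by blast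
qed

lemma integrable_mult_bounded_borel:
  assumes v: "integrable M v" and w: "bounded_borel w" and t: "t \<in> M \<rightarrow>\<^sub>M borel"
  shows "integrable M (\<lambda>x. v x * w (t x))"
proof -
  obtain B where w': "w \<in> borel_measurable borel" "\<And>x. \<bar>w x\<bar> \<le> B"
    using w by (auto simp: bounded_borel_def)
  show ?thesis
  proof (rule Bochner_Integration.integrable_bound)
    show "integrable M (\<lambda>x. B * v x)" using v by simp
    show "(\<lambda>x. v x * w (t x)) \<in> borel_measurable M"
      using v measurable_compose[OF t w'(1)] by auto
    have "\<bar>v x\<bar> * \<bar>w (t x)\<bar> \<le> \<bar>v x\<bar> * \<bar>B\<bar>" for x
      using w'(2)[of "t x"] by (intro mult_left_mono) auto
    then show "AE x in M. norm (v x * w (t x)) \<le> norm (B * v x)"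
      by (simp add: abs_mult mult.commute)
  qed
qed

lemma test_function_line:
  assumes \<phi>: "test_function V \<phi>"
  shows "C1 (\<lambda>t. \<phi> (x + (t - x $ k) *\<^sub>R axis k 1)) (\<lambda>t. partial_deriv k \<phi> (x + (t - x $ k) *\<^sub>R axis k 1))"
    and "\<exists>R. \<forall>t. t \<notin> {-R<..<R} \<longrightarrow> \<phi> (x + (t - x $ k) *\<^sub>R axis k 1) = 0"
proof -
  let ?l = "\<lambda>t. x + (t - x $ k) *\<^sub>R axis k 1"
  have "((\<lambda>t. \<phi> (?l t)) has_real_derivative partial_deriv k \<phi> (?l t)) (at t)" for t
  proof -
    have "(?l has_derivative (\<lambda>h. h *\<^sub>R axis k 1)) (at t)"
      by (auto intro!: derivative_eq_intros)
    from has_derivative_compose[OF this test_function_has_derivative[OF \<phi>]]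
    have "((\<lambda>t. \<phi> (?l t)) has_derivative (\<lambda>h. frechet_derivative \<phi> (at (?l t)) (h *\<^sub>R axis k 1))) (at t)" .
    moreover have "frechet_derivative \<phi> (at (?l t)) (h *\<^sub>R axis k 1) = partial_deriv k \<phi> (?l t) * h" for h
      using linear_scale[OF has_derivative_linear[OF test_function_has_derivative[OF \<phi>]]]
      by (simp add: partial_deriv_def)
    ultimately show ?thesis by (simp add: has_field_derivative_def)
  qed
  moreover have "continuous_on UNIV (\<lambda>t. partial_deriv k \<phi> (?l t))"
    by (rule continuous_on_compose2[OF test_function_continuous_partial[OF \<phi>]])
       (auto intro!: continuous_intros)
  ultimately show "C1 (\<lambda>t. \<phi> (?l t)) (\<lambda>t. partial_deriv k \<phi> (?l t))" by (simp add: C1_def)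
  obtain K where K: "compact K" "\<And>x. x \<notin> K \<Longrightarrow> \<phi> x = 0" using test_function_support[OF \<phi>] by metis
  from compact_imp_bounded[OF K(1)] obtain R where R: "\<And>x. x \<in> K \<Longrightarrow> norm x \<le> R" by (auto simp: bounded_iff)
  have "\<phi> (?l t) = 0" if "t \<notin> {-(R+1)<..<R+1}" for t
  proof (rule K(2), rule notI)
    assume "?l t \<in> K"
    then have "norm (?l t) \<le> R" by (rule R)
    moreover have "\<bar>?l t $ k\<bar> \<le> norm (?l t)" by (rule component_le_norm_cart)
    moreover have "?l t $ k = t" by (simp add: axis_def)
    ultimately show False using that by auto
  qed
  then show "\<exists>R. \<forall>t. t \<notin> {-R<..<R} \<longrightarrow> \<phi> (?l t) = 0" by blast
qed

context singular_staircase
begin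

text \<open>
  The derivative of \<open>f1 (c t) + f2 (c t) * h t\<close> has the absolutely continuous part
  \<open>f2 (c t) * h' t\<close> and a singular part, the image under \<open>T\<close> of the density
  \<open>f1' t + f2' t * h (T t)\<close>. The argument of \<open>h\<close> changes because \<open>h\<close> is evaluated at the image
  point.
\<close>

lemma integral_staircase_product:
  assumes f1: "C1 f1 f1'" and f2: "C1 f2 f2'" and h: "C1 h h'" and psi: "C1 \<psi> \<psi>'"
    and supp: "\<And>t. t \<notin> {-R<..<R} \<Longrightarrow> \<psi> t = 0"
  shows "(\<integral>t. (f1 (c t) + f2 (c t) * h t) * \<psi>' t + f2 (c t) * h' t * \<psi> t
      + (f1' t + f2' t * h (T t)) * \<psi> (T t) \<partial>lborel) = 0"
proof -
  have p2: "C1 (\<lambda>t. h t * \<psi> t) (\<lambda>t. h' t * \<psi> t + \<psi>' t * h t)" by (rule C1_mult[OF h psi])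
  note A = integral_staircase_by_parts[OF C1_deriv[OF f1] C1_cont'[OF f1] C1_deriv[OF psi] C1_cont'[OF psi] supp]
  note B = integral_staircase_by_parts[OF C1_deriv[OF f2] C1_cont'[OF f2] C1_deriv[OF p2] C1_cont'[OF p2], of R]
  have B': "\<And>t. t \<notin> {-R<..<R} \<Longrightarrow> h t * \<psi> t = 0" using supp by simp
  have "(f1 (c t) + f2 (c t) * h t) * \<psi>' t + f2 (c t) * h' t * \<psi> t + (f1' t + f2' t * h (T t)) * \<psi> (T t)
    = (f1 (c t) * \<psi>' t + f1' t * \<psi> (T t))
      + (f2 (c t) * (h' t * \<psi> t + \<psi>' t * h t) + f2' t * (h (T t) * \<psi> (T t)))" for t
    by (simp add: algebra_simps)
  then show ?thesis using A B[OF B'] by simp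
qed

definition push :: "'n::finite \<Rightarrow> real^'n \<Rightarrow> real^'n" where
  "push k x = x + (T (x $ k) - x $ k) *\<^sub>R axis k 1"

lemma borel_measurable_push [measurable]: "push k \<in> borel_measurable borel"
  unfolding push_def[abs_def] by measurable

lemma push_nth: "push k x $ l = (if l = k then T (x $ k) else x $ l)"
  by (simp add: push_def axis_def)

text \<open>
  If \<open>v\<close> has the form of the previous rule on every line in direction \<open>k\<close>, then its derivative in
  that direction is the density \<open>g\<close> plus the image under \<open>push k\<close> of the density \<open>s\<close>.
\<close>

lemma distr_derivative_by_lines:
  fixes v g s :: "real^'n \<Rightarrow> real"
  assumes \<phi>: "test_function V \<phi>"
    and int: "integrable lborel v" "integrable lborel g" "integrable lborel s"
    and line: "\<And>x. \<exists>f1 f1' f2 f2' h h'. C1 f1 f1' \<and> C1 f2 f2' \<and> C1 h h' \<and>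
       (\<forall>t. v (x + (t - x $ k) *\<^sub>R axis k 1) = f1 (c t) + f2 (c t) * h t \<and>
            g (x + (t - x $ k) *\<^sub>R axis k 1) = f2 (c t) * h' t \<and>
            s (x + (t - x $ k) *\<^sub>R axis k 1) = f1' t + f2' t * h (T t))"
  shows "- (\<integral>x. v x * partial_deriv k \<phi> x \<partial>lborel)
      = (\<integral>x. g x * \<phi> x \<partial>lborel) + (\<integral>x. s x * \<phi> (push k x) \<partial>lborel)"
proof -
  have i1: "integrable lborel (\<lambda>x. v x * partial_deriv k \<phi> x)"
    by (rule integrable_mult_bounded_borel[OF int(1) partial_deriv_bounded_borel[OF \<phi>], of "\<lambda>x. x"]) simp
  have i2: "integrable lborel (\<lambda>x. g x * \<phi> x)"
    by (rule integrable_mult_bounded_borel[OF int(2) test_function_bounded_borel[OF \<phi>], of "\<lambda>x. x"]) simp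
  have i3: "integrable lborel (\<lambda>x. s x * \<phi> (push k x))"
    by (rule integrable_mult_bounded_borel[OF int(3) test_function_bounded_borel[OF \<phi>]]) simp
  define F where "F x = v x * partial_deriv k \<phi> x + g x * \<phi> x + s x * \<phi> (push k x)" for x
  have F: "integrable lborel F" unfolding F_def using i1 i2 i3 by simp
  then have [measurable]: "F \<in> borel_measurable borel" using borel_measurable_integrable by auto
  have "(\<integral>x. F x \<partial>lborel) = 0"
  proof (rule integral_eq_0_by_lines[OF F, of k])
    fix x
    let ?l = "\<lambda>t. x + (t - x $ k) *\<^sub>R axis k 1"
    obtain f1 f1' f2 f2' h h' where C: "C1 f1 f1'" "C1 f2 f2'" "C1 h h'"
      and eq: "\<And>t. v (?l t) = f1 (c t) + f2 (c t) * h t" "\<And>t. g (?l t) = f2 (c t) * h' t"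
        "\<And>t. s (?l t) = f1' t + f2' t * h (T t)"
      using line[of x] by metis
    obtain R where R: "\<And>t. t \<notin> {-R<..<R} \<Longrightarrow> \<phi> (?l t) = 0" using test_function_line(2)[OF \<phi>] by blast
    have p: "push k (?l t) = ?l (T t)" for t
      by (simp add: push_def axis_def vec_eq_iff)
    have "(\<integral>s. F (x + s *\<^sub>R axis k 1) \<partial>lborel) = (\<integral>s. F (?l (s + x $ k)) \<partial>lborel)" by simp
    also have "\<dots> = (\<integral>t. F (?l t) \<partial>lborel)"
      by (rule integrable_translation(2)) measurable
    also have "\<dots> = 0"
      unfolding F_def eq p using integral_staircase_product[OF C test_function_line(1)[OF \<phi>] R] by simp
    finally show "(\<integral>s. F (x + s *\<^sub>R axis k 1) \<partial>lborel) = 0" .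
  qed
  then show ?thesis unfolding F_def using i1 i2 i3 by simp
qed

end

section \<open>Measures determined by test functions\<close>

lemma signed_integral_dominated_convergence:
  fixes f :: "nat \<Rightarrow> 'a::topological_space \<Rightarrow> real"
  assumes r: "radon_measure \<Omega> \<mu>" and f: "\<And>n. bounded_borel (f n)" and g: "bounded_borel g"
    and lim: "\<And>x. (\<lambda>n. f n x) \<longlonglongrightarrow> g x" and b: "\<And>n x. \<bar>f n x\<bar> \<le> B"
  shows "(\<lambda>n. signed_integral \<Omega> \<mu> (f n)) \<longlonglongrightarrow> signed_integral \<Omega> \<mu> g"
proof -
  have *: "(\<lambda>n. integral\<^sup>L (positive_part \<Omega> \<nu>) (f n)) \<longlonglongrightarrow> integral\<^sup>L (positive_part \<Omega> \<nu>) g"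
    if r: "radon_measure \<Omega> \<nu>" for \<nu>
  proof (rule integral_dominated_convergence[where w = "\<lambda>_. B"])
    show "g \<in> borel_measurable (positive_part \<Omega> \<nu>)" "\<And>n. f n \<in> borel_measurable (positive_part \<Omega> \<nu>)"
      using integrable_positive_part[OF r] f g by auto
    show "integrable (positive_part \<Omega> \<nu>) (\<lambda>_. B)"
      by (rule integrable_positive_part[OF r bounded_borel_const])
  qed (use lim b in auto)
  show ?thesis unfolding signed_integral_def
    by (intro tendsto_diff * r radon_measure_uminus)
qed

lemma radon_measure_Int:
  assumes r: "radon_measure \<Omega> \<mu>" and "A \<in> borel_sets \<Omega>" "B \<in> borel_sets \<Omega>"
  shows "\<mu> A = \<mu> (A \<inter> B) + \<mu> (A - B)"
proof -
  have "\<mu> ((A \<inter> B) \<union> (A - B)) = \<mu> (A \<inter> B) + \<mu> (A - B)"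
    by (rule radon_measure_Un[OF r]) (use assms in auto)
  moreover have "(A \<inter> B) \<union> (A - B) = A" by blast
  ultimately show ?thesis by simp
qed

text \<open>
  The boxes contained in a given box generate its Borel sets and are stable under intersection.
\<close>

lemma radon_measure_zero_on_box:
  fixes \<mu> :: "(real^'n) set \<Rightarrow> real"
  assumes r: "radon_measure \<Omega> \<mu>" and \<Omega>: "\<Omega> \<in> sets borel" and subset: "box u v \<subseteq> \<Omega>"
    and zero: "\<And>a b. box a b \<subseteq> box u v \<Longrightarrow> \<mu> (box a b) = 0"
    and A: "A \<in> sets borel"
  shows "\<mu> (A \<inter> box u v) = 0"
proof -
  let ?U = "box u v"
  let ?E = "range (\<lambda>(a, b). box a b) :: (real^'n) set set"
  have bU: "B \<inter> ?U \<in> borel_sets \<Omega>" if "B \<in> sets borel" for B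
    using that subset \<Omega> by (auto simp: borel_sets_iff)
  have sb: "sets (borel :: (real^'n) measure) = sigma_sets UNIV ?E"
    unfolding borel_eq_box by (rule sets_measure_of) simp
  have mem: "A \<in> sigma_sets UNIV ?E" using A sb by simp
  have stable: "Int_stable ?E"
    unfolding Int_stable_def by (auto simp: box_Int_box)
  have inborel: "B \<in> sets borel" if "B \<in> sigma_sets UNIV ?E" for B
    using that sb by simp
  have sub: "?E \<subseteq> Pow UNIV" by simp
  from stable sub mem show ?thesis
  proof (induction rule: sigma_sets_induct_disjoint)
    case (basic B)
    then obtain a b where B: "B = box a b" by auto
    obtain a' b' where "B \<inter> ?U = box a' b'" unfolding B box_Int_box by blast
    then show ?case using zero[of a' b'] by (metis inf_le2)
  next
    case empty
    then show ?case using radon_measure_empty[OF r] by simp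
  next
    case (compl B)
    have "\<mu> (?U - B \<inter> ?U) = \<mu> ?U - \<mu> (B \<inter> ?U)"
      by (rule radon_measure_Diff[OF r]) (use bU[OF inborel[OF compl(1)]] bU[of UNIV] in auto)
    moreover have "(UNIV - B) \<inter> ?U = ?U - B \<inter> ?U" by blast
    ultimately show ?case using compl zero[of u v] by simp
  next
    case (union F)
    have "(\<lambda>i. \<mu> (F i \<inter> ?U)) sums \<mu> (\<Union>i. F i \<inter> ?U)"
    proof (rule radon_measure_sums[OF r])
      show "range (\<lambda>i. F i \<inter> ?U) \<subseteq> borel_sets \<Omega>" using union(2) inborel bU by blast
      show "disjoint_family (\<lambda>i. F i \<inter> ?U)" using union(1) by (auto simp: disjoint_family_on_def)
    qed
    then have "(\<lambda>i. 0) sums \<mu> (\<Union>i. F i \<inter> ?U)" using union(3) by simp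
    moreover have "(\<Union>i. F i \<inter> ?U) = (\<Union>i. F i) \<inter> ?U" by blast
    ultimately show ?case using sums_unique2[OF sums_zero] by metis
  qed
qed

text \<open>
  The bump functions of a box converge boundedly to its indicator function, which gives the claim
  for boxes contained in \<open>V\<close>; and \<open>V\<close> is a countable union of such boxes.
\<close>

lemma radon_measure_eq_0_if_test:
  fixes \<mu> :: "(real^'n) set \<Rightarrow> real"
  assumes r: "radon_measure \<Omega> \<mu>" and \<Omega>: "\<Omega> \<in> sets borel" and V: "open V" "V \<subseteq> \<Omega>"
    and zero: "\<And>\<phi>. test_function V \<phi> \<Longrightarrow> signed_integral \<Omega> \<mu> \<phi> = 0"
    and A: "A \<in> sets borel" "A \<subseteq> V"
  shows "\<mu> A = 0"
proof -
  have box0: "\<mu> (box a b) = 0" if "box a b \<subseteq> V" for a b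
  proof -
    have "(\<lambda>n. signed_integral \<Omega> \<mu> (box_bump a b n)) \<longlonglongrightarrow> signed_integral \<Omega> \<mu> (indicator (box a b))"
    proof (rule signed_integral_dominated_convergence[OF r])
      show "bounded_borel (box_bump a b n)" for n
        using C_k_box_bump[of 0 a b n] box_bump_bounds[of a b n]
        by (auto simp: bounded_borel_def intro!: borel_measurable_continuous_onI exI[of _ 1])
      show "\<bar>box_bump a b n x\<bar> \<le> 1" for n x using box_bump_bounds[of a b n x] by simp
    qed (auto intro: bounded_borel_indicator box_bump_limit)
    moreover have "eventually (\<lambda>n. signed_integral \<Omega> \<mu> (box_bump a b n) = 0) sequentially"
      using eventually_gt_at_top[of 0] by eventually_elim (use zero test_function_box_bump[OF that] in blast)
    ultimately have "signed_integral \<Omega> \<mu> (indicator (box a b)) = 0"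
      using LIMSEQ_unique tendsto_eventually by metis
    moreover have "box a b \<inter> \<Omega> = box a b" using that V by blast
    ultimately show ?thesis using signed_integral_indicator[OF r \<Omega>, of "box a b"] by simp
  qed
  obtain \<D> where D: "countable \<D>" "\<D> \<subseteq> Pow V" "\<And>X. X \<in> \<D> \<Longrightarrow> \<exists>a b. X = box a b" "\<Union>\<D> = V"
    using open_countable_Union_open_box[OF V(1)] by metis
  define W where "W n = (if \<D> = {} then {} else from_nat_into \<D> n)" for n
  have W: "\<exists>a b. W n = box a b" "W n \<subseteq> V" for n
  proof -
    have "box 0 (0::real^'n) = {}" by (auto simp: mem_box_cart dest: less_asym)
    then have "\<exists>a b. {} = box a (b::real^'n)" by metis
    then show "\<exists>a b. W n = box a b" using D(3) from_nat_into[of \<D> n] by (auto simp: W_def)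
    show "W n \<subseteq> V" using D(2) from_nat_into[of \<D> n] by (auto simp: W_def)
  qed
  have WV: "(\<Union>n. W n) = V"
  proof (cases "\<D> = {}")
    case False
    then have "range (from_nat_into \<D>) = \<D>" using D(1) by (rule range_from_nat_into)
    then show ?thesis using D(4) False by (simp add: W_def)
  qed (use D(4) in \<open>auto simp: W_def\<close>)
  have Wb: "W n \<in> sets borel" for n using W(1)[of n] by auto
  define S where "S n = A \<inter> disjointed W n" for n
  have Sb: "S n \<in> sets borel" for n
    unfolding S_def using A(1) sets.range_disjointed_sets[of W borel] Wb by auto
  have S0: "\<mu> (S n) = 0" for n
  proof -
    obtain a b where ab: "W n = box a b" using W(1) by blast
    have "\<mu> (S n \<inter> box a b) = 0"
      by (rule radon_measure_zero_on_box[OF r \<Omega> _ _ Sb]) (use W(2)[of n] ab V box0 in auto)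
    moreover have "S n \<inter> box a b = S n" using disjointed_subset[of W n] ab by (auto simp: S_def)
    ultimately show ?thesis by simp
  qed
  have "(\<lambda>n. \<mu> (S n)) sums \<mu> (\<Union>n. S n)"
  proof (rule radon_measure_sums[OF r])
    have "S n \<subseteq> \<Omega>" for n using A(2) V(2) by (auto simp: S_def)
    then show "range S \<subseteq> borel_sets \<Omega>" using Sb by (auto simp: borel_sets_iff[OF \<Omega>])
    show "disjoint_family S"
      using disjoint_family_disjointed[of W] by (auto simp: disjoint_family_on_def S_def)
  qed
  moreover have "(\<Union>n. S n) = A" using A(2) WV UN_disjointed_eq[of W] by (auto simp: S_def)
  ultimately have "(\<lambda>n. 0) sums \<mu> A" using S0 by simp
  then show ?thesis using sums_unique2[OF sums_zero] by metis
qed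

lemma signed_integral_diff:
  assumes r: "radon_measure \<Omega> \<mu>" "radon_measure \<Omega> \<nu>" and \<Omega>: "\<Omega> \<in> sets borel" and f: "bounded_borel f"
  shows "signed_integral \<Omega> (\<lambda>A. \<mu> A - \<nu> A) f = signed_integral \<Omega> \<mu> f - signed_integral \<Omega> \<nu> f"
proof (rule signed_integral_eqI[OF radon_measure_diff[OF r] \<Omega> _ _ _ _ f])
  fix f g :: "'a \<Rightarrow> real" and c :: real
  assume f: "bounded_borel f"
  show "signed_integral \<Omega> \<mu> (\<lambda>x. f x + g x) - signed_integral \<Omega> \<nu> (\<lambda>x. f x + g x)
    = signed_integral \<Omega> \<mu> f - signed_integral \<Omega> \<nu> f + (signed_integral \<Omega> \<mu> g - signed_integral \<Omega> \<nu> g)"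
    if "bounded_borel g" using signed_integral_add[OF r(1) f that] signed_integral_add[OF r(2) f that] by simp
  show "signed_integral \<Omega> \<mu> (\<lambda>x. c * f x) - signed_integral \<Omega> \<nu> (\<lambda>x. c * f x)
    = c * (signed_integral \<Omega> \<mu> f - signed_integral \<Omega> \<nu> f)"
    using signed_integral_scale[of \<Omega> \<mu> c f] signed_integral_scale[of \<Omega> \<nu> c f] by (simp add: right_diff_distrib)
  let ?K = "\<lambda>\<mu>. measure (positive_part \<Omega> \<mu>) \<Omega> + measure (positive_part \<Omega> (\<lambda>A. - \<mu> A)) \<Omega>"
  show "\<bar>signed_integral \<Omega> \<mu> f - signed_integral \<Omega> \<nu> f\<bar> \<le> (?K \<mu> + ?K \<nu>) * c" if "\<And>x. \<bar>f x\<bar> \<le> c"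
  proof -
    have "\<bar>signed_integral \<Omega> \<mu> f\<bar> \<le> ?K \<mu> * c" "\<bar>signed_integral \<Omega> \<nu> f\<bar> \<le> ?K \<nu> * c"
      by (intro signed_integral_bound[OF r(1) f that] signed_integral_bound[OF r(2) f that])+
    then show ?thesis unfolding distrib_right[of "?K \<mu>" "?K \<nu>" c] by linarith
  qed
next
  fix A :: "'a set" assume "A \<in> sets borel"
  then show "signed_integral \<Omega> \<mu> (indicator A) - signed_integral \<Omega> \<nu> (indicator A) = \<mu> (A \<inter> \<Omega>) - \<nu> (A \<inter> \<Omega>)"
    using signed_integral_indicator[OF r(1) \<Omega>] signed_integral_indicator[OF r(2) \<Omega>] by simp
qed

lemma radon_measure_eqI_test:
  fixes \<mu> \<nu> :: "(real^'n) set \<Rightarrow> real"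
  assumes r: "radon_measure \<Omega> \<mu>" "radon_measure \<Omega> \<nu>" and \<Omega>: "\<Omega> \<in> sets borel" and V: "open V" "V \<subseteq> \<Omega>"
    and eq: "\<And>\<phi>. test_function V \<phi> \<Longrightarrow> signed_integral \<Omega> \<mu> \<phi> = signed_integral \<Omega> \<nu> \<phi>"
    and A: "A \<in> sets borel" "A \<subseteq> V"
  shows "\<mu> A = \<nu> A"
proof -
  have "\<mu> A - \<nu> A = 0"
  proof (rule radon_measure_eq_0_if_test[OF radon_measure_diff[OF r] \<Omega> V _ A])
    fix \<phi> assume "test_function V \<phi>"
    then show "signed_integral \<Omega> (\<lambda>A. \<mu> A - \<nu> A) \<phi> = 0"
      using signed_integral_diff[OF r \<Omega> test_function_bounded_borel] eq by simp
  qed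
  then show ?thesis by simp
qed

text \<open>
  Every measure constructed below is a series of images under maps \<open>\<tau> m k\<close> of integrable densities
  \<open>f m k\<close>. Countable additivity holds in each term by dominated convergence, and passes to the
  series by Tannery's theorem, since the terms are dominated by the summable sequence \<open>e\<close>.
\<close>

lemma radon_measure_superposition:
  fixes f :: "nat \<Rightarrow> 'k::finite \<Rightarrow> 'a::euclidean_space \<Rightarrow> real" and \<tau> :: "nat \<Rightarrow> 'k \<Rightarrow> 'a \<Rightarrow> 'a"
  assumes f: "\<And>m k. integrable lborel (f m k)" and \<tau>: "\<And>m k. \<tau> m k \<in> borel_measurable borel"
    and b: "\<And>m k. (\<integral>x. \<bar>f m k x\<bar> \<partial>lborel) \<le> e m" and e: "summable e"
    and \<Omega>: "\<Omega> \<in> sets borel"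
  defines "I \<equiv> \<lambda>\<phi>. \<Sum>m. \<Sum>k\<in>UNIV. \<integral>x. f m k x * \<phi> (\<tau> m k x) \<partial>lborel"
  defines "\<mu> \<equiv> \<lambda>A. if A \<in> borel_sets \<Omega> then I (indicator A) else 0"
  shows "radon_measure \<Omega> \<mu>"
    and "bounded_borel \<phi> \<Longrightarrow> (\<And>x. x \<notin> \<Omega> \<Longrightarrow> \<phi> x = 0) \<Longrightarrow> signed_integral \<Omega> \<mu> \<phi> = I \<phi>"
proof -
  define J where "J m \<phi> = (\<Sum>k\<in>UNIV. \<integral>x. f m k x * \<phi> (\<tau> m k x) \<partial>lborel)" for m \<phi>
  have int: "integrable lborel (\<lambda>x. f m k x * \<phi> (\<tau> m k x))" if "bounded_borel \<phi>" for m k \<phi>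
    by (rule integrable_mult_bounded_borel[OF f that]) (use \<tau> in simp)
  have Jb: "\<bar>J m \<phi>\<bar> \<le> (real CARD('k) * c) * e m" if "bounded_borel \<phi>" "\<And>x. \<bar>\<phi> x\<bar> \<le> c" for m \<phi> c
  proof -
    have c: "c \<ge> 0" using that(2)[of undefined] by linarith
    have "\<bar>\<integral>x. f m k x * \<phi> (\<tau> m k x) \<partial>lborel\<bar> \<le> c * e m" for k
    proof -
      have "\<bar>\<integral>x. f m k x * \<phi> (\<tau> m k x) \<partial>lborel\<bar> \<le> (\<integral>x. \<bar>f m k x * \<phi> (\<tau> m k x)\<bar> \<partial>lborel)"
        using integral_norm_bound[of lborel "\<lambda>x. f m k x * \<phi> (\<tau> m k x)"] by simp
      also have "\<dots> \<le> (\<integral>x. c * \<bar>f m k x\<bar> \<partial>lborel)"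
      proof (rule integral_mono)
        show "integrable lborel (\<lambda>x. \<bar>f m k x * \<phi> (\<tau> m k x)\<bar>)" using int[OF that(1)] by simp
        show "integrable lborel (\<lambda>x. c * \<bar>f m k x\<bar>)" using f by simp
        show "\<bar>f m k x * \<phi> (\<tau> m k x)\<bar> \<le> c * \<bar>f m k x\<bar>" for x
          using mult_right_mono[OF that(2)[of "\<tau> m k x"], of "\<bar>f m k x\<bar>"] by (simp add: abs_mult mult.commute)
      qed
      also have "\<dots> \<le> c * e m" using c b[of m k] by (simp add: mult_left_mono)
      finally show ?thesis .
    qed
    then have "\<bar>J m \<phi>\<bar> \<le> (\<Sum>k\<in>(UNIV::'k set). c * e m)"
      unfolding J_def by (intro order_trans[OF sum_abs] sum_mono) auto
    then show ?thesis by (simp add: mult.assoc)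
  qed
  have Js: "summable (\<lambda>m. J m \<phi>)" if \<phi>: "bounded_borel \<phi>" for \<phi>
  proof -
    obtain c where c: "\<And>x. \<bar>\<phi> x\<bar> \<le> c" using \<phi> by (auto simp: bounded_borel_def)
    show ?thesis
      by (rule summable_comparison_test'[where g = "\<lambda>m. (real CARD('k) * c) * e m" and N = 0])
         (use Jb[OF \<phi> c] e in \<open>auto intro: summable_mult\<close>)
  qed
  have IJ: "I \<phi> = (\<Sum>m. J m \<phi>)" for \<phi> by (simp add: I_def J_def)
  have Jadd: "J m (\<lambda>x. \<phi> x + \<psi> x) = J m \<phi> + J m \<psi>" if "bounded_borel \<phi>" "bounded_borel \<psi>" for m \<phi> \<psi>
    using int[OF that(1)] int[OF that(2)] by (simp add: J_def distrib_left sum.distrib)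
  have Jscale: "J m (\<lambda>x. c * \<phi> x) = c * J m \<phi>" for m c \<phi>
    by (simp add: J_def sum_distrib_left mult.left_commute)
  have Iadd: "I (\<lambda>x. \<phi> x + \<psi> x) = I \<phi> + I \<psi>" if "bounded_borel \<phi>" "bounded_borel \<psi>" for \<phi> \<psi>
    unfolding IJ Jadd[OF that] by (rule suminf_add[symmetric]) (use Js that in auto)
  have Iscale: "I (\<lambda>x. c * \<phi> x) = c * I \<phi>" if "bounded_borel \<phi>" for c \<phi>
    unfolding IJ Jscale by (rule suminf_mult) (use Js that in auto)
  have Ibound: "\<bar>I \<phi>\<bar> \<le> (real CARD('k) * suminf e) * c" if "bounded_borel \<phi>" "\<And>x. \<bar>\<phi> x\<bar> \<le> c" for \<phi> c
  proof -
    have s: "summable (\<lambda>m. (real CARD('k) * c) * e m)" using e by (rule summable_mult)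
    have "\<bar>I \<phi>\<bar> \<le> (\<Sum>m. (real CARD('k) * c) * e m)"
      using norm_suminf_le[of "\<lambda>m. J m \<phi>", OF _ s] Jb[OF that] by (simp add: IJ)
    also have "\<dots> = (real CARD('k) * suminf e) * c" using suminf_mult[OF e, of "real CARD('k) * c"] by simp
    finally show ?thesis .
  qed
  show r: "radon_measure \<Omega> \<mu>"
    unfolding radon_measure_def
  proof (intro conjI allI impI)
    show "\<mu> A = 0" if "A \<notin> borel_sets \<Omega>" for A using that by (simp add: \<mu>_def)
    fix A :: "nat \<Rightarrow> 'a set" assume A: "range A \<subseteq> borel_sets \<Omega> \<and> disjoint_family A"
    have Ab: "A i \<in> sets borel" for i using A borel_sets_iff[OF \<Omega>] by blast
    have Ub: "(\<Union>i. A i) \<in> borel_sets \<Omega>" using A by blast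
    have Uborel: "(\<Union>i. A i) \<in> sets borel" using Ab by blast
    have fin: "I (\<lambda>x. \<Sum>i<n. indicator (A i) x) = (\<Sum>i<n. I (indicator (A i)))" for n
    proof (induction n)
      case 0
      show ?case using Iscale[OF bounded_borel_const[of 0], of 0] by simp
    next
      case (Suc n)
      then show ?case
        by (simp add: Iadd bounded_borel_sum bounded_borel_indicator Ab)
    qed
    have lim: "(\<lambda>n. I (\<lambda>x. \<Sum>i<n. indicator (A i) x)) \<longlonglongrightarrow> I (indicator (\<Union>i. A i))"
    proof -
      have ind: "(\<Sum>i<n. indicator (A i) x :: real) = indicator (\<Union>i<n. A i) x" for n x
        using A by (subst indicator_UN_disjoint) (auto simp: disjoint_family_on_def)
      have ptw: "(\<lambda>n. \<Sum>i<n. indicator (A i) x :: real) \<longlonglongrightarrow> indicator (\<Union>i. A i) x" for x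
        unfolding ind by (rule LIMSEQ_indicator_UN[where A = A])
      have bb: "bounded_borel (\<lambda>x. \<Sum>i<n. indicator (A i) x)" for n
        by (intro bounded_borel_sum bounded_borel_indicator Ab) auto
      have b1: "\<bar>\<Sum>i<n. indicator (A i) x :: real\<bar> \<le> 1" for n x unfolding ind by (simp add: indicator_def)
      have Jlim: "(\<lambda>n. J m (\<lambda>x. \<Sum>i<n. indicator (A i) x)) \<longlonglongrightarrow> J m (indicator (\<Union>i. A i))" for m
        unfolding J_def
      proof (intro tendsto_sum integral_dominated_convergence[where w = "\<lambda>x. \<bar>f m k x\<bar>" for k])
        fix k
        show "(\<lambda>x. f m k x * indicator (\<Union>i. A i) (\<tau> m k x)) \<in> borel_measurable lborel"
          using int[OF bounded_borel_indicator[OF Uborel]] by auto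
        show "(\<lambda>x. f m k x * (\<Sum>i<n. indicator (A i) (\<tau> m k x))) \<in> borel_measurable lborel" for n
          using int[OF bb[of n]] by auto
        show "integrable lborel (\<lambda>x. \<bar>f m k x\<bar>)" using f by simp
        show "AE x in lborel. (\<lambda>n. f m k x * (\<Sum>i<n. indicator (A i) (\<tau> m k x))) \<longlonglongrightarrow> f m k x * indicator (\<Union>i. A i) (\<tau> m k x)"
          by (intro AE_I2 tendsto_mult_left ptw)
        show "AE x in lborel. norm (f m k x * (\<Sum>i<n. indicator (A i) (\<tau> m k x))) \<le> \<bar>f m k x\<bar>" for n
          by (intro AE_I2) (use mult_left_mono[OF b1, of "\<bar>f m k x\<bar>" for x] in \<open>simp add: abs_mult\<close>)
      qed
      show ?thesis
        unfolding IJ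
      proof (rule conjunct2[OF conjunct2[OF tannerys_theorem]])
        show "(\<lambda>n. J m (\<lambda>x. \<Sum>i<n. indicator (A i) x)) \<longlonglongrightarrow> J m (indicator (\<Union>i. A i))" for m by (rule Jlim)
        show "summable (\<lambda>m. (real CARD('k) * 1) * e m)" using e by (rule summable_mult)
        show "\<forall>\<^sub>F (m, n) in at_top \<times>\<^sub>F sequentially. norm (J m (\<lambda>x. \<Sum>i<n. indicator (A i) x)) \<le> (real CARD('k) * 1) * e m"
          using Jb[OF bb b1] by (intro always_eventually) auto
      qed simp
    qed
    show "(\<lambda>k. \<mu> (A k)) sums \<mu> (\<Union>k. A k)"
      unfolding sums_def using lim A Ub by (simp add: fin \<mu>_def subset_eq)
  qed
  show "signed_integral \<Omega> \<mu> \<phi> = I \<phi>" if \<phi>: "bounded_borel \<phi>" and supp: "\<And>x. x \<notin> \<Omega> \<Longrightarrow> \<phi> x = 0"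
  proof -
    have bb: "bounded_borel (\<lambda>x. indicator \<Omega> x * \<psi> x)" if "bounded_borel \<psi>" for \<psi>
    proof -
      obtain c where c: "\<psi> \<in> borel_measurable borel" "\<And>x. \<bar>\<psi> x\<bar> \<le> c" using \<open>bounded_borel \<psi>\<close> by (auto simp: bounded_borel_def)
      have "\<bar>indicator \<Omega> x * \<psi> x\<bar> \<le> \<bar>c\<bar>" for x using c(2)[of x] by (auto simp: indicator_def)
      then show ?thesis unfolding bounded_borel_def using c(1) \<Omega> by (auto intro!: borel_measurable_times)
    qed
    have "signed_integral \<Omega> \<mu> \<phi> = I (\<lambda>x. indicator \<Omega> x * \<phi> x)"
    proof (rule signed_integral_eqI[OF r \<Omega> _ _ _ _ \<phi>])
      fix g h :: "'a \<Rightarrow> real" and c :: real assume g: "bounded_borel g"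
      show "I (\<lambda>x. indicator \<Omega> x * (g x + h x)) = I (\<lambda>x. indicator \<Omega> x * g x) + I (\<lambda>x. indicator \<Omega> x * h x)"
        if "bounded_borel h" using Iadd[OF bb[OF g] bb[OF that]] by (simp add: distrib_left)
      show "I (\<lambda>x. indicator \<Omega> x * (c * g x)) = c * I (\<lambda>x. indicator \<Omega> x * g x)"
        using Iscale[OF bb[OF g], of c] by (simp add: mult.left_commute)
      show "\<bar>I (\<lambda>x. indicator \<Omega> x * g x)\<bar> \<le> (real CARD('k) * suminf e) * c" if "\<And>x. \<bar>g x\<bar> \<le> c"
      proof (rule Ibound[OF bb[OF g]])
        show "\<bar>indicator \<Omega> x * g x\<bar> \<le> c" for x using that[of x] by (auto simp: indicator_def)
      qed
    next
      fix A :: "'a set" assume A: "A \<in> sets borel"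
      have "(\<lambda>x. indicator \<Omega> x * indicator A x) = (indicator (A \<inter> \<Omega>) :: 'a \<Rightarrow> real)"
        by (auto simp: indicator_def)
      then show "I (\<lambda>x. indicator \<Omega> x * indicator A x) = \<mu> (A \<inter> \<Omega>)"
        using A \<Omega> by (simp add: \<mu>_def borel_sets_iff)
    qed
    also have "(\<lambda>x. indicator \<Omega> x * \<phi> x) = \<phi>" using supp by (auto simp: indicator_def fun_eq_iff)
    finally show ?thesis .
  qed
qed

section \<open>Oscillating digits\<close>

lemma C1_compose: "C1 f f' \<Longrightarrow> C1 g g' \<Longrightarrow> C1 (\<lambda>x. f (g x)) (\<lambda>x. f' (g x) * g' x)"
proof -
  assume f: "C1 f f'" and g: "C1 g g'"
  have "((\<lambda>x. f (g x)) has_real_derivative f' (g x) * g' x) (at x)" for x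
    by (rule DERIV_chain2[OF C1_deriv[OF f] C1_deriv[OF g]])
  moreover have "continuous_on UNIV (\<lambda>x. f' (g x) * g' x)"
    by (intro continuous_on_mult C1_cont'[OF g] continuous_on_compose2[OF C1_cont'[OF f] C1_cont[OF g]]) auto
  ultimately show ?thesis by (auto simp: C1_def)
qed

lemma C1_cos: "C1 cos (\<lambda>x. - sin x)"
  by (auto simp: C1_def intro!: derivative_eq_intros continuous_intros)

lemma C1_bounded:
  assumes "C1 f f'" obtains B where "B \<ge> 0" "\<And>x. x \<in> {-R..R} \<Longrightarrow> \<bar>f x\<bar> \<le> B" "\<And>x. x \<in> {-R..R} \<Longrightarrow> \<bar>f' x\<bar> \<le> B"
proof -
  have "bounded (f ` {-R..R})" "bounded (f' ` {-R..R})"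
    using C1_cont[OF assms] C1_cont'[OF assms]
    by (auto intro!: compact_imp_bounded compact_continuous_image intro: continuous_on_subset)
  then obtain B1 B2 where "\<forall>x\<in>{-R..R}. \<bar>f x\<bar> \<le> B1" "\<forall>x\<in>{-R..R}. \<bar>f' x\<bar> \<le> B2"
    by (auto simp: bounded_iff)
  then show ?thesis by (intro that[of "max 0 (max B1 B2)"]) (auto simp: le_max_iff_disj)
qed

lemma ex_antiderivative:
  fixes r :: "real \<Rightarrow> real"
  assumes "continuous_on UNIV r"
  shows "\<exists>F. C1 F r \<and> F a = 0"
proof -
  have "\<exists>F. \<forall>x. -\<infinity> < ereal x \<longrightarrow> ereal x < \<infinity> \<longrightarrow> (F has_vector_derivative r x) (at x)"
    by (rule einterval_antiderivative) (use assms in \<open>auto simp: continuous_on_eq_continuous_at\<close>)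
  then obtain F where "\<And>x. (F has_real_derivative r x) (at x)"
    by (auto simp: has_real_derivative_iff_has_vector_derivative)
  then have "C1 (\<lambda>x. F x - F a) (\<lambda>x. r x - 0)"
    using assms by (intro C1_diff C1_const) (auto simp: C1_def)
  then show ?thesis by (intro exI[of _ "\<lambda>x. F x - F a"]) simp
qed

lemma C1_mono: "C1 f f' \<Longrightarrow> (\<And>x. x \<in> {a..b} \<Longrightarrow> 0 \<le> f' x) \<Longrightarrow> a \<le> b \<Longrightarrow> f a \<le> f b"
  by (rule DERIV_nonneg_imp_nondecreasing) (auto intro!: exI C1_deriv)

lemma C1_increment_bound:
  assumes "C1 f f'" "\<And>x. x \<in> {a..b} \<Longrightarrow> \<bar>f' x\<bar> \<le> B" "a \<le> b"
  shows "\<bar>f b - f a\<bar> \<le> B * (b - a)"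
proof -
  note B = C1_cmult[OF C1_ident, of B]
  have "B * a - f a \<le> B * b - f b"
    by (rule C1_mono[OF C1_diff[OF B assms(1)]]) (use assms(2,3) in \<open>auto simp: abs_le_iff\<close>)
  moreover have "B * a + f a \<le> B * b + f b"
    by (rule C1_mono[OF C1_add[OF B assms(1)]]) (use assms(2,3) in \<open>force simp: abs_le_iff\<close>)+
  ultimately show ?thesis by (simp add: abs_le_iff algebra_simps)
qed

lemma C1_zero_const: "C1 f (\<lambda>x. 0) \<Longrightarrow> f x = f y"
  using DERIV_isconst_all[of f x y] by (simp add: C1_def)

definition ramp2 :: "real \<Rightarrow> real" where "ramp2 x = (max 0 x)\<^sup>2"

lemma C1_ramp2: "C1 ramp2 (\<lambda>x. 2 * max 0 x)"
proof -
  have "(ramp2 has_real_derivative 2 * max 0 x) (at x)" for x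
  proof -
    consider "x > 0" | "x < 0" | "x = 0" by linarith
    then show ?thesis
    proof cases
      case 1
      have "((\<lambda>x. x\<^sup>2) has_real_derivative 2 * max 0 x) (at x)"
        using 1 by (auto intro!: derivative_eq_intros)
      then show ?thesis
        by (rule has_field_derivative_transform_within_open[of _ _ _ "{0<..}"])
           (use 1 in \<open>auto simp: ramp2_def\<close>)
    next
      case 2
      have "((\<lambda>x. 0) has_real_derivative 2 * max 0 x) (at x)"
        using 2 by (auto simp: max_def)
      then show ?thesis
        by (rule has_field_derivative_transform_within_open[of _ _ _ "{..<0}"])
           (use 2 in \<open>auto simp: ramp2_def max_def\<close>)
    next
      case 3
      have "ramp2 h / h = max 0 h" for h by (auto simp: ramp2_def max_def power2_eq_square)
      moreover have "((\<lambda>h. max 0 h) \<longlongrightarrow> max 0 (0::real)) (at 0)"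
        by (intro tendsto_max tendsto_const tendsto_ident_at)
      ultimately show ?thesis using 3 by (simp add: DERIV_def ramp2_def[of 0])
    qed
  qed
  then show ?thesis by (auto simp: C1_def intro!: continuous_intros)
qed

text \<open>
  The integral of the hat function on \<open>[-1, 1]\<close>. The second difference of \<open>ramp2\<close> is an explicit
  formula for it, and its symmetry gives the digits below mean exactly 1.
\<close>

definition smooth_step :: "real \<Rightarrow> real" where
  "smooth_step s = (ramp2 (s + 1) - 2 * ramp2 s + ramp2 (s - 1)) / 2"

definition smooth_step' :: "real \<Rightarrow> real" where
  "smooth_step' s = max 0 (s + 1) - 2 * max 0 s + max 0 (s - 1)"

lemma C1_smooth_step: "C1 smooth_step smooth_step'"
proof -
  have "C1 (\<lambda>s. (1/2) * (ramp2 (1 * s + 1) - 2 * ramp2 s + ramp2 (1 * s + (-1))))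
    (\<lambda>s. (1/2) * (1 * (2 * max 0 (1 * s + 1)) - 2 * (2 * max 0 s) + 1 * (2 * max 0 (1 * s + (-1)))))"
    by (intro C1_cmult C1_add C1_diff C1_compose_affine[OF C1_ramp2] C1_ramp2)
  moreover have "(\<lambda>s. (1/2) * (ramp2 (1 * s + 1) - 2 * ramp2 s + ramp2 (1 * s + (-1)))) = smooth_step"
    by (simp add: smooth_step_def[abs_def])
  moreover have "(\<lambda>s. (1/2) * (1 * (2 * max 0 (1 * s + 1)) - 2 * (2 * max 0 s) + 1 * (2 * max 0 (1 * s + (-1)))))
      = smooth_step'"
    by (simp add: smooth_step'_def[abs_def] fun_eq_iff)
  ultimately show ?thesis by simp
qed

lemma smooth_step_cases:
  "s \<le> -1 \<Longrightarrow> smooth_step s = 0" "s \<ge> 1 \<Longrightarrow> smooth_step s = 1"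
  "s \<le> -1 \<or> s \<ge> 1 \<Longrightarrow> smooth_step' s = 0"
  by (auto simp: smooth_step_def ramp2_def smooth_step'_def power2_eq_square algebra_simps max_def)

lemma smooth_step_bounds: "0 \<le> smooth_step s" "smooth_step s \<le> 1"
proof -
  have "\<And>s. 0 \<le> smooth_step' s"
    by (auto simp: smooth_step'_def max_def)
  then have mono: "\<And>s t. s \<le> t \<Longrightarrow> smooth_step s \<le> smooth_step t"
    using C1_mono[OF C1_smooth_step] by blast
  show "0 \<le> smooth_step s"
    using mono[of "min s (-1)" s] smooth_step_cases(1)[of "min s (-1)"] by simp
  show "smooth_step s \<le> 1"
    using mono[of s "max s 1"] smooth_step_cases(2)[of "max s 1"] by simp
qed

lemma smooth_step_symmetric: "smooth_step s + smooth_step (- s) = 1"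
proof -
  consider "s \<le> -1" | "-1 < s \<and> s < 0" | "s = 0" | "0 < s \<and> s < 1" | "1 \<le> s" by linarith
  then show ?thesis
    by cases (auto simp: smooth_step_def ramp2_def power2_eq_square max_def field_simps)
qed

text \<open>
  For large \<open>N\<close> the \<open>2\<pi>\<close>-periodic function \<open>digit N\<close> takes the values 2 and 0, each on almost half
  of the period. The cutoffs \<open>on_digit N\<close> and \<open>off_digit N\<close> live where it is 2 and 0,
  respectively, and have means just below \<open>1/2\<close>.
\<close>

definition digit :: "real \<Rightarrow> real \<Rightarrow> real" where "digit N x = 2 * smooth_step (N * cos x)"
definition on_digit :: "real \<Rightarrow> real \<Rightarrow> real" where "on_digit N x = smooth_step (N * cos x - 2)"
definition off_digit :: "real \<Rightarrow> real \<Rightarrow> real" where "off_digit N x = smooth_step (- N * cos x - 2)"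

lemma C1_digits: "\<exists>d. C1 (digit N) d" "\<exists>d. C1 (on_digit N) d" "\<exists>d. C1 (off_digit N) d"
proof -
  have *: "\<exists>d. C1 (\<lambda>x. smooth_step (a * cos x - b)) d" for a b
    using C1_compose[OF C1_smooth_step C1_diff[OF C1_cmult[OF C1_cos, of a] C1_const[of b]]] by blast
  show "\<exists>d. C1 (on_digit N) d" using *[of N 2] by (simp add: on_digit_def[abs_def])
  show "\<exists>d. C1 (off_digit N) d" using *[of "- N" 2] by (simp add: off_digit_def[abs_def])
  show "\<exists>d. C1 (digit N) d"
    using *[of N 0] C1_cmult[of _ _ 2] by (fastforce simp: digit_def[abs_def])
qed

lemma digit_bounds: "0 \<le> digit N x" "0 \<le> on_digit N x" "on_digit N x \<le> 1" "0 \<le> off_digit N x" "off_digit N x \<le> 1"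
  by (auto simp: digit_def on_digit_def off_digit_def smooth_step_bounds)

lemma on_digit_pos:
  assumes "on_digit N x > 0" shows "digit N x = 2"
proof -
  have "\<not> N * cos x - 2 \<le> -1"
    using assms smooth_step_cases(1) unfolding on_digit_def by fastforce
  then show ?thesis by (simp add: digit_def smooth_step_cases(2))
qed

lemma off_digit_pos:
  assumes "off_digit N x > 0" shows "digit N x = 0"
proof -
  have "\<not> - N * cos x - 2 \<le> -1"
    using assms smooth_step_cases(1) unfolding off_digit_def by fastforce
  then show ?thesis by (simp add: digit_def smooth_step_cases(1))
qed

text \<open>
  For periodic functions this says that the mean is zero, in the form in which it is used.
\<close>

definition oscillating :: "(real \<Rightarrow> real) \<Rightarrow> bool" where
  "oscillating r \<longleftrightarrow> (\<exists>F C. C1 F r \<and> (\<forall>x. \<bar>F x\<bar> \<le> C))"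

text \<open>
  The function \<open>G x = F x - p * x\<close> is a periodic primitive of \<open>r - p\<close>, because its increment over
  one period vanishes.
\<close>

lemma oscillating_periodic:
  assumes F: "C1 F r" and per: "\<And>x. r (x + 2 * pi) = r x" and p: "F (z + pi) - F (z - pi) = 2 * pi * p"
  shows "oscillating (\<lambda>x. r x - p)"
proof -
  define G where "G x = F x - p * x" for x
  have G: "C1 G (\<lambda>x. r x - p * 1)"
    unfolding G_def by (intro C1_diff F C1_cmult C1_ident)
  have "C1 (\<lambda>x. G (1 * x + 2 * pi) - G x) (\<lambda>x. 1 * (r (1 * x + 2 * pi) - p * 1) - (r x - p * 1))"
    by (intro C1_diff C1_compose_affine[OF G] G)
  then have "C1 (\<lambda>x. G (x + 2 * pi) - G x) (\<lambda>x. 0)" by (simp add: per)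
  then have "G (x + 2 * pi) - G x = G ((z - pi) + 2 * pi) - G (z - pi)" for x by (rule C1_zero_const)
  moreover have "G ((z - pi) + 2 * pi) - G (z - pi) = 0"
  proof -
    have "(z - pi) + 2 * pi = z + pi" by simp
    then show ?thesis using p unfolding G_def by (simp only:) (simp add: algebra_simps)
  qed
  ultimately have Gper: "G (x + 2 * pi) = G x" for x by (metis eq_iff_diff_eq_0)
  have Gint: "G (x + 2 * pi * of_int k) = G x" for x k
  proof (induction k rule: int_induct[where k = 0])
    case (step1 i) then show ?case using Gper[of "x + 2 * pi * of_int i"] by (simp add: algebra_simps)
  next
    case (step2 i) then show ?case using Gper[of "x + 2 * pi * of_int (i - 1)"] by (simp add: algebra_simps)
  qed simp
  obtain C where C: "\<And>x. x \<in> {-(2 * pi)..2 * pi} \<Longrightarrow> \<bar>G x\<bar> \<le> C"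
    using C1_bounded[OF G, of "2 * pi"] by metis
  have "\<bar>G x\<bar> \<le> C" for x
  proof -
    define y where "y = x + 2 * pi * of_int (- \<lfloor>x / (2 * pi)\<rfloor>)"
    have "of_int \<lfloor>x / (2 * pi)\<rfloor> \<le> x / (2 * pi)" "x / (2 * pi) < of_int \<lfloor>x / (2 * pi)\<rfloor> + 1" by linarith+
    then have "of_int \<lfloor>x / (2 * pi)\<rfloor> * (2 * pi) \<le> x / (2 * pi) * (2 * pi)"
        "x / (2 * pi) * (2 * pi) \<le> (of_int \<lfloor>x / (2 * pi)\<rfloor> + 1) * (2 * pi)"
      by (auto intro!: mult_right_mono simp del: times_divide_eq_left)
    moreover have "x / (2 * pi) * (2 * pi) = x" by simp
    ultimately have "of_int \<lfloor>x / (2 * pi)\<rfloor> * (2 * pi) \<le> x" "x \<le> (of_int \<lfloor>x / (2 * pi)\<rfloor> + 1) * (2 * pi)"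
      by metis+
    then have "0 \<le> y" "y \<le> 2 * pi"
      unfolding y_def by (simp_all add: algebra_simps)
    then have "\<bar>G y\<bar> \<le> C" by (intro C) auto
    then show ?thesis unfolding y_def by (simp only: Gint)
  qed
  then show ?thesis unfolding oscillating_def using G by (intro exI[of _ G] exI[of _ C]) simp
qed

text \<open>
  Shifting the argument by \<open>\<pi>\<close> changes the sign of the cosine, and
  \<open>digit N (x + \<pi>) + digit N x = 2\<close>.
\<close>

lemma oscillating_digit: "oscillating (\<lambda>x. digit N x - 1)"
proof -
  obtain d where "C1 (digit N) d" using C1_digits by blast
  then obtain F where F: "C1 F (digit N)" using ex_antiderivative C1_cont by blast
  have "C1 (\<lambda>x. F (1 * x + pi) + F x - 2 * x) (\<lambda>x. 1 * digit N (1 * x + pi) + digit N x - 2 * 1)"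
    by (intro C1_diff C1_add C1_compose_affine[OF F] F C1_cmult C1_ident)
  moreover have "1 * digit N (1 * x + pi) + digit N x - 2 * 1 = 0" for x
    using smooth_step_symmetric[of "N * cos x"] by (simp add: digit_def)
  ultimately have "C1 (\<lambda>x. F (x + pi) + F x - 2 * x) (\<lambda>x. 0)" by simp
  from C1_zero_const[OF this, of 0 "-pi"] have p: "F (0 + pi) - F (0 - pi) = 2 * pi * 1" by simp
  show ?thesis by (rule oscillating_periodic[OF F _ p]) (simp add: digit_def)
qed

lemma oscillating_plateau:
  assumes r: "C1 r d" and per: "\<And>x. r (x + 2 * pi) = r x" and nonneg: "\<And>x. 0 \<le> r x"
    and one: "\<And>x. \<bar>x - z\<bar> \<le> pi * t \<Longrightarrow> r x = 1" and t: "0 \<le> t" "t \<le> 1"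
  shows "\<exists>p\<ge>t. oscillating (\<lambda>x. r x - p)"
proof -
  obtain F where F: "C1 F r" using ex_antiderivative C1_cont[OF r] by blast
  have pt: "0 \<le> pi * t" "pi * t \<le> pi" using t by auto
  have "C1 (\<lambda>x. F x - x) (\<lambda>x. r x - 1)" by (intro C1_diff F C1_ident)
  then have "F (z - pi * t) - (z - pi * t) \<le> F (z + pi * t) - (z + pi * t)"
    by (rule C1_mono) (use one pt in \<open>auto simp: abs_le_iff\<close>)
  moreover have "F (z - pi) \<le> F (z - pi * t)" "F (z + pi * t) \<le> F (z + pi)"
    by (rule C1_mono[OF F nonneg], use pt in simp)+
  ultimately have "2 * pi * t \<le> F (z + pi) - F (z - pi)" by simp
  then have "t \<le> (F (z + pi) - F (z - pi)) / (2 * pi)" by (simp add: field_simps)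
  moreover have "oscillating (\<lambda>x. r x - (F (z + pi) - F (z - pi)) / (2 * pi))"
    by (rule oscillating_periodic[OF F per, of z]) simp
  ultimately show ?thesis by blast
qed

text \<open>
  With \<open>N = 3 / cos (\<pi> t)\<close> the cutoff \<open>on_digit N\<close> equals 1 at distance at most \<open>\<pi> t\<close> from 0, and
  \<open>off_digit N\<close> at distance at most \<open>\<pi> t\<close> from \<open>\<pi>\<close>, that is, on the fraction \<open>t\<close> of the period.
\<close>

lemma ex_digit_frequency:
  assumes "0 < t" "t < 1 / 2"
  shows "\<exists>N. (\<exists>p\<ge>t. oscillating (\<lambda>x. on_digit N x - p)) \<and> (\<exists>p\<ge>t. oscillating (\<lambda>x. off_digit N x - p))"
proof -
  have "0 < pi * t" "pi * t < pi * (1 / 2)" using assms by (auto intro: mult_strict_left_mono simp del: times_divide_eq_right)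
  then have c: "cos (pi * t) > 0"
    by (intro cos_gt_zero_pi) (use pi_gt_zero in linarith)+
  define N where "N = 3 / cos (pi * t)"
  have N0: "N > 0" using c by (simp add: N_def)
  have cosge: "N * cos x \<ge> 3" if "\<bar>x\<bar> \<le> pi * t" for x
  proof -
    have "cos (pi * t) \<le> cos \<bar>x\<bar>"
      using that assms by (intro cos_monotone_0_pi_le) auto
    then have "cos (pi * t) \<le> cos x" by simp
    then have "N * cos (pi * t) \<le> N * cos x" using N0 by (intro mult_left_mono) auto
    then show ?thesis using c by (simp add: N_def)
  qed
  obtain d1 d2 where d: "C1 (on_digit N) d1" "C1 (off_digit N) d2" using C1_digits by blast
  have "\<exists>p\<ge>t. oscillating (\<lambda>x. on_digit N x - p)"
  proof (rule oscillating_plateau[OF d(1), of 0])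
    show "on_digit N x = 1" if "\<bar>x - 0\<bar> \<le> pi * t" for x
      using cosge[of x] that by (auto simp: on_digit_def intro!: smooth_step_cases)
  qed (use assms in \<open>auto simp: on_digit_def smooth_step_bounds\<close>)
  moreover have "\<exists>p\<ge>t. oscillating (\<lambda>x. off_digit N x - p)"
  proof (rule oscillating_plateau[OF d(2), of pi])
    show "off_digit N x = 1" if "\<bar>x - pi\<bar> \<le> pi * t" for x
      using cosge[of "x - pi"] that by (auto simp: off_digit_def intro!: smooth_step_cases)
  qed (use assms in \<open>auto simp: off_digit_def smooth_step_bounds\<close>)
  ultimately show ?thesis by blast
qed

text \<open>
  Integration by parts moves the derivative from the bounded primitive of \<open>r\<close> at frequency \<open>l\<close>,
  which is of size \<open>1/l\<close>, to \<open>f\<close>.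
\<close>

lemma fast_oscillation:
  assumes f: "C1 f f'" and r: "oscillating r" and "\<kappa> > 0" "R > 0"
  shows "\<exists>l0. \<forall>l\<ge>l0. \<exists>G. C1 G (\<lambda>x. f x * r (l * x)) \<and> G (- R) = 0 \<and> (\<forall>x\<in>{-R..R}. \<bar>G x\<bar> \<le> \<kappa>)"
proof -
  obtain F C where F: "C1 F r" "\<And>x. \<bar>F x\<bar> \<le> C" using r by (auto simp: oscillating_def)
  obtain B where B: "B \<ge> 0" "\<And>x. x \<in> {-R..R} \<Longrightarrow> \<bar>f x\<bar> \<le> B" "\<And>x. x \<in> {-R..R} \<Longrightarrow> \<bar>f' x\<bar> \<le> B"
    using C1_bounded[OF f] by metis
  have C0: "C \<ge> 0" using F(2)[of 0] by linarith
  define l0 where "l0 = (B * C * (2 * R + 2) + 1) / \<kappa>"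
  have l0: "l0 > 0" unfolding l0_def using B C0 assms by (intro divide_pos_pos add_nonneg_pos) auto
  have "\<exists>G. C1 G (\<lambda>x. f x * r (l * x)) \<and> G (- R) = 0 \<and> (\<forall>x\<in>{-R..R}. \<bar>G x\<bar> \<le> \<kappa>)" if l: "l \<ge> l0" for l
  proof -
    have lpos: "l > 0" using l l0 by simp
    have Fl: "C1 (\<lambda>x. (1 / l) * F (l * x + 0)) (\<lambda>x. (1 / l) * (l * r (l * x + 0)))"
      by (intro C1_cmult C1_compose_affine F)
    then have Fl: "C1 (\<lambda>x. F (l * x) / l) (\<lambda>x. r (l * x))" using lpos by simp
    note fF = C1_mult[OF f Fl]
    have cont: "continuous_on UNIV (\<lambda>x. f x * r (l * x))"
      by (intro continuous_on_mult C1_cont[OF f] C1_cont'[OF Fl])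
    obtain G where G: "C1 G (\<lambda>x. f x * r (l * x))" "G (- R) = 0" using ex_antiderivative[OF cont] by blast
    have W: "C1 (\<lambda>x. G x - f x * (F (l * x) / l)) (\<lambda>x. f x * r (l * x) - (f' x * (F (l * x) / l) + r (l * x) * f x))"
      by (rule C1_diff[OF G(1) fF])
    have FB: "\<bar>F y / l\<bar> \<le> C / l" for y using F(2)[of y] lpos by (simp add: divide_right_mono)
    have "\<bar>G x\<bar> \<le> \<kappa>" if x: "x \<in> {-R..R}" for x
    proof -
      have "\<bar>(G x - f x * (F (l * x) / l)) - (G (- R) - f (- R) * (F (l * (- R)) / l))\<bar> \<le> (B * (C / l)) * (x - (- R))"
      proof (rule C1_increment_bound[OF W])
        fix y assume "y \<in> {-R..x}"
        then have "\<bar>f' y\<bar> * \<bar>F (l * y) / l\<bar> \<le> B * (C / l)"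
          using x by (intro mult_mono B FB) (use B in auto)
        then show "\<bar>f y * r (l * y) - (f' y * (F (l * y) / l) + r (l * y) * f y)\<bar> \<le> B * (C / l)"
          by (simp add: abs_mult algebra_simps)
      qed (use x in auto)
      moreover have "(B * (C / l)) * (x - (- R)) \<le> (B * (C / l)) * (2 * R)"
        using x B C0 lpos by (intro mult_left_mono) auto
      moreover have "\<bar>f x * (F (l * x) / l)\<bar> \<le> B * (C / l)"
        unfolding abs_mult using x B(1) by (intro mult_mono B(2) FB) auto
      moreover have "\<bar>f (- R) * (F (l * (- R)) / l)\<bar> \<le> B * (C / l)"
        unfolding abs_mult using assms B(1) by (intro mult_mono B(2) FB) auto
      ultimately have "\<bar>G x\<bar> \<le> (B * (C / l)) * (2 * R) + B * (C / l) + B * (C / l)" using G(2) by linarith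
      also have "\<dots> = (B * (C / l)) * (2 * R + 2)" by (simp only: distrib_left mult_1_right) simp
      also have "\<dots> = (B * C * (2 * R + 2)) / l" by simp
      also have "\<dots> \<le> \<kappa>"
      proof -
        have "B * C * (2 * R + 2) \<le> \<kappa> * l0" using assms by (simp add: l0_def)
        also have "\<dots> \<le> \<kappa> * l" using l assms by (intro mult_left_mono) auto
        finally show ?thesis using lpos by (simp add: pos_divide_le_eq)
      qed
      finally show ?thesis .
    qed
    then show ?thesis using G by blast
  qed
  then show ?thesis by blast
qed

section \<open>Lacunary products\<close>

definition mass :: "real \<Rightarrow> real \<Rightarrow> (real \<Rightarrow> real) \<Rightarrow> real" where
  "mass a b P = (\<integral>x. indicator {a..b} x * P x \<partial>lborel)"

lemma mass_C1: "a \<le> b \<Longrightarrow> C1 F P \<Longrightarrow> mass a b P = F b - F a"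
  unfolding mass_def by (rule integral_derivative_interval) (auto simp: C1_def)

text \<open>
  One frequency \<open>l\<close> serves three purposes: the primitive of the increment \<open>f * (r (l x) - 1)\<close> is
  small, and the two cutoffs retain their means when multiplied by \<open>Q\<close>.
\<close>

lemma oscillation_step:
  assumes f: "C1 f f'" and Q: "C1 Q Q'"
    and pos: "mass a b Q > 0" and ab: "{a..b} \<subseteq> {-R..R}" "a \<le> b" and R: "R > 0" and k: "\<kappa> > 0"
    and r: "oscillating (\<lambda>x. r x - 1)"
    and on: "oscillating (\<lambda>x. on x - p)" "t < p" and off: "oscillating (\<lambda>x. off x - q)" "t < q"
  shows "\<exists>l. (\<exists>G. C1 G (\<lambda>x. f x * r (l * x) - f x) \<and> G (- R) = 0 \<and> (\<forall>x\<in>{-R..R}. \<bar>G x\<bar> \<le> \<kappa>)) \<and>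
     mass a b (\<lambda>x. Q x * on (l * x)) \<ge> t * mass a b Q \<and> mass a b (\<lambda>x. Q x * off (l * x)) \<ge> t * mass a b Q"
proof -
  define d1 d2 where "d1 = (p - t) * mass a b Q / 2" and "d2 = (q - t) * mass a b Q / 2"
  have d: "d1 > 0" "d2 > 0" using pos on(2) off(2) by (auto simp: d1_def d2_def)
  obtain l0 where l0: "\<And>l. l \<ge> l0 \<Longrightarrow> \<exists>G. C1 G (\<lambda>x. f x * (r (l * x) - 1)) \<and> G (- R) = 0 \<and> (\<forall>x\<in>{-R..R}. \<bar>G x\<bar> \<le> \<kappa>)"
    using fast_oscillation[OF f r k R] by blast
  obtain l1 where l1: "\<And>l. l \<ge> l1 \<Longrightarrow> \<exists>G. C1 G (\<lambda>x. Q x * (on (l * x) - p)) \<and> G (- R) = 0 \<and> (\<forall>x\<in>{-R..R}. \<bar>G x\<bar> \<le> d1)"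
    using fast_oscillation[OF Q on(1) d(1) R] by blast
  obtain l2 where l2: "\<And>l. l \<ge> l2 \<Longrightarrow> \<exists>G. C1 G (\<lambda>x. Q x * (off (l * x) - q)) \<and> G (- R) = 0 \<and> (\<forall>x\<in>{-R..R}. \<bar>G x\<bar> \<le> d2)"
    using fast_oscillation[OF Q off(1) d(2) R] by blast
  define l where "l = max l0 (max l1 l2)"
  obtain QQ where QQ: "C1 QQ Q" using ex_antiderivative C1_cont[OF Q] by blast
  have mQ: "mass a b Q = QQ b - QQ a" by (rule mass_C1[OF ab(2) QQ])
  have *: "mass a b (\<lambda>x. Q x * w (l * x)) \<ge> t * mass a b Q"
    if G: "C1 G (\<lambda>x. Q x * (w (l * x) - p'))" "\<And>x. x \<in> {-R..R} \<Longrightarrow> \<bar>G x\<bar> \<le> (p' - t) * mass a b Q / 2" for G w p'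
  proof -
    have "C1 (\<lambda>x. p' * QQ x + G x) (\<lambda>x. p' * Q x + Q x * (w (l * x) - p'))"
      by (intro C1_add C1_cmult QQ G)
    then have "C1 (\<lambda>x. p' * QQ x + G x) (\<lambda>x. Q x * w (l * x))" by (simp add: algebra_simps)
    from mass_C1[OF ab(2) this] have "mass a b (\<lambda>x. Q x * w (l * x)) = p' * mass a b Q + (G b - G a)"
      by (simp add: mQ algebra_simps)
    moreover have "\<bar>G a\<bar> \<le> (p' - t) * mass a b Q / 2" "\<bar>G b\<bar> \<le> (p' - t) * mass a b Q / 2"
      using ab G(2)[of a] G(2)[of b] by auto
    ultimately show ?thesis by (simp add: algebra_simps)
  qed
  show ?thesis
  proof (intro exI[of _ l] conjI)
    show "\<exists>G. C1 G (\<lambda>x. f x * r (l * x) - f x) \<and> G (- R) = 0 \<and> (\<forall>x\<in>{-R..R}. \<bar>G x\<bar> \<le> \<kappa>)"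
      using l0[of l] by (simp add: l_def algebra_simps)
    show "mass a b (\<lambda>x. Q x * on (l * x)) \<ge> t * mass a b Q"
    proof -
      have "l \<ge> l1" by (simp add: l_def)
      from l1[OF this] obtain G where G: "C1 G (\<lambda>x. Q x * (on (l * x) - p))" "\<forall>x\<in>{-R..R}. \<bar>G x\<bar> \<le> d1" by blast
      show ?thesis by (rule *[OF G(1)]) (use G(2) in \<open>simp add: d1_def\<close>)
    qed
    show "mass a b (\<lambda>x. Q x * off (l * x)) \<ge> t * mass a b Q"
    proof -
      have "l \<ge> l2" by (simp add: l_def)
      from l2[OF this] obtain G where G: "C1 G (\<lambda>x. Q x * (off (l * x) - q))" "\<forall>x\<in>{-R..R}. \<bar>G x\<bar> \<le> d2" by blast
      show ?thesis by (rule *[OF G(1)]) (use G(2) in \<open>simp add: d2_def\<close>)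
    qed
  qed
qed

text \<open>
  The cutoff \<open>Q\<close> lives where the product \<open>f\<close> has doubled \<open>n\<close> times. Multiplication with a new
  digit divides it into \<open>Q1\<close>, where the product doubles again, and \<open>Z\<close>, where it becomes zero;
  each of them keeps the fraction \<open>t\<close> of the mass. The function \<open>g\<close> is the current product in the
  other variable. It is given before the frequency is chosen, so the increment can be made to
  oscillate fast compared with the size of \<open>g\<close> and of its derivative.
\<close>

lemma lacunary_step:
  assumes f: "C1 f f'" "\<And>x. 0 \<le> f x" and Q: "\<exists>Q'. C1 Q Q'" "\<And>x. 0 \<le> Q x \<and> Q x \<le> 1"
    and fQ: "\<And>x. Q x > 0 \<Longrightarrow> f x = 2 ^ n" and m: "mass a b Q \<ge> t ^ n * (b - a)"
    and ab: "{a..b} \<subseteq> {-R..R}" "a < b" and R: "R > 0" and t: "0 < t" "t < 1 / 2"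
    and g: "C1 g g'" and e: "e > 0"
  obtains F F' Q1 Z G where "C1 F F'" "\<And>x. 0 \<le> F x" "\<exists>Q'. C1 Q1 Q'" "\<And>x. 0 \<le> Q1 x \<and> Q1 x \<le> 1"
    "\<And>x. Q1 x > 0 \<Longrightarrow> F x = 2 ^ Suc n" "mass a b Q1 \<ge> t ^ Suc n * (b - a)"
    "continuous_on UNIV Z" "\<And>x. 0 \<le> Z x \<and> Z x \<le> 1" "mass a b Z \<ge> t ^ Suc n * (b - a)"
    "\<And>x. Z x > 0 \<Longrightarrow> Q x > 0 \<and> F x = 0" "\<And>x. Q1 x > 0 \<Longrightarrow> Q x > 0" "\<And>x. f x = 0 \<Longrightarrow> F x = 0"
    "C1 G (\<lambda>x. F x - f x)" "G (- R) = 0"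
    "\<And>x. x \<in> {-R..R} \<Longrightarrow> \<bar>G x\<bar> \<le> e"
    "\<And>x y. x \<in> {-R..R} \<Longrightarrow> y \<in> {-R..R} \<Longrightarrow> \<bar>g y * G x\<bar> \<le> e \<and> \<bar>g' y * G x\<bar> \<le> e"
proof -
  obtain B where B: "B \<ge> 0" "\<And>x. x \<in> {-R..R} \<Longrightarrow> \<bar>g x\<bar> \<le> B" "\<And>x. x \<in> {-R..R} \<Longrightarrow> \<bar>g' x\<bar> \<le> B"
    using C1_bounded[OF g] by metis
  define k where "k = e / (1 + B)"
  have k: "k > 0" using e B(1) by (simp add: k_def)
  have ke: "k \<le> e" "B * k \<le> e" using e B(1) by (auto simp: k_def field_simps)
  obtain s where s: "t < s" "s < 1 / 2" using t dense by blast
  obtain N p q where N: "p \<ge> s" "oscillating (\<lambda>x. on_digit N x - p)" "q \<ge> s" "oscillating (\<lambda>x. off_digit N x - q)"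
    using ex_digit_frequency[of s] s t by auto
  have tn: "t ^ n * (b - a) > 0" using t ab by simp
  obtain Q' where Q': "C1 Q Q'" using Q by blast
  obtain l G where G: "C1 G (\<lambda>x. f x * digit N (l * x) - f x)" "G (- R) = 0" "\<forall>x\<in>{-R..R}. \<bar>G x\<bar> \<le> k"
    and mon: "mass a b (\<lambda>x. Q x * on_digit N (l * x)) \<ge> t * mass a b Q"
    and moff: "mass a b (\<lambda>x. Q x * off_digit N (l * x)) \<ge> t * mass a b Q"
  proof -
    have "mass a b Q > 0" "a \<le> b" "t < p" "t < q" using m tn ab(2) N s by auto
    from oscillation_step[OF f(1) Q' this(1) ab(1) this(2) R k oscillating_digit[of N] N(2) this(3) N(4) this(4)]
    show ?thesis by (elim exE conjE) (rule that)
  qed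
  have m': "t * mass a b Q \<ge> t ^ Suc n * (b - a)"
    using mult_left_mono[OF m, of t] t by simp
  have comp: "\<exists>d. C1 (\<lambda>x. h x * w (l * x)) d" if "C1 h h'" "\<exists>d. C1 w d" for h h' w
  proof -
    from that(2) obtain d where "C1 w d" by (elim exE)
    from C1_mult[OF that(1) C1_compose_affine[OF this, of l 0]] show ?thesis by auto
  qed
  obtain F' where F': "C1 (\<lambda>x. f x * digit N (l * x)) F'" using comp[OF f(1) C1_digits(1)] by blast
  obtain Z' where Z': "C1 (\<lambda>x. Q x * off_digit N (l * x)) Z'" using comp[OF Q' C1_digits(3)] by blast
  have u: "0 \<le> Q x * w \<and> Q x * w \<le> 1" if "0 \<le> w" "w \<le> 1" for x w
    using Q(2)[of x] that by (auto intro: mult_le_one)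
  have posD: "Q x > 0 \<and> w > 0" if "Q x * w > 0" "0 \<le> w" for x w
    using Q(2)[of x] that by (auto simp: zero_less_mult_iff)
  show ?thesis
  proof (rule that)
    show "C1 (\<lambda>x. f x * digit N (l * x)) F'" by (rule F')
    show "0 \<le> f x * digit N (l * x)" for x using f(2) digit_bounds by auto
    show "\<exists>d. C1 (\<lambda>x. Q x * on_digit N (l * x)) d"
      by (rule comp[OF Q' C1_digits(2)])
    show "0 \<le> Q x * on_digit N (l * x) \<and> Q x * on_digit N (l * x) \<le> 1"
      "0 \<le> Q x * off_digit N (l * x) \<and> Q x * off_digit N (l * x) \<le> 1" for x
      by (intro u digit_bounds)+
    show "f x * digit N (l * x) = 2 ^ Suc n" if "Q x * on_digit N (l * x) > 0" for x
      using posD[OF that digit_bounds(2)] on_digit_pos[of N "l * x"] fQ[of x] by simp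
    show "mass a b (\<lambda>x. Q x * on_digit N (l * x)) \<ge> t ^ Suc n * (b - a)" using mon m' by linarith
    show "continuous_on UNIV (\<lambda>x. Q x * off_digit N (l * x))" by (rule C1_cont[OF Z'])
    show "mass a b (\<lambda>x. Q x * off_digit N (l * x)) \<ge> t ^ Suc n * (b - a)" using moff m' by linarith
    show "Q x > 0 \<and> f x * digit N (l * x) = 0" if "Q x * off_digit N (l * x) > 0" for x
      using posD[OF that digit_bounds(4)] off_digit_pos[of N "l * x"] by simp
    show "Q x > 0" if "Q x * on_digit N (l * x) > 0" for x
      using posD[OF that digit_bounds(2)] by simp
    show "f x * digit N (l * x) = 0" if "f x = 0" for x using that by simp
    show "C1 G (\<lambda>x. f x * digit N (l * x) - f x)" "G (- R) = 0" by (fact G)+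
    show "\<bar>G x\<bar> \<le> e" if "x \<in> {-R..R}" for x using G(3) ke that by fastforce
    show "\<bar>g y * G x\<bar> \<le> e \<and> \<bar>g' y * G x\<bar> \<le> e" if xy: "x \<in> {-R..R}" "y \<in> {-R..R}" for x y
    proof -
      have "\<bar>g y\<bar> * \<bar>G x\<bar> \<le> B * k" "\<bar>g' y\<bar> * \<bar>G x\<bar> \<le> B * k"
        using B(2,3)[OF xy(2)] G(3) xy(1) B(1) by (auto intro!: mult_mono)
      then show ?thesis using ke(2) by (auto simp: abs_mult)
    qed
  qed
qed

text \<open>
  A stage of the construction of \<open>lacunary_products\<close>: the two products \<open>A\<close> and \<open>B\<close>, each followed
  by its derivative, the cutoffs \<open>P\<close> and \<open>Q\<close> that live where they have always doubled, and the
  cutoff \<open>Z\<close> that lives where \<open>B\<close> has just become zero.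
\<close>

type_synonym lacunary_state = "(real \<Rightarrow> real) \<times> (real \<Rightarrow> real) \<times> (real \<Rightarrow> real) \<times> (real \<Rightarrow> real) \<times>
  (real \<Rightarrow> real) \<times> (real \<Rightarrow> real) \<times> (real \<Rightarrow> real)"

text \<open>
  The products are extended alternately: \<open>A (Suc n)\<close> is chosen once \<open>B n\<close> is known, and
  \<open>B (Suc n)\<close> once \<open>A (Suc n)\<close> is known. So the primitives \<open>GA n\<close> and \<open>GB n\<close> of the increments are
  small even after multiplication by the product in the other variable that goes with them in the
  summation by parts. The index of \<open>Z\<close> is shifted: \<open>Z (Suc n)\<close> lives where \<open>B\<close> has doubled \<open>n\<close>
  times and is zero from then on.
\<close>

lemma lacunary_products:
  fixes R a1 b1 a2 b2 t e :: real
  assumes R: "R > 0" and ab1: "{a1..b1} \<subseteq> {-R..R}" "a1 < b1" and ab2: "{a2..b2} \<subseteq> {-R..R}" "a2 < b2"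
    and t: "0 < t" "t < 1 / 2" and e: "e > 0"
  obtains A A' B B' GA GB P Z :: "nat \<Rightarrow> real \<Rightarrow> real" where
    "\<And>n. C1 (A n) (A' n)" "\<And>n. C1 (B n) (B' n)" "A 0 = (\<lambda>_. 1)" "B 0 = (\<lambda>_. 1)"
    "\<And>n x. 0 \<le> A n x" "\<And>n x. 0 \<le> B n x"
    "\<And>n. C1 (GA n) (\<lambda>x. A (Suc n) x - A n x)" "\<And>n. GA n (- R) = 0"
    "\<And>n. C1 (GB n) (\<lambda>x. B (Suc n) x - B n x)" "\<And>n. GB n (- R) = 0"
    "\<And>n x y. x \<in> {-R..R} \<Longrightarrow> y \<in> {-R..R} \<Longrightarrow> \<bar>GA n x\<bar> \<le> e / 2 ^ n \<and> \<bar>B n y * GA n x\<bar> \<le> e / 2 ^ n \<and> \<bar>B' n y * GA n x\<bar> \<le> e / 2 ^ n"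
    "\<And>n x y. x \<in> {-R..R} \<Longrightarrow> y \<in> {-R..R} \<Longrightarrow> \<bar>GB n x\<bar> \<le> e / 2 ^ n \<and> \<bar>A (Suc n) y * GB n x\<bar> \<le> e / 2 ^ n \<and> \<bar>A' (Suc n) y * GB n x\<bar> \<le> e / 2 ^ n"
    "\<And>n. continuous_on UNIV (P n)" "\<And>n. continuous_on UNIV (Z n)"
    "\<And>n x. 0 \<le> P n x \<and> P n x \<le> 1" "\<And>n x. 0 \<le> Z n x \<and> Z n x \<le> 1"
    "\<And>n k x. P n x > 0 \<Longrightarrow> k \<le> n \<Longrightarrow> A k x = 2 ^ k"
    "\<And>n k x. Z (Suc n) x > 0 \<Longrightarrow> k \<le> n \<Longrightarrow> B k x = 2 ^ k"
    "\<And>n k x. Z (Suc n) x > 0 \<Longrightarrow> n < k \<Longrightarrow> B k x = 0"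
    "\<And>n. mass a2 b2 (P n) \<ge> t ^ n * (b2 - a2)" "\<And>n. mass a1 b1 (Z (Suc n)) \<ge> t ^ Suc n * (b1 - a1)"
proof -
  \<comment> \<open>\<open>Inv n\<close> describes stage \<open>n\<close> by itself, \<open>Rel n\<close> relates it to the next stage\<close>
  define Inv :: "nat \<Rightarrow> lacunary_state \<Rightarrow> bool" where "Inv n = (\<lambda>(A, A', B, B', P, Q, Z). C1 A A' \<and> C1 B B' \<and> (\<forall>x. 0 \<le> A x) \<and> (\<forall>x. 0 \<le> B x) \<and>
     (\<exists>d. C1 P d) \<and> (\<exists>d. C1 Q d) \<and> (\<forall>x. 0 \<le> P x \<and> P x \<le> 1) \<and> (\<forall>x. 0 \<le> Q x \<and> Q x \<le> 1) \<and>
     (\<forall>x. P x > 0 \<longrightarrow> A x = 2 ^ n) \<and> (\<forall>x. Q x > 0 \<longrightarrow> B x = 2 ^ n) \<and>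
     mass a2 b2 P \<ge> t ^ n * (b2 - a2) \<and> mass a1 b1 Q \<ge> t ^ n * (b1 - a1) \<and>
     continuous_on UNIV Z \<and> (\<forall>x. 0 \<le> Z x \<and> Z x \<le> 1) \<and>
     (n = 0 \<longrightarrow> A = (\<lambda>_. 1) \<and> B = (\<lambda>_. 1)))" for n
  define Rel :: "nat \<Rightarrow> lacunary_state \<Rightarrow> lacunary_state \<Rightarrow> bool" where "Rel n = (\<lambda>(A, A', B, B', P, Q, Z) (A1, A1', B1, B1', P1, Q1, Z1). \<exists>GA GB.
     C1 GA (\<lambda>x. A1 x - A x) \<and> GA (- R) = 0 \<and> C1 GB (\<lambda>x. B1 x - B x) \<and> GB (- R) = 0 \<and>
     (\<forall>x\<in>{-R..R}. \<bar>GA x\<bar> \<le> e / 2 ^ n) \<and> (\<forall>x\<in>{-R..R}. \<forall>y\<in>{-R..R}. \<bar>B y * GA x\<bar> \<le> e / 2 ^ n \<and> \<bar>B' y * GA x\<bar> \<le> e / 2 ^ n) \<and>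
     (\<forall>x\<in>{-R..R}. \<bar>GB x\<bar> \<le> e / 2 ^ n) \<and> (\<forall>x\<in>{-R..R}. \<forall>y\<in>{-R..R}. \<bar>A1 y * GB x\<bar> \<le> e / 2 ^ n \<and> \<bar>A1' y * GB x\<bar> \<le> e / 2 ^ n) \<and>
     (\<forall>x. P1 x > 0 \<longrightarrow> P x > 0) \<and> (\<forall>x. Q1 x > 0 \<longrightarrow> Q x > 0) \<and> (\<forall>x. Z1 x > 0 \<longrightarrow> Q x > 0 \<and> B1 x = 0) \<and>
     (\<forall>x. B x = 0 \<longrightarrow> B1 x = 0) \<and> mass a1 b1 Z1 \<ge> t ^ Suc n * (b1 - a1))"
    for n
  have "\<exists>s. \<forall>n. Inv n (s n) \<and> Rel n (s n) (s (Suc n))"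
  proof (rule dependent_nat_choice)
    have "mass a1 b1 (\<lambda>_. 1) = b1 - a1" "mass a2 b2 (\<lambda>_. 1) = b2 - a2"
      using ab1 ab2 mass_C1[OF _ C1_ident] by auto
    then have "Inv 0 (\<lambda>_. 1, \<lambda>_. 0, \<lambda>_. 1, \<lambda>_. 0, \<lambda>_. 1, \<lambda>_. 1, \<lambda>_. 0)"
      unfolding Inv_def using C1_const by auto
    then show "\<exists>s. Inv 0 s" by blast
  next
    fix s n assume "Inv n s"
    moreover obtain A A' B B' P Q Z where s: "s = (A, A', B, B', P, Q, Z)" by (metis prod.exhaust)
    ultimately have I: "C1 A A'" "C1 B B'" "\<And>x. 0 \<le> A x" "\<And>x. 0 \<le> B x" "\<exists>d. C1 P d" "\<exists>d. C1 Q d"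
      "\<And>x. 0 \<le> P x \<and> P x \<le> 1" "\<And>x. 0 \<le> Q x \<and> Q x \<le> 1"
      "\<And>x. P x > 0 \<Longrightarrow> A x = 2 ^ n" "\<And>x. Q x > 0 \<Longrightarrow> B x = 2 ^ n"
      "mass a2 b2 P \<ge> t ^ n * (b2 - a2)" "mass a1 b1 Q \<ge> t ^ n * (b1 - a1)"
      unfolding Inv_def by auto
    have en: "e / 2 ^ n > 0" using e by simp
    obtain A1 A1' P1 Z0 GA where 1: "C1 A1 A1'" "\<And>x. 0 \<le> A1 x" "\<exists>d. C1 P1 d" "\<And>x. 0 \<le> P1 x \<and> P1 x \<le> 1"
      "\<And>x. P1 x > 0 \<Longrightarrow> A1 x = 2 ^ Suc n" "mass a2 b2 P1 \<ge> t ^ Suc n * (b2 - a2)"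
      "continuous_on UNIV Z0" "\<And>x. 0 \<le> Z0 x \<and> Z0 x \<le> 1" "mass a2 b2 Z0 \<ge> t ^ Suc n * (b2 - a2)"
      "\<And>x. Z0 x > 0 \<Longrightarrow> P x > 0 \<and> A1 x = 0" "\<And>x. P1 x > 0 \<Longrightarrow> P x > 0" "\<And>x. A x = 0 \<Longrightarrow> A1 x = 0"
      "C1 GA (\<lambda>x. A1 x - A x)" "GA (- R) = 0" "\<And>x. x \<in> {-R..R} \<Longrightarrow> \<bar>GA x\<bar> \<le> e / 2 ^ n"
      "\<And>x y. x \<in> {-R..R} \<Longrightarrow> y \<in> {-R..R} \<Longrightarrow> \<bar>B y * GA x\<bar> \<le> e / 2 ^ n \<and> \<bar>B' y * GA x\<bar> \<le> e / 2 ^ n"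
      by (rule lacunary_step[OF I(1,3,5,7,9,11) ab2 R t I(2) en], assumption) (rule that; assumption)
    obtain B1 B1' Q1 Z1 GB where 2: "C1 B1 B1'" "\<And>x. 0 \<le> B1 x" "\<exists>d. C1 Q1 d" "\<And>x. 0 \<le> Q1 x \<and> Q1 x \<le> 1"
      "\<And>x. Q1 x > 0 \<Longrightarrow> B1 x = 2 ^ Suc n" "mass a1 b1 Q1 \<ge> t ^ Suc n * (b1 - a1)"
      "continuous_on UNIV Z1" "\<And>x. 0 \<le> Z1 x \<and> Z1 x \<le> 1" "mass a1 b1 Z1 \<ge> t ^ Suc n * (b1 - a1)"
      "\<And>x. Z1 x > 0 \<Longrightarrow> Q x > 0 \<and> B1 x = 0" "\<And>x. Q1 x > 0 \<Longrightarrow> Q x > 0" "\<And>x. B x = 0 \<Longrightarrow> B1 x = 0"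
      "C1 GB (\<lambda>x. B1 x - B x)" "GB (- R) = 0" "\<And>x. x \<in> {-R..R} \<Longrightarrow> \<bar>GB x\<bar> \<le> e / 2 ^ n"
      "\<And>x y. x \<in> {-R..R} \<Longrightarrow> y \<in> {-R..R} \<Longrightarrow> \<bar>A1 y * GB x\<bar> \<le> e / 2 ^ n \<and> \<bar>A1' y * GB x\<bar> \<le> e / 2 ^ n"
      by (rule lacunary_step[OF I(2,4,6,8,10,12) ab1 R t 1(1) en], assumption) (rule that; assumption)
    have "Inv (Suc n) (A1, A1', B1, B1', P1, Q1, Z1)"
      unfolding Inv_def prod.case by (intro conjI allI impI 1(1-6) 2(1-8)) simp_all
    moreover have "Rel n s (A1, A1', B1, B1', P1, Q1, Z1)"
      unfolding Rel_def s prod.case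
      by (rule exI[of _ GA], rule exI[of _ GB], intro conjI allI ballI impI 1(13-15) 2(9,13-15))
         (use 1(11,16) 2(10,11,12,16) in auto)
    ultimately show "\<exists>s'. Inv (Suc n) s' \<and> Rel n s s'" by blast
  qed
  then obtain s where s: "\<And>n. Inv n (s n)" "\<And>n. Rel n (s n) (s (Suc n))" by blast
  define A where "A n = fst (s n)" for n
  define A' where "A' n = fst (snd (s n))" for n
  define B where "B n = fst (snd (snd (s n)))" for n
  define B' where "B' n = fst (snd (snd (snd (s n))))" for n
  define P where "P n = fst (snd (snd (snd (snd (s n)))))" for n
  define Q where "Q n = fst (snd (snd (snd (snd (snd (s n))))))" for n
  define Z where "Z n = snd (snd (snd (snd (snd (snd (s n))))))" for n
  have sn: "s n = (A n, A' n, B n, B' n, P n, Q n, Z n)" for n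
    by (simp add: A_def A'_def B_def B'_def P_def Q_def Z_def)
  note I = s(1)[unfolded sn Inv_def prod.case]
  note RR = s(2)[unfolded sn Rel_def prod.case]
  define X where "X n g h \<longleftrightarrow> C1 g (\<lambda>x. A (Suc n) x - A n x) \<and> g (- R) = 0 \<and> C1 h (\<lambda>x. B (Suc n) x - B n x) \<and> h (- R) = 0 \<and>
     (\<forall>x\<in>{-R..R}. \<bar>g x\<bar> \<le> e / 2 ^ n) \<and> (\<forall>x\<in>{-R..R}. \<forall>y\<in>{-R..R}. \<bar>B n y * g x\<bar> \<le> e / 2 ^ n \<and> \<bar>B' n y * g x\<bar> \<le> e / 2 ^ n) \<and>
     (\<forall>x\<in>{-R..R}. \<bar>h x\<bar> \<le> e / 2 ^ n) \<and> (\<forall>x\<in>{-R..R}. \<forall>y\<in>{-R..R}. \<bar>A (Suc n) y * h x\<bar> \<le> e / 2 ^ n \<and> \<bar>A' (Suc n) y * h x\<bar> \<le> e / 2 ^ n) \<and>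
     (\<forall>x. P (Suc n) x > 0 \<longrightarrow> P n x > 0) \<and> (\<forall>x. Q (Suc n) x > 0 \<longrightarrow> Q n x > 0) \<and> (\<forall>x. Z (Suc n) x > 0 \<longrightarrow> Q n x > 0 \<and> B (Suc n) x = 0) \<and>
     (\<forall>x. B n x = 0 \<longrightarrow> B (Suc n) x = 0) \<and> mass a1 b1 (Z (Suc n)) \<ge> t ^ Suc n * (b1 - a1)" for n g h
  have "\<forall>n. \<exists>g h. X n g h" unfolding X_def by (rule allI, rule RR)
  then obtain GA where "\<forall>n. \<exists>h. X n (GA n) h" using choice[of "\<lambda>n g. \<exists>h. X n g h"] by blast
  then obtain GB where "\<forall>n. X n (GA n) (GB n)" using choice[of "\<lambda>n h. X n (GA n) h"] by blast
  then have G: "X n (GA n) (GB n)" for n by blast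
  note G = G[unfolded X_def]
  have Pmono: "P k x > 0" if "P n x > 0" "k \<le> n" for n k x
    using that(2,1) by (induction rule: inc_induct) (use G in blast)+
  have Qmono: "Q k x > 0" if "Q n x > 0" "k \<le> n" for n k x
    using that(2,1) by (induction rule: inc_induct) (use G in blast)+
  have Bzero: "B k x = 0" if "B n x = 0" "n \<le> k" for n k x
    using that(2,1) by (induction rule: dec_induct) (use G in blast)+
  show ?thesis
  proof (rule that[of A A' B B' GA GB P Z])
    show "A k x = 2 ^ k" if "P n x > 0" "k \<le> n" for n k x
      using I[of k] Pmono[OF that] by blast
    show "B k x = 2 ^ k" if "Z (Suc n) x > 0" "k \<le> n" for n k x
      using I[of k] Qmono[of n x k] G[of n] that by blast
    show "B k x = 0" if "Z (Suc n) x > 0" "n < k" for n k x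
      using Bzero[of "Suc n" x k] G[of n] that by auto
    show "A 0 = (\<lambda>_. 1)" "B 0 = (\<lambda>_. 1)" using I[of 0] by blast+
    show "C1 (A n) (A' n)" "C1 (B n) (B' n)" "0 \<le> A n x" "0 \<le> B n x" "continuous_on UNIV (Z n)"
      "0 \<le> P n x \<and> P n x \<le> 1" "0 \<le> Z n x \<and> Z n x \<le> 1" "mass a2 b2 (P n) \<ge> t ^ n * (b2 - a2)" for n x
      using I[of n] by blast+
    show "continuous_on UNIV (P n)" for n using I[of n] C1_cont by blast
  qed (use G in blast)+
qed

section \<open>Stability under a staircase, and a lower bound\<close>

text \<open>
  The staircase \<open>c\<close> is chosen last, when all other functions are fixed. It is only known to lie
  within \<open>\<epsilon>\<close> of the identity, so estimates of this and the following lemmas hold uniformly over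
  all such \<open>c\<close>, for all small \<open>\<epsilon>\<close>.
\<close>

lemma eventually_composition_near:
  fixes f :: "real \<Rightarrow> real"
  assumes f: "continuous_on UNIV f" and k: "\<kappa> > 0"
  shows "\<forall>\<^sub>F \<epsilon> in at_right 0. \<forall>c. (\<forall>x. \<bar>c x - x\<bar> \<le> \<epsilon>) \<longrightarrow> (\<forall>x\<in>{-R..R}. \<bar>f (c x) - f x\<bar> \<le> \<kappa>)"
proof -
  have "uniformly_continuous_on {-R-1..R+1} f"
    by (intro compact_uniformly_continuous continuous_on_subset[OF f]) auto
  then obtain d where d: "d > 0" "\<And>x y. x \<in> {-R-1..R+1} \<Longrightarrow> y \<in> {-R-1..R+1} \<Longrightarrow> dist y x < d \<Longrightarrow> dist (f y) (f x) < \<kappa>"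
    using k unfolding uniformly_continuous_on_def by metis
  have "\<forall>\<^sub>F \<epsilon> in at_right (0::real). \<epsilon> \<in> {0<..<min d 1}"
    by (rule eventually_at_right_real) (use d in auto)
  then show ?thesis
  proof (rule eventually_mono, intro allI impI ballI)
    fix \<epsilon> c x assume *: "\<epsilon> \<in> {0<..<min d 1}" "\<forall>x::real. \<bar>c x - x\<bar> \<le> \<epsilon>" "x \<in> {-R..R}"
    then have n: "\<bar>c x - x\<bar> \<le> \<epsilon>" by blast
    have "dist (f (c x)) (f x) < \<kappa>"
    proof (rule d(2))
      show "x \<in> {-R-1..R+1}" using *(3) by simp
      show "c x \<in> {-R-1..R+1}" using *(1,3) n by auto
      show "dist (c x) x < d" using *(1) n by (simp add: dist_real_def)
    qed
    then show "\<bar>f (c x) - f x\<bar> \<le> \<kappa>" by (simp add: dist_real_def)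
  qed
qed

lemma eventually_antiderivative_near:
  assumes F: "C1 F f" "F (- R) = 0" and k: "\<kappa> > 0" and R: "R > 0"
  shows "\<forall>\<^sub>F \<epsilon> in at_right 0. \<forall>c. (\<forall>x. \<bar>c x - x\<bar> \<le> \<epsilon>) \<longrightarrow> (\<forall>G. C1 G (\<lambda>t. f (c t)) \<longrightarrow> G (- R) = 0 \<longrightarrow>
     (\<forall>t\<in>{-R..R}. \<bar>G t\<bar> \<le> \<bar>F t\<bar> + \<kappa> \<and> \<bar>F (c t) - G t\<bar> \<le> \<kappa>))"
proof -
  define k' where "k' = \<kappa> / (4 * R + 2)"
  have k': "k' > 0" using k R by (simp add: k'_def)
  have kk: "k' * (2 * R) \<le> \<kappa> / 2"
    using k R by (simp add: k'_def field_simps)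
  have "\<forall>\<^sub>F \<epsilon> in at_right 0. \<forall>c. (\<forall>x. \<bar>c x - x\<bar> \<le> \<epsilon>) \<longrightarrow> (\<forall>x\<in>{-R..R}. \<bar>f (c x) - f x\<bar> \<le> k')"
    by (rule eventually_composition_near[OF C1_cont'[OF F(1)] k'])
  moreover have "\<forall>\<^sub>F \<epsilon> in at_right 0. \<forall>c. (\<forall>x. \<bar>c x - x\<bar> \<le> \<epsilon>) \<longrightarrow> (\<forall>x\<in>{-R..R}. \<bar>F (c x) - F x\<bar> \<le> \<kappa> / 2)"
    by (rule eventually_composition_near[OF C1_cont[OF F(1)]]) (use k in simp)
  ultimately show ?thesis
  proof (eventually_elim, intro allI impI ballI)
    fix \<epsilon> c G t
    assume 1: "\<forall>c. (\<forall>x. \<bar>c x - x\<bar> \<le> \<epsilon>) \<longrightarrow> (\<forall>x\<in>{-R..R}. \<bar>f (c x) - f x\<bar> \<le> k')"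
      and 2: "\<forall>c. (\<forall>x. \<bar>c x - x\<bar> \<le> \<epsilon>) \<longrightarrow> (\<forall>x\<in>{-R..R}. \<bar>F (c x) - F x\<bar> \<le> \<kappa> / 2)"
      and c: "\<forall>x. \<bar>c x - x\<bar> \<le> \<epsilon>" and G: "C1 G (\<lambda>t. f (c t))" "G (- R) = 0" and t: "t \<in> {-R..R}"
    have "\<bar>(G t - F t) - (G (- R) - F (- R))\<bar> \<le> k' * (t - (- R))"
      by (rule C1_increment_bound[OF C1_diff[OF G(1) F(1)]]) (use 1 c t in auto)
    also have "\<dots> \<le> k' * (2 * R)" using t k' by (intro mult_left_mono) auto
    also have "\<dots> \<le> \<kappa> / 2" by (rule kk)
    finally have 3: "\<bar>G t - F t\<bar> \<le> \<kappa> / 2" using G F by simp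
    have "\<bar>F (c t) - F t\<bar> \<le> \<kappa> / 2" using 2 c t by blast
    then show "\<bar>G t\<bar> \<le> \<bar>F t\<bar> + \<kappa> \<and> \<bar>F (c t) - G t\<bar> \<le> \<kappa>" using 3 k by linarith
  qed
qed

lemma integrable_indicator_interval_mult:
  fixes f :: "real \<Rightarrow> real"
  assumes "continuous_on UNIV f"
  shows "integrable lborel (\<lambda>x. indicator {a..b} x * f x)"
  using borel_integrable_compact[of "{a..b}" f] continuous_on_subset[OF assms] by simp

lemma mass_near:
  assumes "continuous_on UNIV f" "continuous_on UNIV g" "\<And>x. x \<in> {a..b} \<Longrightarrow> \<bar>g x - f x\<bar> \<le> \<kappa>" "a \<le> b"
  shows "\<bar>mass a b g - mass a b f\<bar> \<le> \<kappa> * (b - a)"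
proof -
  note i = integrable_indicator_interval_mult[OF assms(1), of a b] integrable_indicator_interval_mult[OF assms(2), of a b]
  have "mass a b g - mass a b f = (\<integral>x. indicator {a..b} x * g x - indicator {a..b} x * f x \<partial>lborel)"
    unfolding mass_def using i by simp
  also have "\<bar>\<dots>\<bar> \<le> (\<integral>x. \<bar>indicator {a..b} x * g x - indicator {a..b} x * f x\<bar> \<partial>lborel)"
    using integral_norm_bound[of lborel "\<lambda>x. indicator {a..b} x * g x - indicator {a..b} x * f x"] by simp
  also have "\<dots> \<le> (\<integral>x. \<kappa> * indicator {a..b} x \<partial>lborel)"
  proof (rule integral_mono)
    show "integrable lborel (\<lambda>x. \<bar>indicator {a..b} x * g x - indicator {a..b} x * f x\<bar>)"
      using i by auto
    show "integrable lborel (\<lambda>x. \<kappa> * indicator {a..b} x)"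
      by (intro integrable_mult_right integrable_real_indicator) (use assms(4) in auto)
  qed (use assms(3) in \<open>auto simp: indicator_def\<close>)
  also have "\<dots> = \<kappa> * (b - a)" using assms(4) by simp
  finally show ?thesis .
qed

lemma eventually_mass_near:
  assumes "continuous_on UNIV f" "{a..b} \<subseteq> {-R..R}" "a < b" "\<kappa> > 0"
  shows "\<forall>\<^sub>F \<epsilon> in at_right 0. \<forall>c. (\<forall>x. \<bar>c x - x\<bar> \<le> \<epsilon>) \<longrightarrow> continuous_on UNIV c \<longrightarrow> \<bar>mass a b (\<lambda>x. f (c x)) - mass a b f\<bar> \<le> \<kappa>"
proof -
  have k: "\<kappa> / (b - a) > 0" using assms by simp
  show ?thesis
  proof (rule eventually_mono[OF eventually_composition_near[OF assms(1) k, of R]], intro allI impI)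
    fix \<epsilon> c assume 1: "\<forall>c. (\<forall>x. \<bar>c x - x\<bar> \<le> \<epsilon>) \<longrightarrow> (\<forall>x\<in>{-R..R}. \<bar>f (c x) - f x\<bar> \<le> \<kappa> / (b - a))"
      and c: "\<forall>x. \<bar>c x - x\<bar> \<le> \<epsilon>" "continuous_on UNIV c"
    have "\<bar>mass a b (\<lambda>x. f (c x)) - mass a b f\<bar> \<le> \<kappa> / (b - a) * (b - a)"
      by (rule mass_near[OF assms(1) continuous_on_compose2[OF assms(1) c(2)]]) (use 1 c assms in auto)
    then show "\<bar>mass a b (\<lambda>x. f (c x)) - mass a b f\<bar> \<le> \<kappa>" using assms by simp
  qed
qed

text \<open>
  At most one summand on the left is nonzero, as the value of \<open>m\<close> can be read off from the values
  \<open>B k x\<close>. For that \<open>m\<close> the sum on the right is \<open>2 * (4^m - 1) / 3 - 2 * 4^m\<close>: the terms before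
  \<open>m\<close> form a geometric series, the term \<open>m\<close> contains the drop of \<open>B\<close> to zero, and the later terms
  vanish. The drop dominates.
\<close>

lemma staircase_sum_lower_bound:
  fixes A B P Z :: "nat \<Rightarrow> real \<Rightarrow> real"
  assumes PA: "\<And>n k x. P n x > 0 \<Longrightarrow> k \<le> n \<Longrightarrow> A k x = 2 ^ k"
    and ZB: "\<And>n k x. Z (Suc n) x > 0 \<Longrightarrow> k \<le> n \<Longrightarrow> B k x = 2 ^ k"
    and ZB0: "\<And>n k x. Z (Suc n) x > 0 \<Longrightarrow> n < k \<Longrightarrow> B k x = 0"
    and P01: "\<And>n x. 0 \<le> P n x \<and> P n x \<le> 1" and Z01: "\<And>n x. 0 \<le> Z n x \<and> Z n x \<le> 1"
  shows "(\<Sum>m<M. 4 ^ Suc m / 3 * Z (Suc m) x * P (Suc m) y)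
    \<le> \<bar>\<Sum>m<M. (B (Suc m) x - B m x) * A (Suc m) y\<bar>"
proof -
  let ?D = "\<Sum>m<M. (B (Suc m) x - B m x) * A (Suc m) y"
  have uniq: "m = n" if "Z (Suc m) x > 0" "Z (Suc n) x > 0" for m n
  proof (rule ccontr)
    assume "m \<noteq> n"
    then consider "m < n" | "n < m" by linarith
    then show False
    proof cases
      case 1 then show False using ZB[OF that(2), of n] ZB[OF that(2), of "Suc m"] ZB0[OF that(1), of n] by simp
    next
      case 2 then show False using ZB[OF that(1), of m] ZB0[OF that(2), of m] by simp
    qed
  qed
  show ?thesis
  proof (cases "\<exists>m<M. Z (Suc m) x > 0 \<and> P (Suc m) y > 0")
    case False
    have "Z (Suc m) x * P (Suc m) y = 0" if "m < M" for m
      using False that Z01[of "Suc m" x] P01[of "Suc m" y] by fastforce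
    then have "(\<Sum>m<M. 4 ^ Suc m / 3 * Z (Suc m) x * P (Suc m) y) = 0"
      by (intro sum.neutral) (auto simp: mult.assoc)
    then show ?thesis by simp
  next
    case True
    then obtain m where m: "m < M" "Z (Suc m) x > 0" "P (Suc m) y > 0" by blast
    have "(\<Sum>n<M. 4 ^ Suc n / 3 * Z (Suc n) x * P (Suc n) y) = (\<Sum>n\<in>{m}. 4 ^ Suc n / 3 * Z (Suc n) x * P (Suc n) y)"
    proof (rule sum.mono_neutral_right)
      show "\<forall>n\<in>{..<M} - {m}. 4 ^ Suc n / 3 * Z (Suc n) x * P (Suc n) y = 0"
      proof
        fix n assume "n \<in> {..<M} - {m}"
        then have "\<not> Z (Suc n) x > 0" using uniq[OF m(2)] by auto
        then have "Z (Suc n) x = 0" using Z01[of "Suc n" x] by linarith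
        then show "4 ^ Suc n / 3 * Z (Suc n) x * P (Suc n) y = 0" by simp
      qed
    qed (use m in auto)
    also have "\<dots> \<le> 4 ^ Suc m / 3"
    proof -
      have "Z (Suc m) x * P (Suc m) y \<le> 1" using Z01[of "Suc m" x] P01[of "Suc m" y] by (auto intro: mult_le_one)
      then have "4 ^ Suc m / 3 * (Z (Suc m) x * P (Suc m) y) \<le> 4 ^ Suc m / 3 * 1" by (intro mult_left_mono) auto
      then show ?thesis by (simp add: mult.assoc)
    qed
    also have "4 ^ Suc m / 3 \<le> \<bar>?D\<bar>"
    proof -
      have B: "k \<le> m \<Longrightarrow> B k x = 2 ^ k" "m < k \<Longrightarrow> B k x = 0" for k using ZB[OF m(2)] ZB0[OF m(2)] by auto
      have A: "k \<le> Suc m \<Longrightarrow> A k y = 2 ^ k" for k using PA[OF m(3)] by auto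
      have "?D = (\<Sum>k<Suc m. (B (Suc k) x - B k x) * A (Suc k) y)"
        by (rule sum.mono_neutral_right) (use m B in auto)
      also have "\<dots> = (\<Sum>k<m. 2 * 4 ^ k) - 2 * 4 ^ m"
      proof -
        have "(\<Sum>k<m. (B (Suc k) x - B k x) * A (Suc k) y) = (\<Sum>k<m. 2 * 4 ^ k)"
          by (rule sum.cong) (auto simp: A B power_mult_distrib[symmetric])
        moreover have "(B (Suc m) x - B m x) * A (Suc m) y = - (2 * 4 ^ m)"
          by (simp add: A B power_mult_distrib[symmetric])
        ultimately show ?thesis by simp
      qed
      also have "(\<Sum>k<m. 2 * 4 ^ k) = 2 * (4 ^ m - 1) / (3::real)"
        by (induction m) (auto simp: field_simps)
      finally have D: "?D = 2 * (4 ^ m - 1) / 3 - 2 * 4 ^ m" .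
      have "(4::real) ^ Suc m / 3 \<le> - (2 * (4 ^ m - 1) / 3 - 2 * 4 ^ m)" by simp
      then show ?thesis unfolding D by linarith
    qed
    finally show ?thesis .
  qed
qed

section \<open>A planar field of small strain and large rotation\<close>

lemma finite_uniform_bound:
  fixes X :: "nat \<Rightarrow> real \<Rightarrow> real"
  assumes "\<And>m. \<exists>b. \<forall>x\<in>S. \<bar>X m x\<bar> \<le> b"
  obtains K where "K \<ge> 0" "\<And>m x. m < M \<Longrightarrow> x \<in> S \<Longrightarrow> \<bar>X m x\<bar> \<le> K"
proof -
  obtain b where b: "\<And>m x. x \<in> S \<Longrightarrow> \<bar>X m x\<bar> \<le> b m" using assms by metis
  have "\<bar>X m x\<bar> \<le> (\<Sum>m<M. \<bar>b m\<bar>)" if "m < M" "x \<in> S" for m x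
  proof -
    have "\<bar>X m x\<bar> \<le> \<bar>b m\<bar>" using b[OF that(2), of m] by linarith
    also have "\<dots> \<le> (\<Sum>m<M. \<bar>b m\<bar>)" by (rule member_le_sum) (use that in auto)
    finally show ?thesis .
  qed
  then show ?thesis by (intro that[of "\<Sum>m<M. \<bar>b m\<bar>"]) (auto intro: sum_nonneg)
qed

lemma continuous_bounded_interval:
  fixes f :: "real \<Rightarrow> real"
  assumes "continuous_on UNIV f" shows "\<exists>b. \<forall>x\<in>{-R..R}. \<bar>f x\<bar> \<le> b"
proof -
  have "bounded (f ` {-R..R})"
    by (intro compact_imp_bounded compact_continuous_image continuous_on_subset[OF assms]) auto
  then show ?thesis by (auto simp: bounded_iff)
qed

lemma sum_geometric_bound:
  assumes "\<And>m. m < M \<Longrightarrow> \<bar>x m\<bar> \<le> e / 2 ^ m + k" "e \<ge> 0"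
  shows "\<bar>\<Sum>m<M. x m :: real\<bar> \<le> 2 * e + real M * k"
proof -
  have g: "(\<Sum>m<M. e / 2 ^ m) \<le> 2 * e"
  proof -
    have "(\<Sum>m<M. e / 2 ^ m) = 2 * e - 2 * e / 2 ^ M" by (induction M) (auto simp: field_simps)
    then show ?thesis using assms(2) by simp
  qed
  have "\<bar>\<Sum>m<M. x m\<bar> \<le> (\<Sum>m<M. \<bar>x m\<bar>)" by (rule sum_abs)
  also have "\<dots> \<le> (\<Sum>m<M. e / 2 ^ m + k)" by (intro sum_mono assms) auto
  also have "\<dots> \<le> 2 * e + real M * k" using g by (simp add: sum.distrib)
  finally show ?thesis .
qed

definition jointly_continuous :: "(real \<Rightarrow> real \<Rightarrow> real) \<Rightarrow> bool" where
  "jointly_continuous f \<longleftrightarrow> continuous_on UNIV (\<lambda>z. f (fst z) (snd z))"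

lemma jointly_continuous_compose:
  assumes "jointly_continuous f" "continuous_on S g" "continuous_on S h"
  shows "continuous_on S (\<lambda>x. f (g x) (h x))"
proof -
  have "continuous_on S (\<lambda>x. (\<lambda>z. f (fst z) (snd z)) (g x, h x))"
    by (rule continuous_on_compose2[OF assms(1)[unfolded jointly_continuous_def] continuous_on_Pair[OF assms(2,3)]]) auto
  then show ?thesis by simp
qed

lemma jointly_continuous_intros:
  "continuous_on UNIV g \<Longrightarrow> jointly_continuous (\<lambda>x y. g x)"
  "continuous_on UNIV g \<Longrightarrow> jointly_continuous (\<lambda>x y. g y)"
  "jointly_continuous f \<Longrightarrow> jointly_continuous f' \<Longrightarrow> jointly_continuous (\<lambda>x y. f x y * f' x y)"
  "jointly_continuous f \<Longrightarrow> jointly_continuous f' \<Longrightarrow> jointly_continuous (\<lambda>x y. f x y - f' x y)"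
  "(\<And>m. m \<in> I \<Longrightarrow> jointly_continuous (F m)) \<Longrightarrow> jointly_continuous (\<lambda>x y. \<Sum>m\<in>I. F m x y)"
  "jointly_continuous (\<lambda>x y. a)"
  unfolding jointly_continuous_def
  by (auto intro!: continuous_intros elim: continuous_on_compose2[where f = fst] continuous_on_compose2[where f = snd])

text \<open>
  Here \<open>D z y = \<alpha> * (\<Sum>m<M. (B (Suc m) z - B m z) * A (Suc m) y)\<close>. The functions \<open>q\<close> and \<open>w\<close> are
  the primitives of \<open>D z (c t)\<close> and of \<open>D (c t) y\<close> in \<open>t\<close>, and \<open>p\<close> is the primitive of
  \<open>\<alpha> * (B M z * A M y - 1)\<close> in \<open>y\<close>; the indices 1 and 2 denote the partial derivatives of \<open>p\<close> and
  \<open>q\<close> in the first and of \<open>p\<close> in the second argument, while \<open>w2\<close> is the derivative of \<open>w\<close> in its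
  argument \<open>y\<close>. The components of the field will be \<open>p - q\<close> and \<open>w\<close>. Both are small, and so are
  their derivatives \<open>p1 - q1\<close> and \<open>w2\<close>. The derivative \<open>p2\<close> is small only in the mean: it is
  bounded by \<open>\<alpha> * (b z * a y + 1)\<close>, where \<open>b\<close> and \<open>a\<close> are the last products, whose masses do not
  depend on the number of factors. The lower bound \<open>\<Lambda>\<close> for the rotation can be prescribed
  independently of \<open>\<eta>\<close> and \<open>\<alpha>\<close>, at the expense of \<open>M\<close>.
\<close>

lemma planar_field:
  fixes R a1 b1 a2 b2 \<delta> \<eta> \<alpha> \<Lambda> :: real
  assumes R: "R > 0" and ab1: "{a1..b1} \<subseteq> {-R..R}" "a1 < b1" and ab2: "{a2..b2} \<subseteq> {-R..R}" "a2 < b2"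
    and \<delta>: "\<delta> > 0" and \<eta>: "\<eta> > 0" and \<alpha>: "\<alpha> > 0"
  obtains \<epsilon> c T N p p1 p2 q q1 w w2 D a b M d Z P where
    "singular_staircase \<epsilon> c T N" "\<epsilon> \<le> \<delta>"
    "\<And>y. C1 (\<lambda>z. p z y) (\<lambda>z. p1 z y)" "\<And>z. C1 (p z) (p2 z)" "\<And>t. C1 (\<lambda>z. q z t) (\<lambda>z. q1 z t)"
    "\<And>z. C1 (q z) (\<lambda>t. D z (c t))" "\<And>t. C1 (\<lambda>y. w y t) (\<lambda>y. w2 y t)" "\<And>y. C1 (w y) (\<lambda>t. D (c t) y)"
    "jointly_continuous p" "jointly_continuous p1" "jointly_continuous p2" "jointly_continuous q"
    "jointly_continuous q1" "jointly_continuous w" "jointly_continuous w2" "jointly_continuous D"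
    "\<And>z t. z \<in> {-R..R} \<Longrightarrow> t \<in> {-R..R} \<Longrightarrow> c t \<in> {-R..R} \<Longrightarrow> \<bar>p z (c t) - q z t\<bar> \<le> \<eta> \<and> \<bar>p1 z (c t) - q1 z t\<bar> \<le> \<eta>"
    "\<And>y t. y \<in> {-R..R} \<Longrightarrow> t \<in> {-R..R} \<Longrightarrow> \<bar>w y t\<bar> \<le> \<eta> \<and> \<bar>w2 y t\<bar> \<le> \<eta>"
    "\<And>z y. \<bar>p2 z y\<bar> \<le> \<alpha> * (b z * a y + 1)" "continuous_on UNIV a" "continuous_on UNIV b"
    "\<And>x. 0 \<le> a x" "\<And>x. 0 \<le> b x" "mass (-R) R a \<le> 3 * R" "mass (-R) R (\<lambda>x. b (c x)) \<le> 3 * R"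
    "\<And>x y. \<bar>D (c x) (c y)\<bar> \<ge> (\<Sum>m<M. d m * Z m x * P m y)"
    "\<And>m::nat. continuous_on UNIV (Z m)" "\<And>m. continuous_on UNIV (P m)"
    "(\<Sum>m<M. d m * mass a1 b1 (Z m) * mass a2 b2 (P m)) \<ge> \<Lambda>"
proof -
  \<comment> \<open>Each of the \<open>M\<close> terms of the lower bound contributes \<open>\<alpha> * ((b1 - a1) * (b2 - a2)) / 24\<close>: a
    factor \<open>1/3\<close> comes from the bound for the sum, \<open>1/2\<close> from the loss of mass in the cutoffs, and
    \<open>1/2\<close> from each of the two compositions with \<open>c\<close>.\<close>
  obtain M :: nat where M: "real M * (\<alpha> * ((b1 - a1) * (b2 - a2)) / 24) \<ge> \<Lambda>"
  proof -
    have pos: "\<alpha> * ((b1 - a1) * (b2 - a2)) / 24 > 0" using \<alpha> ab1 ab2 by simp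
    obtain M :: nat where "real M \<ge> \<Lambda> / (\<alpha> * ((b1 - a1) * (b2 - a2)) / 24)" using real_arch_simple by blast
    then show ?thesis using pos that by (metis pos_divide_le_eq)
  qed
  \<comment> \<open>\<open>t\<close> is so close to \<open>1/2\<close> that \<open>(4 * t\<^sup>2)\<^sup>m = (1 - \<theta>)\<^sup>2\<^sup>m \<ge> 1/2\<close> for all \<open>m \<le> M\<close>, by
    Bernoulli's inequality\<close>
  define \<theta> where "\<theta> = 1 / (4 * real M + 4)"
  define t where "t = (1 - \<theta>) / 2"
  have \<theta>: "0 < \<theta>" "\<theta> < 1" by (auto simp: \<theta>_def)
  have t: "0 < t" "t < 1 / 2" using \<theta> by (auto simp: t_def)
  \<comment> \<open>The primitives of all increments of a product add up to at most \<open>2 * e\<close>. The first bound on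
    \<open>e\<close> keeps the masses of \<open>A M\<close> and \<open>B M\<close> below \<open>3 * R\<close>, the second one keeps the field small.\<close>
  define e where "e = min (R / 4) (\<eta> / (8 * \<alpha>))"
  have e: "e > 0" using R \<eta> \<alpha> by (auto simp: e_def)
  have e_small: "e \<le> R / 4" "\<alpha> * (2 * e) \<le> \<eta> / 2"
  proof -
    show "e \<le> R / 4" by (simp add: e_def)
    have "\<alpha> * e \<le> \<alpha> * (\<eta> / (8 * \<alpha>))" using \<alpha> by (intro mult_left_mono) (auto simp: e_def)
    also have "\<dots> = \<eta> / 8" using \<alpha> by simp
    finally show "\<alpha> * (2 * e) \<le> \<eta> / 2" using \<eta> by simp
  qed
  obtain A A' B B' GA GB P Z :: "nat \<Rightarrow> real \<Rightarrow> real" where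
    AB: "\<And>n. C1 (A n) (A' n)" "\<And>n. C1 (B n) (B' n)" "A 0 = (\<lambda>_. 1)" "B 0 = (\<lambda>_. 1)"
      "\<And>n x. 0 \<le> A n x" "\<And>n x. 0 \<le> B n x"
    and GA: "\<And>n. C1 (GA n) (\<lambda>x. A (Suc n) x - A n x)" "\<And>n. GA n (- R) = 0"
    and GB: "\<And>n. C1 (GB n) (\<lambda>x. B (Suc n) x - B n x)" "\<And>n. GB n (- R) = 0"
    and GAb: "\<And>n x y. x \<in> {-R..R} \<Longrightarrow> y \<in> {-R..R} \<Longrightarrow> \<bar>GA n x\<bar> \<le> e / 2 ^ n \<and> \<bar>B n y * GA n x\<bar> \<le> e / 2 ^ n \<and> \<bar>B' n y * GA n x\<bar> \<le> e / 2 ^ n"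
    and GBb: "\<And>n x y. x \<in> {-R..R} \<Longrightarrow> y \<in> {-R..R} \<Longrightarrow> \<bar>GB n x\<bar> \<le> e / 2 ^ n \<and> \<bar>A (Suc n) y * GB n x\<bar> \<le> e / 2 ^ n \<and> \<bar>A' (Suc n) y * GB n x\<bar> \<le> e / 2 ^ n"
    and PZ: "\<And>n. continuous_on UNIV (P n)" "\<And>n. continuous_on UNIV (Z n)"
      "\<And>n x. 0 \<le> P n x \<and> P n x \<le> 1" "\<And>n x. 0 \<le> Z n x \<and> Z n x \<le> 1"
    and PA: "\<And>n k x. P n x > 0 \<Longrightarrow> k \<le> n \<Longrightarrow> A k x = 2 ^ k"
    and ZB: "\<And>n k x. Z (Suc n) x > 0 \<Longrightarrow> k \<le> n \<Longrightarrow> B k x = 2 ^ k"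
    and ZB0: "\<And>n k x. Z (Suc n) x > 0 \<Longrightarrow> n < k \<Longrightarrow> B k x = 0"
    and Pm: "\<And>n. mass a2 b2 (P n) \<ge> t ^ n * (b2 - a2)" and Zm: "\<And>n. mass a1 b1 (Z (Suc n)) \<ge> t ^ Suc n * (b1 - a1)"
    by (rule lacunary_products[OF R ab1 ab2 t e]) (rule that; assumption)
  have B'0: "B' 0 x = 0" for x
  proof (rule DERIV_unique[OF C1_deriv[OF AB(2)[of 0]]])
    show "(B 0 has_real_derivative 0) (at x)" by (simp add: AB(4))
  qed
  define dB where "dB m x = B (Suc m) x - B m x" for m x
  define dB' where "dB' m x = B' (Suc m) x - B' m x" for m x
  have dB: "C1 (dB m) (dB' m)" for m
    unfolding dB_def[abs_def] dB'_def[abs_def] by (intro C1_diff AB)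
  have GB': "C1 (GB m) (dB m)" for m
    unfolding dB_def[abs_def] by (rule GB)
  define AA where "AA m y = y + R + (\<Sum>k<m. GA k y)" for m y
  have AA: "C1 (AA m) (A m)" "AA m (- R) = 0" for m
  proof -
    have *: "C1 (\<lambda>y. y + R + (\<Sum>k<m. GA k y)) (\<lambda>y. 1 + 0 + (\<Sum>k<m. A (Suc k) y - A k y))"
      by (intro C1_add C1_sum C1_ident C1_const GA)
    have "1 + 0 + (\<Sum>k<m. A (Suc k) y - A k y) = A m y" for y
      using sum_lessThan_telescope[of "\<lambda>k. A k y" m] AB(3) by simp
    then show "C1 (AA m) (A m)" using * by (simp add: AA_def[abs_def])
    show "AA m (- R) = 0" by (simp add: AA_def GA)
  qed
  have AA_Suc: "AA (Suc m) y = AA m y + GA m y" for m y by (simp add: AA_def)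
  \<comment> \<open>The errors made by composing the primitives with \<open>c\<close> are multiplied by the products and their derivatives,
    so the admissible error \<open>\<kappa>\<close> depends on a common bound \<open>K\<close> for these.\<close>
  obtain K1 where K1: "K1 \<ge> 0" "\<And>m x. m < M \<Longrightarrow> x \<in> {-R..R} \<Longrightarrow> \<bar>dB m x\<bar> \<le> K1"
    by (rule finite_uniform_bound[of "{-R..R}" dB M]) (use continuous_bounded_interval[OF C1_cont[OF dB]] in auto)
  obtain K2 where K2: "K2 \<ge> 0" "\<And>m x. m < M \<Longrightarrow> x \<in> {-R..R} \<Longrightarrow> \<bar>dB' m x\<bar> \<le> K2"
    by (rule finite_uniform_bound[of "{-R..R}" dB' M]) (use continuous_bounded_interval[OF C1_cont'[OF dB]] in auto)
  obtain K3 where K3: "K3 \<ge> 0" "\<And>m x. m < M \<Longrightarrow> x \<in> {-R..R} \<Longrightarrow> \<bar>A (Suc m) x\<bar> \<le> K3"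
    by (rule finite_uniform_bound[of "{-R..R}" "\<lambda>m. A (Suc m)" M]) (use continuous_bounded_interval[OF C1_cont[OF AB(1)]] in auto)
  obtain K4 where K4: "K4 \<ge> 0" "\<And>m x. m < M \<Longrightarrow> x \<in> {-R..R} \<Longrightarrow> \<bar>A' (Suc m) x\<bar> \<le> K4"
    by (rule finite_uniform_bound[of "{-R..R}" "\<lambda>m. A' (Suc m)" M]) (use continuous_bounded_interval[OF C1_cont'[OF AB(1)]] in auto)
  define K where "K = K1 + K2 + K3 + K4"
  have K: "K \<ge> 0" "K1 \<le> K" "K2 \<le> K" "K3 \<le> K" "K4 \<le> K" using K1 K2 K3 K4 by (auto simp: K_def)
  define \<kappa> where "\<kappa> = \<eta> / (2 * \<alpha> * (real M * K + 1))"
  have MK: "real M * K + 1 > 0" using K(1) by (simp add: add_nonneg_pos)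
  then have \<kappa>: "\<kappa> > 0" unfolding \<kappa>_def using \<eta> \<alpha> by (intro divide_pos_pos mult_pos_pos) auto
  have \<kappa>_small: "\<alpha> * (real M * (K * \<kappa>)) \<le> \<eta> / 2"
  proof -
    have "\<alpha> * (real M * (K * \<kappa>)) = \<alpha> * \<kappa> * (real M * K)" by simp
    also have "\<dots> \<le> \<alpha> * \<kappa> * (real M * K + 1)" using \<alpha> \<kappa> by (intro mult_left_mono) auto
    also have "\<dots> = \<eta> / 2"
    proof -
      have "\<alpha> * (\<eta> / (2 * \<alpha> * X)) * X = \<eta> / 2" if "X > 0" for X using that \<alpha> by simp
      then show ?thesis unfolding \<kappa>_def using MK by blast
    qed
    finally show ?thesis .
  qed
  have smallness: "\<alpha> * (2 * e + real M * (K * \<kappa>)) \<le> \<eta>"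
    using e_small(2) \<kappa>_small by (simp add: distrib_left)
  \<comment> \<open>finitely many conditions on \<open>\<epsilon>\<close>, each of which holds for all small \<open>\<epsilon>\<close>\<close>
  have rr: "{-R..R} \<subseteq> {-R..R}" "-R < R" "R / 4 > 0" using R by auto
  have ev: "\<forall>\<^sub>F \<epsilon> in at_right (0::real). \<epsilon> \<in> {0<..<\<delta>} \<and>
      (\<forall>m\<in>{..<M}. \<forall>c. (\<forall>x. \<bar>c x - x\<bar> \<le> \<epsilon>) \<longrightarrow> (\<forall>G. C1 G (\<lambda>t. A (Suc m) (c t)) \<longrightarrow> G (- R) = 0 \<longrightarrow>
        (\<forall>t\<in>{-R..R}. \<bar>G t\<bar> \<le> \<bar>AA (Suc m) t\<bar> + \<kappa> \<and> \<bar>AA (Suc m) (c t) - G t\<bar> \<le> \<kappa>))) \<and>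
      (\<forall>m\<in>{..<M}. \<forall>c. (\<forall>x. \<bar>c x - x\<bar> \<le> \<epsilon>) \<longrightarrow> (\<forall>G. C1 G (\<lambda>t. dB m (c t)) \<longrightarrow> G (- R) = 0 \<longrightarrow>
        (\<forall>t\<in>{-R..R}. \<bar>G t\<bar> \<le> \<bar>GB m t\<bar> + \<kappa> \<and> \<bar>GB m (c t) - G t\<bar> \<le> \<kappa>))) \<and>
      (\<forall>c. (\<forall>x. \<bar>c x - x\<bar> \<le> \<epsilon>) \<longrightarrow> continuous_on UNIV c \<longrightarrow> \<bar>mass (-R) R (\<lambda>x. B M (c x)) - mass (-R) R (B M)\<bar> \<le> R / 4) \<and>
      (\<forall>m\<in>{..<M}. \<forall>c. (\<forall>x. \<bar>c x - x\<bar> \<le> \<epsilon>) \<longrightarrow> continuous_on UNIV c \<longrightarrow> \<bar>mass a1 b1 (\<lambda>x. Z (Suc m) (c x)) - mass a1 b1 (Z (Suc m))\<bar> \<le> t ^ Suc m * (b1 - a1) / 2) \<and>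
      (\<forall>m\<in>{..<M}. \<forall>c. (\<forall>x. \<bar>c x - x\<bar> \<le> \<epsilon>) \<longrightarrow> continuous_on UNIV c \<longrightarrow> \<bar>mass a2 b2 (\<lambda>x. P (Suc m) (c x)) - mass a2 b2 (P (Suc m))\<bar> \<le> t ^ Suc m * (b2 - a2) / 2)"
    (is "eventually ?Q _")
    apply (intro eventually_conj eventually_ball_finite ballI finite_lessThan)
         apply (rule eventually_at_right_real[OF \<delta>])
        apply (rule eventually_antiderivative_near[OF AA \<kappa> R])
       apply (rule eventually_antiderivative_near[OF GB' GB(2) \<kappa> R])
      apply (rule eventually_mass_near[OF C1_cont[OF AB(2)] rr])
     apply (rule eventually_mass_near[OF PZ(2) ab1], use t ab1 in simp)
    apply (rule eventually_mass_near[OF PZ(1) ab2], use t ab2 in simp)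
    done
  have "\<exists>\<epsilon>. ?Q \<epsilon>" by (rule eventually_happens'[OF _ ev]) simp
  then obtain \<epsilon> where Q: "?Q \<epsilon>" by (rule exE)
  have \<epsilon>: "\<epsilon> \<in> {0<..<\<delta>}" by (rule conjunct1[OF Q])
  note Q1 = conjunct2[OF Q]
  note Q2 = conjunct2[OF Q1]
  note Q3 = conjunct2[OF Q2]
  note Q4 = conjunct2[OF Q3]
  have ev1: "\<bar>AA (Suc m) (c t) - G t\<bar> \<le> \<kappa>"
    if "m < M" "\<forall>x. \<bar>c x - x\<bar> \<le> \<epsilon>" "C1 G (\<lambda>t. A (Suc m) (c t))" "G (- R) = 0" "t \<in> {-R..R}" for m c G t
    using conjunct1[OF Q1] that by blast
  have ev2: "\<bar>G t\<bar> \<le> \<bar>GB m t\<bar> + \<kappa>"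
    if "m < M" "\<forall>x. \<bar>c x - x\<bar> \<le> \<epsilon>" "C1 G (\<lambda>t. dB m (c t))" "G (- R) = 0" "t \<in> {-R..R}" for m c G t
    using conjunct1[OF Q2] that by blast
  have ev3: "\<bar>mass (-R) R (\<lambda>x. B M (c x)) - mass (-R) R (B M)\<bar> \<le> R / 4"
    if "\<forall>x. \<bar>c x - x\<bar> \<le> \<epsilon>" "continuous_on UNIV c" for c
    using conjunct1[OF Q3] that by blast
  have ev4: "\<bar>mass a1 b1 (\<lambda>x. Z (Suc m) (c x)) - mass a1 b1 (Z (Suc m))\<bar> \<le> t ^ Suc m * (b1 - a1) / 2"
    if "m < M" "\<forall>x. \<bar>c x - x\<bar> \<le> \<epsilon>" "continuous_on UNIV c" for m c
    using conjunct1[OF Q4] that by blast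
  have ev5: "\<bar>mass a2 b2 (\<lambda>x. P (Suc m) (c x)) - mass a2 b2 (P (Suc m))\<bar> \<le> t ^ Suc m * (b2 - a2) / 2"
    if "m < M" "\<forall>x. \<bar>c x - x\<bar> \<le> \<epsilon>" "continuous_on UNIV c" for m c
    using conjunct2[OF Q4] that by blast
  obtain c T N where sc: "singular_staircase \<epsilon> c T N" using ex_singular_staircase[of \<epsilon>] \<epsilon> by auto
  interpret singular_staircase \<epsilon> c T N by (rule sc)
  have near: "\<forall>x. \<bar>c x - x\<bar> \<le> \<epsilon>" using c_near by blast
  have "\<exists>G. C1 G (\<lambda>t. A (Suc m) (c t)) \<and> G (- R) = 0" "\<exists>G. C1 G (\<lambda>t. dB m (c t)) \<and> G (- R) = 0" for m
    by (intro ex_antiderivative continuous_on_compose2[OF C1_cont[OF AB(1)] c_continuous]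
        continuous_on_compose2[OF C1_cont[OF dB] c_continuous]; simp)+
  then obtain HA HB where HA: "\<And>m. C1 (HA m) (\<lambda>t. A (Suc m) (c t))" "\<And>m. HA m (- R) = 0"
    and HB: "\<And>m. C1 (HB m) (\<lambda>t. dB m (c t))" "\<And>m. HB m (- R) = 0" by metis
  define p where "p z y = \<alpha> * (B M z * AA M y - AA 0 y)" for z y
  define p1 where "p1 z y = \<alpha> * (B' M z * AA M y)" for z y
  define p2 where "p2 z y = \<alpha> * (B M z * A M y - A 0 y)" for z y
  define q where "q z t = \<alpha> * (\<Sum>m<M. dB m z * HA m t)" for z t
  define q1 where "q1 z t = \<alpha> * (\<Sum>m<M. dB' m z * HA m t)" for z t
  define w where "w y t = \<alpha> * (\<Sum>m<M. A (Suc m) y * HB m t)" for y t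
  define w2 where "w2 y t = \<alpha> * (\<Sum>m<M. A' (Suc m) y * HB m t)" for y t
  define D where "D z y = \<alpha> * (\<Sum>m<M. dB m z * A (Suc m) y)" for z y
  note defs = p_def p1_def p2_def q_def q1_def w_def w2_def D_def
  have C1_multc: "C1 (\<lambda>x. f x * k) (\<lambda>x. f' x * k)" if "C1 f f'" for f f' k
    using C1_cmult[OF that, of k] by (simp add: mult.commute)
  \<comment> \<open>summation by parts: with \<open>HA m\<close> in place of \<open>AA (Suc m)\<close> the second summands add up to \<open>q\<close>, so
    \<open>p - q\<close> only contains small primitives\<close>
  have tel: "B M z * AA M y - AA 0 y = (\<Sum>m<M. B m z * GA m y + dB m z * AA (Suc m) y)" for z y
  proof -
    have "B m z * GA m y + dB m z * AA (Suc m) y = B (Suc m) z * AA (Suc m) y - B m z * AA m y" for m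
      by (simp add: dB_def AA_Suc algebra_simps)
    then show ?thesis using sum_lessThan_telescope[of "\<lambda>m. B m z * AA m y" M] AB(4) by simp
  qed
  have tel': "B' M z * AA M y = (\<Sum>m<M. B' m z * GA m y + dB' m z * AA (Suc m) y)" for z y
  proof -
    have "B' m z * GA m y + dB' m z * AA (Suc m) y = B' (Suc m) z * AA (Suc m) y - B' m z * AA m y" for m
      by (simp add: dB'_def AA_Suc algebra_simps)
    then show ?thesis using sum_lessThan_telescope[of "\<lambda>m. B' m z * AA m y" M] B'0 by simp
  qed
  have fin: "\<bar>\<alpha> * (\<Sum>m<M. x m)\<bar> \<le> \<eta>" if "\<And>m. m < M \<Longrightarrow> \<bar>x m\<bar> \<le> e / 2 ^ m + K * \<kappa>" for x
  proof -
    have "\<bar>\<Sum>m<M. x m\<bar> \<le> 2 * e + real M * (K * \<kappa>)" by (rule sum_geometric_bound) (use that e in auto)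
    then have "\<alpha> * \<bar>\<Sum>m<M. x m\<bar> \<le> \<alpha> * (2 * e + real M * (K * \<kappa>))" using \<alpha> by (intro mult_left_mono) auto
    also note smallness
    finally show ?thesis using \<alpha> by (simp add: abs_mult)
  qed
  have prodK: "\<bar>u * v\<bar> \<le> K * \<kappa>" if "\<bar>u\<bar> \<le> K" "\<bar>v\<bar> \<le> \<kappa>" for u v
    unfolding abs_mult by (rule mult_mono) (use that K in auto)
  show ?thesis
  proof (rule that)
    show "singular_staircase \<epsilon> c T N" by (rule sc)
    show "\<epsilon> \<le> \<delta>" using \<epsilon> by simp
    show "C1 (\<lambda>z. p z y) (\<lambda>z. p1 z y)" for y
      using C1_cmult[OF C1_diff[OF C1_multc[OF AB(2)[of M], of "AA M y"] C1_const[of "AA 0 y"]], of \<alpha>]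
      by (simp add: p_def p1_def)
    show "C1 (p z) (p2 z)" for z
      unfolding p_def[abs_def] p2_def[abs_def] by (intro C1_cmult C1_diff AA)
    show "C1 (\<lambda>z. q z s) (\<lambda>z. q1 z s)" for s
      unfolding q_def q1_def by (intro C1_cmult C1_sum C1_multc dB)
    show "C1 (q z) (\<lambda>t. D z (c t))" for z
      unfolding q_def[abs_def] D_def by (intro C1_cmult C1_sum HA)
    show "C1 (\<lambda>y. w y s) (\<lambda>y. w2 y s)" for s
      unfolding w_def w2_def by (intro C1_cmult C1_sum C1_multc AB)
    show "C1 (w y) (\<lambda>t. D (c t) y)" for y
    proof -
      have "C1 (\<lambda>t. \<alpha> * (\<Sum>m<M. A (Suc m) y * HB m t)) (\<lambda>t. \<alpha> * (\<Sum>m<M. A (Suc m) y * dB m (c t)))"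
        by (intro C1_cmult C1_sum HB)
      then show ?thesis by (simp add: w_def[abs_def] D_def mult.commute)
    qed
    note ct = C1_cont[OF AB(1)] C1_cont'[OF AB(1)] C1_cont[OF AB(2)] C1_cont'[OF AB(2)] C1_cont[OF dB] C1_cont'[OF dB]
      C1_cont[OF AA(1)] C1_cont[OF HA(1)] C1_cont[OF HB(1)]
    show "jointly_continuous p" "jointly_continuous p1" "jointly_continuous p2" "jointly_continuous q"
      "jointly_continuous q1" "jointly_continuous w" "jointly_continuous w2" "jointly_continuous D"
      unfolding p_def[abs_def] p1_def[abs_def] p2_def[abs_def] q_def[abs_def] q1_def[abs_def] w_def[abs_def] w2_def[abs_def] D_def[abs_def]
      by (intro jointly_continuous_intros(3-6) jointly_continuous_intros(1,2)[OF ct(1)] jointly_continuous_intros(1,2)[OF ct(2)]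
          jointly_continuous_intros(1,2)[OF ct(3)] jointly_continuous_intros(1,2)[OF ct(4)] jointly_continuous_intros(1,2)[OF ct(5)]
          jointly_continuous_intros(1,2)[OF ct(6)] jointly_continuous_intros(1,2)[OF ct(7)] jointly_continuous_intros(1,2)[OF ct(8)]
          jointly_continuous_intros(1,2)[OF ct(9)])+
    show "\<bar>p z (c s) - q z s\<bar> \<le> \<eta> \<and> \<bar>p1 z (c s) - q1 z s\<bar> \<le> \<eta>"
      if z: "z \<in> {-R..R}" and s: "s \<in> {-R..R}" and cs: "c s \<in> {-R..R}" for z s
    proof
      have "p z (c s) - q z s = \<alpha> * (\<Sum>m<M. B m z * GA m (c s) + dB m z * (AA (Suc m) (c s) - HA m s))"
        by (simp add: p_def q_def tel right_diff_distrib[symmetric] sum_subtractf[symmetric]) (simp add: algebra_simps)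
      also have "\<bar>\<dots>\<bar> \<le> \<eta>"
      proof (rule fin)
        fix m assume m: "m < M"
        have "\<bar>B m z * GA m (c s)\<bar> \<le> e / 2 ^ m" using GAb[OF cs z] by blast
        moreover have "\<bar>dB m z * (AA (Suc m) (c s) - HA m s)\<bar> \<le> K * \<kappa>"
          by (rule prodK) (use K1(2)[OF m z] K ev1[OF m near HA s] in auto)
        ultimately show "\<bar>B m z * GA m (c s) + dB m z * (AA (Suc m) (c s) - HA m s)\<bar> \<le> e / 2 ^ m + K * \<kappa>" by linarith
      qed
      finally show "\<bar>p z (c s) - q z s\<bar> \<le> \<eta>" .
      have "p1 z (c s) - q1 z s = \<alpha> * (\<Sum>m<M. B' m z * GA m (c s) + dB' m z * (AA (Suc m) (c s) - HA m s))"
        by (simp add: p1_def q1_def tel' right_diff_distrib[symmetric] sum_subtractf[symmetric]) (simp add: algebra_simps)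
      also have "\<bar>\<dots>\<bar> \<le> \<eta>"
      proof (rule fin)
        fix m assume m: "m < M"
        have "\<bar>B' m z * GA m (c s)\<bar> \<le> e / 2 ^ m" using GAb[OF cs z] by blast
        moreover have "\<bar>dB' m z * (AA (Suc m) (c s) - HA m s)\<bar> \<le> K * \<kappa>"
          by (rule prodK) (use K2(2)[OF m z] K ev1[OF m near HA s] in auto)
        ultimately show "\<bar>B' m z * GA m (c s) + dB' m z * (AA (Suc m) (c s) - HA m s)\<bar> \<le> e / 2 ^ m + K * \<kappa>" by linarith
      qed
      finally show "\<bar>p1 z (c s) - q1 z s\<bar> \<le> \<eta>" .
    qed
    show "\<bar>w y s\<bar> \<le> \<eta> \<and> \<bar>w2 y s\<bar> \<le> \<eta>" if y: "y \<in> {-R..R}" and s: "s \<in> {-R..R}" for y s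
    proof
      have HBs: "\<bar>HB m s\<bar> \<le> \<bar>GB m s\<bar> + \<kappa>" if "m < M" for m using ev2[OF that near HB s] .
      have split: "\<bar>u * HB m s\<bar> \<le> e / 2 ^ m + K * \<kappa>" if m: "m < M" and u: "\<bar>u\<bar> \<le> K" "\<bar>u * GB m s\<bar> \<le> e / 2 ^ m" for u m
      proof -
        have "\<bar>u\<bar> * \<bar>HB m s\<bar> \<le> \<bar>u\<bar> * (\<bar>GB m s\<bar> + \<kappa>)" by (intro mult_left_mono HBs m) simp
        also have "\<dots> = \<bar>u * GB m s\<bar> + \<bar>u\<bar> * \<kappa>" by (simp add: abs_mult distrib_left)
        also have "\<bar>u\<bar> * \<kappa> \<le> K * \<kappa>" using u(1) \<kappa> by (intro mult_right_mono) auto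
        finally show ?thesis using u(2) by (simp add: abs_mult)
      qed
      show "\<bar>w y s\<bar> \<le> \<eta>" unfolding w_def
        by (rule fin, rule split) (use K3(2) K(4) y GBb[OF s y] in \<open>auto intro: order_trans\<close>)
      show "\<bar>w2 y s\<bar> \<le> \<eta>" unfolding w2_def
        by (rule fin, rule split) (use K4(2) K(5) y GBb[OF s y] in \<open>auto intro: order_trans\<close>)
    qed
    show "\<bar>p2 z y\<bar> \<le> \<alpha> * (B M z * A M y + 1)" for z y
    proof -
      have "\<bar>B M z * A M y - A 0 y\<bar> \<le> B M z * A M y + 1"
        using mult_nonneg_nonneg[OF AB(6)[of M z] AB(5)[of M y]] unfolding AB(3) by linarith
      then show ?thesis unfolding p2_def using \<alpha> by (simp add: abs_mult)
    qed
    show "continuous_on UNIV (A M)" "continuous_on UNIV (B M)" by (fact ct)+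
    show "0 \<le> A M x" "0 \<le> B M x" for x by (fact AB)+
    have massA: "mass (- R) R (A M) \<le> 2 * R + 2 * e"
    proof -
      have "mass (- R) R (A M) = AA M R - AA M (- R)" by (rule mass_C1) (use R AA in auto)
      moreover have "AA M R = 2 * R + (\<Sum>k<M. GA k R)" by (simp add: AA_def)
      moreover have "\<bar>\<Sum>k<M. GA k R\<bar> \<le> 2 * e + real M * 0"
        by (rule sum_geometric_bound) (use GAb[of R R] R e in auto)
      ultimately show ?thesis using AA(2)[of M] by linarith
    qed
    then show "mass (- R) R (A M) \<le> 3 * R" using e_small R by linarith
    have massB: "mass (- R) R (B M) \<le> 2 * R + 2 * e"
    proof -
      have "C1 (\<lambda>y. y + R + (\<Sum>k<M. GB k y)) (\<lambda>y. 1 + 0 + (\<Sum>k<M. B (Suc k) y - B k y))"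
        by (intro C1_add C1_sum C1_ident C1_const GB)
      moreover have "1 + 0 + (\<Sum>k<M. B (Suc k) y - B k y) = B M y" for y
        using sum_lessThan_telescope[of "\<lambda>k. B k y" M] AB(4) by simp
      ultimately have "C1 (\<lambda>y. y + R + (\<Sum>k<M. GB k y)) (B M)" by simp
      from mass_C1[OF _ this, of "-R" R] have "mass (- R) R (B M) = 2 * R + (\<Sum>k<M. GB k R)" using R by (simp add: GB)
      moreover have "\<bar>\<Sum>k<M. GB k R\<bar> \<le> 2 * e + real M * 0"
        by (rule sum_geometric_bound) (use GBb[of R R] R e in auto)
      ultimately show ?thesis by linarith
    qed
    then show "mass (- R) R (\<lambda>x. B M (c x)) \<le> 3 * R"
      using ev3[OF near c_continuous] e_small R by linarith
    show "\<bar>D (c x) (c y)\<bar> \<ge> (\<Sum>m<M. (\<alpha> * (4 ^ Suc m / 3)) * Z (Suc m) (c x) * P (Suc m) (c y))" for x y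
    proof -
      have "\<alpha> * (\<Sum>m<M. 4 ^ Suc m / 3 * Z (Suc m) (c x) * P (Suc m) (c y)) \<le> \<alpha> * \<bar>\<Sum>m<M. dB m (c x) * A (Suc m) (c y)\<bar>"
        unfolding dB_def using \<alpha> by (intro mult_left_mono staircase_sum_lower_bound PA ZB ZB0 PZ) auto
      moreover have "\<bar>D (c x) (c y)\<bar> = \<alpha> * \<bar>\<Sum>m<M. dB m (c x) * A (Suc m) (c y)\<bar>"
        using \<alpha> by (simp add: D_def abs_mult)
      moreover have "(\<Sum>m<M. (\<alpha> * (4 ^ Suc m / 3)) * Z (Suc m) (c x) * P (Suc m) (c y))
          = \<alpha> * (\<Sum>m<M. 4 ^ Suc m / 3 * Z (Suc m) (c x) * P (Suc m) (c y))"
        by (simp only: sum_distrib_left mult.assoc)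
      ultimately show ?thesis by simp
    qed
    show "continuous_on UNIV (\<lambda>x. Z (Suc m) (c x))" "continuous_on UNIV (\<lambda>x. P (Suc m) (c x))" for m
      by (rule continuous_on_compose2[OF PZ(2) c_continuous] continuous_on_compose2[OF PZ(1) c_continuous], simp)+
    show "\<Lambda> \<le> (\<Sum>m<M. \<alpha> * (4 ^ Suc m / 3) * mass a1 b1 (\<lambda>x. Z (Suc m) (c x)) * mass a2 b2 (\<lambda>x. P (Suc m) (c x)))"
    proof -
      have "\<alpha> * ((b1 - a1) * (b2 - a2)) / 24 \<le> \<alpha> * (4 ^ Suc m / 3) * mass a1 b1 (\<lambda>x. Z (Suc m) (c x)) * mass a2 b2 (\<lambda>x. P (Suc m) (c x))"
        if m: "m < M" for m
      proof -
        have t4: "4 ^ Suc m * (t ^ Suc m * t ^ Suc m) \<ge> 1 / 2"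
        proof -
          have "1 - real (2 * Suc m) * \<theta> \<le> (1 - \<theta>) ^ (2 * Suc m)"
            using Bernoulli_inequality[of "- \<theta>" "2 * Suc m"] \<theta> by simp
          moreover have "real (2 * Suc m) * \<theta> \<le> 1 / 2"
          proof -
            have "real (2 * Suc m) \<le> (4 * real M + 4) / 2" using m by simp
            then have "real (2 * Suc m) * \<theta> \<le> (4 * real M + 4) / 2 * \<theta>" using \<theta> by (intro mult_right_mono) auto
            also have "\<dots> = 1 / 2"
            proof -
              have "4 * real M + 4 \<noteq> 0" by linarith
              then show ?thesis by (simp add: \<theta>_def field_simps)
            qed
            finally show ?thesis .
          qed
          moreover have "4 ^ Suc m * (t ^ Suc m * t ^ Suc m) = (1 - \<theta>) ^ (2 * Suc m)"
          proof -
            have "(4 * (t * t)) ^ Suc m = ((1 - \<theta>) * (1 - \<theta>)) ^ Suc m" by (simp add: t_def)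
            then show ?thesis by (simp only: power_mult_distrib power_mult power2_eq_square)
          qed
          ultimately show ?thesis by linarith
        qed
        have z: "mass a1 b1 (\<lambda>x. Z (Suc m) (c x)) \<ge> t ^ Suc m * (b1 - a1) / 2"
          using ev4[OF m near c_continuous] Zm[of m] by linarith
        have p: "mass a2 b2 (\<lambda>x. P (Suc m) (c x)) \<ge> t ^ Suc m * (b2 - a2) / 2"
          using ev5[OF m near c_continuous] Pm[of "Suc m"] by linarith
        have n1: "0 \<le> t ^ Suc m * (b1 - a1) / 2" "0 \<le> t ^ Suc m * (b2 - a2) / 2" using t ab1 ab2 by simp_all
        have "\<alpha> * ((b1 - a1) * (b2 - a2)) / 24 = (\<alpha> * ((b1 - a1) * (b2 - a2)) / 12) * (1 / 2)" by simp
        also have "\<dots> \<le> (\<alpha> * ((b1 - a1) * (b2 - a2)) / 12) * (4 ^ Suc m * (t ^ Suc m * t ^ Suc m))"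
          using \<alpha> ab1 ab2 by (intro mult_left_mono t4) auto
        also have "\<dots> = \<alpha> * (4 ^ Suc m / 3) * ((t ^ Suc m * (b1 - a1) / 2) * (t ^ Suc m * (b2 - a2) / 2))" by simp
        also have "\<dots> \<le> \<alpha> * (4 ^ Suc m / 3) * (mass a1 b1 (\<lambda>x. Z (Suc m) (c x)) * mass a2 b2 (\<lambda>x. P (Suc m) (c x)))"
          using \<alpha> n1 z p by (intro mult_left_mono mult_mono) auto
        finally show ?thesis by (simp add: mult.assoc)
      qed
      then have "(\<Sum>m<M. \<alpha> * ((b1 - a1) * (b2 - a2)) / 24) \<le> (\<Sum>m<M. \<alpha> * (4 ^ Suc m / 3) * mass a1 b1 (\<lambda>x. Z (Suc m) (c x)) * mass a2 b2 (\<lambda>x. P (Suc m) (c x)))"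
        by (intro sum_mono) auto
      then show ?thesis using M by simp
    qed
  qed
qed

section \<open>A rotating field with singular strain\<close>

definition replace_coordinate :: "'n \<Rightarrow> real^'n \<Rightarrow> real \<Rightarrow> real^'n" where
  "replace_coordinate k x t = x + (t - x $ k) *\<^sub>R axis k 1"

lemma replace_coordinate_nth: "replace_coordinate k x t $ m = (if m = k then t else x $ m)"
  by (simp add: replace_coordinate_def axis_def)

lemma jointly_continuous_measurable:
  assumes "jointly_continuous f" "g \<in> borel_measurable M" "h \<in> borel_measurable M"
  shows "(\<lambda>x. f (g x) (h x)) \<in> borel_measurable M"
proof -
  have "(\<lambda>z. f (fst z) (snd z)) \<in> borel_measurable borel"
    using assms(1) by (auto simp: jointly_continuous_def intro: borel_measurable_continuous_onI)
  moreover have "(\<lambda>x. (g x, h x)) \<in> borel_measurable M" using assms(2,3) by (rule borel_measurable_Pair)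
  ultimately have "(\<lambda>x. (\<lambda>z. f (fst z) (snd z)) (g x, h x)) \<in> borel_measurable M"
    by (rule measurable_compose[rotated])
  then show ?thesis by simp
qed

text \<open>
  The output of \<open>planar_field\<close>, to be used in the plane of the coordinates \<open>i\<close> and \<open>j\<close>, together
  with a cutoff in each coordinate. The margins are multiples of \<open>\<delta>\<close>, since \<open>c\<close> and \<open>T\<close> move
  points by at most \<open>\<epsilon> \<le> \<delta>\<close>.
\<close>

locale rotating_field = singular_staircase \<epsilon> c T N for \<epsilon> c T N +
  fixes i j :: "'n::finite" and l h :: "real^'n" and R \<delta> \<eta> \<alpha> :: real
    and bump bump' :: "'n \<Rightarrow> real \<Rightarrow> real" and p p1 p2 q q1 w w2 D :: "real \<Rightarrow> real \<Rightarrow> real" and a b :: "real \<Rightarrow> real"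
  assumes ij: "i \<noteq> j" and \<delta>: "\<delta> > 0" "\<epsilon> \<le> \<delta>" and \<eta>: "\<eta> > 0" and \<alpha>: "\<alpha> > 0"
    and R: "\<And>k. - R \<le> l $ k \<and> h $ k \<le> R"
    and bump_facts: "\<And>k. C1 (bump k) (bump' k)" "\<And>k y. 0 \<le> bump k y \<and> bump k y \<le> 1" "\<And>k y. \<bar>bump' k y\<bar> \<le> 2 / \<delta>"
    and bump_0: "\<And>k y. y \<notin> {l $ k + \<delta><..<h $ k - \<delta>} \<Longrightarrow> bump k y = 0 \<and> bump' k y = 0"
    and bump_1: "\<And>k y. y \<in> {l $ k + 3 * \<delta>..h $ k - 3 * \<delta>} \<Longrightarrow> bump k y = 1 \<and> bump' k y = 0"
    and C1s: "\<And>y. C1 (\<lambda>z. p z y) (\<lambda>z. p1 z y)" "\<And>z. C1 (p z) (p2 z)" "\<And>t. C1 (\<lambda>z. q z t) (\<lambda>z. q1 z t)"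
      "\<And>z. C1 (q z) (\<lambda>t. D z (c t))" "\<And>t. C1 (\<lambda>y. w y t) (\<lambda>y. w2 y t)" "\<And>y. C1 (w y) (\<lambda>t. D (c t) y)"
    and jc: "jointly_continuous p" "jointly_continuous p1" "jointly_continuous p2" "jointly_continuous q"
      "jointly_continuous q1" "jointly_continuous w" "jointly_continuous w2" "jointly_continuous D"
    and pq: "\<And>z t. z \<in> {-R..R} \<Longrightarrow> t \<in> {-R..R} \<Longrightarrow> c t \<in> {-R..R} \<Longrightarrow> \<bar>p z (c t) - q z t\<bar> \<le> \<eta> \<and> \<bar>p1 z (c t) - q1 z t\<bar> \<le> \<eta>"
    and ww: "\<And>y t. y \<in> {-R..R} \<Longrightarrow> t \<in> {-R..R} \<Longrightarrow> \<bar>w y t\<bar> \<le> \<eta> \<and> \<bar>w2 y t\<bar> \<le> \<eta>"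
    and p2: "\<And>z y. \<bar>p2 z y\<bar> \<le> \<alpha> * (b z * a y + 1)"
    and ab: "continuous_on UNIV a" "continuous_on UNIV b" "\<And>x. 0 \<le> a x" "\<And>x. 0 \<le> b x"
begin

definition other_cutoffs :: "'n \<Rightarrow> real^'n \<Rightarrow> real" where
  "other_cutoffs k x = (\<Prod>m\<in>UNIV - {k}. bump m (c (x $ m)))"

definition cutoff :: "real^'n \<Rightarrow> real" where
  "cutoff x = (\<Prod>m\<in>UNIV. bump m (c (x $ m)))"

text \<open>
  Only the last argument of \<open>q\<close> is a coordinate that is not composed with \<open>c\<close>. It is the variable
  of integration in a primitive of \<open>D\<close>, and differentiation with respect to it gives an absolutely
  continuous derivative. The same holds for \<open>w\<close> in \<open>field_j\<close>.
\<close>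

definition field_i :: "real^'n \<Rightarrow> real" where
  "field_i x = p (c (x $ i)) (c (x $ j)) - q (c (x $ i)) (x $ j)"

definition field_j :: "real^'n \<Rightarrow> real" where
  "field_j x = w (c (x $ j)) (x $ i)"

definition displacement :: "real^'n \<Rightarrow> real^'n" where
  "displacement x = (\<chi> m. if m = i then cutoff x * field_i x else if m = j then cutoff x * field_j x else 0)"

definition rotation :: "real^'n \<Rightarrow> real" where
  "rotation x = D (c (x $ i)) (c (x $ j))"

text \<open>
  The density of the absolutely continuous part of the derivative of component \<open>m\<close> in direction
  \<open>k\<close>.
\<close>

definition ac_density :: "'n \<Rightarrow> 'n \<Rightarrow> real^'n \<Rightarrow> real" where
  "ac_density m k x = (if m = i \<and> k = j then - (cutoff x * rotation x)
     else if m = j \<and> k = i then cutoff x * rotation x else 0)"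

text \<open>
  The density whose image under \<open>push k\<close> is the singular part of the derivative of component \<open>m\<close>
  in direction \<open>k\<close>. It arises by differentiation with respect to \<open>c (x\<^sub>k)\<close>, after which \<open>c (x\<^sub>k)\<close>
  is replaced by \<open>x\<^sub>k\<close> and a bare coordinate \<open>x\<^sub>k\<close> by \<open>T (x\<^sub>k)\<close>, as \<open>integral_staircase_product\<close>
  prescribes.
\<close>

definition sing_density :: "'n \<Rightarrow> 'n \<Rightarrow> real^'n \<Rightarrow> real" where
  "sing_density m k x = other_cutoffs k x *
    (if m = i then
       (if k = i then bump' i (x $ i) * (p (x $ i) (c (x $ j)) - q (x $ i) (x $ j))
            + bump i (x $ i) * (p1 (x $ i) (c (x $ j)) - q1 (x $ i) (x $ j))
        else if k = j then bump' j (x $ j) * (p (c (x $ i)) (x $ j) - q (c (x $ i)) (T (x $ j)))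
            + bump j (x $ j) * p2 (c (x $ i)) (x $ j)
        else bump' k (x $ k) * field_i x)
     else if m = j then
       (if k = i then bump' i (x $ i) * w (c (x $ j)) (T (x $ i))
        else if k = j then bump' j (x $ j) * w (x $ j) (x $ i) + bump j (x $ j) * w2 (x $ j) (x $ i)
        else bump' k (x $ k) * field_j x)
     else 0)"

lemma cutoff_split: "cutoff x = other_cutoffs k x * bump k (c (x $ k))"
proof -
  have "cutoff x = bump k (c (x $ k)) * (\<Prod>m\<in>UNIV - {k}. bump m (c (x $ m)))"
    unfolding cutoff_def by (rule prod.remove) auto
  then show ?thesis by (simp add: other_cutoffs_def mult.commute)
qed

lemma other_cutoffs_replace: "other_cutoffs k (replace_coordinate k x t) = other_cutoffs k x"
  unfolding other_cutoffs_def by (intro prod.cong refl) (simp add: replace_coordinate_nth)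

lemma continuous_c_nth: "continuous_on UNIV (\<lambda>x::real^'n. c (x $ m))"
  by (rule continuous_on_compose2[OF c_continuous]) (auto intro!: continuous_intros)

lemma continuous_nth: "continuous_on UNIV (\<lambda>x::real^'n. x $ m)"
  by (intro continuous_intros)

lemma continuous_bump_c: "continuous_on UNIV (\<lambda>x::real^'n. bump m (c (x $ m)))"
  by (rule continuous_on_compose2[OF C1_cont[OF bump_facts(1)] continuous_c_nth]) simp

lemma continuous_cutoff: "continuous_on UNIV cutoff"
  unfolding cutoff_def[abs_def] by (intro continuous_on_prod continuous_bump_c)

lemma continuous_other_cutoffs: "continuous_on UNIV (other_cutoffs k)"
  unfolding other_cutoffs_def[abs_def] by (intro continuous_on_prod continuous_bump_c)

lemma continuous_fields: "continuous_on UNIV field_i" "continuous_on UNIV field_j" "continuous_on UNIV rotation"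
  unfolding field_i_def[abs_def] field_j_def[abs_def] rotation_def[abs_def]
  by (intro continuous_on_diff jointly_continuous_compose[OF jc(1)] jointly_continuous_compose[OF jc(4)]
      jointly_continuous_compose[OF jc(6)] jointly_continuous_compose[OF jc(8)] continuous_c_nth continuous_nth)+

lemma displacement_nth: "displacement x $ m = (if m = i then cutoff x * field_i x else if m = j then cutoff x * field_j x else 0)"
  by (simp add: displacement_def)

lemma continuous_displacement_nth: "continuous_on UNIV (\<lambda>x. displacement x $ m)"
proof -
  consider "m = i" | "m = j" "m \<noteq> i" | "m \<noteq> i" "m \<noteq> j" by blast
  then show ?thesis
    by cases (simp_all add: displacement_nth continuous_on_mult continuous_cutoff continuous_fields)
qed

lemma continuous_displacement: "continuous_on UNIV displacement"
proof -
  have "continuous_on UNIV (\<lambda>x. \<chi> m. displacement x $ m)"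
    by (intro continuous_on_vec_lambda continuous_displacement_nth)
  then show ?thesis by simp
qed

lemma continuous_ac_density: "continuous_on UNIV (ac_density m k)"
proof -
  consider "m = i \<and> k = j" | "\<not> (m = i \<and> k = j)" "m = j \<and> k = i" | "\<not> (m = i \<and> k = j)" "\<not> (m = j \<and> k = i)"
    by blast
  then show ?thesis
    unfolding ac_density_def[abs_def]
    by cases (auto intro!: continuous_on_mult continuous_on_minus continuous_cutoff continuous_fields)
qed

lemma other_cutoffs_bounds: "0 \<le> other_cutoffs k x" "other_cutoffs k x \<le> 1"
  unfolding other_cutoffs_def using bump_facts(2) by (auto intro!: prod_nonneg prod_le_1)

lemma cutoff_bounds: "0 \<le> cutoff x" "cutoff x \<le> 1"
  unfolding cutoff_def using bump_facts(2) by (auto intro!: prod_nonneg prod_le_1)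

lemma bump_c_nonzero:
  assumes "bump m (c t) \<noteq> 0"
  shows "t \<in> {l $ m<..<h $ m}" "c t \<in> {-R..R}" "t \<in> {-R..R}"
proof -
  have "c t \<in> {l $ m + \<delta><..<h $ m - \<delta>}" using assms bump_0 by blast
  moreover have "\<bar>c t - t\<bar> \<le> \<delta>" using c_near[of t] \<delta> by linarith
  ultimately show "t \<in> {l $ m<..<h $ m}" "c t \<in> {-R..R}" "t \<in> {-R..R}"
    using R[of m] \<delta>(1) by (auto simp: abs_le_iff)
qed

lemma bump_T_nonzero:
  assumes "bump m y \<noteq> 0 \<or> bump' m y \<noteq> 0"
  shows "y \<in> {-R..R}" "T y \<in> {-R..R}" "y \<in> {l $ m<..<h $ m}"
proof -
  have "y \<in> {l $ m + \<delta><..<h $ m - \<delta>}" using assms bump_0 by blast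
  moreover have "\<bar>T y - y\<bar> \<le> \<delta>" using T_near[of y] \<delta> by linarith
  ultimately show "y \<in> {-R..R}" "T y \<in> {-R..R}" "y \<in> {l $ m<..<h $ m}"
    using R[of m] \<delta>(1) by (auto simp: abs_le_iff)
qed

lemma other_cutoffs_nonzero:
  assumes "other_cutoffs k x \<noteq> 0" "m \<noteq> k"
  shows "bump m (c (x $ m)) \<noteq> 0"
  using assms by (auto simp: other_cutoffs_def prod_zero_iff)

lemma cutoff_nonzero: "cutoff x \<noteq> 0 \<Longrightarrow> bump m (c (x $ m)) \<noteq> 0"
  by (auto simp: cutoff_def prod_zero_iff)

lemma cutoff_outside: "x \<notin> box l h \<Longrightarrow> cutoff x = 0"
  using cutoff_nonzero bump_c_nonzero(1) by (auto simp: mem_box_cart greaterThanLessThan_iff)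

lemma displacement_outside: "x \<notin> box l h \<Longrightarrow> displacement x = 0"
  by (simp add: vec_eq_iff displacement_nth cutoff_outside)

lemma field_bounds:
  assumes "cutoff x \<noteq> 0 \<or> (\<exists>k. k \<noteq> i \<and> k \<noteq> j \<and> other_cutoffs k x \<noteq> 0)"
  shows "\<bar>field_i x\<bar> \<le> \<eta>" "\<bar>field_j x\<bar> \<le> \<eta>"
proof -
  have "bump i (c (x $ i)) \<noteq> 0" "bump j (c (x $ j)) \<noteq> 0"
    using assms cutoff_nonzero other_cutoffs_nonzero by metis+
  then show "\<bar>field_i x\<bar> \<le> \<eta>" "\<bar>field_j x\<bar> \<le> \<eta>"
    using bump_c_nonzero[of i "x $ i"] bump_c_nonzero[of j "x $ j"] pq ww unfolding field_i_def field_j_def by blast+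
qed

lemma displacement_bound: "norm (displacement x) \<le> 2 * \<eta>"
proof -
  have b: "\<bar>cutoff x * field_i x\<bar> \<le> \<eta>" "\<bar>cutoff x * field_j x\<bar> \<le> \<eta>"
  proof -
    have *: "\<bar>cutoff x * f\<bar> \<le> \<eta>" if "cutoff x \<noteq> 0 \<Longrightarrow> \<bar>f\<bar> \<le> \<eta>" for f
    proof (cases "cutoff x = 0")
      case False
      have "\<bar>cutoff x\<bar> * \<bar>f\<bar> \<le> 1 * \<eta>" by (rule mult_mono) (use that False cutoff_bounds[of x] in auto)
      then show ?thesis by (simp add: abs_mult)
    qed (use \<eta> in simp)
    show "\<bar>cutoff x * field_i x\<bar> \<le> \<eta>" "\<bar>cutoff x * field_j x\<bar> \<le> \<eta>" by (rule *, rule field_bounds, simp)+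
  qed
  have "norm (displacement x) \<le> (\<Sum>m\<in>UNIV. \<bar>displacement x $ m\<bar>)" by (rule norm_le_l1_cart)
  also have "\<dots> = (\<Sum>m\<in>{i, j}. \<bar>displacement x $ m\<bar>)"
    by (rule sum.mono_neutral_right) (auto simp: displacement_nth)
  also have "\<dots> \<le> 2 * \<eta>" using b ij by (simp add: displacement_nth)
  finally show ?thesis .
qed

lemma integrable_box_vanishing:
  assumes "continuous_on UNIV f" "\<And>x. x \<notin> box l h \<Longrightarrow> f x = (0::real)"
  shows "integrable lborel f"
  by (rule integrable_continuous_vanishing[OF assms(1), of "cbox l h"]) (use assms(2) box_subset_cbox[of l h] in auto)

lemma integrable_displacement: "integrable lborel (\<lambda>x. displacement x $ m)"
  by (rule integrable_box_vanishing[OF continuous_displacement_nth]) (simp add: displacement_outside)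

lemma integrable_ac_density: "integrable lborel (ac_density m k)"
  by (rule integrable_box_vanishing[OF continuous_ac_density]) (simp add: ac_density_def cutoff_outside)

lemma measurable_sing_density: "sing_density m k \<in> borel_measurable borel"
proof -
  have [measurable]: "other_cutoffs k \<in> borel_measurable borel" "field_i \<in> borel_measurable borel" "field_j \<in> borel_measurable borel" for k
    using continuous_other_cutoffs continuous_fields by (auto intro: borel_measurable_continuous_onI)
  have [measurable]: "bump m \<in> borel_measurable borel" "bump' m \<in> borel_measurable borel" for m
    using C1_cont[OF bump_facts(1)] C1_cont'[OF bump_facts(1)] by (auto intro: borel_measurable_continuous_onI)
  note [measurable] = jointly_continuous_measurable[OF jc(1)] jointly_continuous_measurable[OF jc(2)]
    jointly_continuous_measurable[OF jc(3)] jointly_continuous_measurable[OF jc(4)] jointly_continuous_measurable[OF jc(5)]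
    jointly_continuous_measurable[OF jc(6)] jointly_continuous_measurable[OF jc(7)]
  show ?thesis
    unfolding sing_density_def[abs_def] by measurable
qed

definition majorant :: "real^'n \<Rightarrow> real" where
  "majorant x = indicator (cbox (\<chi> m. - R) (\<chi> m. R)) x * ((2 / \<delta> + 1) * \<eta> + \<alpha> * (b (c (x $ i)) * a (x $ j) + 1))"

text \<open>
  All terms are bounded by \<open>\<eta>\<close> times the size of the cutoffs, except for the term that contains
  \<open>p2\<close>.
\<close>

lemma sing_density_bound: "\<bar>sing_density m k x\<bar> \<le> majorant x"
proof (cases "sing_density m k x = 0")
  case True
  then show ?thesis using \<delta> \<eta> \<alpha> ab by (simp add: majorant_def)
next
  case False
  have oc: "other_cutoffs k x \<noteq> 0" using False by (auto simp: sing_density_def)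
  have mi: "m = i \<or> m = j"
  proof (rule ccontr)
    assume "\<not> (m = i \<or> m = j)"
    then have "sing_density m k x = 0" by (simp add: sing_density_def)
    then show False using False by simp
  qed
  have ck: "bump k (x $ k) \<noteq> 0 \<or> bump' k (x $ k) \<noteq> 0"
  proof (rule ccontr)
    assume "\<not> (bump k (x $ k) \<noteq> 0 \<or> bump' k (x $ k) \<noteq> 0)"
    with ij have "sing_density m k x = 0" by (cases "k = i"; cases "k = j"; simp add: sing_density_def)
    then show False using False by simp
  qed
  note K = bump_T_nonzero[OF ck]
  have M: "x $ n \<in> {-R..R}" "c (x $ n) \<in> {-R..R}" if "n \<noteq> k" for n
    using bump_c_nonzero[OF other_cutoffs_nonzero[OF oc that]] by auto
  have W: "x \<in> cbox (\<chi> m. - R) (\<chi> m. R)"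
    using K(1) M(1) by (fastforce simp: mem_box_cart)
  have cc: "\<bar>bump k (x $ k)\<bar> \<le> 1" "\<bar>bump' k (x $ k)\<bar> \<le> 2 / \<delta>" using bump_facts(2,3)[of k "x $ k"] by auto
  have two: "\<bar>bump' k (x $ k) * f + bump k (x $ k) * g\<bar> \<le> (2 / \<delta> + 1) * \<eta>" if "\<bar>f\<bar> \<le> \<eta>" "\<bar>g\<bar> \<le> \<eta>" for f g
  proof -
    have "\<bar>bump' k (x $ k)\<bar> * \<bar>f\<bar> \<le> 2 / \<delta> * \<eta>"
      by (rule mult_mono) (use cc that \<delta> in auto)
    moreover have "\<bar>bump k (x $ k)\<bar> * \<bar>g\<bar> \<le> 1 * \<eta>"
      by (rule mult_mono) (use cc that \<delta> in auto)
    moreover have "\<bar>bump' k (x $ k) * f + bump k (x $ k) * g\<bar> \<le> \<bar>bump' k (x $ k)\<bar> * \<bar>f\<bar> + \<bar>bump k (x $ k)\<bar> * \<bar>g\<bar>"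
      using abs_triangle_ineq[of "bump' k (x $ k) * f" "bump k (x $ k) * g"] by (simp add: abs_mult)
    ultimately show ?thesis unfolding distrib_right by linarith
  qed
  have one: "\<bar>bump' k (x $ k) * f\<bar> \<le> (2 / \<delta> + 1) * \<eta>" if "\<bar>f\<bar> \<le> \<eta>" for f
    using two[OF that, of 0] \<eta> by simp
  have nn: "0 \<le> \<alpha> * (b (c (x $ i)) * a (x $ j) + 1)" using \<alpha> ab by simp
  have oc1: "\<bar>other_cutoffs k x * f\<bar> \<le> \<bar>f\<bar>" for f
    using other_cutoffs_bounds[of k x] mult_right_mono[of "other_cutoffs k x" 1 "\<bar>f\<bar>"] by (simp add: abs_mult)
  have fb: "\<bar>field_i x\<bar> \<le> \<eta>" "\<bar>field_j x\<bar> \<le> \<eta>" if "k \<noteq> i" "k \<noteq> j"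
    by (rule field_bounds; use that oc in blast)+
  have "\<bar>sing_density m k x\<bar> \<le> (2 / \<delta> + 1) * \<eta> + \<alpha> * (b (c (x $ i)) * a (x $ j) + 1)"
  proof -
    consider "m = i" "k = i" | "m = i" "k = j" | "m = i" "k \<noteq> i" "k \<noteq> j" | "m = j" "k = i" | "m = j" "k = j" | "m = j" "k \<noteq> i" "k \<noteq> j"
      using mi by blast
    moreover have wrap: ?thesis
      if "sing_density m k x = other_cutoffs k x * f"
        "\<bar>f\<bar> \<le> (2 / \<delta> + 1) * \<eta> + \<alpha> * (b (c (x $ i)) * a (x $ j) + 1)" for f
      unfolding that(1) using oc1[of f] that(2) by linarith
    moreover have wrap': ?thesis
      if "sing_density m k x = other_cutoffs k x * f" "\<bar>f\<bar> \<le> (2 / \<delta> + 1) * \<eta>" for f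
      by (rule wrap[OF that(1)]) (use that(2) nn in linarith)
    ultimately show ?thesis
    proof cases
      case 1
      have b: "\<bar>p (x $ i) (c (x $ j)) - q (x $ i) (x $ j)\<bar> \<le> \<eta> \<and> \<bar>p1 (x $ i) (c (x $ j)) - q1 (x $ i) (x $ j)\<bar> \<le> \<eta>"
        by (rule pq) (use K M[of j] 1 ij in auto)
      show ?thesis
        by (rule wrap'[OF _ two[OF conjunct1[OF b] conjunct2[OF b]]]) (use 1 ij in \<open>simp add: sing_density_def\<close>)
    next
      case 2
      have "\<bar>p (c (x $ i)) (c (T (x $ j))) - q (c (x $ i)) (T (x $ j))\<bar> \<le> \<eta>"
        using pq[of "c (x $ i)" "T (x $ j)"] K M[of i] 2 ij by (auto simp: c_T)
      then have 3: "\<bar>bump' j (x $ j) * (p (c (x $ i)) (x $ j) - q (c (x $ i)) (T (x $ j)))\<bar> \<le> (2 / \<delta> + 1) * \<eta>"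
        using one 2 by (simp add: c_T)
      have "\<bar>bump j (x $ j)\<bar> * \<bar>p2 (c (x $ i)) (x $ j)\<bar> \<le> 1 * (\<alpha> * (b (c (x $ i)) * a (x $ j) + 1))"
        by (rule mult_mono) (use cc 2 p2 in auto)
      then have 4: "\<bar>bump' j (x $ j) * (p (c (x $ i)) (x $ j) - q (c (x $ i)) (T (x $ j))) + bump j (x $ j) * p2 (c (x $ i)) (x $ j)\<bar>
        \<le> (2 / \<delta> + 1) * \<eta> + \<alpha> * (b (c (x $ i)) * a (x $ j) + 1)"
        using 3 by (intro order_trans[OF abs_triangle_ineq] add_mono) (simp_all add: abs_mult)
      show ?thesis by (rule wrap[OF _ 4]) (use 2 ij in \<open>simp add: sing_density_def\<close>)
    next
      case 3
      show ?thesis by (rule wrap'[OF _ one[OF fb(1)]]) (use 3 in \<open>simp_all add: sing_density_def\<close>)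
    next
      case 4
      have b: "\<bar>w (c (x $ j)) (T (x $ i))\<bar> \<le> \<eta>" using ww[of "c (x $ j)" "T (x $ i)"] K M[of j] 4 ij by auto
      show ?thesis by (rule wrap'[OF _ one[OF b]]) (use 4 ij in \<open>simp_all add: sing_density_def\<close>)
    next
      case 5
      have b: "\<bar>w (x $ j) (x $ i)\<bar> \<le> \<eta> \<and> \<bar>w2 (x $ j) (x $ i)\<bar> \<le> \<eta>"
        by (rule ww) (use K M[of i] 5 ij in auto)
      show ?thesis
        by (rule wrap'[OF _ two[OF conjunct1[OF b] conjunct2[OF b]]]) (use 5 ij in \<open>simp_all add: sing_density_def\<close>)
    next
      case 6
      show ?thesis by (rule wrap'[OF _ one[OF fb(2)]]) (use 6 ij in \<open>simp_all add: sing_density_def\<close>)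
    qed
  qed
  then show ?thesis using W by (simp add: majorant_def)
qed

lemma integrable_majorant: "integrable lborel majorant"
proof -
  have "continuous_on UNIV (\<lambda>x::real^'n. (2 / \<delta> + 1) * \<eta> + \<alpha> * (b (c (x $ i)) * a (x $ j) + 1))"
    by (intro continuous_intros continuous_on_compose2[OF ab(2) continuous_c_nth] continuous_on_compose2[OF ab(1) continuous_nth]) auto
  then have "integrable lborel (\<lambda>x::real^'n. indicator (cbox (\<chi> m. - R) (\<chi> m. R)) x *\<^sub>R ((2 / \<delta> + 1) * \<eta> + \<alpha> * (b (c (x $ i)) * a (x $ j) + 1)))"
    by (intro borel_integrable_compact compact_cbox) (auto intro: continuous_on_subset)
  then show ?thesis by (simp add: majorant_def[abs_def])
qed

lemma integrable_sing_density: "integrable lborel (sing_density m k)"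
proof (rule Bochner_Integration.integrable_bound[OF integrable_majorant])
  show "sing_density m k \<in> borel_measurable lborel" using measurable_sing_density by simp
  show "AE x in lborel. norm (sing_density m k x) \<le> norm (majorant x)"
    using order_trans[OF sing_density_bound abs_ge_self] by (intro AE_I2) simp
qed

text \<open>
  On a line in direction \<open>k\<close> the factor that depends on the bare coordinate is \<open>q\<close> for component
  \<open>i\<close> in direction \<open>j\<close>, it is \<open>w\<close> for component \<open>j\<close> in direction \<open>i\<close>, and it is absent otherwise.
\<close>

lemma displacement_line:
  "\<exists>f1 f1' f2 f2' g g'. C1 f1 f1' \<and> C1 f2 f2' \<and> C1 g g' \<and>
     (\<forall>t. displacement (replace_coordinate k x t) $ m = f1 (c t) + f2 (c t) * g t \<and>
          ac_density m k (replace_coordinate k x t) = f2 (c t) * g' t \<and>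
          sing_density m k (replace_coordinate k x t) = f1' t + f2' t * g (T t))"
proof -
  let ?O = "other_cutoffs k x"
  have cut: "cutoff (replace_coordinate k x t) = ?O * bump k (c t)" for t
    using cutoff_split[of "replace_coordinate k x t" k] other_cutoffs_replace[of k x t]
    by (simp add: replace_coordinate_nth)
  note Z = C1_const[of 0]
  note simps = displacement_nth ac_density_def sing_density_def cut other_cutoffs_replace replace_coordinate_nth field_i_def field_j_def rotation_def
  have mk: ?thesis
    if "C1 f1 f1'" "C1 f2 f2'" "C1 g g'"
      "\<And>t. displacement (replace_coordinate k x t) $ m = f1 (c t) + f2 (c t) * g t"
      "\<And>t. ac_density m k (replace_coordinate k x t) = f2 (c t) * g' t"
      "\<And>t. sing_density m k (replace_coordinate k x t) = f1' t + f2' t * g (T t)" for f1 f1' f2 f2' g g'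
    by (rule exI[of _ f1], rule exI[of _ f1'], rule exI[of _ f2], rule exI[of _ f2'], rule exI[of _ g], rule exI[of _ g'])
       (use that in simp)
  consider "m = i" "k = i" | "m = i" "k = j" | "m = i" "k \<noteq> i" "k \<noteq> j" | "m = j" "k = i" | "m = j" "k = j" | "m = j" "k \<noteq> i" "k \<noteq> j" | "m \<noteq> i" "m \<noteq> j"
    by blast
  then show ?thesis
  proof cases
    case 1
    have C: "C1 (\<lambda>z. ?O * (bump i z * (p z (c (x $ j)) - q z (x $ j))))
      (\<lambda>z. ?O * (bump' i z * (p z (c (x $ j)) - q z (x $ j)) + (p1 z (c (x $ j)) - q1 z (x $ j)) * bump i z))"
      by (intro C1_cmult C1_mult C1_diff bump_facts C1s)
    show ?thesis by (rule mk[OF C Z Z]) (use 1 ij in \<open>simp_all add: simps cut[unfolded 1(2)] algebra_simps\<close>)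
  next
    case 2
    have C: "C1 (\<lambda>y. ?O * (bump j y * p (c (x $ i)) y)) (\<lambda>y. ?O * (bump' j y * p (c (x $ i)) y + p2 (c (x $ i)) y * bump j y))"
      by (intro C1_cmult C1_mult bump_facts C1s)
    have E: "C1 (\<lambda>y. - (?O * bump j y)) (\<lambda>y. - (?O * bump' j y))" by (intro C1_minus C1_cmult bump_facts)
    have F: "C1 (q (c (x $ i))) (\<lambda>t. D (c (x $ i)) (c t))" by (rule C1s)
    show ?thesis by (rule mk[OF C E F]) (use 2 ij in \<open>simp_all add: simps cut[unfolded 2(2)] algebra_simps\<close>)
  next
    case 3
    have C: "C1 (\<lambda>y. ?O * (field_i x * bump k y)) (\<lambda>y. ?O * (field_i x * bump' k y))"
      by (intro C1_cmult bump_facts)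
    show ?thesis by (rule mk[OF C Z Z]) (use 3 in \<open>simp_all add: simps\<close>)
  next
    case 4
    have E: "C1 (\<lambda>y. ?O * bump i y) (\<lambda>y. ?O * bump' i y)" by (intro C1_cmult bump_facts)
    have F: "C1 (w (c (x $ j))) (\<lambda>t. D (c t) (c (x $ j)))" by (rule C1s)
    show ?thesis by (rule mk[OF Z E F]) (use 4 ij in \<open>simp_all add: simps cut[unfolded 4(2)] algebra_simps\<close>)
  next
    case 5
    have C: "C1 (\<lambda>y. ?O * (bump j y * w y (x $ i))) (\<lambda>y. ?O * (bump' j y * w y (x $ i) + w2 y (x $ i) * bump j y))"
      by (intro C1_cmult C1_mult bump_facts C1s)
    show ?thesis by (rule mk[OF C Z Z]) (use 5 ij in \<open>simp_all add: simps cut[unfolded 5(2)] algebra_simps\<close>)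
  next
    case 6
    have C: "C1 (\<lambda>y. ?O * (field_j x * bump k y)) (\<lambda>y. ?O * (field_j x * bump' k y))"
      by (intro C1_cmult bump_facts)
    show ?thesis by (rule mk[OF C Z Z]) (use 6 ij in \<open>simp_all add: simps\<close>)
  next
    case 7
    show ?thesis by (rule mk[OF Z Z Z]) (use 7 in \<open>simp_all add: simps\<close>)
  qed
qed

lemma distr_partial_displacement:
  assumes "test_function V \<phi>"
  shows "- (\<integral>x. displacement x $ m * partial_deriv k \<phi> x \<partial>lborel)
    = (\<integral>x. ac_density m k x * \<phi> x \<partial>lborel) + (\<integral>x. sing_density m k x * \<phi> (push k x) \<partial>lborel)"
  by (rule distr_derivative_by_lines[OF assms integrable_displacement integrable_ac_density integrable_sing_density
        displacement_line[unfolded replace_coordinate_def]])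

definition strain_density :: "'n \<Rightarrow> 'n \<Rightarrow> 'n \<Rightarrow> real^'n \<Rightarrow> real" where
  "strain_density m n k x = (if k = n then sing_density m n x / 2 else 0) + (if k = m then sing_density n m x / 2 else 0)"

lemma strain_density_sym: "strain_density m n k = strain_density n m k"
  by (auto simp: strain_density_def fun_eq_iff)

lemma integrable_strain_density: "integrable lborel (strain_density m n k)"
  unfolding strain_density_def[abs_def]
  by (cases "k = n"; cases "k = m"; simp add: integrable_sing_density)

lemma strain_density_mass: "(\<integral>x. \<bar>strain_density m n k x\<bar> \<partial>lborel) \<le> (\<integral>x. majorant x \<partial>lborel)"
proof (rule integral_mono)
  fix x
  have "\<bar>sing_density m n x\<bar> \<le> majorant x" "\<bar>sing_density n m x\<bar> \<le> majorant x" by (rule sing_density_bound)+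
  then show "\<bar>strain_density m n k x\<bar> \<le> majorant x" unfolding strain_density_def by auto
qed (use integrable_strain_density integrable_majorant in auto)

text \<open>
  The absolutely continuous parts cancel because \<open>ac_density\<close> is antisymmetric in its indices.
\<close>

lemma distr_strain_displacement:
  assumes \<phi>: "test_function V \<phi>"
  shows "- (\<integral>x. displacement x $ m * partial_deriv n \<phi> x \<partial>lborel) / 2 - (\<integral>x. displacement x $ n * partial_deriv m \<phi> x \<partial>lborel) / 2
    = (\<Sum>k\<in>UNIV. \<integral>x. strain_density m n k x * \<phi> (push k x) \<partial>lborel)"
proof -
  have i: "integrable lborel (\<lambda>x. sing_density m k x * \<phi> (push k' x))" for m k k'
    by (rule integrable_mult_bounded_borel[OF integrable_sing_density test_function_bounded_borel[OF \<phi>]]) simp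
  have "(\<integral>x. strain_density m n k x * \<phi> (push k x) \<partial>lborel)
    = (if k = n then (\<integral>x. sing_density m n x * \<phi> (push n x) \<partial>lborel) / 2 else 0)
      + (if k = m then (\<integral>x. sing_density n m x * \<phi> (push m x) \<partial>lborel) / 2 else 0)" for k
    using i by (auto simp: strain_density_def distrib_right add_divide_distrib mult.commute)
  then have "(\<Sum>k\<in>UNIV. \<integral>x. strain_density m n k x * \<phi> (push k x) \<partial>lborel)
    = (\<integral>x. sing_density m n x * \<phi> (push n x) \<partial>lborel) / 2 + (\<integral>x. sing_density n m x * \<phi> (push m x) \<partial>lborel) / 2"
    by (simp add: sum.distrib)
  moreover have "(\<integral>x. ac_density m n x * \<phi> x \<partial>lborel) + (\<integral>x. ac_density n m x * \<phi> x \<partial>lborel) = 0"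
  proof -
    have "ac_density n m x = - ac_density m n x" for x using ij by (auto simp: ac_density_def)
    then show ?thesis by simp
  qed
  ultimately show ?thesis
    using distr_partial_displacement[OF \<phi>, of m n] distr_partial_displacement[OF \<phi>, of n m] by (simp add: field_simps)
qed

end

section \<open>Cells of small strain and large rotation\<close>

lemma replace_coordinate_axis: "x + s *\<^sub>R axis k 1 = replace_coordinate k x (x $ k + s)"
  by (simp add: replace_coordinate_def)

lemma integral_box_factor:
  fixes lo hi :: "real^'n" and A :: "real^'n \<Rightarrow> real"
  assumes A: "continuous_on UNIV A" "\<And>x t. A (replace_coordinate k x t) = A x"
    and g: "continuous_on UNIV g" and lohi: "lo $ k < hi $ k"
  shows "(hi $ k - lo $ k) * (\<integral>x. indicator (cbox lo hi) x * (A x * g (x $ k)) \<partial>lborel)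
    = mass (lo $ k) (hi $ k) g * (\<integral>x. indicator (cbox lo hi) x * A x \<partial>lborel)"
proof -
  define S where "S = {x::real^'n. \<forall>m. m \<noteq> k \<longrightarrow> lo $ m \<le> x $ m \<and> x $ m \<le> hi $ m}"
  define a where "a x = indicator S x * A x" for x
  have split: "indicator (cbox lo hi) x = indicator S x * (indicator {lo $ k..hi $ k} (x $ k) :: real)" for x
    by (auto simp: indicator_def S_def mem_box_cart)
  have int: "integrable lborel (\<lambda>x. indicator (cbox lo hi) x * f x)" if "continuous_on UNIV f" for f :: "real^'n \<Rightarrow> real"
    using borel_integrable_compact[OF compact_cbox continuous_on_subset[OF that]] by simp
  have gk: "continuous_on UNIV (\<lambda>x::real^'n. g (x $ k))"
    by (rule continuous_on_compose2[OF g]) (auto intro!: continuous_intros)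
  have eq1: "a x * (indicator {lo $ k..hi $ k} (x $ k) * g (x $ k)) = indicator (cbox lo hi) x * (A x * g (x $ k))" for x
    by (simp add: a_def split)
  have eq2: "a x * indicator {lo $ k..hi $ k} (x $ k) = indicator (cbox lo hi) x * A x" for x
    by (simp add: a_def split)
  have "(\<integral>t. indicator {lo $ k..hi $ k} t \<partial>lborel) * (\<integral>x. a x * (indicator {lo $ k..hi $ k} (x $ k) * g (x $ k)) \<partial>lborel)
    = (\<integral>t. indicator {lo $ k..hi $ k} t * g t \<partial>lborel) * (\<integral>x. a x * indicator {lo $ k..hi $ k} (x $ k) \<partial>lborel)"
  proof (rule integral_coordinate_exchange)
    show "a (x + s *\<^sub>R axis k 1) = a x" for x s
      unfolding a_def replace_coordinate_axis A(2)
      by (auto simp: indicator_def S_def replace_coordinate_nth)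
    show "integrable lborel (\<lambda>t. indicator {lo $ k..hi $ k} t * g t)" by (rule integrable_indicator_interval_mult[OF g])
    show "integrable lborel (\<lambda>x. a x * (indicator {lo $ k..hi $ k} (x $ k) * g (x $ k)))"
      unfolding eq1 by (intro int continuous_on_mult A gk)
    show "integrable lborel (indicator {lo $ k..hi $ k} :: real \<Rightarrow> real)"
      using integrable_indicator_interval_mult[of "\<lambda>_. 1" "lo $ k" "hi $ k"] by simp
    show "integrable lborel (\<lambda>x. a x * indicator {lo $ k..hi $ k} (x $ k))"
      unfolding eq2 by (intro int A)
  qed
  moreover have "(\<integral>t. indicator {lo $ k..hi $ k} t \<partial>lborel) = hi $ k - lo $ k" using lohi by simp
  ultimately show ?thesis unfolding eq1 eq2 mass_def by simp
qed

lemma integral_box_two_factors: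
  fixes lo hi :: "real^'n"
  assumes ij: "i \<noteq> j" and g: "continuous_on UNIV g1" "continuous_on UNIV g2" and lohi: "\<And>m. lo $ m < hi $ m"
  shows "(hi $ i - lo $ i) * (hi $ j - lo $ j) * (\<integral>x. indicator (cbox lo hi) x * (g1 (x $ i) * g2 (x $ j)) \<partial>lborel)
    = mass (lo $ i) (hi $ i) g1 * mass (lo $ j) (hi $ j) g2 * measure lborel (cbox lo hi)"
proof -
  have c: "continuous_on UNIV (\<lambda>x::real^'n. g2 (x $ j))"
    by (rule continuous_on_compose2[OF g(2)]) (auto intro!: continuous_intros)
  have 1: "(hi $ i - lo $ i) * (\<integral>x. indicator (cbox lo hi) x * (g2 (x $ j) * g1 (x $ i)) \<partial>lborel)
    = mass (lo $ i) (hi $ i) g1 * (\<integral>x. indicator (cbox lo hi) x * g2 (x $ j) \<partial>lborel)"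
    by (rule integral_box_factor[OF c _ g(1) lohi]) (use ij in \<open>simp add: replace_coordinate_nth\<close>)
  have 2: "(hi $ j - lo $ j) * (\<integral>x. indicator (cbox lo hi) x * (1 * g2 (x $ j)) \<partial>lborel)
    = mass (lo $ j) (hi $ j) g2 * (\<integral>x. indicator (cbox lo hi) x * 1 \<partial>lborel)"
    by (rule integral_box_factor[OF continuous_on_const _ g(2) lohi]) simp
  have "(\<integral>x. indicator (cbox lo hi) x * 1 \<partial>lborel) = measure lborel (cbox lo hi)" by simp
  with 2 have 3: "(hi $ j - lo $ j) * (\<integral>x. indicator (cbox lo hi) x * g2 (x $ j) \<partial>lborel)
    = mass (lo $ j) (hi $ j) g2 * measure lborel (cbox lo hi)" by simp
  have 4: "(\<integral>x. indicator (cbox lo hi) x * (g2 (x $ j) * g1 (x $ i)) \<partial>lborel)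
    = (\<integral>x. indicator (cbox lo hi) x * (g1 (x $ i) * g2 (x $ j)) \<partial>lborel)" by (simp only: mult.commute)
  show ?thesis using 1[unfolded 4] 3 by algebra
qed

text \<open>
  Apply \<open>integral_coordinate_exchange\<close> to the indicator functions of \<open>N\<close> and of an interval,
  restricted to a large cube.
\<close>

lemma null_set_cylinder:
  fixes N :: "real set"
  assumes N: "closed N" "negligible N"
  shows "{x::real^'n. x $ k \<in> N} \<in> null_sets lborel"
proof -
  have bor: "N \<in> sets borel" using N by (intro borel_closed)
  have bcyl: "{x::real^'n. x $ k \<in> N} \<in> sets borel"
    using measurable_sets[OF measurable_vec_nth bor, of k] by (simp add: vimage_def)
  have N0: "N \<in> null_sets lborel"
    using N(2) bor by (simp add: negligible_iff_null_sets null_sets_def)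
  define Q where "Q n = cbox (\<chi> m. - real n) (\<chi> m. real n :: real^'n)" for n
  have "{x. x $ k \<in> N} \<inter> Q n \<in> null_sets lborel" if n: "n > 0" for n
  proof -
    define S where "S = {x::real^'n. \<forall>m. m \<noteq> k \<longrightarrow> - real n \<le> x $ m \<and> x $ m \<le> real n}"
    let ?I = "{- real n..real n}"
    have mQ: "Q n \<in> sets borel" by (simp add: Q_def)
    have e1: "indicator S x * indicator (N \<inter> ?I) (x $ k) = (indicator ({x. x $ k \<in> N} \<inter> Q n) x :: real)" for x
      by (auto simp: indicator_def S_def Q_def mem_box_cart)
    have e2: "indicator S x * indicator ?I (x $ k) = (indicator (Q n) x :: real)" for x
      by (auto simp: indicator_def S_def Q_def mem_box_cart)
    have iQ: "integrable lborel (indicator (Q n) :: real^'n \<Rightarrow> real)"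
      using mQ emeasure_lborel_cbox_finite by (intro integrable_real_indicator) (auto simp: Q_def)
    have iNQ: "integrable lborel (indicator ({x. x $ k \<in> N} \<inter> Q n) :: real^'n \<Rightarrow> real)"
      by (rule Bochner_Integration.integrable_bound[OF iQ])
         (use bcyl mQ in \<open>auto simp: indicator_def\<close>)
    have i1: "integrable lborel (indicator ?I :: real \<Rightarrow> real)"
      using integrable_indicator_interval_mult[of "\<lambda>_. 1" "- real n" "real n"] by simp
    have i2: "integrable lborel (indicator (N \<inter> ?I) :: real \<Rightarrow> real)"
      by (rule Bochner_Integration.integrable_bound[OF i1]) (use bor in \<open>auto simp: indicator_def\<close>)
    have "(\<integral>t. indicator ?I t \<partial>lborel) * (\<integral>x. indicator S x * indicator (N \<inter> ?I) (x $ k) \<partial>lborel)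
      = (\<integral>t. indicator (N \<inter> ?I) t \<partial>lborel) * (\<integral>x. indicator S x * indicator ?I (x $ k) \<partial>lborel :: real)"
    proof (rule integral_coordinate_exchange[OF _ i2 _ i1])
      show "indicator S (x + s *\<^sub>R axis k 1) = (indicator S x :: real)" for x s
        unfolding replace_coordinate_axis by (auto simp: indicator_def S_def replace_coordinate_nth)
      show "integrable lborel (\<lambda>x. indicator S x * indicator (N \<inter> ?I) (x $ k) :: real)" unfolding e1 by (rule iNQ)
      show "integrable lborel (\<lambda>x. indicator S x * indicator ?I (x $ k) :: real)" unfolding e2 by (rule iQ)
    qed
    moreover have "(\<integral>t. indicator (N \<inter> ?I) t \<partial>lborel) = (0::real)"
    proof -
      have "N \<inter> ?I \<in> null_sets lborel" using N0 by (intro null_set_Int2) auto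
      then show ?thesis by (simp add: null_sets_def measure_def)
    qed
    ultimately have "(\<integral>x. indicator ({x. x $ k \<in> N} \<inter> Q n) x \<partial>lborel) = (0::real)"
      unfolding e1 using n by simp
    then have "measure lborel ({x. x $ k \<in> N} \<inter> Q n) = 0" by simp
    moreover have "emeasure lborel ({x. x $ k \<in> N} \<inter> Q n) \<noteq> \<infinity>"
    proof -
      have "emeasure lborel ({x. x $ k \<in> N} \<inter> Q n) \<le> emeasure lborel (Q n)"
        using mQ by (intro emeasure_mono) auto
      also have "\<dots> < \<infinity>" unfolding Q_def by (rule emeasure_lborel_cbox_finite)
      finally show ?thesis by simp
    qed
    ultimately have "emeasure lborel ({x. x $ k \<in> N} \<inter> Q n) = 0" by (simp add: measure_eq_0_null_sets emeasure_eq_ennreal_measure)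
    then show ?thesis using bcyl mQ by auto
  qed
  then have "(\<Union>n. {x. x $ k \<in> N} \<inter> Q (Suc n)) \<in> null_sets lborel" by (intro null_sets_UN) auto
  moreover have "(\<Union>n. {x. x $ k \<in> N} \<inter> Q (Suc n)) = {x. x $ k \<in> N}"
  proof -
    have "\<exists>n. x \<in> Q (Suc n)" for x
    proof -
      obtain n :: nat where n: "norm x \<le> real n" using real_arch_simple by blast
      have "- real (Suc n) \<le> x $ m \<and> x $ m \<le> real (Suc n)" for m
        using component_le_norm_cart[of x m] n by (simp add: abs_le_iff)
      then have "x \<in> Q (Suc n)" by (simp only: Q_def mem_box_cart vec_lambda_beta) blast
      then show ?thesis by blast
    qed
    then show ?thesis by blast
  qed
  ultimately show ?thesis by simp
qed

context rotating_field
begin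

definition inner_box :: "(real^'n) set" where
  "inner_box = box (\<chi> m. l $ m + 4 * \<delta>) (\<chi> m. h $ m - 4 * \<delta>)"

lemma inner_box_subset: "inner_box \<subseteq> box l h"
proof
  fix x assume "x \<in> inner_box"
  then have "l $ m + 4 * \<delta> < x $ m \<and> x $ m < h $ m - 4 * \<delta>" for m
    by (auto simp: inner_box_def mem_box_cart)
  then have "l $ m < x $ m \<and> x $ m < h $ m" for m using \<delta> by (smt (verit))
  then show "x \<in> box l h" by (auto simp: mem_box_cart)
qed

lemma bump_inner: "x \<in> inner_box \<Longrightarrow> bump m (c (x $ m)) = 1"
proof -
  assume "x \<in> inner_box"
  then have "l $ m + 4 * \<delta> < x $ m \<and> x $ m < h $ m - 4 * \<delta>" by (auto simp: inner_box_def mem_box_cart)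
  then have "c (x $ m) \<in> {l $ m + 3 * \<delta>..h $ m - 3 * \<delta>}" using c_near[of "x $ m"] \<delta> by (auto simp: abs_le_iff)
  then show ?thesis using bump_1 by blast
qed

lemma cutoff_inner: "x \<in> inner_box \<Longrightarrow> cutoff x = 1"
  unfolding cutoff_def by (rule prod.neutral) (auto simp: bump_inner)

lemma sing_density_inner: "push i x \<in> inner_box \<Longrightarrow> sing_density j i x = 0"
proof -
  assume "push i x \<in> inner_box"
  then have "l $ i + 4 * \<delta> < push i x $ i \<and> push i x $ i < h $ i - 4 * \<delta>" by (auto simp: inner_box_def mem_box_cart)
  then have "l $ i + 4 * \<delta> < T (x $ i) \<and> T (x $ i) < h $ i - 4 * \<delta>" by (simp add: push_nth)
  then have "x $ i \<in> {l $ i + 3 * \<delta>..h $ i - 3 * \<delta>}" using T_near[of "x $ i"] \<delta> by (auto simp: abs_le_iff)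
  then have "bump' i (x $ i) = 0" using bump_1 by blast
  then show ?thesis using ij by (simp add: sing_density_def)
qed

lemma distr_partial_inner:
  assumes \<phi>: "test_function inner_box \<phi>"
  shows "- (\<integral>x. displacement x $ j * partial_deriv i \<phi> x \<partial>lborel) = (\<integral>x. rotation x * \<phi> x \<partial>lborel)"
proof -
  obtain K where K: "K \<subseteq> inner_box" "\<And>x. x \<notin> K \<Longrightarrow> \<phi> x = 0" using test_function_support[OF \<phi>] by metis
  have A: "(\<lambda>x. ac_density j i x * \<phi> x) = (\<lambda>x. rotation x * \<phi> x)"
  proof
    fix x show "ac_density j i x * \<phi> x = rotation x * \<phi> x"
      using K cutoff_inner[of x] ij by (cases "x \<in> K") (auto simp: ac_density_def)
  qed
  have B: "(\<lambda>x. sing_density j i x * \<phi> (push i x)) = (\<lambda>x. 0)"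
  proof
    fix x show "sing_density j i x * \<phi> (push i x) = 0"
      using K sing_density_inner[of x] by (cases "push i x \<in> K") auto
  qed
  show ?thesis using distr_partial_displacement[OF \<phi>, of j i] unfolding A B by simp
qed

text \<open>
  Near a point none of whose coordinates lies in \<open>N\<close>, the composed coordinates are constant and
  the cutoff is 1. There the field depends only on the bare coordinates in \<open>q\<close> and \<open>w\<close>, whose
  derivatives are \<open>rotation x\<close>.
\<close>

lemma displacement_derivative:
  assumes x: "x \<in> inner_box" and xN: "\<And>m. x $ m \<notin> N"
  shows "\<exists>L. (displacement has_derivative (\<lambda>v. L *v v)) (at x) \<and> L $ j $ i = rotation x"
proof -
  define ci cj where "ci = c (x $ i)" and "cj = c (x $ j)"
  define F :: "real^'n \<Rightarrow> real^'n" where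
    "F y = (p ci cj - q ci (y $ j)) *\<^sub>R axis i 1 + w cj (y $ i) *\<^sub>R axis j 1" for y
  define L :: "real^'n^'n" where
    "L = (\<chi> m n. if m = i \<and> n = j then - rotation x else if m = j \<and> n = i then rotation x else 0)"
  have nth: "((\<lambda>y::real^'n. y $ m) has_derivative (\<lambda>v. v $ m)) (at x)" for m
    by (rule bounded_linear_imp_has_derivative[OF bounded_linear_vec_nth])
  have dq: "((\<lambda>y::real^'n. q ci (y $ j)) has_derivative (\<lambda>v. rotation x * v $ j)) (at x)"
    using has_derivative_compose[OF nth C1_deriv[OF C1s(4)[of ci], unfolded has_field_derivative_def]]
    by (simp add: rotation_def ci_def)
  have dw: "((\<lambda>y::real^'n. w cj (y $ i)) has_derivative (\<lambda>v. rotation x * v $ i)) (at x)"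
    using has_derivative_compose[OF nth C1_deriv[OF C1s(6)[of cj], unfolded has_field_derivative_def]]
    by (simp add: rotation_def cj_def)
  have dF: "(F has_derivative (\<lambda>v. (0 - rotation x * v $ j) *\<^sub>R axis i 1 + (rotation x * v $ i) *\<^sub>R axis j 1)) (at x)"
    unfolding F_def
    by (intro has_derivative_add has_derivative_scaleR_left has_derivative_diff has_derivative_const dq dw)
  have Leq: "(\<lambda>v. (0 - rotation x * v $ j) *\<^sub>R axis i 1 + (rotation x * v $ i) *\<^sub>R axis j 1) = (\<lambda>v. L *v v)"
  proof
    fix v :: "real^'n"
    have row: "(L *v v) $ m = (if m = i then - rotation x * v $ j else if m = j then rotation x * v $ i else 0)" for m
    proof -
      have "(L *v v) $ m = (\<Sum>n\<in>UNIV. (if m = i \<and> n = j then - rotation x else if m = j \<and> n = i then rotation x else 0) * v $ n)"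
        by (simp add: matrix_vector_mult_def L_def)
      also have "\<dots> = (\<Sum>n\<in>UNIV. if n = j then (if m = i then - rotation x * v $ j else 0) else if n = i then (if m = j then rotation x * v $ i else 0) else 0)"
        using ij by (intro sum.cong) auto
      also have "\<dots> = (\<Sum>n\<in>{i, j}. if n = j then (if m = i then - rotation x * v $ j else 0) else if n = i then (if m = j then rotation x * v $ i else 0) else 0)"
        by (rule sum.mono_neutral_right) auto
      finally show ?thesis using ij by auto
    qed
    show "(0 - rotation x * v $ j) *\<^sub>R axis i 1 + (rotation x * v $ i) *\<^sub>R axis j 1 = L *v v"
      using ij by (auto simp: vec_eq_iff row axis_def)
  qed
  have near: "\<forall>\<^sub>F y in nhds x. displacement y = F y"
  proof -
    have ev: "\<forall>\<^sub>F y in nhds x. c (y $ m) = c (x $ m)" for m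
    proof -
      have "filterlim (\<lambda>y::real^'n. y $ m) (nhds (x $ m)) (nhds x)"
        by (intro tendsto_vec_nth filterlim_ident)
      then show ?thesis using c_locally_constant[OF xN[of m]] by (rule eventually_compose_filterlim[rotated])
    qed
    have 1: "\<forall>\<^sub>F y in nhds x. c (y $ i) = ci \<and> c (y $ j) = cj"
      unfolding ci_def cj_def by (intro eventually_conj ev)
    have 2: "\<forall>\<^sub>F y in nhds x. y \<in> inner_box"
      using x by (intro eventually_nhds_in_open) (auto simp: inner_box_def)
    show ?thesis using 1 2
    proof eventually_elim
      case (elim y)
      then show ?case using ij
        by (auto simp: vec_eq_iff displacement_nth cutoff_inner field_i_def field_j_def F_def axis_def)
    qed
  qed
  then obtain U where U: "open U" "x \<in> U" "\<And>y. y \<in> U \<Longrightarrow> displacement y = F y" unfolding eventually_nhds by blast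
  have "(displacement has_derivative (\<lambda>v. L *v v)) (at x)"
    by (rule has_derivative_transform_within_open[OF dF[unfolded Leq] U(1,2)]) (simp add: U(3))
  moreover have "L $ j $ i = rotation x" using ij by (simp add: L_def)
  ultimately show ?thesis by blast
qed

definition singular_set :: "(real^'n) set" where
  "singular_set = (\<Union>m. {x. x $ m \<in> N})"

lemma singular_set_null: "singular_set \<in> null_sets lborel"
proof -
  have "(\<Union>m\<in>(UNIV::'n set). {x::real^'n. x $ m \<in> N}) \<in> null_sets lborel"
    by (intro null_sets_UN' null_set_cylinder N_closed N_negligible) auto
  then show ?thesis by (simp add: singular_set_def)
qed

text \<open>
  This is what makes the strain singular.
\<close>

lemma push_in_singular_set: "push k x \<in> singular_set"
proof -
  have "push k x $ k \<in> N" using T_in_N[of "x $ k"] push_nth[of k x k] by simp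
  then show ?thesis unfolding singular_set_def by blast
qed

text \<open>
  The means of \<open>a\<close> and of \<open>b \<circ> c\<close> over \<open>[- R, R]\<close> are at most \<open>3/2\<close>. As they depend on different
  coordinates, the mean of their product is at most \<open>9/4 \<le> 3\<close>.
\<close>

lemma majorant_integral:
  assumes R0: "R > 0" and ma: "mass (-R) R a \<le> 3 * R" and mb: "mass (-R) R (\<lambda>x. b (c x)) \<le> 3 * R"
  shows "(\<integral>x. majorant x \<partial>lborel) \<le> ((2 / \<delta> + 1) * \<eta> + 4 * \<alpha>) * measure lborel (cbox (\<chi> m. - R) (\<chi> m. R :: real^'n))"
proof -
  let ?W = "cbox (\<chi> m. - R) (\<chi> m. R :: real^'n)"
  let ?E = "\<integral>x. indicator ?W x * (b (c (x $ i)) * a (x $ j)) \<partial>lborel"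
  have cont: "continuous_on UNIV (\<lambda>x::real^'n. b (c (x $ i)) * a (x $ j))"
    by (intro continuous_intros continuous_on_compose2[OF ab(2) continuous_c_nth] continuous_on_compose2[OF ab(1) continuous_nth]) auto
  have i1: "integrable lborel (\<lambda>x. indicator ?W x * (b (c (x $ i)) * a (x $ j)))"
    using borel_integrable_compact[OF compact_cbox continuous_on_subset[OF cont]] by simp
  have i2: "integrable lborel (\<lambda>x. indicator ?W x * (1::real))"
    using borel_integrable_compact[of ?W "\<lambda>_. 1::real"] by simp
  have E: "(2 * R) * (2 * R) * ?E = mass (-R) R (\<lambda>x. b (c x)) * mass (-R) R a * measure lborel ?W"
    using integral_box_two_factors[OF ij continuous_on_compose2[OF ab(2) c_continuous] ab(1), of "\<chi> m. - R" "\<chi> m. R"] R0 by simp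
  have m0: "0 \<le> mass (-R) R a" unfolding mass_def using ab by (intro Bochner_Integration.integral_nonneg) auto
  have "mass (-R) R (\<lambda>x. b (c x)) * mass (-R) R a \<le> (3 * R) * (3 * R)"
    by (rule mult_mono) (use ma mb m0 R0 in auto)
  then have "(2 * R) * (2 * R) * ?E \<le> (3 * R) * (3 * R) * measure lborel ?W"
    unfolding E by (rule mult_right_mono) simp
  also have "\<dots> \<le> (2 * R) * (2 * R) * (3 * measure lborel ?W)"
    using R0 by (simp add: mult_mono)
  finally have E3: "?E \<le> 3 * measure lborel ?W" using R0 by simp
  have "majorant x = ((2 / \<delta> + 1) * \<eta> + \<alpha>) * (indicator ?W x * 1) + \<alpha> * (indicator ?W x * (b (c (x $ i)) * a (x $ j)))" for x
    by (simp add: majorant_def algebra_simps)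
  then have "(\<integral>x. majorant x \<partial>lborel) = ((2 / \<delta> + 1) * \<eta> + \<alpha>) * (\<integral>x. indicator ?W x * 1 \<partial>lborel) + \<alpha> * ?E"
    using i1 i2 by simp
  also have "(\<integral>x. indicator ?W x * 1 \<partial>lborel) = measure lborel ?W" by simp
  also have "((2 / \<delta> + 1) * \<eta> + \<alpha>) * measure lborel ?W + \<alpha> * ?E
      \<le> ((2 / \<delta> + 1) * \<eta> + \<alpha>) * measure lborel ?W + \<alpha> * (3 * measure lborel ?W)"
    using \<alpha> E3 by (intro add_left_mono mult_left_mono) auto
  also have "\<dots> = ((2 / \<delta> + 1) * \<eta> + 4 * \<alpha>) * measure lborel ?W" by (simp add: algebra_simps)
  finally show ?thesis .
qed

lemma rotation_integral:
  fixes M :: nat and d :: "nat \<Rightarrow> real" and Z P :: "nat \<Rightarrow> real \<Rightarrow> real" and lo hi :: "real^'n"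
  assumes lohi: "\<And>m. lo $ m < hi $ m" and sub: "cbox lo hi \<subseteq> inner_box"
    and D: "\<And>x y. \<bar>D (c x) (c y)\<bar> \<ge> (\<Sum>m<M. d m * Z m x * P m y)"
    and ZP: "\<And>m. continuous_on UNIV (Z m)" "\<And>m. continuous_on UNIV (P m)"
    and tot: "(\<Sum>m<M. d m * mass (lo $ i) (hi $ i) (Z m) * mass (lo $ j) (hi $ j) (P m))
      \<ge> (hi $ i - lo $ i) * (hi $ j - lo $ j) / measure lborel (cbox lo hi)"
  shows "(\<integral>x. indicator inner_box x * \<bar>rotation x\<bar> \<partial>lborel) \<ge> 1"
proof -
  let ?V = "measure lborel (cbox lo hi)" and ?L = "(hi $ i - lo $ i) * (hi $ j - lo $ j)"
  have V: "?V > 0"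
  proof -
    have "cbox lo hi \<noteq> {}" using lohi by (auto simp: interval_ne_empty_cart less_imp_le)
    then have "?V = (\<Prod>m\<in>UNIV. hi $ m - lo $ m)" by (rule content_cbox_cart)
    then show ?thesis using lohi by (simp add: prod_pos)
  qed
  have L: "?L > 0" using lohi[of i] lohi[of j] by simp
  have ZPc: "continuous_on UNIV (\<lambda>x::real^'n. Z m (x $ i) * P m (x $ j))" for m
    by (intro continuous_on_mult continuous_on_compose2[OF ZP(1)] continuous_on_compose2[OF ZP(2)] continuous_nth) auto
  have i1: "integrable lborel (\<lambda>x. indicator (cbox lo hi) x * (Z m (x $ i) * P m (x $ j)))" for m
    using borel_integrable_compact[OF compact_cbox continuous_on_subset[OF ZPc]] by simp
  have absr: "continuous_on UNIV (\<lambda>x. \<bar>rotation x\<bar>)" by (intro continuous_intros continuous_fields)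
  have i2: "integrable lborel (\<lambda>x. indicator inner_box x * \<bar>rotation x\<bar>)"
  proof (rule Bochner_Integration.integrable_bound)
    show "integrable lborel (\<lambda>x. indicator (cbox l h) x * \<bar>rotation x\<bar>)"
      using borel_integrable_compact[OF compact_cbox continuous_on_subset[OF absr]] by simp
    show "(\<lambda>x. indicator inner_box x * \<bar>rotation x\<bar>) \<in> borel_measurable lborel"
      using borel_measurable_continuous_onI[OF absr] by (auto simp: inner_box_def intro!: borel_measurable_times)
    show "AE x in lborel. norm (indicator inner_box x * \<bar>rotation x\<bar>) \<le> norm (indicator (cbox l h) x * \<bar>rotation x\<bar>)"
      using inner_box_subset box_subset_cbox[of l h] by (intro AE_I2) (auto simp: indicator_def)
  qed
  have I: "(\<integral>x. indicator (cbox lo hi) x * (Z m (x $ i) * P m (x $ j)) \<partial>lborel)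
      = mass (lo $ i) (hi $ i) (Z m) * mass (lo $ j) (hi $ j) (P m) * ?V / ?L" for m
    using integral_box_two_factors[OF ij ZP(1)[of m] ZP(2)[of m] lohi] L by (simp add: field_simps)
  have "y / v * (v / y) = 1" if "v > 0" "y > 0" for v y :: real using that by simp
  from this[OF V L] have "1 = ?L / ?V * (?V / ?L)" by simp
  also have "\<dots> \<le> (\<Sum>m<M. d m * mass (lo $ i) (hi $ i) (Z m) * mass (lo $ j) (hi $ j) (P m)) * (?V / ?L)"
    using tot V L by (intro mult_right_mono) auto
  also have "\<dots> = (\<Sum>m<M. d m * (\<integral>x. indicator (cbox lo hi) x * (Z m (x $ i) * P m (x $ j)) \<partial>lborel))"
    unfolding I sum_distrib_right by (intro sum.cong) auto
  also have "\<dots> = (\<integral>x. (\<Sum>m<M. d m * (indicator (cbox lo hi) x * (Z m (x $ i) * P m (x $ j)))) \<partial>lborel)"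
    using i1 by (simp add: Bochner_Integration.integral_sum)
  also have "\<dots> \<le> (\<integral>x. indicator inner_box x * \<bar>rotation x\<bar> \<partial>lborel)"
  proof (rule integral_mono[OF _ i2])
    show "integrable lborel (\<lambda>x. \<Sum>m<M. d m * (indicator (cbox lo hi) x * (Z m (x $ i) * P m (x $ j))))" using i1 by simp
    fix x :: "real^'n"
    show "(\<Sum>m<M. d m * (indicator (cbox lo hi) x * (Z m (x $ i) * P m (x $ j)))) \<le> indicator inner_box x * \<bar>rotation x\<bar>"
      using D[of "x $ i" "x $ j"] sub by (cases "x \<in> cbox lo hi") (auto simp: rotation_def mult.assoc)
  qed
  finally show ?thesis .
qed

end

text \<open>
  The properties of a rotating field that the final argument uses: the strain consists of images
  of small densities under maps into the null set \<open>S\<close>, and the entry \<open>(j, i)\<close> of the gradient is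
  \<open>D\<close> on the open set \<open>Q\<close>, both in the sense of distributions and pointwise off \<open>S\<close>.
\<close>

locale rotation_cell =
  fixes i j :: "'n::finite" and l h :: "real^'n" and \<eta> :: real
    and u :: "real^'n \<Rightarrow> real^'n" and f :: "'n \<Rightarrow> 'n \<Rightarrow> 'n \<Rightarrow> real^'n \<Rightarrow> real"
    and \<tau> :: "'n \<Rightarrow> real^'n \<Rightarrow> real^'n" and S Q :: "(real^'n) set" and D :: "real^'n \<Rightarrow> real"
  assumes continuous: "continuous_on UNIV u" and outside: "\<And>x. x \<notin> box l h \<Longrightarrow> u x = 0"
    and small: "\<And>x. norm (u x) \<le> \<eta>"
    and integrable_strain: "\<And>m n k. integrable lborel (f m n k)"
    and strain_mass: "\<And>m n k. (\<integral>x. \<bar>f m n k x\<bar> \<partial>lborel) \<le> \<eta>"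
    and strain_sym: "\<And>m n k. f m n k = f n m k"
    and measurable_pushes: "\<And>k. \<tau> k \<in> borel_measurable borel"
    and pushes_in: "\<And>k x. \<tau> k x \<in> S" and null: "S \<in> null_sets lborel"
    and distr_strain: "\<And>V \<phi> m n. test_function V \<phi> \<Longrightarrow>
      - (\<integral>x. u x $ m * partial_deriv n \<phi> x \<partial>lborel) / 2 - (\<integral>x. u x $ n * partial_deriv m \<phi> x \<partial>lborel) / 2
      = (\<Sum>k\<in>UNIV. \<integral>x. f m n k x * \<phi> (\<tau> k x) \<partial>lborel)"
    and core: "open Q" "Q \<subseteq> box l h"
    and continuous_rotation: "continuous_on UNIV D"
    and large_rotation: "(\<integral>x. indicator Q x * \<bar>D x\<bar> \<partial>lborel) \<ge> 1"
    and differentiable: "\<And>x. x \<in> Q \<Longrightarrow> x \<notin> S \<Longrightarrow> \<exists>L. (u has_derivative (\<lambda>v. L *v v)) (at x) \<and> L $ j $ i = D x"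
    and distr_rotation: "\<And>\<phi>. test_function Q \<phi> \<Longrightarrow>
      - (\<integral>x. u x $ j * partial_deriv i \<phi> x \<partial>lborel) = (\<integral>x. D x * \<phi> x \<partial>lborel)"

lemma ex_rotation_cell:
  fixes l h :: "real^'n"
  assumes ij: "i \<noteq> j" and lh: "\<And>m. l $ m < h $ m" and \<eta>: "\<eta> > 0"
  shows "\<exists>u f \<tau> S Q D. rotation_cell i j l h \<eta> u f \<tau> S Q D"
proof -
  obtain \<delta> where \<delta>: "\<delta> > 0" "\<And>m. 20 * \<delta> \<le> h $ m - l $ m"
  proof -
    let ?G = "range (\<lambda>m. h $ m - l $ m)"
    have "Min ?G > 0" using lh by (subst Min_gr_iff) auto
    moreover have "Min ?G \<le> h $ m - l $ m" for m by (rule Min_le) auto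
    ultimately show ?thesis by (intro that[of "Min ?G / 20"]) auto
  qed
  define R where "R = norm l + norm h + 1"
  have R0: "R > 0" by (simp add: R_def add_nonneg_pos)
  have R: "- R \<le> l $ m \<and> h $ m \<le> R" for m
    using component_le_norm_cart[of l m] component_le_norm_cart[of h m] norm_ge_zero[of l] norm_ge_zero[of h]
    unfolding R_def abs_le_iff by linarith
  \<comment> \<open>inside the box where the cutoff is 1, which has the margin \<open>4 * \<delta>\<close>\<close>
  define lo hi :: "real^'n" where "lo = (\<chi> m. l $ m + 5 * \<delta>)" and "hi = (\<chi> m. h $ m - 5 * \<delta>)"
  have lohi: "lo $ m < hi $ m" for m using \<delta>(1) \<delta>(2)[of m] by (simp add: lo_def hi_def)
  have sub: "{lo $ m..hi $ m} \<subseteq> {-R..R}" for m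
    using R[of m] \<delta>(1) by (auto simp: lo_def hi_def)
  let ?W = "measure lborel (cbox (\<chi> m. - R) (\<chi> m. R :: real^'n))"
  have W0: "?W \<ge> 0" by simp
  \<comment> \<open>\<open>\<alpha>\<close> and \<open>\<eta>'\<close> are such that the bound of \<open>majorant_integral\<close> is at most \<open>\<eta>\<close>\<close>
  define \<alpha> where "\<alpha> = \<eta> / (8 * (?W + 1))"
  define \<eta>' where "\<eta>' = min (\<eta> / 2) (\<eta> / (2 * (2 / \<delta> + 1) * (?W + 1)))"
  have \<alpha>: "\<alpha> > 0" unfolding \<alpha>_def using \<eta> W0 by (intro divide_pos_pos mult_pos_pos) linarith+
  have dd: "2 / \<delta> + 1 > 0" using \<delta>(1) by (simp add: add_pos_pos)
  have W1: "?W + 1 > 0" using W0 by linarith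
  have "\<eta> / (2 * (2 / \<delta> + 1) * (?W + 1)) > 0"
    by (intro divide_pos_pos mult_pos_pos \<eta> dd W1) simp
  moreover have "\<eta> / 2 > 0" using \<eta> by simp
  ultimately have \<eta>': "\<eta>' > 0" unfolding \<eta>'_def min_less_iff_conj by blast
  have small: "((2 / \<delta> + 1) * \<eta>' + 4 * \<alpha>) * ?W \<le> \<eta>"
  proof -
    have cancel: "y * (e / (2 * y * v)) * v = e / 2" if "y > 0" "v > 0" for y e v :: real using that by simp
    have cancel': "4 * (e / (8 * v)) * v = e / 2" if "v > 0" for e v :: real using that by simp
    have "((2 / \<delta> + 1) * \<eta>' + 4 * \<alpha>) * ?W \<le> ((2 / \<delta> + 1) * \<eta>' + 4 * \<alpha>) * (?W + 1)"
      using \<alpha> \<eta>' dd by (intro mult_left_mono) auto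
    also have "\<dots> = (2 / \<delta> + 1) * \<eta>' * (?W + 1) + 4 * \<alpha> * (?W + 1)" by (simp only: distrib_right)
    also have "\<dots> \<le> (2 / \<delta> + 1) * (\<eta> / (2 * (2 / \<delta> + 1) * (?W + 1))) * (?W + 1) + 4 * \<alpha> * (?W + 1)"
      using dd W1 by (intro add_right_mono mult_right_mono mult_left_mono) (auto simp: \<eta>'_def)
    also have "\<dots> = \<eta> / 2 + \<eta> / 2" unfolding \<alpha>_def cancel[OF dd W1] cancel'[OF W1] ..
    finally show ?thesis by simp
  qed
  \<comment> \<open>normalised so that the other coordinates, which contribute the remaining factors of the
    volume, leave an integral of at least 1\<close>
  define \<Lambda> where "\<Lambda> = (hi $ i - lo $ i) * (hi $ j - lo $ j) / measure lborel (cbox lo hi)"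
  obtain \<epsilon> c T N p p1 p2 q q1 w w2 D a b M d Z P where
    st: "singular_staircase \<epsilon> c T N" "\<epsilon> \<le> \<delta>"
    and C1s: "\<And>y. C1 (\<lambda>z. p z y) (\<lambda>z. p1 z y)" "\<And>z. C1 (p z) (p2 z)" "\<And>t. C1 (\<lambda>z. q z t) (\<lambda>z. q1 z t)"
    "\<And>z. C1 (q z) (\<lambda>t. D z (c t))" "\<And>t. C1 (\<lambda>y. w y t) (\<lambda>y. w2 y t)" "\<And>y. C1 (w y) (\<lambda>t. D (c t) y)"
    and jc: "jointly_continuous p" "jointly_continuous p1" "jointly_continuous p2" "jointly_continuous q"
    "jointly_continuous q1" "jointly_continuous w" "jointly_continuous w2" "jointly_continuous D"
    and pq: "\<And>z t. z \<in> {-R..R} \<Longrightarrow> t \<in> {-R..R} \<Longrightarrow> c t \<in> {-R..R} \<Longrightarrow> \<bar>p z (c t) - q z t\<bar> \<le> \<eta>' \<and> \<bar>p1 z (c t) - q1 z t\<bar> \<le> \<eta>'"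
    and ww: "\<And>y t. y \<in> {-R..R} \<Longrightarrow> t \<in> {-R..R} \<Longrightarrow> \<bar>w y t\<bar> \<le> \<eta>' \<and> \<bar>w2 y t\<bar> \<le> \<eta>'"
    and p2: "\<And>z y. \<bar>p2 z y\<bar> \<le> \<alpha> * (b z * a y + 1)" and ab: "continuous_on UNIV a" "continuous_on UNIV b"
    "\<And>x. 0 \<le> a x" "\<And>x. 0 \<le> b x" and mass: "mass (-R) R a \<le> 3 * R" "mass (-R) R (\<lambda>x. b (c x)) \<le> 3 * R"
    and D: "\<And>x y. \<bar>D (c x) (c y)\<bar> \<ge> (\<Sum>m<M. d m * Z m x * P m y)"
    and ZP: "\<And>m::nat. continuous_on UNIV (Z m)" "\<And>m. continuous_on UNIV (P m)"
    and tot: "(\<Sum>m<M. d m * mass (lo $ i) (hi $ i) (Z m) * mass (lo $ j) (hi $ j) (P m)) \<ge> \<Lambda>"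
    by (rule planar_field[OF R0 sub lohi sub lohi \<delta>(1) \<eta>' \<alpha>]) (rule that; assumption)
  \<comment> \<open>the coefficients of the two affine maps in the cutoff\<close>
  define A B where "A m = - (l $ m + 2 * \<delta>) / \<delta>" and "B m = (h $ m - 2 * \<delta>) / \<delta>" for m
  define bump where "bump m y = smooth_step (1 / \<delta> * y + A m) * smooth_step (- (1 / \<delta>) * y + B m)" for m y
  define bump' where "bump' m y = (1 / \<delta> * smooth_step' (1 / \<delta> * y + A m)) * smooth_step (- (1 / \<delta>) * y + B m)
    + (- (1 / \<delta>) * smooth_step' (- (1 / \<delta>) * y + B m)) * smooth_step (1 / \<delta> * y + A m)" for m y
  have AB: "1 / \<delta> * y + A m = (y - (l $ m + 2 * \<delta>)) / \<delta>" "- (1 / \<delta>) * y + B m = (h $ m - 2 * \<delta> - y) / \<delta>" for m y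
    using \<delta>(1) by (simp_all add: A_def B_def field_simps)
  have ss': "0 \<le> smooth_step' s \<and> smooth_step' s \<le> 1" for s
    by (auto simp: smooth_step'_def max_def)
  have rf: "rotating_field \<epsilon> c T N i j l h R \<delta> \<eta>' \<alpha> bump bump' p p1 p2 q q1 w w2 D a b"
  proof (intro rotating_field.intro st(1) rotating_field_axioms.intro ij \<delta>(1) st(2) \<eta>' \<alpha> R C1s jc pq ww p2 ab)
    show "C1 (bump m) (bump' m)" for m
      unfolding bump_def[abs_def] bump'_def[abs_def]
      by (rule C1_mult[OF C1_compose_affine[OF C1_smooth_step] C1_compose_affine[OF C1_smooth_step]])
    show "0 \<le> bump m y \<and> bump m y \<le> 1" for m y
      unfolding bump_def by (auto intro: mult_nonneg_nonneg mult_le_one smooth_step_bounds)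
    show "\<bar>bump' m y\<bar> \<le> 2 / \<delta>" for m y
    proof -
      have *: "\<bar>smooth_step' s * smooth_step t\<bar> \<le> 1" for s t
        using ss'[of s] smooth_step_bounds[of t] by (simp add: abs_mult mult_le_one)
      define X Y where "X = smooth_step' (1 / \<delta> * y + A m) * smooth_step (- (1 / \<delta>) * y + B m)"
        and "Y = smooth_step' (- (1 / \<delta>) * y + B m) * smooth_step (1 / \<delta> * y + A m)"
      have "bump' m y = (X - Y) / \<delta>" by (simp add: bump'_def X_def Y_def diff_divide_distrib)
      moreover have "\<bar>X - Y\<bar> \<le> 2" using *[of "1 / \<delta> * y + A m" "- (1 / \<delta>) * y + B m"]
          *[of "- (1 / \<delta>) * y + B m" "1 / \<delta> * y + A m"] unfolding X_def Y_def by linarith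
      ultimately show ?thesis using \<delta>(1) by (simp add: abs_divide divide_right_mono)
    qed
    show "bump m y = 0 \<and> bump' m y = 0" if "y \<notin> {l $ m + \<delta><..<h $ m - \<delta>}" for m y
    proof -
      have "y \<le> l $ m + \<delta> \<or> h $ m - \<delta> \<le> y" using that by auto
      then consider "y \<le> l $ m + \<delta>" | "h $ m - \<delta> \<le> y" by blast
      then show ?thesis
      proof cases
        case 1
        then have "1 / \<delta> * y + A m \<le> - 1" unfolding AB using \<delta>(1) by (simp add: pos_divide_le_eq)
        then have "smooth_step (1 / \<delta> * y + A m) = 0" "smooth_step' (1 / \<delta> * y + A m) = 0"
          by (blast intro: smooth_step_cases)+
        then show ?thesis unfolding bump_def bump'_def by (simp only:) simp
      next
        case 2
        then have "- (1 / \<delta>) * y + B m \<le> - 1" unfolding AB using \<delta>(1) by (simp add: pos_divide_le_eq)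
        then have "smooth_step (- (1 / \<delta>) * y + B m) = 0" "smooth_step' (- (1 / \<delta>) * y + B m) = 0"
          by (blast intro: smooth_step_cases)+
        then show ?thesis unfolding bump_def bump'_def by (simp only:) simp
      qed
    qed
    show "bump m y = 1 \<and> bump' m y = 0" if "y \<in> {l $ m + 3 * \<delta>..h $ m - 3 * \<delta>}" for m y
    proof -
      have "1 / \<delta> * y + A m \<ge> 1" "- (1 / \<delta>) * y + B m \<ge> 1" unfolding AB using \<delta>(1) that by (simp_all add: pos_le_divide_eq)
      then have "smooth_step (1 / \<delta> * y + A m) = 1" "smooth_step' (1 / \<delta> * y + A m) = 0"
          "smooth_step (- (1 / \<delta>) * y + B m) = 1" "smooth_step' (- (1 / \<delta>) * y + B m) = 0"
        by (blast intro: smooth_step_cases)+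
      then show ?thesis unfolding bump_def bump'_def by (simp only:) simp
    qed
  qed
  interpret rotating_field \<epsilon> c T N i j l h R \<delta> \<eta>' \<alpha> bump bump' p p1 p2 q q1 w w2 D a b by (rule rf)
  have maj: "(\<integral>x. majorant x \<partial>lborel) \<le> \<eta>"
    using majorant_integral[OF R0 mass] small by linarith
  have "rotation_cell i j l h \<eta> displacement strain_density push singular_set inner_box rotation"
  proof (rule rotation_cell.intro)
    show "norm (displacement x) \<le> \<eta>" for x
      using displacement_bound[of x] by (simp add: \<eta>'_def)
    show "(\<integral>x. \<bar>strain_density m n k x\<bar> \<partial>lborel) \<le> \<eta>" for m n k
      using strain_density_mass maj by (rule order_trans)
    show "(\<integral>x. indicator inner_box x * \<bar>rotation x\<bar> \<partial>lborel) \<ge> 1"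
    proof (rule rotation_integral[OF lohi _ D ZP tot[unfolded \<Lambda>_def]])
      show "cbox lo hi \<subseteq> inner_box"
      proof
        fix x assume "x \<in> cbox lo hi"
        then have "l $ m + 5 * \<delta> \<le> x $ m \<and> x $ m \<le> h $ m - 5 * \<delta>" for m by (auto simp: mem_box_cart lo_def hi_def)
        then have "l $ m + 4 * \<delta> < x $ m \<and> x $ m < h $ m - 4 * \<delta>" for m using \<delta>(1) by (smt (verit))
        then show "x \<in> inner_box" by (auto simp: inner_box_def mem_box_cart)
      qed
    qed
    show "\<exists>L. (displacement has_derivative (\<lambda>v. L *v v)) (at x) \<and> L $ j $ i = rotation x"
      if "x \<in> inner_box" "x \<notin> singular_set" for x
      using displacement_derivative[OF that(1)] that(2) by (auto simp: singular_set_def)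
    show "open inner_box" unfolding inner_box_def by (rule open_box)
  qed (fact continuous_displacement displacement_outside integrable_strain_density strain_density_sym
      borel_measurable_push push_in_singular_set singular_set_null distr_strain_displacement inner_box_subset
      continuous_fields distr_partial_inner)+
  then show ?thesis by blast
qed

section \<open>Symmetric gradients, jumps and approximate gradients\<close>

lemma distr_partial_eq:
  fixes v :: "real^'n \<Rightarrow> real"
  assumes \<phi>: "test_function \<Omega> \<phi>" and v: "v \<in> borel_measurable borel"
  shows "distr_partial \<Omega> j v \<phi> = - (\<integral>x. v x * partial_deriv j \<phi> x \<partial>lborel)"
proof -
  obtain K where K: "K \<subseteq> \<Omega>" "\<And>x k. x \<notin> K \<Longrightarrow> partial_deriv k \<phi> x = 0"
    using test_function_support[OF \<phi>] by metis
  have "(\<lambda>x. indicator \<Omega> x *\<^sub>R (v x * partial_deriv j \<phi> x)) = (\<lambda>x. v x * partial_deriv j \<phi> x)"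
    using K by (auto simp: fun_eq_iff indicator_def)
  moreover have "(\<lambda>x. v x * partial_deriv j \<phi> x) \<in> borel_measurable lborel"
    using v borel_measurable_continuous_onI[OF test_function_continuous_partial[OF \<phi>]] by simp
  ultimately show ?thesis
    unfolding distr_partial_def set_lebesgue_integral_def partial_deriv_def[symmetric]
    by (simp add: integral_completion)
qed

lemma radon_measure_vec:
  fixes \<mu> :: "'a::topological_space set \<Rightarrow> 'b::real_normed_vector^'n"
  assumes "\<And>i. radon_measure \<Omega> (\<lambda>A. \<mu> A $ i)"
  shows "radon_measure \<Omega> \<mu>"
  unfolding radon_measure_def
proof (intro conjI allI impI)
  show "\<mu> A = 0" if "A \<notin> borel_sets \<Omega>" for A
    using radon_measure_outside[OF assms that] by (simp add: vec_eq_iff)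
  show "(\<lambda>k. \<mu> (A k)) sums \<mu> (\<Union>k. A k)"
    if "range A \<subseteq> borel_sets \<Omega> \<and> disjoint_family A" for A :: "nat \<Rightarrow> 'a set"
    unfolding sums_def
  proof (rule vec_tendstoI)
    fix i
    show "(\<lambda>n. (\<Sum>k<n. \<mu> (A k)) $ i) \<longlonglongrightarrow> \<mu> (\<Union>k. A k) $ i"
      using radon_measure_sums[OF assms, of A i] that by (simp add: sums_def)
  qed
qed

lemma radon_measure_nth:
  "radon_measure \<Omega> \<mu> \<Longrightarrow> radon_measure \<Omega> (\<lambda>A. \<mu> A $ i)"
  by (rule radon_measure_bounded_linear[OF bounded_linear_vec_nth])

lemma sym_grad_eq:
  assumes \<Omega>: "open \<Omega>" and \<mu>: "is_sym_grad_measure \<Omega> u \<mu>"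
  shows "sym_grad \<Omega> u = \<mu>"
  unfolding sym_grad_def
proof (rule the_equality)
  show "is_sym_grad_measure \<Omega> u \<mu>" by (rule \<mu>)
  fix \<nu> assume \<nu>: "is_sym_grad_measure \<Omega> u \<nu>"
  have r: "radon_measure \<Omega> (\<lambda>A. \<mu> A $ m $ n)" "radon_measure \<Omega> (\<lambda>A. \<nu> A $ m $ n)" for m n
    using \<mu> \<nu> by (auto simp: is_sym_grad_measure_def intro: radon_measure_nth[OF radon_measure_nth])
  have \<Omega>b: "\<Omega> \<in> sets borel" using \<Omega> by simp
  have "\<nu> A $ m $ n = \<mu> A $ m $ n" for A m n
  proof (cases "A \<in> borel_sets \<Omega>")
    case True
    then have A: "A \<in> sets borel" "A \<subseteq> \<Omega>" by (simp_all add: borel_sets_iff[OF \<Omega>b])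
    have "signed_integral \<Omega> (\<lambda>A. \<mu> A $ m $ n) \<phi> = signed_integral \<Omega> (\<lambda>A. \<nu> A $ m $ n) \<phi>"
      if "test_function \<Omega> \<phi>" for \<phi> using \<mu> \<nu> that unfolding is_sym_grad_measure_def by metis
    from radon_measure_eqI_test[OF r \<Omega>b \<Omega> order_refl this A] show ?thesis by simp
  next
    case False
    then show ?thesis using radon_measure_outside[OF r(1)] radon_measure_outside[OF r(2)] by simp
  qed
  then show "\<nu> = \<mu>" by (simp add: fun_eq_iff vec_eq_iff)
qed

text \<open>
  Two singular measures that differ by an absolutely continuous one agree on the union of the null
  sets that carry them, and both vanish off it.
\<close>

lemma singular_part_eq:
  fixes \<mu> :: "'a::euclidean_space set \<Rightarrow> 'b::real_normed_vector"
  assumes r: "radon_measure \<Omega> \<mu>" and s: "singular_lebesgue \<Omega> \<mu>"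
  shows "singular_part \<Omega> \<mu> = \<mu>"
  unfolding singular_part_def
proof (rule the_equality)
  show "radon_measure \<Omega> \<mu> \<and> singular_lebesgue \<Omega> \<mu> \<and> ac_lebesgue \<Omega> (\<lambda>A. \<mu> A - \<mu> A)"
    using r s by (simp add: ac_lebesgue_def)
  fix \<sigma> assume \<sigma>: "radon_measure \<Omega> \<sigma> \<and> singular_lebesgue \<Omega> \<sigma> \<and> ac_lebesgue \<Omega> (\<lambda>A. \<mu> A - \<sigma> A)"
  then have r': "radon_measure \<Omega> \<sigma>" by blast
  obtain M N where
    M: "M \<in> borel_sets \<Omega>" "M \<in> null_sets lebesgue" "\<And>A. A \<in> borel_sets \<Omega> \<Longrightarrow> A \<inter> M = {} \<Longrightarrow> \<mu> A = 0"
    and N: "N \<in> borel_sets \<Omega>" "N \<in> null_sets lebesgue" "\<And>A. A \<in> borel_sets \<Omega> \<Longrightarrow> A \<inter> N = {} \<Longrightarrow> \<sigma> A = 0"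
    using s \<sigma> unfolding singular_lebesgue_def by meson
  have "\<sigma> A = \<mu> A" for A
  proof (cases "A \<in> borel_sets \<Omega>")
    case True
    have MN: "M \<union> N \<in> borel_sets \<Omega>" "M \<union> N \<in> null_sets lebesgue" using M N by auto
    have I: "A \<inter> (M \<union> N) \<in> borel_sets \<Omega>" "A - (M \<union> N) \<in> borel_sets \<Omega>" using True MN by auto
    have "A \<inter> (M \<union> N) \<in> null_sets lebesgue"
      using MN(2) by (rule completion.complete2[rotated]) auto
    then have "\<mu> (A \<inter> (M \<union> N)) - \<sigma> (A \<inter> (M \<union> N)) = 0"
      using \<sigma> I(1) by (auto simp: ac_lebesgue_def)
    moreover have "\<mu> (A - (M \<union> N)) = 0" by (rule M(3)[OF I(2)]) blast
    moreover have "\<sigma> (A - (M \<union> N)) = 0" by (rule N(3)[OF I(2)]) blast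
    ultimately show ?thesis
      using radon_measure_Int[OF r True MN(1)] radon_measure_Int[OF r' True MN(1)] by simp
  next
    case False
    then show ?thesis using radon_measure_outside[OF r] radon_measure_outside[OF r'] by simp
  qed
  then show "\<sigma> = \<mu>" by blast
qed

lemma radon_measure_density:
  fixes g :: "'a::euclidean_space \<Rightarrow> real"
  assumes g: "integrable lborel g" and \<Omega>: "\<Omega> \<in> sets borel"
  defines "\<nu> \<equiv> \<lambda>A. if A \<in> borel_sets \<Omega> then \<integral>x. g x * indicator A x \<partial>lborel else 0"
  shows "radon_measure \<Omega> \<nu>"
    and "bounded_borel \<phi> \<Longrightarrow> (\<And>x. x \<notin> \<Omega> \<Longrightarrow> \<phi> x = 0) \<Longrightarrow> signed_integral \<Omega> \<nu> \<phi> = (\<integral>x. g x * \<phi> x \<partial>lborel)"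
proof -
  let ?f = "\<lambda>(m::nat) (k::unit). if m = 0 then g else (\<lambda>_. 0)"
  let ?e = "\<lambda>m::nat. if m = 0 then \<integral>x. \<bar>g x\<bar> \<partial>lborel else 0"
  have I: "(\<Sum>m. \<Sum>k\<in>UNIV. \<integral>x. ?f m k x * \<psi> x \<partial>lborel) = (\<integral>x. g x * \<psi> x \<partial>lborel)" for \<psi> :: "'a \<Rightarrow> real"
    by (subst suminf_finite[of "{0}"]) auto
  have 1: "integrable lborel (?f m k)" for m k using g by simp
  have 2: "(\<integral>x. \<bar>?f m k x\<bar> \<partial>lborel) \<le> ?e m" for m k by simp
  have 3: "summable ?e" by (rule summable_finite[of "{0}"]) auto
  have 4: "(\<lambda>x. x) \<in> borel_measurable borel" by simp
  note * = radon_measure_superposition[of ?f "\<lambda>_ _ x. x" ?e, OF 1 4 2 3 \<Omega>]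
  show "radon_measure \<Omega> \<nu>" using *(1) unfolding I \<nu>_def .
  show "signed_integral \<Omega> \<nu> \<phi> = (\<integral>x. g x * \<phi> x \<partial>lborel)"
    if "bounded_borel \<phi>" "\<And>x. x \<notin> \<Omega> \<Longrightarrow> \<phi> x = 0"
    using *(2)[OF that] unfolding I \<nu>_def .
qed

lemma continuous_set_integrable:
  fixes g :: "'a::euclidean_space \<Rightarrow> 'b::euclidean_space"
  assumes "continuous_on UNIV g" "A \<in> sets borel" "bounded A"
  shows "set_integrable lebesgue A g"
proof -
  have "compact (closure A)" using assms(3) by simp
  then have "integrable lborel (\<lambda>x. indicator (closure A) x *\<^sub>R g x)"
    using continuous_on_subset[OF assms(1)] by (intro borel_integrable_compact) auto
  then have "set_integrable lebesgue (closure A) g"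
    unfolding set_integrable_def by (subst integrable_completion) auto
  then show ?thesis
    by (rule set_integrable_subset) (use assms(2) closure_subset in auto)
qed

text \<open>
  A ball of radius \<open>s * r\<close> makes up the fraction \<open>s\<^sup>n\<close> of a ball of radius \<open>r\<close>, so an average over
  \<open>H\<close> cannot be small if the function is large on a ball in \<open>H\<close> of comparable radius.
\<close>

lemma average_ge_on_subball:
  fixes x z :: "'a::euclidean_space"
  assumes g: "continuous_on UNIV g" "\<And>y. 0 \<le> g y" and H: "H \<in> sets borel" "H \<subseteq> ball x r"
    and r: "r > 0" and s: "s > 0" and sub: "ball z (s * r) \<subseteq> H" and b: "\<And>y. y \<in> ball z (s * r) \<Longrightarrow> b \<le> g y"
  shows "s ^ DIM('a) * b \<le> (LINT y:H|lebesgue. g y) / measure lebesgue (ball x r)"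
proof -
  have bH: "bounded H" using H(2) bounded_ball bounded_subset by blast
  have "measure lebesgue (ball z (s * r)) = s ^ DIM('a) * measure lebesgue (ball x r)"
    using content_ball[of "s * r" z] content_ball[of r x] r s by (simp add: power_mult_distrib)
  moreover have m: "measure lebesgue (ball x r) > 0" using r content_ball_pos[of r x] by simp
  moreover have "b * measure lebesgue (ball z (s * r)) \<le> (LINT y:H|lebesgue. g y)"
  proof -
    have "b * measure lebesgue (ball z (s * r)) = (LINT y:ball z (s * r)|lebesgue. b)"
      by (simp add: set_lebesgue_integral_def emeasure_bounded_finite)
    also have "\<dots> \<le> (LINT y:ball z (s * r)|lebesgue. g y)"
      by (intro set_integral_mono continuous_set_integrable g b) auto
    also have "\<dots> \<le> (LINT y:H|lebesgue. g y)"
      unfolding set_lebesgue_integral_def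
      using continuous_set_integrable[OF g(1) H(1) bH] continuous_set_integrable[OF g(1), of "ball z (s * r)"] sub g(2)
      by (intro integral_mono) (auto simp: set_integrable_def indicator_def)
    finally show ?thesis .
  qed
  ultimately show ?thesis by (simp add: pos_le_divide_eq mult.commute mult.left_commute)
qed

text \<open>
  The half ball contains a ball of half the radius. If \<open>a\<close> were different from \<open>u x\<close>, then by
  continuity \<open>\<bar>u - a\<bar>\<close> would stay above \<open>\<bar>u x - a\<bar> / 2\<close> near \<open>x\<close>, and the averages would not tend
  to 0.
\<close>

lemma one_sided_limit_continuous:
  fixes u :: "real^'n \<Rightarrow> real^'n"
  assumes u: "continuous_on UNIV u" and \<nu>: "norm \<nu> = 1" and lim: "has_one_sided_limit u x \<nu> a"
  shows "a = u x"
proof (rule ccontr)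
  assume "a \<noteq> u x"
  define e where "e = norm (u x - a) / 2"
  have e: "e > 0" using \<open>a \<noteq> u x\<close> by (simp add: e_def)
  have "isCont u x" using u by (simp add: continuous_on_eq_continuous_at)
  then obtain d where d: "d > 0" "\<And>y. dist y x < d \<Longrightarrow> dist (u y) (u x) < e"
    using e unfolding continuous_at_eps_delta by metis
  let ?q = "\<lambda>r. (LINT y:(ball x r \<inter> {y. (y - x) \<bullet> \<nu> > 0})|lebesgue. norm (u y - a)) / measure lebesgue (ball x r)"
  have ev: "eventually (\<lambda>r. (1/2) ^ DIM(real^'n) * e \<le> ?q r) (at_right 0)"
    using eventually_at_right_less[of 0] eventually_at_right_real[OF d(1)]
  proof eventually_elim
    case (elim r)
    then have r: "0 < r" "r < d" by auto
    have sub: "ball (x + (r/2) *\<^sub>R \<nu>) (1/2 * r) \<subseteq> ball x r \<inter> {y. (y - x) \<bullet> \<nu> > 0}"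
    proof
      fix y assume "y \<in> ball (x + (r/2) *\<^sub>R \<nu>) (1/2 * r)"
      then have n: "norm (y - x - (r/2) *\<^sub>R \<nu>) < r/2"
        by (simp add: dist_norm norm_minus_commute diff_diff_eq)
      have "norm (y - x) \<le> norm (y - x - (r/2) *\<^sub>R \<nu>) + norm ((r/2) *\<^sub>R \<nu>)"
        using norm_triangle_ineq[of "y - x - (r/2) *\<^sub>R \<nu>" "(r/2) *\<^sub>R \<nu>"] by simp
      then have 1: "norm (y - x) < r" using n \<nu> r by simp
      have "\<bar>(y - x - (r/2) *\<^sub>R \<nu>) \<bullet> \<nu>\<bar> < r/2"
        using Cauchy_Schwarz_ineq2[of "y - x - (r/2) *\<^sub>R \<nu>" \<nu>] n \<nu> by simp
      moreover have "(y - x - (r/2) *\<^sub>R \<nu>) \<bullet> \<nu> = (y - x) \<bullet> \<nu> - r/2"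
        using \<nu> by (simp add: inner_diff_left norm_eq_1)
      ultimately have "(y - x) \<bullet> \<nu> > 0" by linarith
      then show "y \<in> ball x r \<inter> {y. (y - x) \<bullet> \<nu> > 0}" using 1 by (simp add: dist_norm norm_minus_commute)
    qed
    show ?case
    proof (rule average_ge_on_subball[OF _ _ _ _ r(1) _ sub])
      show "continuous_on UNIV (\<lambda>y. norm (u y - a))" by (intro continuous_intros u)
      have "open {y. (y - x) \<bullet> \<nu> > 0}" by (intro open_Collect_less continuous_intros)
      then show "ball x r \<inter> {y. (y - x) \<bullet> \<nu> > 0} \<in> sets borel" by auto
      show "e \<le> norm (u y - a)" if "y \<in> ball (x + (r/2) *\<^sub>R \<nu>) (1/2 * r)" for y
      proof -
        have "dist y x < d" using that sub r by (auto simp: dist_commute)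
        then have "norm (u y - u x) < e" using d(2) by (simp add: dist_norm)
        moreover have "norm (u x - a) \<le> norm (u y - u x) + norm (u y - a)"
          using norm_triangle_ineq[of "u x - u y" "u y - a"] by (simp add: norm_minus_commute)
        ultimately show ?thesis by (simp add: e_def)
      qed
    qed auto
  qed
  have "(1/2) ^ DIM(real^'n) * e \<le> 0"
    using lim[unfolded has_one_sided_limit_def] ev by (rule tendsto_lowerbound) simp
  moreover have "(1/2) ^ DIM(real^'n) * e > 0" using e by (intro mult_pos_pos zero_less_power) auto
  ultimately show False by linarith
qed

lemma jump_set_continuous:
  fixes u :: "real^'n \<Rightarrow> real^'n"
  assumes "continuous_on UNIV u" shows "jump_set \<Omega> u = {}"
proof -
  have False if "p \<noteq> q" "norm \<nu> = 1" "has_one_sided_limit u x \<nu> p" "has_one_sided_limit u x (- \<nu>) q" for p q \<nu> x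
    using one_sided_limit_continuous[OF assms that(2,3)] one_sided_limit_continuous[OF assms _ that(4)] that(1,2)
    by simp
  then show ?thesis unfolding jump_set_def by blast
qed

lemma continuous_on_matrix_vector_mult:
  fixes A :: "real^'n^'m"
  shows "continuous_on S g \<Longrightarrow> continuous_on S (\<lambda>y. A *v g y)"
  by (rule continuous_on_compose2[OF linear_continuous_on[OF matrix_vector_mul_bounded_linear[of A], of UNIV]]) auto

lemma has_approx_grad_derivative:
  fixes u :: "real^'n \<Rightarrow> real^'n"
  assumes u: "continuous_on UNIV u" and L: "(u has_derivative (\<lambda>v. L *v v)) (at x)"
  shows "((\<lambda>r. (LINT y:ball x r|lebesgue. norm (u y - u x - L *v (y - x)) / r)
            / measure lebesgue (ball x r)) \<longlongrightarrow> 0) (at_right 0)"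
proof (rule tendstoI)
  fix e :: real assume "e > 0"
  then have e: "e / 2 > 0" by simp
  then obtain d where d: "d > 0" "\<And>y. norm (y - x) < d \<Longrightarrow> norm (u y - u x - L *v (y - x)) \<le> e / 2 * norm (y - x)"
    using L unfolding has_derivative_at_alt by meson
  show "eventually (\<lambda>r. dist ((LINT y:ball x r|lebesgue. norm (u y - u x - L *v (y - x)) / r)
            / measure lebesgue (ball x r)) 0 < e) (at_right 0)"
    using eventually_at_right_less[of 0] eventually_at_right_real[OF d(1)]
  proof eventually_elim
    case (elim r)
    then have r: "0 < r" "r < d" by auto
    let ?g = "\<lambda>y. norm (u y - u x - L *v (y - x)) / r"
    have c: "continuous_on UNIV ?g"
      using r by (intro continuous_intros u continuous_on_matrix_vector_mult) auto
    have m: "measure lebesgue (ball x r) > 0" using r content_ball_pos[of r x] by simp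
    have le: "?g y \<le> e / 2" if "y \<in> ball x r" for y
    proof -
      have n: "norm (y - x) < r" using that by (simp add: dist_norm norm_minus_commute)
      have "norm (u y - u x - L *v (y - x)) \<le> e / 2 * norm (y - x)" using d(2) n r by simp
      also have "\<dots> \<le> e / 2 * r" using n e by (intro mult_left_mono) auto
      finally show ?thesis using r by (simp add: pos_divide_le_eq)
    qed
    have "(LINT y:ball x r|lebesgue. ?g y) \<le> (LINT y:ball x r|lebesgue. e / 2)"
      by (intro set_integral_mono continuous_set_integrable c le) auto
    also have "\<dots> = e / 2 * measure lebesgue (ball x r)"
      by (simp add: set_lebesgue_integral_def emeasure_bounded_finite)
    finally have le_e: "(LINT y:ball x r|lebesgue. ?g y) / measure lebesgue (ball x r) \<le> e / 2"
      using m pos_divide_le_eq by blast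
    have "(LINT y:ball x r|lebesgue. ?g y) \<ge> 0"
      unfolding set_lebesgue_integral_def using r by (intro integral_nonneg_AE) auto
    then have "0 \<le> (LINT y:ball x r|lebesgue. ?g y) / measure lebesgue (ball x r)"
      using m by (rule divide_nonneg_pos)
    moreover have "(LINT y:ball x r|lebesgue. ?g y) / measure lebesgue (ball x r) < e"
      using le_e e by linarith
    ultimately show ?case unfolding dist_real_def by linarith
  qed
qed

text \<open>
  If \<open>L'\<close> is an approximate gradient at \<open>x\<close>, then the average of \<open>\<bar>w + M (y - x)\<bar> / r\<close> over the
  ball of radius \<open>r\<close> tends to zero, where \<open>M = L - L'\<close> and \<open>w\<close> is constant. At the points
  \<open>x \<plusminus> (r/2) v\<close> the norms add up to at least \<open>r \<bar>M v\<bar>\<close>, and they change little on balls of radius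
  \<open>s r\<close> for small \<open>s\<close>. Hence \<open>M v = 0\<close>.
\<close>

lemma approx_grad_eq:
  fixes u :: "real^'n \<Rightarrow> real^'n"
  assumes u: "continuous_on UNIV u" and L: "(u has_derivative (\<lambda>v. L *v v)) (at x)"
  shows "approx_grad u x = L"
proof -
  have ex: "has_approx_grad u x L"
    using has_approx_grad_derivative[OF u L] unfolding has_approx_grad_def by blast
  have "L' = L" if L': "has_approx_grad u x L'" for L'
  proof -
    obtain z where z: "((\<lambda>r. (LINT y:ball x r|lebesgue. norm (u y - z - L' *v (y - x)) / r)
            / measure lebesgue (ball x r)) \<longlongrightarrow> 0) (at_right 0)"
      using L' unfolding has_approx_grad_def by blast
    define w M where "w = u x - z" and "M = L - L'"
    let ?q = "\<lambda>r. (LINT y:ball x r|lebesgue. norm (w + M *v (y - x)) / r) / measure lebesgue (ball x r)"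
    \<comment> \<open>the two expansions differ by an affine map whose scaled mean tends to zero\<close>
    have q0: "(?q \<longlongrightarrow> 0) (at_right 0)"
    proof (rule tendsto_sandwich[of "\<lambda>_. 0"])
      show "((\<lambda>r. (LINT y:ball x r|lebesgue. norm (u y - z - L' *v (y - x)) / r) / measure lebesgue (ball x r)
         + (LINT y:ball x r|lebesgue. norm (u y - u x - L *v (y - x)) / r) / measure lebesgue (ball x r)) \<longlongrightarrow> 0) (at_right 0)"
        using tendsto_add[OF z has_approx_grad_derivative[OF u L]] by simp
      show "eventually (\<lambda>r. 0 \<le> ?q r) (at_right 0)"
        using eventually_at_right_less[of 0]
        by eventually_elim (auto simp: set_lebesgue_integral_def intro!: divide_nonneg_nonneg integral_nonneg_AE)
      show "eventually (\<lambda>r. ?q r \<le> (LINT y:ball x r|lebesgue. norm (u y - z - L' *v (y - x)) / r) / measure lebesgue (ball x r)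
         + (LINT y:ball x r|lebesgue. norm (u y - u x - L *v (y - x)) / r) / measure lebesgue (ball x r)) (at_right 0)"
        using eventually_at_right_less[of 0]
      proof eventually_elim
        case (elim r)
        let ?g = "\<lambda>y. norm (u y - z - L' *v (y - x)) / r" and ?h = "\<lambda>y. norm (u y - u x - L *v (y - x)) / r"
        have c: "set_integrable lebesgue (ball x r) ?g" "set_integrable lebesgue (ball x r) ?h"
          "set_integrable lebesgue (ball x r) (\<lambda>y. norm (w + M *v (y - x)) / r)"
          using elim by (auto intro!: continuous_set_integrable continuous_intros u continuous_on_matrix_vector_mult)
        have "norm (w + M *v (y - x)) / r \<le> ?g y + ?h y" for y
        proof -
          have "w + M *v (y - x) = (u y - z - L' *v (y - x)) - (u y - u x - L *v (y - x))"
            by (simp add: w_def M_def matrix_vector_mult_diff_rdistrib)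
          then have "norm (w + M *v (y - x)) \<le> norm (u y - z - L' *v (y - x)) + norm (u y - u x - L *v (y - x))"
            by (simp only: norm_triangle_ineq4)
          then show ?thesis using elim by (simp add: add_divide_distrib[symmetric] divide_right_mono)
        qed
        then have "(LINT y:ball x r|lebesgue. norm (w + M *v (y - x)) / r) \<le> (LINT y:ball x r|lebesgue. ?g y + ?h y)"
          using c by (intro set_integral_mono set_integral_add) auto
        also have "\<dots> = (LINT y:ball x r|lebesgue. ?g y) + (LINT y:ball x r|lebesgue. ?h y)"
          using c by (intro set_integral_add)
        finally show ?case
          unfolding add_divide_distrib[symmetric] by (rule divide_right_mono) simp
      qed
    qed simp
    have "M *v v = 0" if v: "norm v = 1" for v
    proof (rule ccontr)
      assume "M *v v \<noteq> 0"
      obtain C where C: "C > 0" "\<And>y. norm (M *v y) \<le> norm y * C"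
        using bounded_linear.pos_bounded[OF matrix_vector_mul_bounded_linear[of M]] by blast
      define t where "t = norm (M *v v)"
      have t: "t > 0" using \<open>M *v v \<noteq> 0\<close> by (simp add: t_def)
      define s where "s = min (1/2) (t / (4 * C))"
      have s: "s > 0" "s \<le> 1/2" "C * s \<le> t / 4"
      proof -
        show "s > 0" "s \<le> 1/2" using t C by (auto simp: s_def)
        have "C * s \<le> C * (t / (4 * C))" using C by (intro mult_left_mono) (auto simp: s_def)
        then show "C * s \<le> t / 4" using C by simp
      qed
      have ev: "eventually (\<lambda>r. s ^ DIM(real^'n) * (t / 2) \<le> 2 * ?q r) (at_right 0)"
        using eventually_at_right_less[of 0]
      proof eventually_elim
        case (elim r)
        \<comment> \<open>at the centres of two opposite balls the values of the affine map differ by \<open>r * M *v v\<close>\<close>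
        have part: "s ^ DIM(real^'n) * (norm (w + (\<sigma> * r / 2) *\<^sub>R (M *v v)) / r - C * s) \<le> ?q r" if \<sigma>: "\<bar>\<sigma>\<bar> = 1" for \<sigma>
        proof (rule average_ge_on_subball[OF _ _ _ order_refl elim s(1), where z = "x + (\<sigma> * r / 2) *\<^sub>R v"])
          show "continuous_on UNIV (\<lambda>y. norm (w + M *v (y - x)) / r)"
            using elim by (intro continuous_intros continuous_on_matrix_vector_mult) auto
          have n: "norm (y - x - (\<sigma> * r / 2) *\<^sub>R v) < s * r" if "y \<in> ball (x + (\<sigma> * r / 2) *\<^sub>R v) (s * r)" for y
            using that by (simp add: dist_norm norm_minus_commute diff_diff_eq)
          have nv: "norm ((\<sigma> * r / 2) *\<^sub>R v) = r / 2" using \<sigma> v elim by (simp add: abs_mult)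
          show "ball (x + (\<sigma> * r / 2) *\<^sub>R v) (s * r) \<subseteq> ball x r"
          proof
            fix y assume y: "y \<in> ball (x + (\<sigma> * r / 2) *\<^sub>R v) (s * r)"
            have "s * r \<le> r / 2" using s(2) elim mult_right_mono[of s "1/2" r] by simp
            moreover have "norm (y - x) \<le> norm (y - x - (\<sigma> * r / 2) *\<^sub>R v) + norm ((\<sigma> * r / 2) *\<^sub>R v)"
              using norm_triangle_ineq[of "y - x - (\<sigma> * r / 2) *\<^sub>R v" "(\<sigma> * r / 2) *\<^sub>R v"] by simp
            ultimately have "norm (y - x) < r" using n[OF y] nv by linarith
            then show "y \<in> ball x r" by (simp add: dist_norm norm_minus_commute)
          qed
          show "norm (w + (\<sigma> * r / 2) *\<^sub>R (M *v v)) / r - C * s \<le> norm (w + M *v (y - x)) / r"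
            if y: "y \<in> ball (x + (\<sigma> * r / 2) *\<^sub>R v) (s * r)" for y
          proof -
            define e where "e = y - x - (\<sigma> * r / 2) *\<^sub>R v"
            have "y - x = (\<sigma> * r / 2) *\<^sub>R v + e" by (simp add: e_def)
            then have "M *v (y - x) = (\<sigma> * r / 2) *\<^sub>R (M *v v) + M *v e"
              by (simp only: matrix_vector_right_distrib matrix_vector_mult_scaleR)
            then have "w + (\<sigma> * r / 2) *\<^sub>R (M *v v) = (w + M *v (y - x)) - M *v e" by simp
            then have "norm (w + (\<sigma> * r / 2) *\<^sub>R (M *v v)) \<le> norm (w + M *v (y - x)) + norm (M *v e)"
              by (simp only: norm_triangle_ineq4)
            moreover have "norm (M *v e) \<le> C * s * r"
            proof -
              have "norm e * C \<le> (s * r) * C" using n[OF y] C by (intro mult_right_mono) (auto simp: e_def)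
              then show ?thesis using C(2)[of e] by (simp add: mult.commute mult.left_commute)
            qed
            ultimately have "norm (w + (\<sigma> * r / 2) *\<^sub>R (M *v v)) \<le> norm (w + M *v (y - x)) + C * s * r" by linarith
            then have "norm (w + (\<sigma> * r / 2) *\<^sub>R (M *v v)) / r \<le> (norm (w + M *v (y - x)) + C * s * r) / r"
              using elim by (intro divide_right_mono) auto
            then show ?thesis using elim by (simp add: add_divide_distrib)
          qed
        qed (use elim in auto)
        define X Y where "X = norm (w + (1 * r / 2) *\<^sub>R (M *v v)) / r" and "Y = norm (w + (- 1 * r / 2) *\<^sub>R (M *v v)) / r"
        have "(w + (1 * r / 2) *\<^sub>R (M *v v)) - (w + (- 1 * r / 2) *\<^sub>R (M *v v)) = r *\<^sub>R (M *v v)"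
          by (simp add: scaleR_left_distrib[symmetric])
        then have "norm (r *\<^sub>R (M *v v)) \<le> norm (w + (1 * r / 2) *\<^sub>R (M *v v)) + norm (w + (- 1 * r / 2) *\<^sub>R (M *v v))"
          using norm_triangle_ineq4[of "w + (1 * r / 2) *\<^sub>R (M *v v)" "w + (- 1 * r / 2) *\<^sub>R (M *v v)"] by simp
        then have "r * t \<le> norm (w + (1 * r / 2) *\<^sub>R (M *v v)) + norm (w + (- 1 * r / 2) *\<^sub>R (M *v v))"
          using elim by (simp add: t_def)
        then have XY: "t \<le> X + Y"
          unfolding X_def Y_def add_divide_distrib[symmetric] using elim by (simp add: pos_le_divide_eq mult.commute)
        have "s ^ DIM(real^'n) * (X - C * s) \<le> ?q r" unfolding X_def by (rule part) simp
        moreover have "s ^ DIM(real^'n) * (Y - C * s) \<le> ?q r" unfolding Y_def by (rule part) simp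
        moreover have "s ^ DIM(real^'n) * (t / 2) \<le> s ^ DIM(real^'n) * ((X - C * s) + (Y - C * s))"
          using XY s by (intro mult_left_mono) auto
        ultimately show ?case unfolding distrib_left by linarith
      qed
      have "s ^ DIM(real^'n) * (t / 2) \<le> 0"
        using tendsto_mult_right_zero[OF q0, of 2] ev by (rule tendsto_lowerbound) simp
      moreover have "s ^ DIM(real^'n) * (t / 2) > 0" using s(1) t by (intro mult_pos_pos zero_less_power) auto
      ultimately show False by linarith
    qed
    then have "M *v axis k 1 = 0" for k by simp
    then have "M = 0"
      by (simp add: matrix_vector_mul_component vec_eq_iff matrix_vector_mult_basis column_def)
    then show "L' = L" by (simp add: M_def)
  qed
  then have "(THE L'. has_approx_grad u x L') = L" using ex by (intro the_equality) blast+
  then show ?thesis using ex unfolding approx_grad_def by auto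
qed

lemma C_k_1_coordinate:
  fixes g g' :: "real \<Rightarrow> real"
  assumes g: "C1 g g'"
  shows "C_k 1 (\<lambda>y::real^'n. g (y $ k))"
proof -
  have d: "((\<lambda>y::real^'n. g (y $ k)) has_derivative (\<lambda>h. g' (y $ k) * h $ k)) (at y)" for y
    using has_derivative_compose[OF bounded_linear_imp_has_derivative[OF bounded_linear_vec_nth[of k]]
        C1_deriv[OF g, unfolded has_field_derivative_def], of y UNIV] by simp
  have "frechet_derivative (\<lambda>y::real^'n. g (y $ k)) (at y) = (\<lambda>h. g' (y $ k) * h $ k)" for y
    using frechet_derivative_at[OF d] by simp
  moreover have "continuous_on UNIV (\<lambda>y::real^'n. g' (y $ k) * b $ k)" for b :: "real^'n"
    by (intro continuous_intros continuous_on_compose2[OF C1_cont'[OF g]]) auto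
  ultimately show ?thesis using d by (auto simp: differentiable_def)
qed

text \<open>
  An admissible truncation in the definition of \<open>GBV\<close> that leaves a component of the field
  unchanged, as the field takes values in the unit ball.
\<close>

lemma ex_truncated_coordinate:
  obtains \<phi> :: "real^'n \<Rightarrow> real" where "C_k 1 \<phi>" "\<And>y. norm y \<le> 1 \<Longrightarrow> \<phi> y = y $ j"
    "compact (closure {y. frechet_derivative \<phi> (at y) \<noteq> (\<lambda>_. 0)})"
proof
  define g where "g t = smooth_step (1 * t + 2) * smooth_step ((- 1) * t + 2)" for t
  define \<phi> where "\<phi> y = y $ j * (\<Prod>k\<in>UNIV. g (y $ k))" for y :: "real^'n"
  have g: "\<exists>g'. C1 g g'"
    unfolding g_def using C1_mult[OF C1_compose_affine[OF C1_smooth_step] C1_compose_affine[OF C1_smooth_step]] by blast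
  have g1: "g t = 1" if "\<bar>t\<bar> \<le> 1" for t
    using that smooth_step_cases(2)[of "1 * t + 2"] smooth_step_cases(2)[of "(- 1) * t + 2"] by (simp add: g_def)
  have g0: "g t = 0" if "\<bar>t\<bar> > 3" for t
    using that smooth_step_cases(1)[of "1 * t + 2"] smooth_step_cases(1)[of "(- 1) * t + 2"]
    by (cases "t > 0") (auto simp: g_def)
  show "C_k 1 \<phi>"
  proof -
    have "C_k 1 (\<lambda>y::real^'n. y $ j)" by (rule C_k_1_coordinate[OF C1_ident])
    moreover have "C_k 1 (\<lambda>y::real^'n. g (y $ k))" for k using g C_k_1_coordinate by metis
    ultimately show ?thesis unfolding \<phi>_def[abs_def] by (intro C_k_mult C_k_prod) auto
  qed
  show "\<phi> y = y $ j" if "norm y \<le> 1" for y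
  proof -
    have "g (y $ k) = 1" for k using component_le_norm_cart[of y k] that by (intro g1) simp
    then show ?thesis by (simp add: \<phi>_def)
  qed
  let ?K = "cbox (\<chi> k. - 3) (\<chi> k. 3 :: real^'n)"
  have cK: "closed ?K" by (rule closed_cbox)
  have "frechet_derivative \<phi> (at y) = (\<lambda>_. 0)" if "y \<notin> ?K" for y
  proof -
    have "((\<lambda>_. 0) has_derivative (\<lambda>_. 0)) (at y)" by simp
    then have "(\<phi> has_derivative (\<lambda>_. 0)) (at y)"
    proof (rule has_derivative_transform_within_open[where s = "- ?K"])
      show "open (- ?K)" by (rule open_Compl[OF cK])
      show "y \<in> - ?K" using that by simp
      show "0 = \<phi> z" if z: "z \<in> - ?K" for z
      proof -
        obtain k where "\<not> (- 3 \<le> z $ k \<and> z $ k \<le> 3)" using z by (auto simp: mem_box_cart)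
        then have "\<bar>z $ k\<bar> > 3" by linarith
        then have "g (z $ k) = 0" by (rule g0)
        then have "(\<Prod>k\<in>UNIV. g (z $ k)) = 0" by (intro prod_zero) auto
        then show ?thesis by (simp add: \<phi>_def)
      qed
    qed
    then show ?thesis by (rule frechet_derivative_at[symmetric])
  qed
  then have "{y. frechet_derivative \<phi> (at y) \<noteq> (\<lambda>_. 0)} \<subseteq> ?K" by blast
  then have "closure {y. frechet_derivative \<phi> (at y) \<noteq> (\<lambda>_. 0)} \<subseteq> ?K"
    by (rule closure_minimal) (rule cK)
  then have "bounded (closure {y. frechet_derivative \<phi> (at y) \<noteq> (\<lambda>_. 0)})"
    by (rule bounded_subset[OF bounded_cbox])
  then show "compact (closure {y. frechet_derivative \<phi> (at y) \<noteq> (\<lambda>_. 0)})"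
    by (simp add: compact_eq_bounded_closed)
qed

section \<open>Superposition of disjoint cells\<close>

text \<open>
  The bounds \<open>(1/2) ^ Suc K\<close> add up to 1, so that the sum of the fields and its strain are
  bounded, whereas each of the cells has a rotation of integral at least 1.
\<close>

locale disjoint_cells =
  fixes \<Omega> :: "(real^'n) set" and i j :: 'n and A B :: "real^'n" and l h :: "nat \<Rightarrow> real^'n"
    and u :: "nat \<Rightarrow> real^'n \<Rightarrow> real^'n" and f :: "nat \<Rightarrow> 'n \<Rightarrow> 'n \<Rightarrow> 'n \<Rightarrow> real^'n \<Rightarrow> real"
    and \<tau> :: "nat \<Rightarrow> 'n \<Rightarrow> real^'n \<Rightarrow> real^'n" and S Q :: "nat \<Rightarrow> (real^'n) set" and D :: "nat \<Rightarrow> real^'n \<Rightarrow> real"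
  assumes domain: "open \<Omega>" "cbox A B \<subseteq> \<Omega>" "box A B \<noteq> {}"
    and cells_subset: "\<And>K. box (l K) (h K) \<subseteq> box A B"
    and disjoint: "disjoint_family (\<lambda>K. box (l K) (h K))"
    and cell: "\<And>K. rotation_cell i j (l K) (h K) ((1/2) ^ Suc K) (u K) (f K) (\<tau> K) (S K) (Q K) (D K)"
begin

lemmas cell_continuous = rotation_cell.continuous[OF cell]
  and cell_outside = rotation_cell.outside[OF cell]
  and cell_small = rotation_cell.small[OF cell]
  and cell_integrable_strain = rotation_cell.integrable_strain[OF cell]
  and cell_strain_mass = rotation_cell.strain_mass[OF cell]
  and cell_strain_sym = rotation_cell.strain_sym[OF cell]
  and cell_measurable_pushes = rotation_cell.measurable_pushes[OF cell]
  and cell_pushes_in = rotation_cell.pushes_in[OF cell]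
  and cell_null = rotation_cell.null[OF cell]
  and cell_distr_strain = rotation_cell.distr_strain[OF cell]
  and cell_core = rotation_cell.core[OF cell]
  and cell_continuous_rotation = rotation_cell.continuous_rotation[OF cell]
  and cell_large_rotation = rotation_cell.large_rotation[OF cell]
  and cell_differentiable = rotation_cell.differentiable[OF cell]
  and cell_distr_rotation = rotation_cell.distr_rotation[OF cell]

definition total :: "real^'n \<Rightarrow> real^'n" where
  "total x = (\<Sum>K. u K x)"

lemma borel_domain: "\<Omega> \<in> sets borel"
  using domain by simp

lemma half_le_1: "(1/2::real) ^ Suc K \<le> 1"
  by (rule power_le_one) auto

lemma cell_unique: "x \<in> box (l K) (h K) \<Longrightarrow> x \<in> box (l M) (h M) \<Longrightarrow> K = M"
  using disjoint_family_onD[OF disjoint, of K M] by auto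

lemma total_sums: "(\<lambda>K. u K x) sums total x"
  unfolding total_def
  by (intro summable_sums summable_comparison_test'[OF summable_half, of 0] cell_small)

lemma total_eq:
  assumes "x \<in> box (l K) (h K)" shows "total x = u K x"
proof -
  have "u M x = 0" if "M \<notin> {K}" for M
    using cell_outside[of x M] cell_unique[OF assms, of M] that by blast
  then have "total x = (\<Sum>M\<in>{K}. u M x)" unfolding total_def by (intro suminf_finite) auto
  then show ?thesis by simp
qed

lemma total_outside:
  assumes "x \<notin> box A B" shows "total x = 0"
proof -
  have "u K x = 0" for K using cell_outside[of x K] cells_subset[of K] assms by blast
  then show ?thesis by (simp add: total_def)
qed

lemma norm_total: "norm (total x) \<le> 1"
proof (cases "\<exists>K. x \<in> box (l K) (h K)")
  case True
  then obtain K where "x \<in> box (l K) (h K)" by blast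
  then have "norm (total x) \<le> (1/2) ^ Suc K" using cell_small[of K x] by (simp only: total_eq)
  then show ?thesis using half_le_1[of K] by linarith
next
  case False
  then have "u K x = 0" for K using cell_outside by blast
  then show ?thesis by (simp add: total_def)
qed

lemma continuous_total: "continuous_on UNIV total"
proof -
  have "uniform_limit UNIV (\<lambda>n x. \<Sum>K<n. u K x) (\<lambda>x. suminf (\<lambda>K. u K x)) sequentially"
    by (rule Weierstrass_m_test_ev[OF _ summable_half]) (simp only: cell_small, simp)
  then have "uniform_limit UNIV (\<lambda>n x. \<Sum>K<n. u K x) total sequentially"
    by (simp only: total_def[abs_def])
  moreover have "\<forall>\<^sub>F n in sequentially. continuous_on UNIV (\<lambda>x. \<Sum>K<n. u K x)"
    by (intro always_eventually allI continuous_on_sum cell_continuous)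
  ultimately show ?thesis using uniform_limit_theorem sequentially_bot by metis
qed

lemma total_integrable: "total absolutely_integrable_on \<Omega>"
proof -
  have "set_integrable lebesgue (cbox A B) total"
    by (intro continuous_set_integrable continuous_total) auto
  moreover have "(\<lambda>x. indicator (cbox A B) x *\<^sub>R total x) = (\<lambda>x. indicator \<Omega> x *\<^sub>R total x)"
    using total_outside box_subset_cbox[of A B] domain(2) by (auto simp: fun_eq_iff indicator_def)
  ultimately show ?thesis by (simp only: set_integrable_def)
qed

lemma total_bounded: "total \<in> L_infinity \<Omega>"
proof -
  have "total \<in> borel_measurable lebesgue"
    using borel_measurable_continuous_onI[OF continuous_total] by (intro measurable_completion) simp
  then have "total \<in> borel_measurable (lebesgue_on \<Omega>)" by (rule measurable_restrict_space1)
  then show ?thesis using norm_total by (auto simp: L_infinity_def)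
qed

definition strain :: "(real^'n) set \<Rightarrow> real^'n^'n" where
  "strain X = (\<chi> m n. if X \<in> borel_sets \<Omega>
     then \<Sum>K. \<Sum>k\<in>UNIV. \<integral>x. f K m n k x * indicator X (\<tau> K k x) \<partial>lborel else 0)"

lemmas strain_entries = radon_measure_superposition[where f = "\<lambda>K. f K m n" for m n,
  OF cell_integrable_strain cell_measurable_pushes cell_strain_mass summable_half borel_domain]

lemma strain_nth: "strain X $ m $ n = (if X \<in> borel_sets \<Omega>
     then \<Sum>K. \<Sum>k\<in>UNIV. \<integral>x. f K m n k x * indicator X (\<tau> K k x) \<partial>lborel else 0)"
  by (simp add: strain_def)

lemma radon_strain: "radon_measure \<Omega> strain"
proof (intro radon_measure_vec)
  fix m n show "radon_measure \<Omega> (\<lambda>X. strain X $ m $ n)"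
    unfolding strain_nth by (rule strain_entries(1))
qed

text \<open>
  The maps \<open>\<tau> K k\<close> take values in the null set \<open>S K\<close>.
\<close>

lemma strain_singular: "singular_lebesgue \<Omega> strain"
  unfolding singular_lebesgue_def
proof (intro bexI conjI ballI impI)
  let ?N = "\<Omega> \<inter> (\<Union>K. S K)"
  have U: "(\<Union>K. S K) \<in> null_sets lborel" using cell_null by (intro null_sets_UN) auto
  then have "?N \<in> null_sets lborel" using borel_domain by (intro null_set_Int1) auto
  then show "?N \<in> null_sets lebesgue" by (rule null_sets_completionI)
  have "(\<Union>K. S K) \<in> sets borel" using null_setsD2[OF U] by simp
  then show "?N \<in> borel_sets \<Omega>" using borel_domain by (auto simp: borel_sets_iff)
  fix X assume "X \<in> borel_sets \<Omega>" "X \<inter> ?N = {}"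
  then have "\<tau> K k x \<notin> X" for K k x
    using borel_sets_subset[of X \<Omega>] cell_pushes_in[of K k x] by blast
  then show "strain X = 0" by (simp add: vec_eq_iff strain_nth)
qed

lemma total_distr_partial_sums:
  assumes \<phi>: "test_function \<Omega> \<phi>"
  shows "(\<lambda>K. \<integral>x. u K x $ m * partial_deriv n \<phi> x \<partial>lborel) sums (\<integral>x. total x $ m * partial_deriv n \<phi> x \<partial>lborel)"
proof -
  let ?w = "partial_deriv n \<phi>"
  obtain C where C: "compact C" "\<And>x. x \<notin> C \<Longrightarrow> ?w x = 0" using test_function_support[OF \<phi>] by metis
  have cw: "continuous_on UNIV ?w" by (rule test_function_continuous_partial[OF \<phi>])
  have w: "integrable lborel (\<lambda>x. \<bar>?w x\<bar>)"
    by (intro integrable_abs integrable_continuous_vanishing[OF cw C(2) C(1)])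
  have b: "\<bar>u K x $ m * ?w x\<bar> \<le> (1/2) ^ Suc K * \<bar>?w x\<bar>" for K x
    unfolding abs_mult
    by (intro mult_right_mono order_trans[OF component_le_norm_cart cell_small]) simp
  have int: "integrable lborel (\<lambda>x. u K x $ m * ?w x)" for K
  proof (rule integrable_continuous_vanishing[OF _ _ C(1)])
    show "continuous_on UNIV (\<lambda>x. u K x $ m * ?w x)" by (intro continuous_intros cell_continuous cw)
  qed (simp add: C(2))
  have "(\<lambda>K. \<integral>x. u K x $ m * ?w x \<partial>lborel) sums (\<integral>x. (\<Sum>K. u K x $ m * ?w x) \<partial>lborel)"
  proof (rule sums_integral[OF int])
    show "AE x in lborel. summable (\<lambda>K. norm (u K x $ m * ?w x))"
    proof (rule AE_I2)
      fix x show "summable (\<lambda>K. norm (u K x $ m * ?w x))"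
        by (rule summable_comparison_test'[OF summable_mult2[OF summable_half, of "\<bar>?w x\<bar>"], of 0]) (use b in simp)
    qed
    show "summable (\<lambda>K. \<integral>x. norm (u K x $ m * ?w x) \<partial>lborel)"
    proof (rule summable_comparison_test'[OF summable_mult2[OF summable_half, of "\<integral>x. \<bar>?w x\<bar> \<partial>lborel"], of 0])
      fix K :: nat
      have "(\<integral>x. norm (u K x $ m * ?w x) \<partial>lborel) \<le> (\<integral>x. (1/2) ^ Suc K * \<bar>?w x\<bar> \<partial>lborel)"
        using b by (intro integral_mono integrable_norm int integrable_mult_right w) (simp only: real_norm_def)
      also have "\<dots> = (1/2) ^ Suc K * (\<integral>x. \<bar>?w x\<bar> \<partial>lborel)" by (rule integral_mult_right_zero)
      finally show "norm (\<integral>x. norm (u K x $ m * ?w x) \<partial>lborel) \<le> (1/2) ^ Suc K * (\<integral>x. \<bar>?w x\<bar> \<partial>lborel)"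
        by (simp only: real_norm_def abs_of_nonneg[OF integral_nonneg_AE] norm_ge_zero AE_I2)
    qed
  qed
  moreover have "(\<Sum>K. u K x $ m * ?w x) = total x $ m * ?w x" for x
    by (rule sums_unique[symmetric]) (intro sums_mult2 bounded_linear.sums[OF bounded_linear_vec_nth] total_sums)
  ultimately show ?thesis by simp
qed

lemma borel_measurable_total_nth: "(\<lambda>x. total x $ m) \<in> borel_measurable borel"
  by (intro borel_measurable_continuous_onI continuous_intros continuous_total)

text \<open>
  For each cell this is \<open>cell_distr_strain\<close>, and the series may be integrated term by term against
  a derivative of a test function.
\<close>

lemma strain_is_sym_grad: "is_sym_grad_measure \<Omega> total strain"
  unfolding is_sym_grad_measure_def
proof (intro conjI allI impI)
  show "transpose (strain X) = strain X" for X
  proof -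
    have "strain X $ m $ n = strain X $ n $ m" for m n
      unfolding strain_nth by (simp only: cell_strain_sym[of _ m n])
    then show ?thesis by (simp add: vec_eq_iff transpose_def)
  qed
  fix \<phi> :: "real^'n \<Rightarrow> real" and m n
  assume \<phi>: "test_function \<Omega> \<phi>"
  have "distr_sym_grad \<Omega> m n total \<phi> = - (\<integral>x. total x $ m * partial_deriv n \<phi> x \<partial>lborel) / 2
      - (\<integral>x. total x $ n * partial_deriv m \<phi> x \<partial>lborel) / 2"
    unfolding distr_sym_grad_def distr_partial_eq[OF \<phi> borel_measurable_total_nth] by (simp add: field_simps)
  also have "\<dots> = (\<Sum>K. - (\<integral>x. u K x $ m * partial_deriv n \<phi> x \<partial>lborel) / 2
      - (\<integral>x. u K x $ n * partial_deriv m \<phi> x \<partial>lborel) / 2)"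
    by (rule sums_unique) (intro sums_diff sums_divide sums_minus total_distr_partial_sums[OF \<phi>])
  also have "\<dots> = (\<Sum>K. \<Sum>k\<in>UNIV. \<integral>x. f K m n k x * \<phi> (\<tau> K k x) \<partial>lborel)"
    unfolding cell_distr_strain[OF \<phi>] ..
  also have "\<dots> = signed_integral \<Omega> (\<lambda>X. strain X $ m $ n) \<phi>"
    unfolding strain_nth
  proof (rule strain_entries(2)[symmetric])
    show "bounded_borel \<phi>" by (rule test_function_bounded_borel[OF \<phi>])
    show "\<phi> x = 0" if "x \<notin> \<Omega>" for x using test_function_support[OF \<phi>] that by (metis subsetD)
  qed
  finally show "distr_sym_grad \<Omega> m n total \<phi> = signed_integral \<Omega> (\<lambda>X. strain X $ m $ n) \<phi>" .
qed (rule radon_strain)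

lemma total_BD: "total \<in> BD \<Omega>"
  using total_integrable strain_is_sym_grad by (auto simp: BD_def)

text \<open>
  The strain is singular, so it is its own singular part, and there is no jump set on which the
  restriction would remove anything.
\<close>

lemma sym_grad_total: "sym_grad \<Omega> total = cantor_part \<Omega> total"
proof -
  have "restrict_radon \<Omega> strain \<Omega> = strain"
  proof
    fix X show "restrict_radon \<Omega> strain \<Omega> X = strain X"
    proof (cases "X \<in> borel_sets \<Omega>")
      case True
      then have "X \<inter> \<Omega> = X" using borel_sets_subset by blast
      then show ?thesis using True by (simp add: restrict_radon_def)
    qed (simp add: restrict_radon_def radon_measure_outside[OF radon_strain])
  qed
  then show ?thesis
    unfolding cantor_part_def sym_grad_eq[OF domain(1) strain_is_sym_grad]
      singular_part_eq[OF radon_strain strain_singular] jump_set_continuous[OF continuous_total] by simp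
qed

lemma core_subset: "Q K \<subseteq> box (l K) (h K)" "Q K \<subseteq> \<Omega>" "Q K \<subseteq> box A B"
  using cell_core(2)[of K] cells_subset[of K] domain(2) box_subset_cbox[of A B] by blast+

lemma core_disjoint: "disjoint_family Q"
  unfolding disjoint_family_on_def
proof (intro ballI impI equals0I)
  fix K M x assume "K \<noteq> M" "x \<in> Q K \<inter> Q M"
  then show False using cell_unique[of x K M] core_subset(1)[of K] core_subset(1)[of M] by blast
qed

lemma core_borel: "Q K \<in> sets borel"
  using cell_core(1) by simp

lemma approx_grad_total:
  assumes "x \<in> Q K" "x \<notin> S K" shows "approx_grad total x $ j $ i = D K x"
proof -
  obtain L where L: "(u K has_derivative (\<lambda>v. L *v v)) (at x)" "L $ j $ i = D K x"
    using cell_differentiable[OF assms] by blast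
  have "(total has_derivative (\<lambda>v. L *v v)) (at x)"
  proof (rule has_derivative_transform_within_open[OF L(1) open_box])
    show "x \<in> box (l K) (h K)" using assms core_subset by blast
  qed (simp add: total_eq)
  then have "approx_grad total x = L" by (rule approx_grad_eq[OF continuous_total])
  then show ?thesis using L(2) by simp
qed

lemma rotation_integrable: "integrable lborel (\<lambda>x. indicator (Q K) x * D K x)"
proof -
  have "set_integrable lebesgue (Q K) (D K)"
    using core_subset(3) bounded_subset[OF bounded_box]
    by (intro continuous_set_integrable cell_continuous_rotation core_borel) blast
  moreover have "(\<lambda>x. indicator (Q K) x * D K x) \<in> borel_measurable lborel"
    using core_borel borel_measurable_continuous_onI[OF cell_continuous_rotation] by simp
  ultimately show ?thesis by (simp add: set_integrable_def integrable_completion)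
qed

text \<open>
  The integral of the modulus of the entry \<open>(j, i)\<close> is at least 1 over each of the disjoint sets
  \<open>Q K\<close>.
\<close>

lemma not_integrable_approx_grad: "\<not> approx_grad total absolutely_integrable_on \<Omega>"
proof
  assume "approx_grad total absolutely_integrable_on \<Omega>"
  then have "integrable lebesgue (\<lambda>x. indicator \<Omega> x *\<^sub>R approx_grad total x)" by (simp add: set_integrable_def)
  then have "integrable lebesgue (\<lambda>x. (indicator \<Omega> x *\<^sub>R approx_grad total x) $ j $ i)"
    by (intro integrable_bounded_linear[OF bounded_linear_vec_nth] integrable_bounded_linear[OF bounded_linear_vec_nth])
  then have G: "integrable lebesgue (\<lambda>x. \<bar>indicator \<Omega> x * approx_grad total x $ j $ i\<bar>)"
    by (intro integrable_abs) simp
  let ?I = "\<integral>x. \<bar>indicator \<Omega> x * approx_grad total x $ j $ i\<bar> \<partial>lebesgue"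
  have ind: "\<bar>indicator X x * y\<bar> = indicator X x * \<bar>y\<bar>" for X and x :: "real^'n" and y :: real
    by (simp add: indicator_def)
  have "real M \<le> ?I" for M
  proof -
    have int: "integrable lborel (\<lambda>x. indicator (Q K) x * \<bar>D K x\<bar>)" for K
      using integrable_abs[OF rotation_integrable[of K]] by (simp only: ind)
    have sum_int: "integrable lborel (\<lambda>x. \<Sum>K<M. indicator (Q K) x * \<bar>D K x\<bar>)"
      by (rule Bochner_Integration.integrable_sum) (rule int)
    have "real M = (\<Sum>K<M. 1)" by simp
    also have "\<dots> \<le> (\<Sum>K<M. \<integral>x. indicator (Q K) x * \<bar>D K x\<bar> \<partial>lborel)"
      by (intro sum_mono cell_large_rotation)
    also have "\<dots> = (\<integral>x. (\<Sum>K<M. indicator (Q K) x * \<bar>D K x\<bar>) \<partial>lborel)"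
      by (rule Bochner_Integration.integral_sum[symmetric]) (rule int)
    also have "\<dots> = (\<integral>x. (\<Sum>K<M. indicator (Q K) x * \<bar>D K x\<bar>) \<partial>lebesgue)"
      by (rule integral_completion[OF borel_measurable_integrable[OF sum_int], symmetric])
    also have "\<dots> \<le> ?I"
    proof (rule integral_mono_AE[OF _ G])
      show "integrable lebesgue (\<lambda>x. \<Sum>K<M. indicator (Q K) x * \<bar>D K x\<bar>)"
        using sum_int by (subst integrable_completion[OF borel_measurable_integrable[OF sum_int]])
      have "(\<Union>K. S K) \<in> null_sets lebesgue"
        using cell_null by (intro null_sets_completionI null_sets_UN) auto
      then have "AE x in lebesgue. x \<notin> (\<Union>K. S K)" by (rule AE_not_in)
      then show "AE x in lebesgue. (\<Sum>K<M. indicator (Q K) x * \<bar>D K x\<bar>)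
          \<le> \<bar>indicator \<Omega> x * approx_grad total x $ j $ i\<bar>"
      proof (rule AE_mp, intro AE_I2 impI)
        fix x assume x: "x \<notin> (\<Union>K. S K)"
        show "(\<Sum>K<M. indicator (Q K) x * \<bar>D K x\<bar>) \<le> \<bar>indicator \<Omega> x * approx_grad total x $ j $ i\<bar>"
        proof (cases "\<exists>K. x \<in> Q K")
          case True
          then obtain K where K: "x \<in> Q K" by blast
          have "indicator (Q M) x = (0::real)" if "M \<noteq> K" for M
            using disjoint_family_onD[OF core_disjoint _ _ that] K by (auto simp: indicator_def)
          then have "(\<Sum>K<M. indicator (Q K) x * \<bar>D K x\<bar>) = (\<Sum>L<M. if L = K then \<bar>D K x\<bar> else 0)"
            using K by (intro sum.cong) auto
          also have "\<dots> \<le> \<bar>D K x\<bar>" by (simp add: sum.delta)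
          also have "\<dots> = \<bar>indicator \<Omega> x * approx_grad total x $ j $ i\<bar>"
            using approx_grad_total[OF K] x K core_subset(2)[of K] by auto
          finally show ?thesis .
        qed (simp add: indicator_def)
      qed
    qed
    finally show ?thesis .
  qed
  then show False using reals_Archimedean2[of ?I] by (meson not_le)
qed

text \<open>
  If the truncation of the field had bounded variation in the box, then by uniqueness the entry
  \<open>i\<close> of its derivative would have the density \<open>D K\<close> on \<open>Q K\<close>. One of the sets where \<open>D K\<close> is
  positive or negative then has measure at least \<open>1/2\<close> in modulus. These sets are disjoint for
  different \<open>K\<close>, and the sum of their measures would have to converge.
\<close>

lemma not_GBV: "total \<notin> GBV \<Omega>"
proof
  assume G: "total \<in> GBV \<Omega>"
  obtain \<psi> :: "real^'n \<Rightarrow> real" where \<psi>: "C_k 1 \<psi>" "\<And>y. norm y \<le> 1 \<Longrightarrow> \<psi> y = y $ j"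
    "compact (closure {y. frechet_derivative \<psi> (at y) \<noteq> (\<lambda>_. 0)})"
    by (rule ex_truncated_coordinate[where j = j]) (rule that; assumption)
  let ?U = "box A B"
  have v: "(\<lambda>x. \<psi> (total x)) = (\<lambda>x. total x $ j)" using \<psi>(2) norm_total by blast
  have "(\<lambda>x. \<psi> (total x)) \<in> BV_loc \<Omega>" using G \<psi> by (simp add: GBV_def)
  moreover have "open ?U \<and> compact (closure ?U) \<and> closure ?U \<subseteq> \<Omega>"
    using domain closure_box[OF domain(3)] by (simp add: open_box)
  ultimately have "(\<lambda>x. total x $ j) \<in> BV ?U" unfolding BV_loc_def v by blast
  then obtain \<mu> :: "(real^'n) set \<Rightarrow> real^'n" where \<mu>: "radon_measure ?U \<mu>"
    "\<And>\<phi>. test_function ?U \<phi> \<Longrightarrow> distr_partial ?U i (\<lambda>x. total x $ j) \<phi> = signed_integral ?U (\<lambda>X. \<mu> X $ i) \<phi>"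
    unfolding BV_def by blast
  have r: "radon_measure ?U (\<lambda>X. \<mu> X $ i)" by (rule radon_measure_nth[OF \<mu>(1)])
  have Ub: "?U \<in> sets borel" by simp
  have \<mu>Q: "\<mu> X $ i = (\<integral>x. (indicator (Q K) x * D K x) * indicator X x \<partial>lborel)"
    if X: "X \<in> sets borel" "X \<subseteq> Q K" for X K
  proof -
    let ?\<nu> = "\<lambda>X. if X \<in> borel_sets ?U then \<integral>x. (indicator (Q K) x * D K x) * indicator X x \<partial>lborel else 0"
    note \<nu> = radon_measure_density[OF rotation_integrable[of K] Ub]
    have "\<mu> X $ i = ?\<nu> X"
    proof (rule radon_measure_eqI_test[OF r \<nu>(1) Ub cell_core(1)[of K] core_subset(3)[of K] _ X])
      fix \<phi> :: "real^'n \<Rightarrow> real" assume \<phi>: "test_function (Q K) \<phi>"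
      obtain C where C: "C \<subseteq> Q K" "\<And>x. x \<notin> C \<Longrightarrow> \<phi> x = 0" "\<And>x k. x \<notin> C \<Longrightarrow> partial_deriv k \<phi> x = 0"
        using test_function_support[OF \<phi>] by metis
      have \<phi>U: "test_function ?U \<phi>" using \<phi> core_subset(3)[of K] by (auto simp: test_function_def)
      have "signed_integral ?U (\<lambda>X. \<mu> X $ i) \<phi> = - (\<integral>x. total x $ j * partial_deriv i \<phi> x \<partial>lborel)"
        using \<mu>(2)[OF \<phi>U] distr_partial_eq[OF \<phi>U borel_measurable_total_nth] by simp
      also have "(\<lambda>x. total x $ j * partial_deriv i \<phi> x) = (\<lambda>x. u K x $ j * partial_deriv i \<phi> x)"
      proof
        fix x show "total x $ j * partial_deriv i \<phi> x = u K x $ j * partial_deriv i \<phi> x"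
        proof (cases "x \<in> C")
          case True
          then have "total x = u K x" using C(1) core_subset(1)[of K] by (intro total_eq) blast
          then show ?thesis by simp
        qed (simp add: C(3))
      qed
      also have "- (\<integral>x. u K x $ j * partial_deriv i \<phi> x \<partial>lborel) = (\<integral>x. D K x * \<phi> x \<partial>lborel)"
        by (rule cell_distr_rotation[OF \<phi>])
      also have "(\<lambda>x. D K x * \<phi> x) = (\<lambda>x. (indicator (Q K) x * D K x) * \<phi> x)"
        using C(1,2) by (auto simp: fun_eq_iff indicator_def)
      also have "(\<integral>x. (indicator (Q K) x * D K x) * \<phi> x \<partial>lborel) = signed_integral ?U ?\<nu> \<phi>"
        by (rule \<nu>(2)[symmetric]) (use test_function_bounded_borel[OF \<phi>] C core_subset(3)[of K] in blast)+
      finally show "signed_integral ?U (\<lambda>X. \<mu> X $ i) \<phi> = signed_integral ?U ?\<nu> \<phi>" .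
    qed
    moreover have "X \<in> borel_sets ?U" using X core_subset(3)[of K] by (auto simp: borel_sets_iff[OF Ub])
    ultimately show ?thesis by simp
  qed
  have "\<exists>X. X \<in> sets borel \<and> X \<subseteq> Q K \<and> \<bar>\<mu> X $ i\<bar> \<ge> 1/2" for K
  proof -
    let ?P = "Q K \<inter> {x. 0 < D K x}" and ?R = "Q K \<inter> {x. D K x < 0}"
    have b: "?P \<in> sets borel" "?R \<in> sets borel"
      by (intro sets.Int core_borel borel_open open_Collect_less continuous_on_const cell_continuous_rotation)+
    have int: "integrable lborel (\<lambda>x. (indicator (Q K) x * D K x) * indicator X x)" if "X \<in> sets borel" for X
      by (rule integrable_mult_bounded_borel[OF rotation_integrable bounded_borel_indicator[OF that]]) simp
    have "1 \<le> (\<integral>x. indicator (Q K) x * \<bar>D K x\<bar> \<partial>lborel)" by (rule cell_large_rotation)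
    also have "\<dots> = (\<integral>x. (indicator (Q K) x * D K x) * indicator ?P x - (indicator (Q K) x * D K x) * indicator ?R x \<partial>lborel)"
      by (intro Bochner_Integration.integral_cong) (auto simp: indicator_def)
    also have "\<dots> = \<mu> ?P $ i - \<mu> ?R $ i"
      by (simp only: Bochner_Integration.integral_diff[OF int[OF b(1)] int[OF b(2)]]
          \<mu>Q[OF b(1) Int_lower1] \<mu>Q[OF b(2) Int_lower1])
    finally have "\<bar>\<mu> ?P $ i\<bar> \<ge> 1/2 \<or> \<bar>\<mu> ?R $ i\<bar> \<ge> 1/2" by linarith
    then show ?thesis using b by blast
  qed
  then obtain X where X: "\<And>K. X K \<in> sets borel" "\<And>K. X K \<subseteq> Q K" "\<And>K. \<bar>\<mu> (X K) $ i\<bar> \<ge> 1/2" by metis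
  have "(\<lambda>K. \<mu> (X K) $ i) sums \<mu> (\<Union>K. X K) $ i"
  proof (rule radon_measure_sums[OF r])
    show "range X \<subseteq> borel_sets ?U"
      using X(1,2) core_subset(3) by (fastforce simp: borel_sets_iff[OF Ub])
    show "disjoint_family X"
      using core_disjoint X(2) unfolding disjoint_family_on_def by blast
  qed
  then have "(\<lambda>K. \<mu> (X K) $ i) \<longlonglongrightarrow> 0" by (intro summable_LIMSEQ_zero sums_summable)
  then have "eventually (\<lambda>K. \<bar>\<mu> (X K) $ i\<bar> < 1/2) sequentially"
    by (auto dest: tendstoD[where e = "1/2"])
  then show False using X(3) by (auto simp: eventually_sequentially not_le[symmetric])
qed

end

text \<open>
  Slabs in a box, cut orthogonally to the direction \<open>i\<close> and accumulating at the upper face.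
\<close>

lemma ex_disjoint_cells:
  fixes \<Omega> :: "(real^'n) set"
  assumes ij: "i \<noteq> j" and \<Omega>: "open \<Omega>" "\<Omega> \<noteq> {}"
  shows "\<exists>A B l h u f \<tau> S Q D. disjoint_cells \<Omega> i j A B l h u f \<tau> S Q D"
proof -
  obtain x where "x \<in> \<Omega>" using \<Omega> by blast
  obtain A B where AB: "cbox A B \<subseteq> \<Omega>" "x \<in> box A B" "\<forall>b\<in>Basis. A \<bullet> b < B \<bullet> b"
    using open_contains_cbox[OF \<Omega>(1) \<open>x \<in> \<Omega>\<close>] by metis
  have lt: "A $ m < B $ m" for m using AB(2) by (auto simp: mem_box_cart intro: less_trans)
  \<comment> \<open>relative position of the lower face of slab \<open>K\<close> in direction \<open>i\<close>\<close>
  define t where "t K = 1 - (1/2::real) ^ K" for K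
  define s where "s K = A $ i + (B $ i - A $ i) * t K" for K
  have t: "0 \<le> t K" "t K \<le> 1" "t K < t (Suc K)" for K by (auto simp: t_def power_le_one)
  have mono: "t K \<le> t M" if "K \<le> M" for K M using that by (simp add: t_def power_decreasing)
  have s: "A $ i \<le> s K" "s K \<le> B $ i" "s K < s (Suc K)" for K
  proof -
    show "A $ i \<le> s K" using t(1)[of K] lt[of i] by (simp add: s_def)
    have "(B $ i - A $ i) * t K \<le> (B $ i - A $ i) * 1" using t(2)[of K] lt[of i] by (intro mult_left_mono) auto
    then show "s K \<le> B $ i" by (simp add: s_def)
    have "(B $ i - A $ i) * t K < (B $ i - A $ i) * t (Suc K)" using t(3)[of K] lt[of i] by (intro mult_strict_left_mono) auto
    then show "s K < s (Suc K)" by (simp add: s_def)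
  qed
  have s_mono: "s K \<le> s M" if "K \<le> M" for K M
  proof -
    have "(B $ i - A $ i) * t K \<le> (B $ i - A $ i) * t M" using mono[OF that] lt[of i] by (intro mult_left_mono) auto
    then show ?thesis by (simp add: s_def)
  qed
  define l h :: "nat \<Rightarrow> real^'n" where "l K = (\<chi> m. if m = i then s K else A $ m)"
    and "h K = (\<chi> m. if m = i then s (Suc K) else B $ m)" for K
  have lh: "l K $ m < h K $ m" for K m using s lt by (simp add: l_def h_def)
  have "\<forall>K. \<exists>u f \<tau> S Q D. rotation_cell i j (l K) (h K) ((1/2) ^ Suc K) u f \<tau> S Q D"
    by (intro allI ex_rotation_cell ij lh) simp
  then obtain u f \<tau> S Q D where
    cell: "\<And>K. rotation_cell i j (l K) (h K) ((1/2) ^ Suc K) (u K) (f K) (\<tau> K) (S K) (Q K) (D K)"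
    by metis
  have "disjoint_cells \<Omega> i j A B l h u f \<tau> S Q D"
  proof (rule disjoint_cells.intro[OF \<Omega>(1) AB(1) _ _ _ cell])
    show "box A B \<noteq> {}" using AB(2) by blast
    show "box (l K) (h K) \<subseteq> box A B" for K
    proof
      fix y assume y: "y \<in> box (l K) (h K)"
      have "A $ m < y $ m \<and> y $ m < B $ m" for m
      proof -
        have "l K $ m < y $ m" "y $ m < h K $ m" using y by (auto simp: mem_box_cart)
        then show ?thesis using s(1)[of K] s(2)[of "Suc K"] by (auto simp: l_def h_def split: if_splits)
      qed
      then show "y \<in> box A B" by (simp add: mem_box_cart)
    qed
    have disj: "box (l K) (h K) \<inter> box (l M) (h M) = {}" if "K < M" for K M
    proof -
      have "y $ i < y $ i" if "y \<in> box (l K) (h K)" "y \<in> box (l M) (h M)" for y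
      proof -
        have "y $ i < h K $ i" "l M $ i < y $ i" using that by (auto simp: mem_box_cart)
        then show ?thesis using s_mono[of "Suc K" M] \<open>K < M\<close> by (simp add: l_def h_def)
      qed
      then show ?thesis by blast
    qed
    show "disjoint_family (\<lambda>K. box (l K) (h K))"
      unfolding disjoint_family_on_def by (metis disj Int_commute linorder_neqE_nat)
  qed
  then show ?thesis by blast
qed

theorem theorem3p6:
  fixes \<Omega> :: "(real^'n) set"
  assumes "CARD('n) \<ge> 2" and "open \<Omega>" and "\<Omega> \<noteq> {}"
  shows "\<exists>u \<in> BD \<Omega> \<inter> L_infinity \<Omega>.
           sym_grad \<Omega> u = cantor_part \<Omega> u \<and>
           \<not> approx_grad u absolutely_integrable_on \<Omega> \<and>
           u \<notin> GBV \<Omega>"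
proof -
  obtain i j :: 'n where "i \<noteq> j"
    using assms(1) card_2_iff'[of "UNIV :: 'n set"] ex_card[OF assms(1)] by (metis card_2_iff)
  then obtain A B l h u f \<tau> S Q D where "disjoint_cells \<Omega> i j A B l h u f \<tau> S Q D"
    using ex_disjoint_cells[OF _ assms(2,3)] by metis
  then interpret disjoint_cells \<Omega> i j A B l h u f \<tau> S Q D .
  show ?thesis
    using total_BD total_bounded sym_grad_total not_integrable_approx_grad not_GBV by blast
qed

end
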